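(* Let $H$ be a quasi-Hopf algebra (with bijective antipode) over a field $k$ and $M,N\in{}_H^H\mathcal{YD}^{\rm fd}$. Let $\{{}_im\}_{i=1,\dots,s}$ and $\{{}^im\}_{i=1,\dots,s}$ be dual bases in $M$ and $M^*$, and $\{{}_jn\}_{j=1,\dots,t}$ and $\{{}^jn\}_{j=1,\dots,t}$ dual bases in $N$ and $N^*$ (summations understood). Then the map $\sigma^*_{M,N}:M^*\otimes N^*\to(M\otimes N)^*$ defined by $$\sigma^*_{M,N}(m^*\otimes n^* )(m\otimes n)=\langle m^*,f^2\tilde q^2_2X^3S^{-1}\big(\tilde q^1X^1(p^1\cdot n)_{(-1)}p^2\big)\cdot m\rangle\,\langle n^*,f^1\tilde q^2_1X^2\cdot(p^1\cdot n)_{(0)}\rangle$$ is an isomorphism of Yetter-Drinfeld modules, with inverse $$\sigma^{*-1}_{M,N}(\mu)=\langle\mu,(g^1\cdot{}_jn)_{(-1)}g^2\cdot{}_im\otimes(g^1\cdot{}_jn)_{(0)}\rangle\,{}^im\otimes{}^jn.$$ Similarly, the map ${}^*\sigma_{M,N}:{}^*M\otimes{}^*N\to{}^*(M\otimes N)$ defined by $${}^*\sigma_{M,N}({}^*m\otimes{}^*n)(m\otimes n)=\langle{}^*m,S^{-1}\big(f^2q^1(x^1\tilde p^1S^{-1}(f^1)\cdot n)_{(-1)}x^2\tilde p^2_1\big)\cdot m\rangle\,\langle{}^*n,S^{-1}(x^3\tilde p^2_2)q^2\cdot(x^1\tilde p^1S^{-1}(f^1)\cdot n)_{(0)}\rangle$$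 is an isomorphism of Yetter-Drinfeld modules, with inverse $${}^*\sigma^{-1}_{M,N}(\nu)=\langle\nu,(S^{-1}(g^2)\cdot{}_jn)_{(-1)}S^{-1}(g^1)\cdot{}_im\otimes(S^{-1}(g^2)\cdot{}_jn)_{(0)}\rangle\,{}^im\otimes{}^jn.$$ Here $p_R=p^1\otimes p^2=x^1\otimes x^2\beta S(x^3)$, $q_R=q^1\otimes q^2=X^1\otimes S^{-1}(\alpha X^3)X^2$, $p_L=\tilde p^1\otimes\tilde p^2=X^2S^{-1}(X^1\beta)\otimes X^3$, $q_L=\tilde q^1\otimes\tilde q^2=S(x^1)\alpha x^2\otimes x^3$, and $f=f^1\otimes f^2$ is the Drinfeld twist with inverse $f^{-1}=g^1\otimes g^2$.
   Context: All algebras and vector spaces are over a field $k$, $\otimes=\otimes_k$, and summations are suppressed. A quasi-bialgebra $(H,\Delta,\varepsilon,\Phi)$ is an associative unital algebra $H$ with an invertible $\Phi\in H^{\otimes 3}$ and algebra maps $\Delta:H\to H\otimes H$, $\varepsilon:H\to k$ with $(id\otimes\Delta)(\Delta(h))=\Phi(\Delta\otimes id)(\Delta(h))\Phi^{-1}$, $(id\otimes\varepsilon)\Delta(h)=h=(\varepsilon\otimes id)\Delta(h)$, $(1\otimes\Phi)(id\otimes\Delta\otimes id)(\Phi)(\Phi\otimes1)=(id\otimes id\otimes\Delta)(\Phi)(\Delta\otimes id\otimes id)(\Phi)$, $(id\otimes\varepsilon\otimes id)(\Phi)=1\otimes1$. Write $\Delta(h)=h_1\otimes h_2$, $\Phi=X^1\otimes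 X^2\otimes X^3=Y^1\otimes Y^2\otimes Y^3$, $\Phi^{-1}=x^1\otimes x^2\otimes x^3$ (in each formula every occurrence of $p_R,q_R,p_L,q_L,f,\Phi^{\pm1}$ is an independent copy; $\tilde q^2_1\otimes\tilde q^2_2=\Delta(\tilde q^2)$ etc.). $H$ is a quasi-Hopf algebra if there are an anti-automorphism $S$ of the algebra $H$ and $\alpha,\beta\in H$ with $S(h_1)\alpha h_2=\varepsilon(h)\alpha$, $h_1\beta S(h_2)=\varepsilon(h)\beta$, $X^1\beta S(X^2)\alpha X^3=1$, $S(x^1)\alpha x^2\beta S(x^3)=1$ (normalized so that $\varepsilon(\alpha)=\varepsilon(\beta)=1$). Drinfeld twist: let $A^1\otimes A^2\otimes A^3\otimes A^4=(\Phi\otimes1)(\Delta\otimes id\otimes id)(\Phi^{-1})$, $B^1\otimes B^2\otimes B^3\otimes B^4=(\Delta\otimes id\otimes id)(\Phi)(\Phi^{-1}\otimes1)$, $\gamma=S(A^2)\alpha A^3\otimes S(A^1)\alpha A^4$, $\delta=B^1\beta S(B^4)\otimes B^2\beta S(B^3)$, $\Delta^{\rm op}(h)=h_2\otimes h_1$; then $f=(S\otimes S)(\Delta^{\rm op}(x^1))\,\gamma\,\Delta(x^2\beta S(x^3))$, with inverse $f^{-1}=\Delta(S(x^1)\alpha x^2)\,\delta\,(S\otimes S)(\Delta^{\rm op}(x^3))$. A left Yetter-Drinfeld module is a left $H$-module $M$ with a linear map $\lambda_M:M\to H\otimes M$, $m\mapsto m_{(-1)}\otimes m_{(0)}$, such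 that $X^1m_{(-1)}\otimes (X^2\cdot m_{(0)})_{(-1)}X^3\otimes(X^2\cdot m_{(0)})_{(0)}=X^1(Y^1\cdot m)_{(-1)_1}Y^2\otimes X^2(Y^1\cdot m)_{(-1)_2}Y^3\otimes X^3\cdot(Y^1\cdot m)_{(0)}$, $\varepsilon(m_{(-1)})m_{(0)}=m$, $h_1m_{(-1)}\otimes h_2\cdot m_{(0)}=(h_1\cdot m)_{(-1)}h_2\otimes(h_1\cdot m)_{(0)}$; morphisms are $H$-linear, $H$-colinear maps. ${}_H^H\mathcal{YD}^{\rm fd}$ is the category of finite dimensional ones. Tensor products: $h\cdot(m\otimes n)=h_1\cdot m\otimes h_2\cdot n$ and $\lambda_{M\otimes N}(m\otimes n)=X^1(x^1Y^1\cdot m)_{(-1)}x^2(Y^2\cdot n)_{(-1)}Y^3\otimes X^2\cdot(x^1Y^1\cdot m)_{(0)}\otimes X^3x^3\cdot(Y^2\cdot n)_{(0)}$. Duals: $M^*$ and ${}^*M$ are ${\rm Hom}(M,k)$ with, for $M^*$, $(h\cdot m^* )(m)=m^*(S(h)\cdot m)$, $\lambda_{M^*}(m^* )=\langle m^*,f^2\cdot(g^1\cdot{}_im)_{(0)}\rangle S^{-1}(f^1(g^1\cdot{}_im)_{(-1)}g^2)\otimes{}^im$; and for ${}^*M$, $(h\cdot{}^*m)(m)={}^*m(S^{-1}(h)\cdot m)$, $\lambda_{{}^*M}({}^*m)=\langle{}^*m,S^{-1}(f^1)\cdot(S^{-1}(g^2)\cdot{}_im)_{(0)}\rangle g^1S((S^{-1}(g^2)\cdot{}_im)_{(-1)})f^2\otimes{}^im$.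 *)

theory Defs
  imports Complex_Main "HOL-Library.Function_Algebras"
begin

section \<open>Vector spaces, duals and tensor products\<close>

text \<open>
  A vector space is a subspace \<open>carr V\<close> of an ambient vector space type, so that duals and tensor
  products, which are subspaces of function types, are objects of the same kind as the spaces they
  are built from.
\<close>

record ('k, 'v) space =
  carr :: "'v set"
  scl :: "'k \<Rightarrow> 'v \<Rightarrow> 'v"

definition is_space :: "('k::field, 'v::ab_group_add, 'x) space_scheme \<Rightarrow> bool" where
  "is_space V \<longleftrightarrow> vector_space (scl V) \<and> module.subspace (scl V) (carr V)"

definition ground :: "('k::field, 'k) space" where
  "ground = \<lparr>carr = UNIV, scl = (*)\<rparr>"

definition lin :: "('k, 'v::ab_group_add, 'x) space_scheme \<Rightarrow> ('k, 'w::ab_group_add, 'y) space_scheme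
    \<Rightarrow> ('v \<Rightarrow> 'w) \<Rightarrow> bool" where
  "lin V W f \<longleftrightarrow>
     (\<forall>v\<in>carr V. f v \<in> carr W) \<and>
     (\<forall>v\<in>carr V. \<forall>v'\<in>carr V. f (v + v') = f v + f v') \<and>
     (\<forall>c. \<forall>v\<in>carr V. f (scl V c v) = scl W c (f v))"

definition bilin :: "('k, 'v::ab_group_add, 'x) space_scheme \<Rightarrow> ('k, 'w::ab_group_add, 'y) space_scheme
    \<Rightarrow> ('k, 'u::ab_group_add, 'z) space_scheme \<Rightarrow> ('v \<Rightarrow> 'w \<Rightarrow> 'u) \<Rightarrow> bool" where
  "bilin V W U F \<longleftrightarrow>
     (\<forall>w\<in>carr W. lin V U (\<lambda>v. F v w)) \<and> (\<forall>v\<in>carr V. lin W U (F v))"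

definition fun_scl :: "'k \<Rightarrow> ('a \<Rightarrow> 'k) \<Rightarrow> 'a \<Rightarrow> 'k::field" where
  "fun_scl c f = (\<lambda>x. c * f x)"

text \<open>Functionals are normalised to vanish outside the carrier, so that equality of functionals is
  equality of functions.\<close>

definition dual_space :: "('k::field, 'v::ab_group_add, 'x) space_scheme \<Rightarrow> ('k, 'v \<Rightarrow> 'k) space" where
  "dual_space V = \<lparr>carr = {\<phi>. lin V ground \<phi> \<and> (\<forall>v. v \<notin> carr V \<longrightarrow> \<phi> v = 0)}, scl = fun_scl\<rparr>"

text \<open>
  The tensor product \<open>V \<otimes> W\<close> is realised inside the dual of the space of bilinear forms on
  \<open>V \<times> W\<close>: the pure tensor of \<open>v\<close> and \<open>w\<close> is evaluation of a form at \<open>(v, w)\<close>, and \<open>V \<otimes> W\<close> is the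
  span of the pure tensors.  Its universal property is lemma \<open>tensor_universal\<close> below.
  Iterated tensor products are bracketed to the right.
\<close>

type_synonym ('k, 'a, 'b) tensor = "('a \<Rightarrow> 'b \<Rightarrow> 'k) \<Rightarrow> 'k"

definition pure :: "('k::field, 'v::ab_group_add, 'x) space_scheme \<Rightarrow> ('k, 'w::ab_group_add, 'y) space_scheme
    \<Rightarrow> 'v \<Rightarrow> 'w \<Rightarrow> ('k, 'v, 'w) tensor" where
  "pure V W v w = (\<lambda>B. if bilin V W ground B then B v w else 0)"

definition tensor_space :: "('k::field, 'v::ab_group_add, 'x) space_scheme
    \<Rightarrow> ('k, 'w::ab_group_add, 'y) space_scheme \<Rightarrow> ('k, ('k, 'v, 'w) tensor) space" where
  "tensor_space V W =
     \<lparr>carr = module.span fun_scl {pure V W v w | v w. v \<in> carr V \<and> w \<in> carr W}, scl = fun_scl\<rparr>"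

text \<open>
  Sweedler notation: \<open>sw V W t\<close> is a list of pairs \<open>(v\<^sub>i, w\<^sub>i)\<close> with \<open>t = \<Sum>\<^sub>i v\<^sub>i \<otimes> w\<^sub>i\<close>, and
  \<open>\<Sum>(v, w)\<leftarrow>sw V W t. F v w\<close> is the value at \<open>t\<close> of the linear map induced by a bilinear \<open>F\<close>,
  whichever list is chosen.
\<close>

definition sw :: "('k::field, 'v::ab_group_add, 'x) space_scheme \<Rightarrow> ('k, 'w::ab_group_add, 'y) space_scheme
    \<Rightarrow> ('k, 'v, 'w) tensor \<Rightarrow> ('v \<times> 'w) list" where
  "sw V W t = (SOME xs. set xs \<subseteq> carr V \<times> carr W \<and> t = (\<Sum>(v, w)\<leftarrow>xs. pure V W v w))"

lemma vector_space_fun_scl: "vector_space (fun_scl :: 'k::field \<Rightarrow> ('a \<Rightarrow> 'k) \<Rightarrow> _)"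
  by unfold_locales (auto simp: fun_scl_def algebra_simps fun_eq_iff)

lemma module_fun_scl: "module (fun_scl :: 'k::field \<Rightarrow> ('a \<Rightarrow> 'k) \<Rightarrow> _)"
  by unfold_locales (auto simp: fun_scl_def algebra_simps fun_eq_iff)

lemma is_space_tensor: "is_space (tensor_space V W)"
  by (simp add: is_space_def tensor_space_def vector_space_fun_scl
      module.subspace_span[OF module_fun_scl])

lemma pure_in_tensor:
  "v \<in> carr V \<Longrightarrow> w \<in> carr W \<Longrightarrow> pure V W v w \<in> carr (tensor_space V W)"
  by (auto simp: tensor_space_def intro!: module.span_base[OF module_fun_scl])

lemma bilin_pure:
  "bilin V W (tensor_space V W) (pure V W)"
  unfolding bilin_def[of V W "tensor_space V W"] lin_def
  by (auto simp: pure_in_tensor)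
    (auto simp: tensor_space_def pure_def bilin_def lin_def ground_def fun_scl_def fun_eq_iff)

lemma tensor_rep_exists:
  assumes "is_space V" "t \<in> carr (tensor_space V W)"
  shows "\<exists>xs. set xs \<subseteq> carr V \<times> carr W \<and> t = (\<Sum>(v, w)\<leftarrow>xs. pure V W v w)"
proof -
  interpret T: vector_space "fun_scl :: 'a \<Rightarrow> (('b \<Rightarrow> 'd \<Rightarrow> 'a) \<Rightarrow> 'a) \<Rightarrow> _"
    by (rule vector_space_fun_scl)
  interpret V: vector_space "scl V" using assms(1) by (simp add: is_space_def)
  have sub: "V.subspace (carr V)" using assms(1) by (simp add: is_space_def)
  have "t \<in> T.span {pure V W v w | v w. v \<in> carr V \<and> w \<in> carr W}"
    using assms(2) by (simp add: tensor_space_def)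
  then show ?thesis
  proof (induction rule: T.span_induct_alt)
    case base
    show ?case by (rule exI[of _ "[]"]) simp
  next
    case (step c p y)
    then obtain v w xs where p: "p = pure V W v w" "v \<in> carr V" "w \<in> carr W"
      and xs: "set xs \<subseteq> carr V \<times> carr W" "y = (\<Sum>(v, w)\<leftarrow>xs. pure V W v w)" by auto
    have "fun_scl c p = pure V W (scl V c v) w"
      using p by (auto simp: fun_scl_def pure_def bilin_def lin_def ground_def fun_eq_iff)
    then show ?case
      using p xs V.subspace_scale[OF sub]
      by (intro exI[of _ "(scl V c v, w) # xs"]) auto
  qed
qed

lemma sw:
  assumes "is_space V" "t \<in> carr (tensor_space V W)"
  shows "set (sw V W t) \<subseteq> carr V \<times> carr W" "t = (\<Sum>(v, w)\<leftarrow>sw V W t. pure V W v w)"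
  using someI_ex[OF tensor_rep_exists[OF assms]] unfolding sw_def by blast+

lemma pure_sum_apply:
  assumes "bilin V W ground B"
  shows "(\<Sum>(v, w)\<leftarrow>xs. pure V W v w) B = (\<Sum>(v, w)\<leftarrow>xs. B v w)"
  by (induction xs) (use assms in \<open>auto simp: pure_def\<close>)

lemma tensor_sum_cong:
  assumes U: "is_space U" and F: "bilin V W U F"
    and eq: "(\<Sum>(v, w)\<leftarrow>xs. pure V W v w) = (\<Sum>(v, w)\<leftarrow>ys. pure V W v w)"
  shows "(\<Sum>(v, w)\<leftarrow>xs. F v w) = (\<Sum>(v, w)\<leftarrow>ys. F v w)"
proof (rule ccontr)
  interpret U: vector_space "scl U" using U by (simp add: is_space_def)
  interpret P: vector_space_pair "scl U" "(*) :: 'a \<Rightarrow> 'a \<Rightarrow> 'a"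
    by unfold_locales (auto simp: algebra_simps)
  let ?d = "(\<Sum>(v, w)\<leftarrow>xs. F v w) - (\<Sum>(v, w)\<leftarrow>ys. F v w)"
  assume "(\<Sum>(v, w)\<leftarrow>xs. F v w) \<noteq> (\<Sum>(v, w)\<leftarrow>ys. F v w)"
  then have "U.independent {?d}" by simp
  from P.linear_independent_extend[OF this, of "\<lambda>_. 1"]
  obtain g where g: "Vector_Spaces.linear (scl U) (*) g" "g ?d = 1" by auto
  interpret g: Vector_Spaces.linear "scl U" "(*)" g by (rule g(1))
  have "bilin V W ground (\<lambda>v w. g (F v w))"
    using F by (auto simp: bilin_def lin_def ground_def g.add g.scale)
  from pure_sum_apply[OF this, of xs] pure_sum_apply[OF this, of ys] eq
  have "(\<Sum>(v, w)\<leftarrow>xs. g (F v w)) = (\<Sum>(v, w)\<leftarrow>ys. g (F v w))" by simp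
  moreover have "g (\<Sum>(v, w)\<leftarrow>zs. F v w) = (\<Sum>(v, w)\<leftarrow>zs. g (F v w))" for zs
    by (induction zs) (auto simp: g.zero g.add)
  ultimately have "g ?d = 0" by (simp add: g.diff)
  with g(2) show False by simp
qed

lemma tensor_universal:
  assumes V: "is_space V" and U: "is_space U" and F: "bilin V W U F"
  defines "L \<equiv> \<lambda>t. \<Sum>(v, w)\<leftarrow>sw V W t. F v w"
  shows "lin (tensor_space V W) U L"
    and "\<And>v w. v \<in> carr V \<Longrightarrow> w \<in> carr W \<Longrightarrow> L (pure V W v w) = F v w"
    and "\<And>L'. lin (tensor_space V W) U L' \<Longrightarrow>
           (\<And>v w. v \<in> carr V \<Longrightarrow> w \<in> carr W \<Longrightarrow> L' (pure V W v w) = F v w) \<Longrightarrow>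
           \<forall>t\<in>carr (tensor_space V W). L' t = L t"
proof -
  let ?T = "tensor_space V W"
  interpret V: vector_space "scl V" using V by (simp add: is_space_def)
  interpret U: vector_space "scl U" using U by (simp add: is_space_def)
  interpret T: vector_space "scl ?T" using is_space_tensor[of V W] by (simp add: is_space_def)
  have subV: "V.subspace (carr V)" using V by (simp add: is_space_def)
  have subU: "U.subspace (carr U)" using U by (simp add: is_space_def)
  have subT: "T.subspace (carr ?T)" using is_space_tensor[of V W] by (simp add: is_space_def)
  have pureT: "pure V W v w \<in> carr ?T" if "v \<in> carr V" "w \<in> carr W" for v w
    using bilin_pure[of V W] that by (auto simp: bilin_def lin_def)
  have L: "L t = (\<Sum>(v, w)\<leftarrow>xs. F v w)"
    if "set xs \<subseteq> carr V \<times> carr W" "t = (\<Sum>(v, w)\<leftarrow>xs. pure V W v w)" for t xs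
  proof -
    have "t = (\<Sum>(v, w)\<leftarrow>sw V W t. pure V W v w)"
      unfolding sw_def by (rule someI2[where a = xs]) (use that in auto)
    with that(2) show ?thesis unfolding L_def by (intro tensor_sum_cong[OF U F]) simp
  qed
  have FU: "F v w \<in> carr U" if "v \<in> carr V" "w \<in> carr W" for v w
    using F that by (auto simp: bilin_def lin_def)
  show "L (pure V W v w) = F v w" if "v \<in> carr V" "w \<in> carr W" for v w
    using L[of "[(v, w)]"] that by simp
  show "lin ?T U L" unfolding lin_def
  proof (intro conjI ballI allI)
    fix t assume t: "t \<in> carr ?T"
    note s = sw[OF V t]
    have "(\<Sum>(v, w)\<leftarrow>xs. F v w) \<in> carr U" if "set xs \<subseteq> carr V \<times> carr W" for xs
      using that by (induction xs) (auto intro!: U.subspace_0[OF subU] U.subspace_add[OF subU] FU)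
    with s(1) show "L t \<in> carr U" unfolding L_def by blast
    {
      fix t' assume t': "t' \<in> carr ?T"
      note s' = sw[OF V t']
      have "t + t' = (\<Sum>(v, w)\<leftarrow>sw V W t @ sw V W t'. pure V W v w)"
        using s(2) s'(2) by simp
      then show "L (t + t') = L t + L t'"
        using s s' by (subst L[of "sw V W t @ sw V W t'"]) (auto simp: L_def)
    }
    fix c
    let ?xs = "map (\<lambda>(v, w). (scl V c v, w)) (sw V W t)"
    have "scl ?T c (\<Sum>(v, w)\<leftarrow>zs. pure V W v w)
        = (\<Sum>(v, w)\<leftarrow>map (\<lambda>(v, w). (scl V c v, w)) zs. pure V W v w)"
      if "set zs \<subseteq> carr V \<times> carr W" for zs
      using that bilin_pure[of V W]
      by (induction zs) (auto simp: T.scale_right_distrib bilin_def lin_def)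
    from this[OF s(1)] s(2) have "scl ?T c t = (\<Sum>(v, w)\<leftarrow>?xs. pure V W v w)" by simp
    moreover have "set ?xs \<subseteq> carr V \<times> carr W"
      using s(1) V.subspace_scale[OF subV] by auto
    ultimately have "L (scl ?T c t) = (\<Sum>(v, w)\<leftarrow>?xs. F v w)" by (intro L)
    also have "(\<Sum>(v, w)\<leftarrow>map (\<lambda>(v, w). (scl V c v, w)) zs. F v w) = scl U c (\<Sum>(v, w)\<leftarrow>zs. F v w)"
      if "set zs \<subseteq> carr V \<times> carr W" for zs
      using that F by (induction zs) (auto simp: U.scale_right_distrib bilin_def lin_def)
    from this[OF s(1)] have "(\<Sum>(v, w)\<leftarrow>?xs. F v w) = scl U c (L t)" by (simp add: L_def)
    finally show "L (scl ?T c t) = scl U c (L t)" .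
  qed
  show "\<forall>t\<in>carr ?T. L' t = L t"
    if L': "lin ?T U L'" "\<And>v w. v \<in> carr V \<Longrightarrow> w \<in> carr W \<Longrightarrow> L' (pure V W v w) = F v w" for L'
  proof
    fix t assume t: "t \<in> carr ?T"
    have "L' (0 + 0) = L' 0 + L' 0"
      using L'(1) T.subspace_0[OF subT] unfolding lin_def by blast
    then have L'0: "L' 0 = 0" by simp
    have "(\<Sum>(v, w)\<leftarrow>zs. pure V W v w) \<in> carr ?T \<and>
        L' (\<Sum>(v, w)\<leftarrow>zs. pure V W v w) = (\<Sum>(v, w)\<leftarrow>zs. F v w)"
      if "set zs \<subseteq> carr V \<times> carr W" for zs
      using that
    proof (induction zs)
      case Nil
      show ?case using L'0 T.subspace_0[OF subT] by (simp only: list.map sum_list.Nil simp_thms)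
    next
      case (Cons z zs)
      obtain v w where z: "z = (v, w)" "v \<in> carr V" "w \<in> carr W" using Cons.prems by (cases z) auto
      let ?p = "pure V W v w" and ?r = "\<Sum>(v, w)\<leftarrow>zs. pure V W v w"
      have r: "?r \<in> carr ?T" "L' ?r = (\<Sum>(v, w)\<leftarrow>zs. F v w)" using Cons by auto
      have "?p + ?r \<in> carr ?T" using pureT[OF z(2,3)] r(1) by (rule T.subspace_add[OF subT])
      moreover have "L' (?p + ?r) = L' ?p + L' ?r"
        using L'(1) pureT[OF z(2,3)] r(1) unfolding lin_def by blast
      moreover have "L' ?p = F v w" using z(2,3) by (rule L'(2))
      ultimately show ?case
        using r(2) by (simp only: z(1) list.map sum_list.Cons prod.case simp_thms)
    qed
    from this[OF sw(1)[OF V t]] sw(2)[OF V t] show "L' t = L t" by (simp add: L_def)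
  qed
qed

section \<open>Quasi-Hopf algebras\<close>

text \<open>The underlying algebra is the ring type \<open>'h\<close> itself, hence \<open>carr H = UNIV\<close> below.\<close>

record ('k, 'h) qhopf = "('k, 'h) space" +
  comult :: "'h \<Rightarrow> ('k, 'h, 'h) tensor"
  counit :: "'h \<Rightarrow> 'k"
  Phi :: "('k, 'h, ('k, 'h, 'h) tensor) tensor"
  antip :: "'h \<Rightarrow> 'h"
  alpha :: 'h
  beta :: 'h

type_synonym ('k, 'h) tensor3 = "('k, 'h, ('k, 'h, 'h) tensor) tensor"
type_synonym ('k, 'h) tensor4 = "('k, 'h, ('k, 'h, ('k, 'h, 'h) tensor) tensor) tensor"

context
  fixes H :: "('k::field, 'h::ring_1) qhopf"
begin

private abbreviation (input) "H2 \<equiv> tensor_space H H"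
private abbreviation (input) "H3 \<equiv> tensor_space H H2"
private abbreviation (input) "H4 \<equiv> tensor_space H H3"

definition pure2 :: "'h \<Rightarrow> 'h \<Rightarrow> ('k, 'h, 'h) tensor" where
  "pure2 a b = pure H H a b"

definition pure3 :: "'h \<Rightarrow> 'h \<Rightarrow> 'h \<Rightarrow> ('k, 'h) tensor3" where
  "pure3 a b c = pure H H2 a (pure2 b c)"

definition pure4 :: "'h \<Rightarrow> 'h \<Rightarrow> 'h \<Rightarrow> 'h \<Rightarrow> ('k, 'h) tensor4" where
  "pure4 a b c d = pure H H3 a (pure3 b c d)"

definition sw2 :: "('k, 'h, 'h) tensor \<Rightarrow> ('h \<times> 'h) list" where
  "sw2 t = sw H H t"

definition sw3 :: "('k, 'h) tensor3 \<Rightarrow> ('h \<times> 'h \<times> 'h) list" where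
  "sw3 t = [(a, b, c). (a, u) \<leftarrow> sw H H2 t, (b, c) \<leftarrow> sw2 u]"

definition sw4 :: "('k, 'h) tensor4 \<Rightarrow> ('h \<times> 'h \<times> 'h \<times> 'h) list" where
  "sw4 t = [(a, b, c, d). (a, u) \<leftarrow> sw H H3 t, (b, c, d) \<leftarrow> sw3 u]"

text \<open>Products in the algebras \<open>H \<otimes> H\<close>, \<open>H \<otimes> H \<otimes> H\<close>, \<open>H \<otimes> H \<otimes> H \<otimes> H\<close>; the pointwise product
  that the function type carries plays no role.\<close>

definition mult2 :: "('k, 'h, 'h) tensor \<Rightarrow> ('k, 'h, 'h) tensor \<Rightarrow> ('k, 'h, 'h) tensor"
  (infixl "\<bullet>\<^sub>2" 70) where
  "s \<bullet>\<^sub>2 t = (\<Sum>(a, b)\<leftarrow>sw2 s. \<Sum>(a', b')\<leftarrow>sw2 t. pure2 (a * a') (b * b'))"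

definition mult3 :: "('k, 'h) tensor3 \<Rightarrow> ('k, 'h) tensor3 \<Rightarrow> ('k, 'h) tensor3"
  (infixl "\<bullet>\<^sub>3" 70) where
  "s \<bullet>\<^sub>3 t = (\<Sum>(a, b, c)\<leftarrow>sw3 s. \<Sum>(a', b', c')\<leftarrow>sw3 t. pure3 (a * a') (b * b') (c * c'))"

definition mult4 :: "('k, 'h) tensor4 \<Rightarrow> ('k, 'h) tensor4 \<Rightarrow> ('k, 'h) tensor4"
  (infixl "\<bullet>\<^sub>4" 70) where
  "s \<bullet>\<^sub>4 t = (\<Sum>(a, b, c, d)\<leftarrow>sw4 s. \<Sum>(a', b', c', d')\<leftarrow>sw4 t.
     pure4 (a * a') (b * b') (c * c') (d * d'))"

definition comult_id :: "('k, 'h, 'h) tensor \<Rightarrow> ('k, 'h) tensor3" where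
  "comult_id t = (\<Sum>(a, b)\<leftarrow>sw2 t. \<Sum>(a1, a2)\<leftarrow>sw2 (comult H a). pure3 a1 a2 b)"

definition id_comult :: "('k, 'h, 'h) tensor \<Rightarrow> ('k, 'h) tensor3" where
  "id_comult t = (\<Sum>(a, b)\<leftarrow>sw2 t. \<Sum>(b1, b2)\<leftarrow>sw2 (comult H b). pure3 a b1 b2)"

definition comult_id_id :: "('k, 'h) tensor3 \<Rightarrow> ('k, 'h) tensor4" where
  "comult_id_id t = (\<Sum>(a, b, c)\<leftarrow>sw3 t. \<Sum>(a1, a2)\<leftarrow>sw2 (comult H a). pure4 a1 a2 b c)"

definition id_comult_id :: "('k, 'h) tensor3 \<Rightarrow> ('k, 'h) tensor4" where
  "id_comult_id t = (\<Sum>(a, b, c)\<leftarrow>sw3 t. \<Sum>(b1, b2)\<leftarrow>sw2 (comult H b). pure4 a b1 b2 c)"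

definition id_id_comult :: "('k, 'h) tensor3 \<Rightarrow> ('k, 'h) tensor4" where
  "id_id_comult t = (\<Sum>(a, b, c)\<leftarrow>sw3 t. \<Sum>(c1, c2)\<leftarrow>sw2 (comult H c). pure4 a b c1 c2)"

definition one_tensor :: "('k, 'h) tensor3 \<Rightarrow> ('k, 'h) tensor4" where
  "one_tensor t = (\<Sum>(a, b, c)\<leftarrow>sw3 t. pure4 1 a b c)"

definition tensor_one :: "('k, 'h) tensor3 \<Rightarrow> ('k, 'h) tensor4" where
  "tensor_one t = (\<Sum>(a, b, c)\<leftarrow>sw3 t. pure4 a b c 1)"

definition is_inverse3 :: "('k, 'h) tensor3 \<Rightarrow> ('k, 'h) tensor3 \<Rightarrow> bool" where
  "is_inverse3 s t \<longleftrightarrow> t \<in> carr H3 \<and> s \<bullet>\<^sub>3 t = pure3 1 1 1 \<and> t \<bullet>\<^sub>3 s = pure3 1 1 1"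

definition Phi_inv :: "('k, 'h) tensor3" where
  "Phi_inv = (THE t. is_inverse3 (Phi H) t)"

definition algebra_over :: bool where
  "algebra_over \<longleftrightarrow> is_space H \<and> carr H = UNIV \<and>
     (\<forall>c x y. scl H c x * y = scl H c (x * y) \<and> x * scl H c y = scl H c (x * y))"

definition quasi_bialgebra :: bool where
  "quasi_bialgebra \<longleftrightarrow> algebra_over \<and>
     lin H H2 (comult H) \<and>
     (\<forall>x y. comult H (x * y) = comult H x \<bullet>\<^sub>2 comult H y) \<and> comult H 1 = pure2 1 1 \<and>
     lin H ground (counit H) \<and>
     (\<forall>x y. counit H (x * y) = counit H x * counit H y) \<and> counit H 1 = 1 \<and>
     Phi H \<in> carr H3 \<and> (\<exists>t. is_inverse3 (Phi H) t) \<and>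
     (\<forall>h. id_comult (comult H h) = Phi H \<bullet>\<^sub>3 comult_id (comult H h) \<bullet>\<^sub>3 Phi_inv) \<and>
     (\<forall>h. (\<Sum>(h1, h2)\<leftarrow>sw2 (comult H h). scl H (counit H h2) h1) = h) \<and>
     (\<forall>h. (\<Sum>(h1, h2)\<leftarrow>sw2 (comult H h). scl H (counit H h1) h2) = h) \<and>
     one_tensor (Phi H) \<bullet>\<^sub>4 id_comult_id (Phi H) \<bullet>\<^sub>4 tensor_one (Phi H)
       = id_id_comult (Phi H) \<bullet>\<^sub>4 comult_id_id (Phi H) \<and>
     (\<Sum>(X1, X2, X3)\<leftarrow>sw3 (Phi H). pure2 (scl H (counit H X2) X1) X3) = pure2 1 1"

definition quasi_hopf :: bool where
  "quasi_hopf \<longleftrightarrow> quasi_bialgebra \<and>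
     lin H H (antip H) \<and> bij (antip H) \<and>
     (\<forall>x y. antip H (x * y) = antip H y * antip H x) \<and> antip H 1 = 1 \<and>
     (\<forall>h. (\<Sum>(h1, h2)\<leftarrow>sw2 (comult H h). antip H h1 * alpha H * h2) = scl H (counit H h) (alpha H)) \<and>
     (\<forall>h. (\<Sum>(h1, h2)\<leftarrow>sw2 (comult H h). h1 * beta H * antip H h2) = scl H (counit H h) (beta H)) \<and>
     (\<Sum>(X1, X2, X3)\<leftarrow>sw3 (Phi H). X1 * beta H * antip H X2 * alpha H * X3) = 1 \<and>
     (\<Sum>(x1, x2, x3)\<leftarrow>sw3 Phi_inv. antip H x1 * alpha H * x2 * beta H * antip H x3) = 1 \<and>
     counit H (alpha H) = 1 \<and> counit H (beta H) = 1"

private abbreviation (input) "S \<equiv> antip H"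

definition antip_inv :: "'h \<Rightarrow> 'h" where
  "antip_inv = inv S"

definition p_R :: "('k, 'h, 'h) tensor" where
  "p_R = (\<Sum>(x1, x2, x3)\<leftarrow>sw3 Phi_inv. pure2 x1 (x2 * beta H * S x3))"

definition q_R :: "('k, 'h, 'h) tensor" where
  "q_R = (\<Sum>(X1, X2, X3)\<leftarrow>sw3 (Phi H). pure2 X1 (antip_inv (alpha H * X3) * X2))"

definition p_L :: "('k, 'h, 'h) tensor" where
  "p_L = (\<Sum>(X1, X2, X3)\<leftarrow>sw3 (Phi H). pure2 (X2 * antip_inv (X1 * beta H)) X3)"

definition q_L :: "('k, 'h, 'h) tensor" where
  "q_L = (\<Sum>(x1, x2, x3)\<leftarrow>sw3 Phi_inv. pure2 (S x1 * alpha H * x2) x3)"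

definition gamma_twist :: "('k, 'h, 'h) tensor" where
  "gamma_twist = (\<Sum>(A1, A2, A3, A4)\<leftarrow>sw4 (tensor_one (Phi H) \<bullet>\<^sub>4 comult_id_id Phi_inv).
     pure2 (S A2 * alpha H * A3) (S A1 * alpha H * A4))"

definition delta_twist :: "('k, 'h, 'h) tensor" where
  "delta_twist = (\<Sum>(B1, B2, B3, B4)\<leftarrow>sw4 (comult_id_id (Phi H) \<bullet>\<^sub>4 tensor_one Phi_inv).
     pure2 (B1 * beta H * S B4) (B2 * beta H * S B3))"

definition SS_comult_op :: "'h \<Rightarrow> ('k, 'h, 'h) tensor" where
  "SS_comult_op h = (\<Sum>(h1, h2)\<leftarrow>sw2 (comult H h). pure2 (S h2) (S h1))"

definition twist :: "('k, 'h, 'h) tensor" where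
  "twist = (\<Sum>(x1, x2, x3)\<leftarrow>sw3 Phi_inv.
     SS_comult_op x1 \<bullet>\<^sub>2 gamma_twist \<bullet>\<^sub>2 comult H (x2 * beta H * S x3))"

definition twist_inv :: "('k, 'h, 'h) tensor" where
  "twist_inv = (\<Sum>(x1, x2, x3)\<leftarrow>sw3 Phi_inv.
     comult H (S x1 * alpha H * x2) \<bullet>\<^sub>2 delta_twist \<bullet>\<^sub>2 SS_comult_op x3)"

end

section \<open>Yetter-Drinfeld modules\<close>

record ('k, 'h, 'v) ydm = "('k, 'v) space" +
  act :: "'h \<Rightarrow> 'v \<Rightarrow> 'v"
  coact :: "'v \<Rightarrow> ('k, 'h, 'v) tensor"

definition left_module :: "('k::field, 'h::ring_1) qhopf \<Rightarrow> ('k, 'h, 'v::ab_group_add) ydm \<Rightarrow> bool" where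
  "left_module H M \<longleftrightarrow> is_space M \<and> bilin H M M (act M) \<and>
     (\<forall>h h'. \<forall>m\<in>carr M. act M (h * h') m = act M h (act M h' m)) \<and>
     (\<forall>m\<in>carr M. act M 1 m = m)"

definition yd_module :: "('k::field, 'h::ring_1) qhopf \<Rightarrow> ('k, 'h, 'v::ab_group_add) ydm \<Rightarrow> bool" where
  "yd_module H M \<longleftrightarrow> left_module H M \<and> lin M (tensor_space H M) (coact M) \<and>
     (\<forall>m\<in>carr M.
        (\<Sum>(X1, X2, X3)\<leftarrow>sw3 H (Phi H). \<Sum>(a, m0)\<leftarrow>sw H M (coact M m).
         \<Sum>(b, m00)\<leftarrow>sw H M (coact M (act M X2 m0)).
           pure H (tensor_space H M) (X1 * a) (pure H M (b * X3) m00))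
      = (\<Sum>(X1, X2, X3)\<leftarrow>sw3 H (Phi H). \<Sum>(Y1, Y2, Y3)\<leftarrow>sw3 H (Phi H).
         \<Sum>(a, m0)\<leftarrow>sw H M (coact M (act M Y1 m)). \<Sum>(a1, a2)\<leftarrow>sw2 H (comult H a).
           pure H (tensor_space H M) (X1 * a1 * Y2) (pure H M (X2 * a2 * Y3) (act M X3 m0)))) \<and>
     (\<forall>m\<in>carr M. (\<Sum>(a, m0)\<leftarrow>sw H M (coact M m). scl M (counit H a) m0) = m) \<and>
     (\<forall>h. \<forall>m\<in>carr M.
        (\<Sum>(h1, h2)\<leftarrow>sw2 H (comult H h). \<Sum>(a, m0)\<leftarrow>sw H M (coact M m).
           pure H M (h1 * a) (act M h2 m0))
      = (\<Sum>(h1, h2)\<leftarrow>sw2 H (comult H h). \<Sum>(a, m0)\<leftarrow>sw H M (coact M (act M h1 m)).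
           pure H M (a * h2) m0))"

definition yd_module_fd :: "('k::field, 'h::ring_1) qhopf \<Rightarrow> ('k, 'h, 'v::ab_group_add) ydm \<Rightarrow> bool" where
  "yd_module_fd H M \<longleftrightarrow> yd_module H M \<and> (\<exists>B. finite B \<and> module.span (scl M) B = carr M)"

definition yd_hom :: "('k::field, 'h::ring_1) qhopf \<Rightarrow> ('k, 'h, 'v::ab_group_add) ydm
    \<Rightarrow> ('k, 'h, 'w::ab_group_add) ydm \<Rightarrow> ('v \<Rightarrow> 'w) \<Rightarrow> bool" where
  "yd_hom H M N f \<longleftrightarrow> lin M N f \<and>
     (\<forall>h. \<forall>m\<in>carr M. f (act M h m) = act N h (f m)) \<and>
     (\<forall>m\<in>carr M. coact N (f m) = (\<Sum>(a, m0)\<leftarrow>sw H M (coact M m). pure H N a (f m0)))"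

definition yd_iso_with_inverse :: "('k::field, 'h::ring_1) qhopf \<Rightarrow> ('k, 'h, 'v::ab_group_add) ydm
    \<Rightarrow> ('k, 'h, 'w::ab_group_add) ydm \<Rightarrow> ('v \<Rightarrow> 'w) \<Rightarrow> ('w \<Rightarrow> 'v) \<Rightarrow> bool" where
  "yd_iso_with_inverse H M N f g \<longleftrightarrow> yd_hom H M N f \<and> yd_hom H N M g \<and>
     (\<forall>m\<in>carr M. g (f m) = m) \<and> (\<forall>n\<in>carr N. f (g n) = n)"

definition dual_bases :: "('k::field, 'v::ab_group_add, 'x) space_scheme \<Rightarrow> nat
    \<Rightarrow> (nat \<Rightarrow> 'v) \<Rightarrow> (nat \<Rightarrow> 'v \<Rightarrow> 'k) \<Rightarrow> bool" where
  "dual_bases V s e e' \<longleftrightarrow>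
     inj_on e {1..s} \<and> \<not> module.dependent (scl V) (e ` {1..s}) \<and>
     module.span (scl V) (e ` {1..s}) = carr V \<and>
     (\<forall>i\<in>{1..s}. e' i \<in> carr (dual_space V)) \<and>
     (\<forall>i\<in>{1..s}. \<forall>j\<in>{1..s}. e' i (e j) = (if i = j then 1 else 0))"

definition yd_tensor :: "('k::field, 'h::ring_1) qhopf \<Rightarrow> ('k, 'h, 'm::ab_group_add) ydm
    \<Rightarrow> ('k, 'h, 'n::ab_group_add) ydm \<Rightarrow> ('k, 'h, ('k, 'm, 'n) tensor) ydm" where
  "yd_tensor H M N = \<lparr>
     carr = carr (tensor_space M N),
     scl = scl (tensor_space M N),
     act = (\<lambda>h t. \<Sum>(m, n)\<leftarrow>sw M N t. \<Sum>(h1, h2)\<leftarrow>sw2 H (comult H h).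
       pure M N (act M h1 m) (act N h2 n)),
     coact = (\<lambda>t. \<Sum>(m, n)\<leftarrow>sw M N t.
       \<Sum>(X1, X2, X3)\<leftarrow>sw3 H (Phi H). \<Sum>(x1, x2, x3)\<leftarrow>sw3 H (Phi_inv H). \<Sum>(Y1, Y2, Y3)\<leftarrow>sw3 H (Phi H).
       \<Sum>(a, m0)\<leftarrow>sw H M (coact M (act M (x1 * Y1) m)). \<Sum>(b, n0)\<leftarrow>sw H N (coact N (act N Y2 n)).
         pure H (tensor_space M N) (X1 * a * x2 * b * Y3)
           (pure M N (act M X2 m0) (act N (X3 * x3) n0)))\<rparr>"

text \<open>The coactions on the duals are given by dual bases, on which they do not depend.\<close>

definition yd_left_dual :: "('k::field, 'h::ring_1) qhopf \<Rightarrow> ('k, 'h, 'm::ab_group_add) ydm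
    \<Rightarrow> ('k, 'h, 'm \<Rightarrow> 'k) ydm" where
  "yd_left_dual H M = \<lparr>
     carr = carr (dual_space M),
     scl = scl (dual_space M),
     act = (\<lambda>h \<phi> m. if m \<in> carr M then \<phi> (act M (antip H h) m) else 0),
     coact = (\<lambda>\<phi>. case (SOME (s, e, e'). dual_bases M s e e') of (s, e, e') \<Rightarrow>
       \<Sum>i=1..s. \<Sum>(f1, f2)\<leftarrow>sw2 H (twist H). \<Sum>(g1, g2)\<leftarrow>sw2 H (twist_inv H).
       \<Sum>(a, m0)\<leftarrow>sw H M (coact M (act M g1 (e i))).
         pure H (dual_space M) (scl H (\<phi> (act M f2 m0)) (antip_inv H (f1 * a * g2))) (e' i))\<rparr>"

definition yd_right_dual :: "('k::field, 'h::ring_1) qhopf \<Rightarrow> ('k, 'h, 'm::ab_group_add) ydm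
    \<Rightarrow> ('k, 'h, 'm \<Rightarrow> 'k) ydm" where
  "yd_right_dual H M = \<lparr>
     carr = carr (dual_space M),
     scl = scl (dual_space M),
     act = (\<lambda>h \<phi> m. if m \<in> carr M then \<phi> (act M (antip_inv H h) m) else 0),
     coact = (\<lambda>\<phi>. case (SOME (s, e, e'). dual_bases M s e e') of (s, e, e') \<Rightarrow>
       \<Sum>i=1..s. \<Sum>(f1, f2)\<leftarrow>sw2 H (twist H). \<Sum>(g1, g2)\<leftarrow>sw2 H (twist_inv H).
       \<Sum>(a, m0)\<leftarrow>sw H M (coact M (act M (antip_inv H g2) (e i))).
         pure H (dual_space M)
           (scl H (\<phi> (act M (antip_inv H f1) m0)) (g1 * antip H a * f2)) (e' i))\<rparr>"

section \<open>The maps between duals of tensor products\<close>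

context
  fixes H :: "('k::field, 'h::ring_1) qhopf"
    and M :: "('k, 'h, 'm::ab_group_add) ydm"
    and N :: "('k, 'h, 'n::ab_group_add) ydm"
begin

definition sigma_left_form :: "('m \<Rightarrow> 'k) \<Rightarrow> ('n \<Rightarrow> 'k) \<Rightarrow> 'm \<Rightarrow> 'n \<Rightarrow> 'k" where
  "sigma_left_form \<phi> \<psi> m n =
     (\<Sum>(f1, f2)\<leftarrow>sw2 H (twist H). \<Sum>(q1, q2)\<leftarrow>sw2 H (q_L H). \<Sum>(q21, q22)\<leftarrow>sw2 H (comult H q2).
      \<Sum>(X1, X2, X3)\<leftarrow>sw3 H (Phi H). \<Sum>(p1, p2)\<leftarrow>sw2 H (p_R H).
      \<Sum>(a, n0)\<leftarrow>sw H N (coact N (act N p1 n)).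
        \<phi> (act M (f2 * q22 * X3 * antip_inv H (q1 * X1 * a * p2)) m) * \<psi> (act N (f1 * q21 * X2) n0))"

definition sigma_left :: "('k, 'm \<Rightarrow> 'k, 'n \<Rightarrow> 'k) tensor \<Rightarrow> ('k, 'm, 'n) tensor \<Rightarrow> 'k" where
  "sigma_left t = (\<lambda>u. if u \<in> carr (tensor_space M N) then
     (\<Sum>(\<phi>, \<psi>)\<leftarrow>sw (dual_space M) (dual_space N) t. \<Sum>(m, n)\<leftarrow>sw M N u. sigma_left_form \<phi> \<psi> m n)
     else 0)"

text \<open>The pairing of a functional with an element of \<open>M \<otimes> N\<close> is a scalar, here the coefficient of
  \<open>em' i \<otimes> en' j\<close> via \<open>fun_scl\<close>, the scalar multiplication of every tensor product space.\<close>

definition sigma_left_inv :: "nat \<Rightarrow> (nat \<Rightarrow> 'm) \<Rightarrow> (nat \<Rightarrow> 'm \<Rightarrow> 'k) \<Rightarrow>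
    nat \<Rightarrow> (nat \<Rightarrow> 'n) \<Rightarrow> (nat \<Rightarrow> 'n \<Rightarrow> 'k) \<Rightarrow>
    (('k, 'm, 'n) tensor \<Rightarrow> 'k) \<Rightarrow> ('k, 'm \<Rightarrow> 'k, 'n \<Rightarrow> 'k) tensor" where
  "sigma_left_inv s em em' t en en' \<mu> =
     (\<Sum>i=1..s. \<Sum>j=1..t. fun_scl
       (\<Sum>(g1, g2)\<leftarrow>sw2 H (twist_inv H). \<Sum>(a, n0)\<leftarrow>sw H N (coact N (act N g1 (en j))).
          \<mu> (pure M N (act M (a * g2) (em i)) n0))
       (pure (dual_space M) (dual_space N) (em' i) (en' j)))"

definition sigma_right_form :: "('m \<Rightarrow> 'k) \<Rightarrow> ('n \<Rightarrow> 'k) \<Rightarrow> 'm \<Rightarrow> 'n \<Rightarrow> 'k" where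
  "sigma_right_form \<phi> \<psi> m n =
     (\<Sum>(f1, f2)\<leftarrow>sw2 H (twist H). \<Sum>(q1, q2)\<leftarrow>sw2 H (q_R H). \<Sum>(x1, x2, x3)\<leftarrow>sw3 H (Phi_inv H).
      \<Sum>(p1, p2)\<leftarrow>sw2 H (p_L H). \<Sum>(p21, p22)\<leftarrow>sw2 H (comult H p2).
      \<Sum>(a, n0)\<leftarrow>sw H N (coact N (act N (x1 * p1 * antip_inv H f1) n)).
        \<phi> (act M (antip_inv H (f2 * q1 * a * x2 * p21)) m) * \<psi> (act N (antip_inv H (x3 * p22) * q2) n0))"

definition sigma_right :: "('k, 'm \<Rightarrow> 'k, 'n \<Rightarrow> 'k) tensor \<Rightarrow> ('k, 'm, 'n) tensor \<Rightarrow> 'k" where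
  "sigma_right t = (\<lambda>u. if u \<in> carr (tensor_space M N) then
     (\<Sum>(\<phi>, \<psi>)\<leftarrow>sw (dual_space M) (dual_space N) t. \<Sum>(m, n)\<leftarrow>sw M N u. sigma_right_form \<phi> \<psi> m n)
     else 0)"

definition sigma_right_inv :: "nat \<Rightarrow> (nat \<Rightarrow> 'm) \<Rightarrow> (nat \<Rightarrow> 'm \<Rightarrow> 'k) \<Rightarrow>
    nat \<Rightarrow> (nat \<Rightarrow> 'n) \<Rightarrow> (nat \<Rightarrow> 'n \<Rightarrow> 'k) \<Rightarrow>
    (('k, 'm, 'n) tensor \<Rightarrow> 'k) \<Rightarrow> ('k, 'm \<Rightarrow> 'k, 'n \<Rightarrow> 'k) tensor" where
  "sigma_right_inv s em em' t en en' \<nu> =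
     (\<Sum>i=1..s. \<Sum>j=1..t. fun_scl
       (\<Sum>(g1, g2)\<leftarrow>sw2 H (twist_inv H). \<Sum>(a, n0)\<leftarrow>sw H N (coact N (act N (antip_inv H g2) (en j))).
          \<nu> (pure M N (act M (a * antip_inv H g1) (em i)) n0))
       (pure (dual_space M) (dual_space N) (em' i) (en' j)))"

end

end

theory Submission
  imports Defs
begin

text \<open>
  Elements of \<open>M\<^sup>* \<otimes> N\<^sup>*\<close> and of \<open>(M \<otimes> N)\<^sup>*\<close> are both bilinear forms on \<open>M \<times> N\<close>.  In these terms
  \<open>\<sigma>\<inverse>\<close> sends \<open>b\<close> to \<open>c b\<close> precomposed with the inverse twist, where
  \<open>(c b)(m, n) = b(n\<^sub>-\<^sub>1 \<cdot> m, n\<^sub>0)\<close> is transposition along the braiding of Yetter-Drinfeld modules.  The map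
  \<open>c\<close> has an explicit inverse, which the Yetter-Drinfeld axioms reduce to the snake identities for the
  pentagon, and \<open>\<sigma>\<close> is that inverse precomposed with the twist.  Colinearity of \<open>\<sigma>\<inverse>\<close> is colinearity
  of the braiding, conjugated by \<open>f\<close>; what makes the conjugation work is
  \<open>f \<Delta>(S h) = (S \<otimes> S)(\<Delta>\<^sup>o\<^sup>p h) f\<close> and the formula for the reassociator twisted by \<open>f\<close>,
  both of which follow from the uniqueness of antipodes.  The left and the right duals are treated at
  once, using \<open>(S, f)\<close> for the former and \<open>(S\<inverse>, S\<inverse>(f\<^sup>2) \<otimes> S\<inverse>(f\<^sup>1))\<close> for the latter.
\<close>

section \<open>Linear algebra of tensors\<close>

text \<open>The stated map for right duals is not visibly an inverse of \<open>c\<close> combined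
  with a twist: its twist acts on the arguments of \<open>right_form\<close> instead of on the form
  fed to \<open>coform_inv\<close>, and \<open>right_form\<close> uses \<open>q_R\<close> and
  \<open>p_L\<close> where \<open>coform_inv\<close> uses \<open>q_L\<close> and \<open>p_R\<close>.
  The two expressions are matched by composing with \<open>c\<close>. Expanding f there would carry
  along its whole defining sum, so the composite is computed with \<gamma> = f \<Delta>(\<alpha>) in
  place of f; \<gamma> is explicit and free of \<beta>. Since S(x1) \<alpha> x2 \<beta> S(x3) sums
  to 1 and f intertwines, f is recovered from \<gamma>, and with it the identity. The same device
  yields the twisted reassociator.

  The identities relate Sweedler sums with many bound legs. Tensors are tested on arbitrary
  multilinear forms, so that products become nested sums inside one form and independent sums can be
  exchanged. A leg typically moves by quasi-coassociativity, the pentagon or a Yetter-Drinfeld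
  axiom, and disappears by contraction against \<alpha> or \<beta> followed by a counit.\<close>

lemma is_space_subspaceD:
  assumes "is_space V"
  shows is_space_zero: "0 \<in> carr V"
    and is_space_add: "\<And>x y. x \<in> carr V \<Longrightarrow> y \<in> carr V \<Longrightarrow> x + y \<in> carr V"
    and is_space_scl: "\<And>c x. x \<in> carr V \<Longrightarrow> scl V c x \<in> carr V"
    and is_space_scl_zero: "\<And>c. scl V c 0 = 0"
    and is_space_scl_add: "\<And>c x y. scl V c (x + y) = scl V c x + scl V c y"
    and is_space_scl_add_left: "\<And>c d x. scl V (c + d) x = scl V c x + scl V d x"
    and is_space_scl_scl: "\<And>c d x. scl V c (scl V d x) = scl V (c * d) x"
    and is_space_scl_one: "\<And>x. scl V 1 x = x"
proof -
  interpret vector_space "scl V" using assms by (simp add: is_space_def)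
  have sub: "subspace (carr V)" using assms by (simp add: is_space_def)
  show "0 \<in> carr V" using sub by (rule subspace_0)
  show "x + y \<in> carr V" if "x \<in> carr V" "y \<in> carr V" for x y using sub that by (rule subspace_add)
  show "scl V c x \<in> carr V" if "x \<in> carr V" for c x using sub that by (rule subspace_scale)
  show "scl V c 0 = 0" for c by (rule scale_zero_right)
qed (use assms in \<open>simp_all add: is_space_def vector_space.vector_space_assms\<close>)

lemma is_space_ground [simp]: "is_space (ground :: ('k::field, 'k) space)"
proof -
  interpret vector_space "(*) :: 'k \<Rightarrow> _" by unfold_locales (auto simp: algebra_simps)
  show ?thesis by (simp add: is_space_def ground_def vector_space_axioms)
qed

lemma carr_ground [simp]: "carr ground = UNIV" and scl_ground [simp]: "scl ground = (*)"
  by (simp_all add: ground_def)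

declare is_space_tensor [simp]

lemma scl_tensor [simp]: "scl (tensor_space V W) = fun_scl"
  by (simp add: tensor_space_def)

lemma sum_list_closed:
  "is_space U \<Longrightarrow> (\<And>x. x \<in> set xs \<Longrightarrow> f x \<in> carr U) \<Longrightarrow> (\<Sum>x\<leftarrow>xs. f x) \<in> carr U"
  by (induction xs) (auto simp: is_space_zero is_space_add)

lemma sum_list_scl:
  "is_space U \<Longrightarrow> scl U c (\<Sum>x\<leftarrow>xs. f x) = (\<Sum>x\<leftarrow>xs. scl U c (f x))"
  by (induction xs) (auto simp: is_space_scl_zero is_space_scl_add)

lemma sum_closed:
  assumes "is_space U" "\<And>x. x \<in> A \<Longrightarrow> f x \<in> carr U"
  shows "(\<Sum>x\<in>A. f x) \<in> carr U"
  using assms(2) by (induction A rule: infinite_finite_induct)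
    (auto simp: is_space_zero[OF assms(1)] is_space_add[OF assms(1)])

lemma sum_scl:
  assumes "is_space U"
  shows "scl U c (\<Sum>x\<in>A. f x) = (\<Sum>x\<in>A. scl U c (f x))"
  by (induction A rule: infinite_finite_induct)
    (auto simp: is_space_scl_zero[OF assms] is_space_scl_add[OF assms])

lemma sum_list_swap:
  fixes F :: "'a \<Rightarrow> 'b \<Rightarrow> 'c::comm_monoid_add"
  shows "(\<Sum>x\<leftarrow>xs. \<Sum>y\<leftarrow>ys. F x y) = (\<Sum>y\<leftarrow>ys. \<Sum>x\<leftarrow>xs. F x y)"
  by (induction xs) (auto simp: sum_list_addf)

lemma lin_closed: "lin V W f \<Longrightarrow> v \<in> carr V \<Longrightarrow> f v \<in> carr W"
  by (simp add: lin_def)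

lemma lin_add: "lin V W f \<Longrightarrow> v \<in> carr V \<Longrightarrow> v' \<in> carr V \<Longrightarrow> f (v + v') = f v + f v'"
  by (simp add: lin_def)

lemma lin_scl: "lin V W f \<Longrightarrow> v \<in> carr V \<Longrightarrow> f (scl V c v) = scl W c (f v)"
  by (simp add: lin_def)

lemma lin_zero: "is_space V \<Longrightarrow> lin V W f \<Longrightarrow> f 0 = 0"
  using lin_add[of V W f 0 0] by (simp add: is_space_zero)

lemma lin_sum_list:
  assumes "is_space V" "lin V W f" "\<And>x. x \<in> set xs \<Longrightarrow> g x \<in> carr V"
  shows "f (\<Sum>x\<leftarrow>xs. g x) = (\<Sum>x\<leftarrow>xs. f (g x))"
  using assms(3)
proof (induction xs)
  case (Cons a xs)
  then have "(\<Sum>x\<leftarrow>xs. g x) \<in> carr V" by (intro sum_list_closed assms(1)) auto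
  with Cons show ?case by (simp add: lin_add[OF assms(2)])
qed (simp add: lin_zero[OF assms(1,2)])

lemma lin_sum:
  assumes "is_space V" "lin V W f" "\<And>x. x \<in> A \<Longrightarrow> g x \<in> carr V"
  shows "f (\<Sum>x\<in>A. g x) = (\<Sum>x\<in>A. f (g x))"
  using assms(3)
proof (induction A rule: infinite_finite_induct)
  case (insert a A)
  then have "(\<Sum>x\<in>A. g x) \<in> carr V" by (intro sum_closed assms(1)) auto
  with insert show ?case by (simp add: lin_add[OF assms(2)])
qed (simp_all add: lin_zero[OF assms(1,2)])

lemma lin_ident: "lin V V (\<lambda>x. x)"
  by (simp add: lin_def)

lemma lin_comp: "lin V W f \<Longrightarrow> lin W U g \<Longrightarrow> lin V U (\<lambda>x. g (f x))"
  by (simp add: lin_def)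

lemma lin_sum_body:
  assumes "is_space V" "is_space U" "\<And>y. y \<in> A \<Longrightarrow> lin V U (\<lambda>x. F x y)"
  shows "lin V U (\<lambda>x. \<Sum>y\<in>A. F x y)"
  using assms(3)
  by (induction A rule: infinite_finite_induct)
    (auto simp: lin_def is_space_zero[OF assms(2)] is_space_add[OF assms(2)]
      is_space_scl_zero[OF assms(2)] is_space_scl_add[OF assms(2)])

lemma lin_sum_list_body:
  assumes "is_space V" "is_space U" "\<And>y. y \<in> set ys \<Longrightarrow> lin V U (\<lambda>x. F x y)"
  shows "lin V U (\<lambda>x. \<Sum>y\<leftarrow>ys. F x y)"
  using assms(3)
  by (induction ys)
    (auto simp: lin_def is_space_zero[OF assms(2)] is_space_add[OF assms(2)]
      is_space_scl_zero[OF assms(2)] is_space_scl_add[OF assms(2)])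

lemma lin_scl_const:
  assumes "is_space U" "lin V U f"
  shows "lin V U (\<lambda>x. scl U c (f x))"
  using assms(2)
  by (auto simp: lin_def is_space_scl[OF assms(1)] is_space_scl_add[OF assms(1)]
      is_space_scl_scl[OF assms(1)] mult.commute)

lemma lin_scl_left:
  assumes "is_space U" "lin V ground f" "u \<in> carr U"
  shows "lin V U (\<lambda>x. scl U (f x) u)"
  using assms(2,3)
  by (auto simp: lin_def is_space_scl[OF assms(1)] is_space_scl_add_left[OF assms(1)]
      is_space_scl_scl[OF assms(1)])

lemma lin_mult_ground1: "lin V ground f \<Longrightarrow> lin V ground (\<lambda>x. f x * c)"
  and lin_mult_ground2: "lin V ground f \<Longrightarrow> lin V ground (\<lambda>x. c * f x)"
  by (auto simp: lin_def algebra_simps)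

lemma bilinI:
  "(\<And>w. w \<in> carr W \<Longrightarrow> lin V U (\<lambda>v. F v w)) \<Longrightarrow> (\<And>v. v \<in> carr V \<Longrightarrow> lin W U (F v))
    \<Longrightarrow> bilin V W U F"
  by (simp add: bilin_def)

lemma bilin_lin1: "bilin V W U F \<Longrightarrow> w \<in> carr W \<Longrightarrow> lin X V f \<Longrightarrow> lin X U (\<lambda>x. F (f x) w)"
  and bilin_lin2: "bilin V W U F \<Longrightarrow> v \<in> carr V \<Longrightarrow> lin X W g \<Longrightarrow> lin X U (\<lambda>x. F v (g x))"
  by (auto simp: bilin_def lin_def)

section \<open>Evaluating tensors on bilinear maps\<close>

text \<open>The value at \<open>t\<close> of the linear map induced by \<open>F\<close>. Bilinearity
  of \<open>F\<close> makes it independent of the list chosen by \<open>sw\<close>; rearranging sums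
  uses only that some list is fixed.\<close>

definition ev :: "('k::field, 'v::ab_group_add, 'x) space_scheme \<Rightarrow> ('k, 'w::ab_group_add, 'y) space_scheme
    \<Rightarrow> ('k, 'v, 'w) tensor \<Rightarrow> ('v \<Rightarrow> 'w \<Rightarrow> 'u::ab_group_add) \<Rightarrow> 'u" where
  "ev V W t F = (\<Sum>(v, w)\<leftarrow>sw V W t. F v w)"

lemma ev_cong:
  assumes "is_space V" "t \<in> carr (tensor_space V W)"
    and "\<And>v w. v \<in> carr V \<Longrightarrow> w \<in> carr W \<Longrightarrow> F v w = G v w"
  shows "ev V W t F = ev V W t G"
proof -
  have "map (\<lambda>(v, w). F v w) (sw V W t) = map (\<lambda>(v, w). G v w) (sw V W t)"
    using sw(1)[OF assms(1,2)] assms(3) by auto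
  then show ?thesis unfolding ev_def by (rule arg_cong)
qed

text \<open>Both sides run over two lists fixed in advance, so neither linearity nor membership
  enters. This is why independent Sweedler sums can be reordered freely below.\<close>

lemma ev_swap:
  "ev V W s (\<lambda>a b. ev V' W' t (\<lambda>c d. F a b c d)) = ev V' W' t (\<lambda>c d. ev V W s (\<lambda>a b. F a b c d))"
  unfolding ev_def case_prod_unfold by (rule sum_list_swap)

lemma ev_sum: "ev V W s (\<lambda>a b. \<Sum>y\<in>A. F a b y) = (\<Sum>y\<in>A. ev V W s (\<lambda>a b. F a b y))"
proof -
  have "(\<Sum>(a, b)\<leftarrow>xs. \<Sum>y\<in>A. F a b y) = (\<Sum>y\<in>A. \<Sum>(a, b)\<leftarrow>xs. F a b y)" for xs
    by (induction xs) (auto simp: sum.distrib)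
  then show ?thesis unfolding ev_def .
qed

lemma ev_closed:
  assumes "is_space V" "is_space U" "t \<in> carr (tensor_space V W)"
    and "\<And>v w. v \<in> carr V \<Longrightarrow> w \<in> carr W \<Longrightarrow> F v w \<in> carr U"
  shows "ev V W t F \<in> carr U"
  unfolding ev_def using sw(1)[OF assms(1,3)] assms(4)
  by (intro sum_list_closed assms(2)) auto

lemma ev_scl:
  "is_space U \<Longrightarrow> scl U c (ev V W t F) = ev V W t (\<lambda>v w. scl U c (F v w))"
  unfolding ev_def by (simp add: sum_list_scl case_prod_unfold)

lemma mult_ev: "(c :: 'k::field) * ev V W t F = ev V W t (\<lambda>v w. c * F v w)"
  using ev_scl[OF is_space_ground, of c V W t F] by simp

lemma lin_ev_apply:
  assumes "is_space V" "is_space X" "lin X Y f" "t \<in> carr (tensor_space V W)"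
    and "\<And>v w. v \<in> carr V \<Longrightarrow> w \<in> carr W \<Longrightarrow> F v w \<in> carr X"
  shows "f (ev V W t F) = ev V W t (\<lambda>v w. f (F v w))"
  unfolding ev_def using sw(1)[OF assms(1,4)] assms(5)
  by (subst lin_sum_list[OF assms(2,3)]) (auto simp: case_prod_unfold)

lemma lin_ev_arg:
  assumes "is_space V" "is_space U" "bilin V W U F" "lin X (tensor_space V W) f"
  shows "lin X U (\<lambda>x. ev V W (f x) F)"
  unfolding ev_def by (rule lin_comp[OF assms(4) tensor_universal(1)[OF assms(1-3)]])

lemma lin_ev_body:
  assumes "is_space V" "is_space X" "is_space U" "t \<in> carr (tensor_space V W)"
    and "\<And>v w. v \<in> carr V \<Longrightarrow> w \<in> carr W \<Longrightarrow> lin X U (\<lambda>x. F x v w)"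
  shows "lin X U (\<lambda>x. ev V W t (F x))"
  unfolding ev_def case_prod_unfold using sw(1)[OF assms(1,4)] assms(5)
  by (intro lin_sum_list_body assms(2,3)) auto

lemma ev_pure:
  assumes "is_space V" "is_space U" "bilin V W U F" "v \<in> carr V" "w \<in> carr W"
  shows "ev V W (pure V W v w) F = F v w"
  unfolding ev_def by (rule tensor_universal(2)[OF assms])

lemma ev_fun_scl:
  assumes "is_space V" "is_space U" "bilin V W U F" "s \<in> carr (tensor_space V W)"
  shows "ev V W (fun_scl c s) F = scl U c (ev V W s F)"
  using lin_scl[OF tensor_universal(1)[OF assms(1-3)] assms(4)] by (simp add: ev_def)

lemma ev_ev:
  assumes "is_space V" "is_space U" "bilin V W U F" "is_space X" "t \<in> carr (tensor_space X Y)"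
    and "\<And>v w. v \<in> carr X \<Longrightarrow> w \<in> carr Y \<Longrightarrow> G v w \<in> carr (tensor_space V W)"
  shows "ev V W (ev X Y t G) F = ev X Y t (\<lambda>v w. ev V W (G v w) F)"
  using lin_ev_apply[OF assms(4) is_space_tensor lin_ev_arg[OF assms(1-3) lin_ident] assms(5,6)] .

lemma ev_sum_arg:
  assumes "is_space V" "is_space U" "bilin V W U F" "\<And>y. y \<in> A \<Longrightarrow> G y \<in> carr (tensor_space V W)"
  shows "ev V W (\<Sum>y\<in>A. G y) F = (\<Sum>y\<in>A. ev V W (G y) F)"
  using lin_sum[OF is_space_tensor lin_ev_arg[OF assms(1-3) lin_ident] assms(4)] .

lemma ev_pure_self:
  assumes "is_space V" "t \<in> carr (tensor_space V W)"
  shows "ev V W t (pure V W) = t"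
  using sw(2)[OF assms] by (simp add: ev_def)

text \<open>Tensors are functions on forms, and sums of pure tensors vanish off the bilinear forms;
  so agreement on bilinear forms is already equality of functions.\<close>

lemma tensor_eqI:
  assumes "is_space V" "s \<in> carr (tensor_space V W)" "t \<in> carr (tensor_space V W)"
    and "\<And>B. bilin V W ground B \<Longrightarrow> ev V W s B = ev V W t B"
  shows "s = t"
proof
  fix B
  have *: "u B = (if bilin V W ground B then ev V W u B else 0)" if u: "u \<in> carr (tensor_space V W)" for u
  proof -
    have "u B = (\<Sum>(v, w)\<leftarrow>sw V W u. pure V W v w) B"
      using sw(2)[OF assms(1) u] by simp
    moreover have "(\<Sum>(v, w)\<leftarrow>xs. pure V W v w) B = 0" if "\<not> bilin V W ground B" for xs
      by (induction xs) (use that in \<open>auto simp: pure_def\<close>)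
    ultimately show ?thesis by (simp add: pure_sum_apply ev_def)
  qed
  show "s B = t B" using *[OF assms(2)] *[OF assms(3)] assms(4) by simp
qed

lemma lin_pure1: "lin X V f \<Longrightarrow> w \<in> carr W \<Longrightarrow> lin X (tensor_space V W) (\<lambda>x. pure V W (f x) w)"
  and lin_pure2: "lin X W g \<Longrightarrow> v \<in> carr V \<Longrightarrow> lin X (tensor_space V W) (\<lambda>x. pure V W v (g x))"
  by (rule bilin_lin1[OF bilin_pure], assumption+) (rule bilin_lin2[OF bilin_pure], assumption+)

section \<open>Quasi-Hopf algebras in Sweedler notation\<close>

text \<open>Closure and linearity rules. They discharge the side conditions of almost every
  rewriting step; inside a proof, local additions supply the linearity of the form being tested,
  with each argument composed with a linear map so that the rules chain through nested sums.\<close>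

named_theorems lins

locale quasi_hopf_algebra =
  fixes H :: "('k::field, 'h::ring_1) qhopf"
  assumes quasi_hopf: "quasi_hopf H"
begin

abbreviation "H2 \<equiv> tensor_space H H"
abbreviation "H3 \<equiv> tensor_space H H2"
abbreviation "H4 \<equiv> tensor_space H H3"
abbreviation "S \<equiv> antip H"
abbreviation "T \<equiv> antip_inv H"
abbreviation "\<alpha> \<equiv> alpha H"
abbreviation "\<beta> \<equiv> beta H"
abbreviation "\<epsilon> \<equiv> counit H"
abbreviation "\<Delta> \<equiv> comult H"
abbreviation mul2 (infixl "\<odot>\<^sub>2" 70) where "s \<odot>\<^sub>2 t \<equiv> mult2 H s t"
abbreviation mul3 (infixl "\<odot>\<^sub>3" 70) where "s \<odot>\<^sub>3 t \<equiv> mult3 H s t"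
abbreviation mul4 (infixl "\<odot>\<^sub>4" 70) where "s \<odot>\<^sub>4 t \<equiv> mult4 H s t"

text \<open>Nested because iterated tensor products are bracketed to the right.\<close>

definition ev3 :: "('k, 'h) tensor3 \<Rightarrow> ('h \<Rightarrow> 'h \<Rightarrow> 'h \<Rightarrow> 'u::ab_group_add) \<Rightarrow> 'u" where
  "ev3 t F = ev H H2 t (\<lambda>a u. ev H H u (F a))"

definition ev4 :: "('k, 'h) tensor4 \<Rightarrow> ('h \<Rightarrow> 'h \<Rightarrow> 'h \<Rightarrow> 'h \<Rightarrow> 'u::ab_group_add) \<Rightarrow> 'u" where
  "ev4 t F = ev H H3 t (\<lambda>a u. ev3 u (F a))"

definition trilin :: "('k, 'u::ab_group_add, 'x) space_scheme \<Rightarrow> ('h \<Rightarrow> 'h \<Rightarrow> 'h \<Rightarrow> 'u) \<Rightarrow> bool" where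
  "trilin U F \<longleftrightarrow> (\<forall>b c. lin H U (\<lambda>a. F a b c)) \<and> (\<forall>a c. lin H U (\<lambda>b. F a b c)) \<and>
     (\<forall>a b. lin H U (\<lambda>c. F a b c))"

definition quadlin :: "('k, 'u::ab_group_add, 'x) space_scheme \<Rightarrow> ('h \<Rightarrow> 'h \<Rightarrow> 'h \<Rightarrow> 'h \<Rightarrow> 'u) \<Rightarrow> bool" where
  "quadlin U F \<longleftrightarrow> (\<forall>b c d. lin H U (\<lambda>a. F a b c d)) \<and> (\<forall>a c d. lin H U (\<lambda>b. F a b c d)) \<and>
     (\<forall>a b d. lin H U (\<lambda>c. F a b c d)) \<and> (\<forall>a b c. lin H U (\<lambda>d. F a b c d))"

lemma quasi_bialgebra: "quasi_bialgebra H"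
  using quasi_hopf by (simp add: quasi_hopf_def)

lemma algebra_over: "algebra_over H"
  using quasi_bialgebra by (simp add: quasi_bialgebra_def)

lemma is_space_H [simp, lins]: "is_space H" and carr_H [simp]: "carr H = UNIV"
  using algebra_over by (simp_all add: algebra_over_def)

lemma in_carr_H [lins]: "x \<in> carr H"
  by simp

lemma scl_mult [simp]: "scl H c x * y = scl H c (x * y)" "x * scl H c y = scl H c (x * y)"
  using algebra_over by (simp_all add: algebra_over_def)

declare is_space_tensor [lins] is_space_ground [lins] lin_ident [lins]

lemma lin_mult1 [lins]: "lin V H f \<Longrightarrow> lin V H (\<lambda>x. f x * c)"
  and lin_mult2 [lins]: "lin V H f \<Longrightarrow> lin V H (\<lambda>x. c * f x)"
  by (auto simp: lin_def algebra_simps)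

lemma lin_H_antip: "lin H H S"
  using quasi_hopf by (simp add: quasi_hopf_def)

lemma bij_antip: "bij S"
  using quasi_hopf by (simp add: quasi_hopf_def)

lemma lin_antip [lins]: "lin V H f \<Longrightarrow> lin V H (\<lambda>x. S (f x))"
  by (rule lin_comp[OF _ lin_H_antip])

lemma antip_mult [simp]: "S (x * y) = S y * S x" and antip_one [simp]: "S 1 = 1"
  using quasi_hopf by (simp_all add: quasi_hopf_def)

lemma antip_T [simp]: "S (T x) = x" and T_antip [simp]: "T (S x) = x"
  using bij_antip by (simp_all add: antip_inv_def surj_f_inv_f[OF bij_is_surj] inv_f_f[OF bij_is_inj])

lemma antip_eq_iff: "S x = S y \<longleftrightarrow> x = y"
  using T_antip by metis

lemma T_mult [simp]: "T (x * y) = T y * T x" and T_one [simp]: "T 1 = 1"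
  by (rule antip_eq_iff[THEN iffD1], simp)+

lemma lin_H_T: "lin H H T"
proof -
  have "T (x + y) = T x + T y" "T (scl H c x) = scl H c (T x)" for x y c
    by (rule antip_eq_iff[THEN iffD1],
        simp add: lin_add[OF lin_H_antip] lin_scl[OF lin_H_antip])+
  then show ?thesis by (simp add: lin_def)
qed

lemma lin_T [lins]: "lin V H f \<Longrightarrow> lin V H (\<lambda>x. T (f x))"
  by (rule lin_comp[OF _ lin_H_T])

lemma lin_H_comult: "lin H H2 \<Delta>" and lin_H_counit: "lin H ground \<epsilon>"
  using quasi_bialgebra by (simp_all add: quasi_bialgebra_def)

lemma lin_comult [lins]: "lin V H f \<Longrightarrow> lin V H2 (\<lambda>x. \<Delta> (f x))"
  by (rule lin_comp[OF _ lin_H_comult])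

lemma lin_counit [lins]: "lin V H f \<Longrightarrow> lin V ground (\<lambda>x. \<epsilon> (f x))"
  by (rule lin_comp[OF _ lin_H_counit])

lemma counit_mult [simp]: "\<epsilon> (x * y) = \<epsilon> x * \<epsilon> y" and counit_one [simp]: "\<epsilon> 1 = 1"
  using quasi_bialgebra by (simp_all add: quasi_bialgebra_def)

lemma comult_closed [lins]: "\<Delta> h \<in> carr H2"
  by (rule lin_closed[OF lin_H_comult]) simp

lemma comult_mult: "\<Delta> (x * y) = \<Delta> x \<odot>\<^sub>2 \<Delta> y" and comult_one: "\<Delta> 1 = pure2 H 1 1"
  using quasi_bialgebra by (simp_all add: quasi_bialgebra_def)

declare bilinI [lins] lin_ev_arg [lins] lin_ev_body [lins] lin_scl_const [lins] lin_scl_left [lins]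

lemma trilinI [lins]:
  "(\<And>b c. lin H U (\<lambda>a. F a b c)) \<Longrightarrow> (\<And>a c. lin H U (\<lambda>b. F a b c)) \<Longrightarrow> (\<And>a b. lin H U (\<lambda>c. F a b c))
    \<Longrightarrow> trilin U F"
  by (simp add: trilin_def)

lemma quadlinI [lins]:
  "(\<And>b c d. lin H U (\<lambda>a. F a b c d)) \<Longrightarrow> (\<And>a c d. lin H U (\<lambda>b. F a b c d)) \<Longrightarrow>
   (\<And>a b d. lin H U (\<lambda>c. F a b c d)) \<Longrightarrow> (\<And>a b c. lin H U (\<lambda>d. F a b c d)) \<Longrightarrow> quadlin U F"
  by (simp add: quadlin_def)

lemma lin_bi:
  assumes "bilin H H U G"
  shows "lin X H f \<Longrightarrow> lin X U (\<lambda>x. G (f x) b)" and "lin X H f \<Longrightarrow> lin X U (\<lambda>x. G a (f x))"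
  using bilin_lin1[OF assms] bilin_lin2[OF assms] by simp_all

lemma lin_tri:
  assumes "trilin U G"
  shows "lin X H f \<Longrightarrow> lin X U (\<lambda>x. G (f x) b c)" and "lin X H f \<Longrightarrow> lin X U (\<lambda>x. G a (f x) c)"
    and "lin X H f \<Longrightarrow> lin X U (\<lambda>x. G a b (f x))"
  using assms by (auto simp: trilin_def lin_def)

lemma lin_quad:
  assumes "quadlin U G"
  shows "lin X H f \<Longrightarrow> lin X U (\<lambda>x. G (f x) b c d)" and "lin X H f \<Longrightarrow> lin X U (\<lambda>x. G a (f x) c d)"
    and "lin X H f \<Longrightarrow> lin X U (\<lambda>x. G a b (f x) d)" and "lin X H f \<Longrightarrow> lin X U (\<lambda>x. G a b c (f x))"
  using assms by (auto simp: quadlin_def lin_def)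

lemma lin_uni: "lin H U G \<Longrightarrow> lin X H f \<Longrightarrow> lin X U (\<lambda>x. G (f x))"
  by (rule lin_comp)

lemma lin_ev3_arg [lins]:
  assumes U: "is_space U" and F: "trilin U F" and f: "lin X H3 f"
  shows "lin X U (\<lambda>x. ev3 (f x) F)"
proof -
  note [lins] = lin_tri[OF F]
  show ?thesis unfolding ev3_def by (intro lins U f)
qed

lemma lin_ev3_body [lins]:
  assumes X: "is_space X" and U: "is_space U" and t: "t \<in> carr H3"
    and F: "\<And>a b c. lin X U (\<lambda>x. F x a b c)"
  shows "lin X U (\<lambda>x. ev3 t (F x))"
  unfolding ev3_def by (intro lins X U t F)

lemma lin_ev4_arg [lins]:
  assumes U: "is_space U" and F: "quadlin U F" and f: "lin X H4 f"
  shows "lin X U (\<lambda>x. ev4 (f x) F)"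
proof -
  note [lins] = lin_quad[OF F]
  show ?thesis unfolding ev4_def by (intro lins U f)
qed

lemma lin_ev4_body [lins]:
  assumes X: "is_space X" and U: "is_space U" and t: "t \<in> carr H4"
    and F: "\<And>a b c d. lin X U (\<lambda>x. F x a b c d)"
  shows "lin X U (\<lambda>x. ev4 t (F x))"
  unfolding ev4_def by (intro lins X U t F)

lemma pure2_closed [lins]: "pure2 H a b \<in> carr H2"
  and pure3_closed [lins]: "pure3 H a b c \<in> carr H3"
  and pure4_closed [lins]: "pure4 H a b c d \<in> carr H4"
  by (simp_all add: pure2_def pure3_def pure4_def pure_in_tensor)

lemma lin_pure_H2 [lins]:
  "lin X H f \<Longrightarrow> lin X H2 (\<lambda>x. pure2 H (f x) b)" "lin X H f \<Longrightarrow> lin X H2 (\<lambda>x. pure2 H a (f x))"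
  by (simp_all add: pure2_def lin_pure1 lin_pure2)

lemma lin_pure_H3 [lins]:
  "lin X H f \<Longrightarrow> lin X H3 (\<lambda>x. pure3 H (f x) b c)" "lin X H f \<Longrightarrow> lin X H3 (\<lambda>x. pure3 H a (f x) c)"
  "lin X H f \<Longrightarrow> lin X H3 (\<lambda>x. pure3 H a b (f x))"
  by (simp_all add: pure3_def lin_pure1 lin_pure2 pure2_closed lin_pure_H2)

lemma lin_pure_H4 [lins]:
  "lin X H f \<Longrightarrow> lin X H4 (\<lambda>x. pure4 H (f x) b c d)" "lin X H f \<Longrightarrow> lin X H4 (\<lambda>x. pure4 H a (f x) c d)"
  "lin X H f \<Longrightarrow> lin X H4 (\<lambda>x. pure4 H a b (f x) d)" "lin X H f \<Longrightarrow> lin X H4 (\<lambda>x. pure4 H a b c (f x))"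
  by (simp_all add: pure4_def lin_pure1 lin_pure2 pure3_closed lin_pure_H3)

lemma ev2_pure:
  assumes "is_space U" "bilin H H U F"
  shows "ev H H (pure2 H a b) F = F a b"
  unfolding pure2_def using assms by (simp add: ev_pure)

lemma ev3_pure:
  assumes U: "is_space U" and F: "trilin U F"
  shows "ev3 (pure3 H a b c) F = F a b c"
proof -
  note [lins] = lin_tri[OF F]
  have "bilin H H2 U (\<lambda>a u. ev H H u (F a))" by (intro lins U)
  then have "ev3 (pure3 H a b c) F = ev H H (pure2 H b c) (F a)"
    unfolding ev3_def pure3_def by (rule ev_pure[OF is_space_H U]) (auto intro: lins)
  also have "\<dots> = F a b c" by (rule ev2_pure[OF U]) (intro lins)
  finally show ?thesis .
qed

lemma ev4_pure:
  assumes U: "is_space U" and F: "quadlin U F"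
  shows "ev4 (pure4 H a b c d) F = F a b c d"
proof -
  note [lins] = lin_quad[OF F]
  have "bilin H H3 U (\<lambda>a u. ev3 u (F a))" by (intro lins U)
  then have "ev4 (pure4 H a b c d) F = ev3 (pure3 H b c d) (F a)"
    unfolding ev4_def pure4_def by (rule ev_pure[OF is_space_H U]) (auto intro: lins)
  also have "\<dots> = F a b c d" by (rule ev3_pure[OF U]) (intro lins)
  finally show ?thesis .
qed

lemma ev2_closed [lins]:
  "is_space U \<Longrightarrow> t \<in> carr H2 \<Longrightarrow> (\<And>a b. F a b \<in> carr U) \<Longrightarrow> ev H H t F \<in> carr U"
  by (rule ev_closed) auto

lemma ev3_closed [lins]:
  "is_space U \<Longrightarrow> t \<in> carr H3 \<Longrightarrow> (\<And>a b c. F a b c \<in> carr U) \<Longrightarrow> ev3 t F \<in> carr U"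
  unfolding ev3_def by (rule ev_closed) (auto intro!: ev2_closed)

lemma ev4_closed [lins]:
  "is_space U \<Longrightarrow> t \<in> carr H4 \<Longrightarrow> (\<And>a b c d. F a b c d \<in> carr U) \<Longrightarrow> ev4 t F \<in> carr U"
  unfolding ev4_def by (rule ev_closed) (auto intro!: ev3_closed)

lemma lin_ev2_apply:
  assumes "is_space X" "lin X Y f" "t \<in> carr H2" "\<And>a b. F a b \<in> carr X"
  shows "f (ev H H t F) = ev H H t (\<lambda>a b. f (F a b))"
  by (rule lin_ev_apply[OF is_space_H assms(1-3)]) (rule assms(4))

lemma lin_ev3_apply:
  assumes "is_space X" "lin X Y f" "t \<in> carr H3" "\<And>a b c. F a b c \<in> carr X"
  shows "f (ev3 t F) = ev3 t (\<lambda>a b c. f (F a b c))"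
proof -
  have "f (ev3 t F) = ev H H2 t (\<lambda>a u. f (ev H H u (F a)))"
    unfolding ev3_def by (rule lin_ev_apply[OF is_space_H assms(1-3)]) (intro ev2_closed assms)
  also have "\<dots> = ev3 t (\<lambda>a b c. f (F a b c))"
    unfolding ev3_def
    by (rule ev_cong[OF is_space_H assms(3)]) (rule lin_ev2_apply[OF assms(1,2) _ assms(4)])
  finally show ?thesis .
qed

lemma lin_ev4_apply:
  assumes "is_space X" "lin X Y f" "t \<in> carr H4" "\<And>a b c d. F a b c d \<in> carr X"
  shows "f (ev4 t F) = ev4 t (\<lambda>a b c d. f (F a b c d))"
proof -
  have "f (ev4 t F) = ev H H3 t (\<lambda>a u. f (ev3 u (F a)))"
    unfolding ev4_def by (rule lin_ev_apply[OF is_space_H assms(1-3)]) (intro ev3_closed assms)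
  also have "\<dots> = ev4 t (\<lambda>a b c d. f (F a b c d))"
    unfolding ev4_def
    by (rule ev_cong[OF is_space_H assms(3)]) (rule lin_ev3_apply[OF assms(1,2) _ assms(4)])
  finally show ?thesis .
qed

section \<open>Testing elements of the tensor powers of H on multilinear forms\<close>

lemma tensor2_eqI:
  assumes "s \<in> carr H2" "t \<in> carr H2"
    and "\<And>B. bilin H H ground B \<Longrightarrow> ev H H s B = ev H H t B"
  shows "s = t"
  using assms by (rule tensor_eqI[OF is_space_H])

text \<open>Expanding the inner tensor into pure ones turns a form on H \<times> (H \<otimes> H)
  into a trilinear one. Hence trilinear forms suffice for testing in \<open>tensor3_eqI\<close>;
  \<open>tensor4_eqI\<close> iterates the argument.\<close>

lemma ev3_to_ev:
  assumes "bilin H H2 ground B" "t \<in> carr H3"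
  shows "ev3 t (\<lambda>a b c. B a (pure2 H b c)) = ev H H2 t B"
  unfolding ev3_def
proof (rule ev_cong[OF is_space_H assms(2)])
  fix a u assume u: "u \<in> carr H2"
  have "B a (ev H H u (pure2 H)) = ev H H u (\<lambda>b c. B a (pure2 H b c))"
    by (rule lin_ev2_apply[OF is_space_tensor _ u])
      (use assms(1) in \<open>auto simp: bilin_def intro: lins\<close>)
  then show "ev H H u (\<lambda>b c. B a (pure2 H b c)) = B a u"
    by (simp add: ev_pure_self[OF is_space_H u] pure2_def[abs_def])
qed

lemma tensor3_eqI:
  assumes "s \<in> carr H3" "t \<in> carr H3"
    and "\<And>B. trilin (ground :: ('k, 'k) space) B \<Longrightarrow> ev3 s B = ev3 t B"
  shows "s = t"
proof (rule tensor_eqI[OF is_space_H assms(1,2)])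
  fix B assume B: "bilin H H2 ground B"
  have "trilin ground (\<lambda>a b c. B a (pure2 H b c))"
    by (intro trilinI bilin_lin1[OF B] bilin_lin2[OF B] lins)
  from assms(3)[OF this] show "ev H H2 s B = ev H H2 t B"
    by (simp add: ev3_to_ev[OF B] assms)
qed

lemma tensor4_eqI:
  assumes "s \<in> carr H4" "t \<in> carr H4"
    and "\<And>B. quadlin (ground :: ('k, 'k) space) B \<Longrightarrow> ev4 s B = ev4 t B"
  shows "s = t"
proof (rule tensor_eqI[OF is_space_H assms(1,2)])
  fix B assume B: "bilin H H3 ground B"
  have "quadlin ground (\<lambda>a b c d. B a (pure3 H b c d))"
    by (intro quadlinI bilin_lin1[OF B] bilin_lin2[OF B] lins)
  note * = assms(3)[OF this]
  have "ev4 t (\<lambda>a b c d. B a (pure3 H b c d)) = ev H H3 t B" if t: "t \<in> carr H4" for t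
    unfolding ev4_def
  proof (rule ev_cong[OF is_space_H t])
    fix a u assume u: "u \<in> carr H3"
    have "ev H H2 u (\<lambda>b v. ev H H v (\<lambda>c d. B a (pure3 H b c d))) = ev H H2 u (\<lambda>b v. B a (pure H H2 b v))"
    proof (rule ev_cong[OF is_space_H u])
      fix b v assume v: "v \<in> carr H2"
      have l: "lin H2 ground (\<lambda>v. B a (pure H H2 b v))"
        by (intro bilin_lin2[OF B] lin_pure2 lins)
      have "B a (pure H H2 b (ev H H v (pure2 H))) = ev H H v (\<lambda>c d. B a (pure3 H b c d))"
        unfolding pure3_def by (rule lin_ev2_apply[OF is_space_tensor l v]) (intro lins)
      then show "ev H H v (\<lambda>c d. B a (pure3 H b c d)) = B a (pure H H2 b v)"
        by (simp add: ev_pure_self[OF is_space_H v] pure2_def[abs_def])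
    qed
    also have "\<dots> = B a (ev H H2 u (pure H H2))"
    proof (rule lin_ev_apply[OF is_space_H is_space_tensor _ u, symmetric])
      show "lin H3 ground (B a)" by (intro bilin_lin2[OF B] lins)
    qed (auto intro: pure_in_tensor)
    finally show "ev3 u (\<lambda>b c d. B a (pure3 H b c d)) = B a u"
      by (simp add: ev3_def ev_pure_self[OF is_space_H u])
  qed
  then show "ev H H3 s B = ev H H3 t B" using * assms(1,2) by simp
qed

section \<open>Sweedler sums over the coproduct and the reassociator\<close>

abbreviation "D h \<equiv> ev H H (\<Delta> h)"
abbreviation "P \<equiv> ev3 (Phi H)"
abbreviation "Q \<equiv> ev3 (Phi_inv H)"

lemma sw2_ev: "(\<Sum>(a, b)\<leftarrow>sw2 H t. F a b) = ev H H t F"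
  by (simp add: ev_def sw2_def)

lemma sw3_ev: "(\<Sum>(a, b, c)\<leftarrow>sw3 H t. F a b c) = ev3 t F"
proof -
  have "(\<Sum>(a, b, c)\<leftarrow>[(a, b, c). (a, u) \<leftarrow> xs, (b, c) \<leftarrow> g u]. F a b c)
      = (\<Sum>(a, u)\<leftarrow>xs. \<Sum>(b, c)\<leftarrow>g u. F a b c)" for xs and g :: "_ \<Rightarrow> (_ \<times> _) list"
    by (induction xs) (auto simp: comp_def case_prod_unfold)
  then show ?thesis by (simp add: sw3_def ev3_def ev_def sw2_def)
qed

lemma sw4_ev: "(\<Sum>(a, b, c, d)\<leftarrow>sw4 H t. F a b c d) = ev4 t F"
proof -
  have "(\<Sum>(a, b, c, d)\<leftarrow>[(a, b, c, d). (a, u) \<leftarrow> xs, (b, c, d) \<leftarrow> g u]. F a b c d)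
      = (\<Sum>(a, u)\<leftarrow>xs. \<Sum>(b, c, d)\<leftarrow>g u. F a b c d)" for xs and g :: "_ \<Rightarrow> (_ \<times> _ \<times> _) list"
    by (induction xs) (auto simp: comp_def case_prod_unfold)
  then show ?thesis by (simp add: sw4_def ev4_def ev_def flip: sw3_ev)
qed

lemmas sw_evs = sw2_ev sw3_ev sw4_ev

lemma swap_ev3: "ev V W s (\<lambda>a b. ev3 t (\<lambda>x y z. F a b x y z)) = ev3 t (\<lambda>x y z. ev V W s (\<lambda>a b. F a b x y z))"
  by (simp only: ev3_def ev_swap[of V W])

lemma swap_ev4: "ev V W s (\<lambda>a b. ev4 t (\<lambda>x y z u. F a b x y z u)) = ev4 t (\<lambda>x y z u. ev V W s (\<lambda>a b. F a b x y z u))"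
  by (simp only: ev4_def ev_swap[of V W] swap_ev3)

lemma swap_ev3_ev3: "ev3 s (\<lambda>a b c. ev3 t (\<lambda>x y z. F a b c x y z)) = ev3 t (\<lambda>x y z. ev3 s (\<lambda>a b c. F a b c x y z))"
  by (simp only: ev3_def[of s] swap_ev3)

lemma swap_ev3_ev4: "ev3 s (\<lambda>a b c. ev4 t (\<lambda>x y z u. F a b c x y z u)) = ev4 t (\<lambda>x y z u. ev3 s (\<lambda>a b c. F a b c x y z u))"
  by (simp only: ev3_def[of s] swap_ev4)

lemma ev2_ev2:
  "is_space U \<Longrightarrow> bilin H H U F \<Longrightarrow> is_space V \<Longrightarrow> t \<in> carr (tensor_space V W) \<Longrightarrow>
   (\<And>a b. a \<in> carr V \<Longrightarrow> b \<in> carr W \<Longrightarrow> G a b \<in> carr H2) \<Longrightarrow>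
   ev H H (ev V W t G) F = ev V W t (\<lambda>a b. ev H H (G a b) F)"
  by (rule ev_ev[OF is_space_H])

lemma ev2_ev3:
  "is_space U \<Longrightarrow> bilin H H U F \<Longrightarrow> t \<in> carr H3 \<Longrightarrow> (\<And>a b c. G a b c \<in> carr H2) \<Longrightarrow>
   ev H H (ev3 t G) F = ev3 t (\<lambda>a b c. ev H H (G a b c) F)"
  by (rule lin_ev3_apply[OF is_space_tensor lin_ev_arg[OF is_space_H _ _ lin_ident]])

lemma ev2_ev4:
  "is_space U \<Longrightarrow> bilin H H U F \<Longrightarrow> t \<in> carr H4 \<Longrightarrow> (\<And>a b c d. G a b c d \<in> carr H2) \<Longrightarrow>
   ev H H (ev4 t G) F = ev4 t (\<lambda>a b c d. ev H H (G a b c d) F)"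
  by (rule lin_ev4_apply[OF is_space_tensor lin_ev_arg[OF is_space_H _ _ lin_ident]])

lemma ev3_ev2:
  "is_space U \<Longrightarrow> trilin U F \<Longrightarrow> t \<in> carr H2 \<Longrightarrow> (\<And>a b. G a b \<in> carr H3) \<Longrightarrow>
   ev3 (ev H H t G) F = ev H H t (\<lambda>a b. ev3 (G a b) F)"
  by (rule lin_ev2_apply[OF is_space_tensor lin_ev3_arg[OF _ _ lin_ident]])

lemma ev3_ev3:
  "is_space U \<Longrightarrow> trilin U F \<Longrightarrow> t \<in> carr H3 \<Longrightarrow> (\<And>a b c. G a b c \<in> carr H3) \<Longrightarrow>
   ev3 (ev3 t G) F = ev3 t (\<lambda>a b c. ev3 (G a b c) F)"
  by (rule lin_ev3_apply[OF is_space_tensor lin_ev3_arg[OF _ _ lin_ident]])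

lemma ev4_ev2:
  "is_space U \<Longrightarrow> quadlin U F \<Longrightarrow> t \<in> carr H2 \<Longrightarrow> (\<And>a b. G a b \<in> carr H4) \<Longrightarrow>
   ev4 (ev H H t G) F = ev H H t (\<lambda>a b. ev4 (G a b) F)"
  by (rule lin_ev2_apply[OF is_space_tensor lin_ev4_arg[OF _ _ lin_ident]])

lemma ev4_ev3:
  "is_space U \<Longrightarrow> quadlin U F \<Longrightarrow> t \<in> carr H3 \<Longrightarrow> (\<And>a b c. G a b c \<in> carr H4) \<Longrightarrow>
   ev4 (ev3 t G) F = ev3 t (\<lambda>a b c. ev4 (G a b c) F)"
  by (rule lin_ev3_apply[OF is_space_tensor lin_ev4_arg[OF _ _ lin_ident]])

lemma ev4_ev4:
  "is_space U \<Longrightarrow> quadlin U F \<Longrightarrow> t \<in> carr H4 \<Longrightarrow> (\<And>a b c d. G a b c d \<in> carr H4) \<Longrightarrow>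
   ev4 (ev4 t G) F = ev4 t (\<lambda>a b c d. ev4 (G a b c d) F)"
  by (rule lin_ev4_apply[OF is_space_tensor lin_ev4_arg[OF _ _ lin_ident]])

lemmas ev_evs = ev2_ev2 ev2_ev3 ev2_ev4 ev3_ev2 ev3_ev3 ev4_ev2 ev4_ev3 ev4_ev4

section \<open>Products in the tensor powers of H\<close>

lemma mult2_eq: "s \<odot>\<^sub>2 t = ev H H s (\<lambda>a b. ev H H t (\<lambda>a' b'. pure2 H (a * a') (b * b')))"
  and mult3_eq: "s' \<odot>\<^sub>3 t' = ev3 s' (\<lambda>a b c. ev3 t' (\<lambda>a' b' c'. pure3 H (a * a') (b * b') (c * c')))"
  and mult4_eq: "s'' \<odot>\<^sub>4 t'' = ev4 s'' (\<lambda>a b c d. ev4 t'' (\<lambda>a' b' c' d'. pure4 H (a * a') (b * b') (c * c') (d * d')))"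
  by (simp_all add: mult2_def mult3_def mult4_def sw_evs)

lemma mult2_closed [lins]: "s \<in> carr H2 \<Longrightarrow> t \<in> carr H2 \<Longrightarrow> s \<odot>\<^sub>2 t \<in> carr H2"
  and mult3_closed [lins]: "s' \<in> carr H3 \<Longrightarrow> t' \<in> carr H3 \<Longrightarrow> s' \<odot>\<^sub>3 t' \<in> carr H3"
  and mult4_closed [lins]: "s'' \<in> carr H4 \<Longrightarrow> t'' \<in> carr H4 \<Longrightarrow> s'' \<odot>\<^sub>4 t'' \<in> carr H4"
  by (auto simp: mult2_eq mult3_eq mult4_eq intro!: lins)

lemma ev2_mult:
  assumes [lins]: "is_space U" and F: "bilin H H U F" and [lins]: "s \<in> carr H2" "t \<in> carr H2"
  shows "ev H H (s \<odot>\<^sub>2 t) F = ev H H s (\<lambda>a b. ev H H t (\<lambda>a' b'. F (a * a') (b * b')))"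
  using F by (simp add: mult2_eq ev_evs[where U=U] lins ev2_pure[where U=U])

lemma ev3_mult:
  assumes [lins]: "is_space U" and F: "trilin U F" and [lins]: "s \<in> carr H3" "t \<in> carr H3"
  shows "ev3 (s \<odot>\<^sub>3 t) F = ev3 s (\<lambda>a b c. ev3 t (\<lambda>a' b' c'. F (a * a') (b * b') (c * c')))"
  using F by (simp add: mult3_eq ev_evs[where U=U] lins ev3_pure[where U=U])

lemma ev4_mult:
  assumes [lins]: "is_space U" and F: "quadlin U F" and [lins]: "s \<in> carr H4" "t \<in> carr H4"
  shows "ev4 (s \<odot>\<^sub>4 t) F = ev4 s (\<lambda>a b c d. ev4 t (\<lambda>a' b' c' d'. F (a * a') (b * b') (c * c') (d * d')))"
  using F by (simp add: mult4_eq ev_evs[where U=U] lins ev4_pure[where U=U])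

lemma lin_mult2_left [lins]: "t \<in> carr H2 \<Longrightarrow> lin X H2 f \<Longrightarrow> lin X H2 (\<lambda>x. f x \<odot>\<^sub>2 t)"
  and lin_mult2_right [lins]: "is_space X \<Longrightarrow> s \<in> carr H2 \<Longrightarrow> lin X H2 f \<Longrightarrow> lin X H2 (\<lambda>x. s \<odot>\<^sub>2 f x)"
  by (simp_all add: mult2_eq lins)

lemma lin_mult3_left [lins]: "t \<in> carr H3 \<Longrightarrow> lin X H3 f \<Longrightarrow> lin X H3 (\<lambda>x. f x \<odot>\<^sub>3 t)"
  and lin_mult3_right [lins]: "is_space X \<Longrightarrow> s \<in> carr H3 \<Longrightarrow> lin X H3 f \<Longrightarrow> lin X H3 (\<lambda>x. s \<odot>\<^sub>3 f x)"
  by (simp_all add: mult3_eq lins)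

lemma mult2_assoc:
  assumes [lins]: "s \<in> carr H2" "t \<in> carr H2" "u \<in> carr H2"
  shows "s \<odot>\<^sub>2 t \<odot>\<^sub>2 u = s \<odot>\<^sub>2 (t \<odot>\<^sub>2 u)"
proof (rule tensor2_eqI)
  fix B assume B: "bilin H H ground B"
  note [lins] = lin_bi[OF B]
  show "ev H H (s \<odot>\<^sub>2 t \<odot>\<^sub>2 u) B = ev H H (s \<odot>\<^sub>2 (t \<odot>\<^sub>2 u)) B"
    by (simp add: ev2_mult[where U=ground] B lins mult.assoc)
qed (intro lins)+

lemma mult3_assoc:
  assumes [lins]: "s \<in> carr H3" "t \<in> carr H3" "u \<in> carr H3"
  shows "s \<odot>\<^sub>3 t \<odot>\<^sub>3 u = s \<odot>\<^sub>3 (t \<odot>\<^sub>3 u)"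
proof (rule tensor3_eqI)
  fix B :: "'h \<Rightarrow> 'h \<Rightarrow> 'h \<Rightarrow> 'k" assume B: "trilin ground B"
  note [lins] = lin_tri[OF B]
  show "ev3 (s \<odot>\<^sub>3 t \<odot>\<^sub>3 u) B = ev3 (s \<odot>\<^sub>3 (t \<odot>\<^sub>3 u)) B"
    by (simp add: ev3_mult[where U=ground] B lins mult.assoc)
qed (intro lins)+

lemma mult4_assoc:
  assumes [lins]: "s \<in> carr H4" "t \<in> carr H4" "u \<in> carr H4"
  shows "s \<odot>\<^sub>4 t \<odot>\<^sub>4 u = s \<odot>\<^sub>4 (t \<odot>\<^sub>4 u)"
proof (rule tensor4_eqI)
  fix B :: "'h \<Rightarrow> 'h \<Rightarrow> 'h \<Rightarrow> 'h \<Rightarrow> 'k" assume B: "quadlin ground B"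
  note [lins] = lin_quad[OF B]
  show "ev4 (s \<odot>\<^sub>4 t \<odot>\<^sub>4 u) B = ev4 (s \<odot>\<^sub>4 (t \<odot>\<^sub>4 u)) B"
    by (simp add: ev4_mult[where U=ground] B lins mult.assoc)
qed (intro lins)+

lemma mult2_one:
  assumes [lins]: "s \<in> carr H2"
  shows "s \<odot>\<^sub>2 pure2 H 1 1 = s" "pure2 H 1 1 \<odot>\<^sub>2 s = s"
proof -
  have "ev H H (s \<odot>\<^sub>2 pure2 H 1 1) B = ev H H s B" "ev H H (pure2 H 1 1 \<odot>\<^sub>2 s) B = ev H H s B"
    if B: "bilin H H ground B" for B
  proof -
    note [lins] = lin_bi[OF B]
    show "ev H H (s \<odot>\<^sub>2 pure2 H 1 1) B = ev H H s B" "ev H H (pure2 H 1 1 \<odot>\<^sub>2 s) B = ev H H s B"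
      by (simp_all add: B ev2_mult[where U=ground] ev2_pure[where U=ground] lins)
  qed
  then show "s \<odot>\<^sub>2 pure2 H 1 1 = s" "pure2 H 1 1 \<odot>\<^sub>2 s = s"
    by (intro tensor2_eqI lins; simp)+
qed

lemma mult3_one:
  assumes [lins]: "s \<in> carr H3"
  shows "s \<odot>\<^sub>3 pure3 H 1 1 1 = s" "pure3 H 1 1 1 \<odot>\<^sub>3 s = s"
proof -
  have "ev3 (s \<odot>\<^sub>3 pure3 H 1 1 1) B = ev3 s B" "ev3 (pure3 H 1 1 1 \<odot>\<^sub>3 s) B = ev3 s B"
    if B: "trilin ground B" for B :: "'h \<Rightarrow> 'h \<Rightarrow> 'h \<Rightarrow> 'k"
  proof -
    note [lins] = lin_tri[OF B]
    show "ev3 (s \<odot>\<^sub>3 pure3 H 1 1 1) B = ev3 s B" "ev3 (pure3 H 1 1 1 \<odot>\<^sub>3 s) B = ev3 s B"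
      by (simp_all add: B ev3_mult[where U=ground] ev3_pure[where U=ground] lins)
  qed
  then show "s \<odot>\<^sub>3 pure3 H 1 1 1 = s" "pure3 H 1 1 1 \<odot>\<^sub>3 s = s"
    by (intro tensor3_eqI lins; simp)+
qed

lemma mult4_one:
  assumes [lins]: "s \<in> carr H4"
  shows "s \<odot>\<^sub>4 pure4 H 1 1 1 1 = s" "pure4 H 1 1 1 1 \<odot>\<^sub>4 s = s"
proof -
  have "ev4 (s \<odot>\<^sub>4 pure4 H 1 1 1 1) B = ev4 s B" "ev4 (pure4 H 1 1 1 1 \<odot>\<^sub>4 s) B = ev4 s B"
    if B: "quadlin ground B" for B :: "'h \<Rightarrow> 'h \<Rightarrow> 'h \<Rightarrow> 'h \<Rightarrow> 'k"
  proof -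
    note [lins] = lin_quad[OF B]
    show "ev4 (s \<odot>\<^sub>4 pure4 H 1 1 1 1) B = ev4 s B" "ev4 (pure4 H 1 1 1 1 \<odot>\<^sub>4 s) B = ev4 s B"
      by (simp_all add: B ev4_mult[where U=ground] ev4_pure[where U=ground] lins)
  qed
  then show "s \<odot>\<^sub>4 pure4 H 1 1 1 1 = s" "pure4 H 1 1 1 1 \<odot>\<^sub>4 s = s"
    by (intro tensor4_eqI lins; simp)+
qed

section \<open>The reassociator and the quasi-Hopf axioms in Sweedler form\<close>

lemma Phi_closed [lins]: "Phi H \<in> carr H3"
  using quasi_bialgebra by (simp add: quasi_bialgebra_def)

text \<open>\<open>Phi_inv\<close> is a definite description, so uniqueness of two-sided inverses
  has to come before any property of it.\<close>

lemma Phi_inv: "is_inverse3 H (Phi H) (Phi_inv H)"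
proof -
  obtain t where t: "is_inverse3 H (Phi H) t"
    using quasi_bialgebra by (auto simp: quasi_bialgebra_def)
  have "u = t" if u: "is_inverse3 H (Phi H) u" for u
  proof -
    have [lins]: "Phi H \<in> carr H3" "t \<in> carr H3" "u \<in> carr H3"
      using t u by (auto simp: is_inverse3_def Phi_closed)
    have "u \<odot>\<^sub>3 Phi H \<odot>\<^sub>3 t = u \<odot>\<^sub>3 (Phi H \<odot>\<^sub>3 t)" by (intro mult3_assoc lins)
    then show ?thesis using t u by (simp add: is_inverse3_def mult3_one lins)
  qed
  with t show ?thesis unfolding Phi_inv_def by (rule theI)
qed

lemma Phi_inv_closed [lins]: "Phi_inv H \<in> carr H3"
  and Phi_Phi_inv: "Phi H \<odot>\<^sub>3 Phi_inv H = pure3 H 1 1 1"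
  and Phi_inv_Phi: "Phi_inv H \<odot>\<^sub>3 Phi H = pure3 H 1 1 1"
  using Phi_inv by (simp_all add: is_inverse3_def)

lemma id_comult_eq: "id_comult H t = ev H H t (\<lambda>a b. D b (\<lambda>b1 b2. pure3 H a b1 b2))"
  and comult_id_eq: "comult_id H t = ev H H t (\<lambda>a b. D a (\<lambda>a1 a2. pure3 H a1 a2 b))"
  and comult_id_id_eq: "comult_id_id H u = ev3 u (\<lambda>a b c. D a (\<lambda>a1 a2. pure4 H a1 a2 b c))"
  and id_comult_id_eq: "id_comult_id H u = ev3 u (\<lambda>a b c. D b (\<lambda>b1 b2. pure4 H a b1 b2 c))"
  and id_id_comult_eq: "id_id_comult H u = ev3 u (\<lambda>a b c. D c (\<lambda>c1 c2. pure4 H a b c1 c2))"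
  and one_tensor_eq: "one_tensor H u = ev3 u (\<lambda>a b c. pure4 H 1 a b c)"
  and tensor_one_eq: "tensor_one H u = ev3 u (\<lambda>a b c. pure4 H a b c 1)"
  by (simp_all add: id_comult_def comult_id_def comult_id_id_def id_comult_id_def id_id_comult_def
      one_tensor_def tensor_one_def sw_evs)

lemmas leg_eqs = id_comult_eq comult_id_eq comult_id_id_eq id_comult_id_eq id_id_comult_eq
  one_tensor_eq tensor_one_eq

lemma leg_closed [lins]:
  "t \<in> carr H2 \<Longrightarrow> id_comult H t \<in> carr H3" "t \<in> carr H2 \<Longrightarrow> comult_id H t \<in> carr H3"
  "u \<in> carr H3 \<Longrightarrow> comult_id_id H u \<in> carr H4" "u \<in> carr H3 \<Longrightarrow> id_comult_id H u \<in> carr H4"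
  "u \<in> carr H3 \<Longrightarrow> id_id_comult H u \<in> carr H4" "u \<in> carr H3 \<Longrightarrow> one_tensor H u \<in> carr H4"
  "u \<in> carr H3 \<Longrightarrow> tensor_one H u \<in> carr H4"
  by (auto simp: leg_eqs intro!: lins)

lemma ev3_leg:
  assumes U [lins]: "is_space U" and F: "trilin U F" and [lins]: "t \<in> carr H2"
  shows "ev3 (id_comult H t) F = ev H H t (\<lambda>a b. D b (\<lambda>b1 b2. F a b1 b2))"
    and "ev3 (comult_id H t) F = ev H H t (\<lambda>a b. D a (\<lambda>a1 a2. F a1 a2 b))"
  by (simp_all add: leg_eqs ev_evs[where U=U] ev3_pure[where U=U] F lins)

lemma ev4_leg:
  assumes U [lins]: "is_space U" and F: "quadlin U F" and [lins]: "u \<in> carr H3"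
  shows "ev4 (comult_id_id H u) F = ev3 u (\<lambda>a b c. D a (\<lambda>a1 a2. F a1 a2 b c))"
    and "ev4 (id_comult_id H u) F = ev3 u (\<lambda>a b c. D b (\<lambda>b1 b2. F a b1 b2 c))"
    and "ev4 (id_id_comult H u) F = ev3 u (\<lambda>a b c. D c (\<lambda>c1 c2. F a b c1 c2))"
    and "ev4 (one_tensor H u) F = ev3 u (\<lambda>a b c. F 1 a b c)"
    and "ev4 (tensor_one H u) F = ev3 u (\<lambda>a b c. F a b c 1)"
  by (simp_all add: leg_eqs ev_evs[where U=U] ev4_pure[where U=U] F lins)

lemma D_mult:
  assumes "is_space U" "bilin H H U F"
  shows "D (x * y) F = D x (\<lambda>a b. D y (\<lambda>c d. F (a * c) (b * d)))"
  by (simp add: comult_mult ev2_mult[OF assms] lins)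

lemma D_one: "is_space U \<Longrightarrow> bilin H H U F \<Longrightarrow> D 1 F = F 1 1"
  by (simp add: comult_one ev2_pure)

lemma P_Q:
  assumes "is_space U" "trilin U F"
  shows "P (\<lambda>X1 X2 X3. Q (\<lambda>x1 x2 x3. F (X1 * x1) (X2 * x2) (X3 * x3))) = F 1 1 1"
    and "P (\<lambda>X1 X2 X3. Q (\<lambda>x1 x2 x3. F (x1 * X1) (x2 * X2) (x3 * X3))) = F 1 1 1"
  using ev3_mult[OF assms Phi_closed Phi_inv_closed] ev3_mult[OF assms Phi_inv_closed Phi_closed]
  by (simp_all add: Phi_Phi_inv Phi_inv_Phi ev3_pure[OF assms] swap_ev3_ev3[of "Phi H" "Phi_inv H"])

text \<open>Multiplying out the conjugation leaves a single copy of \<Phi> or of its inverse on each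
  side. In the Sweedler forms \<open>coassoc_P\<close> and \<open>coassoc_Q\<close> this is how the
  legs of an element pass through such a copy.\<close>

lemma coassoc_mult:
  "id_comult H (\<Delta> h) \<odot>\<^sub>3 Phi H = Phi H \<odot>\<^sub>3 comult_id H (\<Delta> h)"
  "Phi_inv H \<odot>\<^sub>3 id_comult H (\<Delta> h) = comult_id H (\<Delta> h) \<odot>\<^sub>3 Phi_inv H"
proof -
  have *: "id_comult H (\<Delta> h) = Phi H \<odot>\<^sub>3 comult_id H (\<Delta> h) \<odot>\<^sub>3 Phi_inv H"
    using quasi_bialgebra by (simp add: quasi_bialgebra_def)
  show "id_comult H (\<Delta> h) \<odot>\<^sub>3 Phi H = Phi H \<odot>\<^sub>3 comult_id H (\<Delta> h)"
    unfolding * by (simp add: mult3_assoc lins Phi_inv_Phi mult3_one)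
  have "Phi_inv H \<odot>\<^sub>3 id_comult H (\<Delta> h) = Phi_inv H \<odot>\<^sub>3 Phi H \<odot>\<^sub>3 (comult_id H (\<Delta> h) \<odot>\<^sub>3 Phi_inv H)"
    unfolding * by (simp add: mult3_assoc lins)
  then show "Phi_inv H \<odot>\<^sub>3 id_comult H (\<Delta> h) = comult_id H (\<Delta> h) \<odot>\<^sub>3 Phi_inv H"
    by (simp add: lins Phi_inv_Phi mult3_one)
qed

lemma coassoc_P:
  assumes U [lins]: "is_space U" and F: "trilin U F"
  shows "P (\<lambda>X1 X2 X3. D h (\<lambda>h1 h2. D h2 (\<lambda>h21 h22. F (h1 * X1) (h21 * X2) (h22 * X3))))
       = P (\<lambda>X1 X2 X3. D h (\<lambda>h1 h2. D h1 (\<lambda>h11 h12. F (X1 * h11) (X2 * h12) (X3 * h2))))"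
proof -
  note [lins] = lin_tri[OF F]
  from arg_cong[OF coassoc_mult(1), of "\<lambda>t. ev3 t F" h] show ?thesis
    by (simp add: ev3_mult[OF U F] ev3_leg[where U=U] lins swap_ev3)
qed

lemma coassoc_Q:
  assumes U [lins]: "is_space U" and F: "trilin U F"
  shows "Q (\<lambda>x1 x2 x3. D h (\<lambda>h1 h2. D h2 (\<lambda>h21 h22. F (x1 * h1) (x2 * h21) (x3 * h22))))
       = Q (\<lambda>x1 x2 x3. D h (\<lambda>h1 h2. D h1 (\<lambda>h11 h12. F (h11 * x1) (h12 * x2) (h2 * x3))))"
proof -
  note [lins] = lin_tri[OF F]
  from arg_cong[OF coassoc_mult(2), of "\<lambda>t. ev3 t F" h] show ?thesis
    by (simp add: ev3_mult[OF U F] ev3_leg[where U=U] lins swap_ev3)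
qed

lemma counit_D:
  assumes "is_space U" "lin H U G"
  shows "D h (\<lambda>a b. scl U (\<epsilon> b) (G a)) = G h" and "D h (\<lambda>a b. scl U (\<epsilon> a) (G b)) = G h"
proof -
  have *: "D h (\<lambda>a b. scl H (\<epsilon> b) a) = h" "D h (\<lambda>a b. scl H (\<epsilon> a) b) = h"
    using quasi_bialgebra by (simp_all add: quasi_bialgebra_def sw_evs)
  have "G (D h (\<lambda>a b. scl H (\<epsilon> b) a)) = D h (\<lambda>a b. scl U (\<epsilon> b) (G a))"
    "G (D h (\<lambda>a b. scl H (\<epsilon> a) b)) = D h (\<lambda>a b. scl U (\<epsilon> a) (G b))"
    by (subst lin_ev2_apply[OF is_space_H assms(2)]; simp add: lins lin_scl[OF assms(2)])+
  then show "D h (\<lambda>a b. scl U (\<epsilon> b) (G a)) = G h" "D h (\<lambda>a b. scl U (\<epsilon> a) (G b)) = G h"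
    by (simp_all add: *)
qed

text \<open>The axiom is composed with an arbitrary linear \<open>G\<close> so that the contraction
  can be carried out deep inside a form; \<open>antip_beta\<close>, \<open>snake_P\<close> and
  \<open>snake_Q\<close> are shaped the same way.\<close>

lemma antip_alpha:
  assumes "lin H U G"
  shows "D h (\<lambda>a b. G (S a * \<alpha> * b)) = scl U (\<epsilon> h) (G \<alpha>)"
proof -
  have "D h (\<lambda>a b. S a * \<alpha> * b) = scl H (\<epsilon> h) \<alpha>"
    using quasi_hopf by (simp add: quasi_hopf_def sw_evs)
  with lin_ev2_apply[OF is_space_H assms comult_closed, of "\<lambda>a b. S a * \<alpha> * b" h] show ?thesis
    by (simp add: lin_scl[OF assms])
qed

lemma antip_beta:
  assumes "lin H U G"
  shows "D h (\<lambda>a b. G (a * \<beta> * S b)) = scl U (\<epsilon> h) (G \<beta>)"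
proof -
  have "D h (\<lambda>a b. a * \<beta> * S b) = scl H (\<epsilon> h) \<beta>"
    using quasi_hopf by (simp add: quasi_hopf_def sw_evs)
  with lin_ev2_apply[OF is_space_H assms comult_closed, of "\<lambda>a b. a * \<beta> * S b" h] show ?thesis
    by (simp add: lin_scl[OF assms])
qed

lemma snake_P:
  assumes "lin H U G"
  shows "P (\<lambda>X1 X2 X3. G (X1 * \<beta> * S X2 * \<alpha> * X3)) = G 1"
proof -
  have "P (\<lambda>X1 X2 X3. X1 * \<beta> * S X2 * \<alpha> * X3) = 1"
    using quasi_hopf by (simp add: quasi_hopf_def sw_evs)
  with lin_ev3_apply[OF is_space_H assms Phi_closed, of "\<lambda>X1 X2 X3. X1 * \<beta> * S X2 * \<alpha> * X3"]
  show ?thesis by simp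
qed

lemma snake_Q:
  assumes "lin H U G"
  shows "Q (\<lambda>x1 x2 x3. G (S x1 * \<alpha> * x2 * \<beta> * S x3)) = G 1"
proof -
  have "Q (\<lambda>x1 x2 x3. S x1 * \<alpha> * x2 * \<beta> * S x3) = 1"
    using quasi_hopf by (simp add: quasi_hopf_def sw_evs)
  with lin_ev3_apply[OF is_space_H assms Phi_inv_closed, of "\<lambda>x1 x2 x3. S x1 * \<alpha> * x2 * \<beta> * S x3"]
  show ?thesis by simp
qed

lemma pentagon: 
  "one_tensor H (Phi H) \<odot>\<^sub>4 id_comult_id H (Phi H) \<odot>\<^sub>4 tensor_one H (Phi H)
     = id_id_comult H (Phi H) \<odot>\<^sub>4 comult_id_id H (Phi H)"
  using quasi_bialgebra by (simp add: quasi_bialgebra_def)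

lemma pentagon_ev:
  assumes U [lins]: "is_space U" and F: "quadlin U F"
  shows "P (\<lambda>X1 X2 X3. P (\<lambda>Y1 Y2 Y3. P (\<lambda>Z1 Z2 Z3. D Y2 (\<lambda>Y21 Y22.
           F (Y1 * Z1) (X1 * Y21 * Z2) (X2 * Y22 * Z3) (X3 * Y3)))))
       = P (\<lambda>X1 X2 X3. P (\<lambda>Y1 Y2 Y3. D X3 (\<lambda>X31 X32. D Y1 (\<lambda>Y11 Y12.
           F (X1 * Y11) (X2 * Y12) (X31 * Y2) (X32 * Y3)))))"
proof -
  note [lins] = lin_quad[OF F]
  from arg_cong[OF pentagon, of "\<lambda>t. ev4 t F"] show ?thesis
    by (simp add: ev4_mult[where U=U] ev4_leg[where U=U] F lins swap_ev3 mult.assoc)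
qed

section \<open>Applying the counit to one leg\<close>

definition eps1 :: "('k, 'h) tensor3 \<Rightarrow> ('k, 'h, 'h) tensor" where
  "eps1 t = ev3 t (\<lambda>a b c. fun_scl (\<epsilon> a) (pure2 H b c))"

definition eps2 :: "('k, 'h) tensor3 \<Rightarrow> ('k, 'h, 'h) tensor" where
  "eps2 t = ev3 t (\<lambda>a b c. fun_scl (\<epsilon> b) (pure2 H a c))"

definition eps3 :: "('k, 'h) tensor3 \<Rightarrow> ('k, 'h, 'h) tensor" where
  "eps3 t = ev3 t (\<lambda>a b c. fun_scl (\<epsilon> c) (pure2 H a b))"

definition counital :: "('k, 'h) tensor3 \<Rightarrow> bool" where
  "counital t \<longleftrightarrow> t \<in> carr H3 \<and> eps1 t = pure2 H 1 1 \<and> eps2 t = pure2 H 1 1 \<and> eps3 t = pure2 H 1 1"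

lemma fun_scl_closed [lins]: "t \<in> carr (tensor_space V W) \<Longrightarrow> fun_scl c t \<in> carr (tensor_space V W)"
  using is_space_scl[OF is_space_tensor] by simp

lemma lin_fun_scl [lins]:
  "lin X (tensor_space V W) f \<Longrightarrow> lin X (tensor_space V W) (\<lambda>x. fun_scl c (f x))"
  "lin X ground g \<Longrightarrow> u \<in> carr (tensor_space V W) \<Longrightarrow> lin X (tensor_space V W) (\<lambda>x. fun_scl (g x) u)"
  using lin_scl_const[OF is_space_tensor] lin_scl_left[OF is_space_tensor] by simp_all

lemma eps_closed [lins]:
  "t \<in> carr H3 \<Longrightarrow> eps1 t \<in> carr H2" "t \<in> carr H3 \<Longrightarrow> eps2 t \<in> carr H2" "t \<in> carr H3 \<Longrightarrow> eps3 t \<in> carr H2"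
  by (auto simp: eps1_def eps2_def eps3_def intro!: lins)

lemma ev2_scl:
  "is_space U \<Longrightarrow> bilin H H U F \<Longrightarrow> s \<in> carr H2 \<Longrightarrow> ev H H (fun_scl c s) F = scl U c (ev H H s F)"
  by (rule ev_fun_scl[OF is_space_H])

lemma ev_eps:
  assumes U [lins]: "is_space U" and F: "bilin H H U F" and [lins]: "t \<in> carr H3"
  shows "ev H H (eps1 t) F = ev3 t (\<lambda>a b c. scl U (\<epsilon> a) (F b c))"
    and "ev H H (eps2 t) F = ev3 t (\<lambda>a b c. scl U (\<epsilon> b) (F a c))"
    and "ev H H (eps3 t) F = ev3 t (\<lambda>a b c. scl U (\<epsilon> c) (F a b))"
  by (simp_all add: eps1_def eps2_def eps3_def ev_evs[where U=U] ev2_scl[where U=U] ev2_pure[where U=U] F lins)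

lemma ev_counital:
  assumes "is_space U" and "bilin H H U F" and "counital t"
  shows "ev3 t (\<lambda>a b c. scl U (\<epsilon> a) (F b c)) = F 1 1"
    and "ev3 t (\<lambda>a b c. scl U (\<epsilon> b) (F a c)) = F 1 1"
    and "ev3 t (\<lambda>a b c. scl U (\<epsilon> c) (F a b)) = F 1 1"
  using ev_eps[OF assms(1,2), of t] assms(3) by (simp_all add: counital_def ev2_pure[OF assms(1,2)])

lemma eps_mult:
  assumes [lins]: "s \<in> carr H3" "t \<in> carr H3"
  shows "eps1 (s \<odot>\<^sub>3 t) = eps1 s \<odot>\<^sub>2 eps1 t" "eps2 (s \<odot>\<^sub>3 t) = eps2 s \<odot>\<^sub>2 eps2 t"
    "eps3 (s \<odot>\<^sub>3 t) = eps3 s \<odot>\<^sub>2 eps3 t"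
proof -
  have "ev H H (eps1 (s \<odot>\<^sub>3 t)) B = ev H H (eps1 s \<odot>\<^sub>2 eps1 t) B"
    "ev H H (eps2 (s \<odot>\<^sub>3 t)) B = ev H H (eps2 s \<odot>\<^sub>2 eps2 t) B"
    "ev H H (eps3 (s \<odot>\<^sub>3 t)) B = ev H H (eps3 s \<odot>\<^sub>2 eps3 t) B" if B: "bilin H H ground B" for B
  proof -
    note [lins] = lin_bi[OF B] lin_mult_ground1 lin_mult_ground2
    have e: "c * ev3 t F = ev3 t (\<lambda>x y z. c * F x y z)" for c :: 'k and F
      by (rule lin_ev3_apply[where X=ground and Y=ground]) (auto simp: lin_def algebra_simps lins)
    show "ev H H (eps1 (s \<odot>\<^sub>3 t)) B = ev H H (eps1 s \<odot>\<^sub>2 eps1 t) B"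
      "ev H H (eps2 (s \<odot>\<^sub>3 t)) B = ev H H (eps2 s \<odot>\<^sub>2 eps2 t) B"
      "ev H H (eps3 (s \<odot>\<^sub>3 t)) B = ev H H (eps3 s \<odot>\<^sub>2 eps3 t) B"
      by (simp_all add: ev_eps[where U=ground] B ev2_mult[where U=ground] ev3_mult[where U=ground] lins
          mult.assoc e)
  qed
  then show "eps1 (s \<odot>\<^sub>3 t) = eps1 s \<odot>\<^sub>2 eps1 t" "eps2 (s \<odot>\<^sub>3 t) = eps2 s \<odot>\<^sub>2 eps2 t"
    "eps3 (s \<odot>\<^sub>3 t) = eps3 s \<odot>\<^sub>2 eps3 t"
    by (intro tensor2_eqI lins; simp)+
qed

end

section \<open>Consequences of the pentagon identity\<close>

context quasi_hopf_algebra
begin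

lemma pure2_scl: "pure2 H (scl H c a) b = fun_scl c (pure2 H a b)"
  using lin_scl[OF lin_pure_H2(1)[OF lin_ident], of a c b] by simp

lemma eps2_Phi: "eps2 (Phi H) = pure2 H 1 1"
proof -
  have "P (\<lambda>X1 X2 X3. pure2 H (scl H (\<epsilon> X2) X1) X3) = pure2 H 1 1"
    using quasi_bialgebra by (simp add: quasi_bialgebra_def sw_evs)
  then show ?thesis by (simp add: eps2_def pure2_scl)
qed

lemma mult_ev3: "t \<in> carr H3 \<Longrightarrow> (c::'k) * ev3 t F = ev3 t (\<lambda>x y z. c * F x y z)"
  by (rule lin_ev3_apply[where X=ground and Y=ground]) (auto simp: lin_def algebra_simps)

text \<open>Only the middle leg of \<open>\<Phi>\<close> is assumed to be counital; applying \<open>\<epsilon>\<close> to the second or third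
  leg of the pentagon identity gives the outer ones.\<close>

lemma counital_Phi: "counital (Phi H)"
proof -
  have m: "P (\<lambda>X1 X2 X3. \<epsilon> X2 * B X1 X3) = B 1 1" if B: "bilin H H ground B" for B :: "'h \<Rightarrow> 'h \<Rightarrow> 'k"
    using ev_eps(2)[OF is_space_ground B Phi_closed] by (simp add: eps2_Phi ev2_pure[OF is_space_ground B])
  \<comment> \<open>In tensor terms \<open>l\<close> says (1 \<otimes> \<open>eps1\<close> \<Phi>)
    \<Phi> = \<Phi> and \<open>r\<close> says \<Phi> (\<open>eps3\<close> \<Phi> \<otimes> 1) =
    \<Phi>. Cancelling \<Phi> then makes the outer legs counital.\<close>
  have l: "P (\<lambda>X1 X2 X3. P (\<lambda>Y1 Y2 Y3. \<epsilon> X1 * G Y1 (X2 * Y2) (X3 * Y3))) = P G" (is "?L = _")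
    and r: "P (\<lambda>X1 X2 X3. P (\<lambda>Y1 Y2 Y3. \<epsilon> Y3 * G (X1 * Y1) (X2 * Y2) X3)) = P G" (is "?R = _")
    if G: "trilin ground G" for G :: "'h \<Rightarrow> 'h \<Rightarrow> 'h \<Rightarrow> 'k"
  proof -
    note [lins] = lin_tri[OF G] lin_mult_ground1 lin_mult_ground2
    have c2: "D h (\<lambda>a b. \<epsilon> a * K b) = K h" and c1: "D h (\<lambda>a b. \<epsilon> b * K a) = K h" if "lin H ground K" for h K
      using counit_D[OF is_space_ground that] by simp_all
    \<comment> \<open>Counits of \<open>Z2\<close> and \<open>Y21\<close> come for free from
      \<open>m\<close> and \<open>c2\<close>. With them \<epsilon> covers the whole second leg of
      the left side of the pentagon.\<close>
    have "?L = P (\<lambda>X1 X2 X3. P (\<lambda>Y1 Y2 Y3. P (\<lambda>Z1 Z2 Z3. \<epsilon> Z2 * (\<epsilon> X1 * G (Y1 * Z1) (X2 * Y2 * Z3) (X3 * Y3)))))"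
      by (subst m) (simp_all add: lins)
    also have "\<dots> = P (\<lambda>X1 X2 X3. P (\<lambda>Y1 Y2 Y3. P (\<lambda>Z1 Z2 Z3. D Y2 (\<lambda>Y21 Y22.
        \<epsilon> Y21 * (\<epsilon> Z2 * (\<epsilon> X1 * G (Y1 * Z1) (X2 * Y22 * Z3) (X3 * Y3)))))))"
      by (subst c2) (simp_all add: lins)
    also have "\<dots> = P (\<lambda>X1 X2 X3. P (\<lambda>Y1 Y2 Y3. P (\<lambda>Z1 Z2 Z3. D Y2 (\<lambda>Y21 Y22.
        \<epsilon> (X1 * Y21 * Z2) * G (Y1 * Z1) (X2 * Y22 * Z3) (X3 * Y3)))))"
      by (simp add: ac_simps)
    also have "\<dots> = P (\<lambda>X1 X2 X3. P (\<lambda>Y1 Y2 Y3. D X3 (\<lambda>X31 X32. D Y1 (\<lambda>Y11 Y12.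
        \<epsilon> (X2 * Y12) * G (X1 * Y11) (X31 * Y2) (X32 * Y3)))))"
      by (rule pentagon_ev[where F="\<lambda>a b c d. \<epsilon> b * G a c d", OF is_space_ground]) (intro lins)
    also have "\<dots> = P (\<lambda>X1 X2 X3. P (\<lambda>Y1 Y2 Y3. D X3 (\<lambda>X31 X32. D Y1 (\<lambda>Y11 Y12.
        \<epsilon> Y12 * (\<epsilon> X2 * G (X1 * Y11) (X31 * Y2) (X32 * Y3))))))"
      by (simp add: ac_simps)
    also have "\<dots> = P (\<lambda>X1 X2 X3. \<epsilon> X2 * P (\<lambda>Y1 Y2 Y3. D X3 (\<lambda>X31 X32. G (X1 * Y1) (X31 * Y2) (X32 * Y3))))"
      by (subst c1) (simp_all add: lins mult_ev3 mult_ev)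
    also have "\<dots> = P G" by (subst m) (simp_all add: lins D_one[where U=ground])
    finally show "?L = P G" .
    have "?R = P (\<lambda>X1 X2 X3. \<epsilon> X2 * P (\<lambda>Y1 Y2 Y3. P (\<lambda>Z1 Z2 Z3. \<epsilon> Z3 * G (Y1 * Z1) (X1 * Y2 * Z2) (X3 * Y3))))"
      by (subst m) (simp_all add: lins)
    also have "\<dots> = P (\<lambda>X1 X2 X3. P (\<lambda>Y1 Y2 Y3. P (\<lambda>Z1 Z2 Z3. \<epsilon> X2 * (\<epsilon> Z3 * G (Y1 * Z1) (X1 * Y2 * Z2) (X3 * Y3)))))"
      by (simp add: mult_ev3 lins)
    also have "\<dots> = P (\<lambda>X1 X2 X3. P (\<lambda>Y1 Y2 Y3. P (\<lambda>Z1 Z2 Z3. D Y2 (\<lambda>Y21 Y22.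
        \<epsilon> Y22 * (\<epsilon> X2 * (\<epsilon> Z3 * G (Y1 * Z1) (X1 * Y21 * Z2) (X3 * Y3)))))))"
      by (subst c1) (simp_all add: lins)
    also have "\<dots> = P (\<lambda>X1 X2 X3. P (\<lambda>Y1 Y2 Y3. P (\<lambda>Z1 Z2 Z3. D Y2 (\<lambda>Y21 Y22.
        \<epsilon> (X2 * Y22 * Z3) * G (Y1 * Z1) (X1 * Y21 * Z2) (X3 * Y3)))))"
      by (simp add: ac_simps)
    also have "\<dots> = P (\<lambda>X1 X2 X3. P (\<lambda>Y1 Y2 Y3. D X3 (\<lambda>X31 X32. D Y1 (\<lambda>Y11 Y12.
        \<epsilon> (X31 * Y2) * G (X1 * Y11) (X2 * Y12) (X32 * Y3)))))"
      by (rule pentagon_ev[where F="\<lambda>a b c d. \<epsilon> c * G a b d", OF is_space_ground]) (intro lins)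
    also have "\<dots> = P (\<lambda>X1 X2 X3. P (\<lambda>Y1 Y2 Y3. D Y1 (\<lambda>Y11 Y12. D X3 (\<lambda>X31 X32.
        \<epsilon> X31 * (\<epsilon> Y2 * G (X1 * Y11) (X2 * Y12) (X32 * Y3))))))"
      by (subst ev_swap) (simp add: ac_simps)
    also have "\<dots> = P (\<lambda>X1 X2 X3. P (\<lambda>Y1 Y2 Y3. \<epsilon> Y2 * D Y1 (\<lambda>Y11 Y12. G (X1 * Y11) (X2 * Y12) (X3 * Y3))))"
      by (subst c2) (simp_all add: lins mult_ev)
    also have "\<dots> = P G" by (subst m) (simp_all add: lins D_one[where U=ground])
    finally show "?R = P G" .
  qed
  have "ev H H (eps1 (Phi H)) B = ev H H (pure2 H 1 1) B" and "ev H H (eps3 (Phi H)) B = ev H H (pure2 H 1 1) B"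
    if B: "bilin H H ground B" for B
  proof -
    note [lins] = lin_bi[OF B] lin_mult_ground1 lin_mult_ground2
    \<comment> \<open>A product \<Phi> \<Phi>\<inverse> = 1 is inserted to create the copy of \<Phi>
      on which \<open>l\<close> acts, and is cancelled afterwards.\<close>
    have "P (\<lambda>X1 X2 X3. \<epsilon> X1 * B X2 X3) = P (\<lambda>X1 X2 X3. P (\<lambda>Y1 Y2 Y3. Q (\<lambda>x1 x2 x3.
        (\<lambda>a b c. \<epsilon> X1 * (\<epsilon> a * B (X2 * b) (X3 * c))) (Y1 * x1) (Y2 * x2) (Y3 * x3))))"
      by (subst P_Q(1)[where U=ground]) (simp_all add: lins)
    also have "\<dots> = P (\<lambda>X1 X2 X3. P (\<lambda>Y1 Y2 Y3. \<epsilon> X1 *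
        Q (\<lambda>x1 x2 x3. \<epsilon> (Y1 * x1) * B (X2 * Y2 * x2) (X3 * Y3 * x3))))"
      by (simp add: mult_ev3 mult.assoc lins)
    also have "\<dots> = P (\<lambda>X1 X2 X3. Q (\<lambda>x1 x2 x3. \<epsilon> (X1 * x1) * B (X2 * x2) (X3 * x3)))"
      by (rule l) (intro lins)
    also have "\<dots> = \<epsilon> 1 * B 1 1" by (rule P_Q(1)[where U=ground]) (intro lins)+
    finally show "ev H H (eps1 (Phi H)) B = ev H H (pure2 H 1 1) B"
      by (simp add: ev_eps[where U=ground] ev2_pure[where U=ground] B lins)
    have "P (\<lambda>X1 X2 X3. \<epsilon> X3 * B X1 X2) = P (\<lambda>X1 X2 X3. Q (\<lambda>x1 x2 x3. P (\<lambda>Z1 Z2 Z3.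
        (\<lambda>a b c. \<epsilon> Z3 * (\<epsilon> c * B (a * Z1) (b * Z2))) (x1 * X1) (x2 * X2) (x3 * X3))))"
      by (subst P_Q(2)[where U=ground]) (simp_all add: lins)
    also have "\<dots> = P (\<lambda>X1 X2 X3. P (\<lambda>Z1 Z2 Z3. \<epsilon> Z3 * Q (\<lambda>x1 x2 x3.
        \<epsilon> (x3 * X3) * B (x1 * (X1 * Z1)) (x2 * (X2 * Z2)))))"
      by (simp add: swap_ev3_ev3[of "Phi_inv H" "Phi H"] mult_ev3 mult.assoc lins)
    also have "\<dots> = P (\<lambda>X1 X2 X3. Q (\<lambda>x1 x2 x3. \<epsilon> (x3 * X3) * B (x1 * X1) (x2 * X2)))"
      by (rule r) (intro lins)
    also have "\<dots> = \<epsilon> 1 * B 1 1" by (rule P_Q(2)[where U=ground]) (intro lins)+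
    finally show "ev H H (eps3 (Phi H)) B = ev H H (pure2 H 1 1) B"
      by (simp add: ev_eps[where U=ground] ev2_pure[where U=ground] B lins)
  qed
  then have "eps1 (Phi H) = pure2 H 1 1" "eps3 (Phi H) = pure2 H 1 1"
    by (intro tensor2_eqI lins; simp)+
  then show ?thesis by (simp add: counital_def lins eps2_Phi)
qed

text \<open>The maps \<open>eps1\<close>, \<open>eps2\<close>, \<open>eps3\<close> are
  multiplicative and unital, so they send the inverse of \<Phi> to the inverse of 1.\<close>

lemma counital_Phi_inv: "counital (Phi_inv H)"
proof -
  have *: "e (Phi_inv H) = pure2 H 1 1"
    if "\<And>s t. s \<in> carr H3 \<Longrightarrow> t \<in> carr H3 \<Longrightarrow> e (s \<odot>\<^sub>3 t) = e s \<odot>\<^sub>2 e t" "e (Phi H) = pure2 H 1 1"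
      "e (pure3 H 1 1 1) = pure2 H 1 1" "e (Phi_inv H) \<in> carr H2" for e
    using that(1)[OF Phi_closed Phi_inv_closed] that(2-4) by (simp add: Phi_Phi_inv mult2_one)
  have o: "eps1 (pure3 H 1 1 1) = pure2 H 1 1" "eps2 (pure3 H 1 1 1) = pure2 H 1 1" "eps3 (pure3 H 1 1 1) = pure2 H 1 1"
    by (simp_all add: eps1_def eps2_def eps3_def ev3_pure[where U=H2] lins is_space_scl_one[OF is_space_tensor, simplified])
  show ?thesis using counital_Phi
    by (simp add: counital_def lins *[of eps1] *[of eps2] *[of eps3] eps_mult o)
qed

text \<open>Multiplicativity of these five maps is what transports invertibility from \<Phi> to
  every factor of the pentagon, in \<open>inverse4_leg\<close>.\<close>

lemma leg_mult:
  assumes [lins]: "s \<in> carr H3" "t \<in> carr H3"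
  shows "comult_id_id H (s \<odot>\<^sub>3 t) = comult_id_id H s \<odot>\<^sub>4 comult_id_id H t" (is "?a = ?a'")
    and "id_comult_id H (s \<odot>\<^sub>3 t) = id_comult_id H s \<odot>\<^sub>4 id_comult_id H t" (is "?b = ?b'")
    and "id_id_comult H (s \<odot>\<^sub>3 t) = id_id_comult H s \<odot>\<^sub>4 id_id_comult H t" (is "?c = ?c'")
    and "one_tensor H (s \<odot>\<^sub>3 t) = one_tensor H s \<odot>\<^sub>4 one_tensor H t" (is "?d = ?d'")
    and "tensor_one H (s \<odot>\<^sub>3 t) = tensor_one H s \<odot>\<^sub>4 tensor_one H t" (is "?e = ?e'")
proof -
  have "ev4 ?a B = ev4 ?a' B" "ev4 ?b B = ev4 ?b' B" "ev4 ?c B = ev4 ?c' B"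
    "ev4 ?d B = ev4 ?d' B" "ev4 ?e B = ev4 ?e' B" if B: "quadlin ground B" for B :: "'h \<Rightarrow> 'h \<Rightarrow> 'h \<Rightarrow> 'h \<Rightarrow> 'k"
  proof -
    note [lins] = lin_quad[OF B]
    show "ev4 ?a B = ev4 ?a' B" "ev4 ?b B = ev4 ?b' B" "ev4 ?c B = ev4 ?c' B"
      "ev4 ?d B = ev4 ?d' B" "ev4 ?e B = ev4 ?e' B"
      by (simp_all add: ev4_mult[where U=ground] ev3_mult[where U=ground] ev4_leg[where U=ground] B
          D_mult[where U=ground] lins swap_ev3)
  qed
  then show "?a = ?a'" "?b = ?b'" "?c = ?c'" "?d = ?d'" "?e = ?e'"
    by (intro tensor4_eqI lins; simp)+
qed

lemma leg_one:
  "comult_id_id H (pure3 H 1 1 1) = pure4 H 1 1 1 1" "id_comult_id H (pure3 H 1 1 1) = pure4 H 1 1 1 1"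
  "id_id_comult H (pure3 H 1 1 1) = pure4 H 1 1 1 1" "one_tensor H (pure3 H 1 1 1) = pure4 H 1 1 1 1"
  "tensor_one H (pure3 H 1 1 1) = pure4 H 1 1 1 1"
  by (simp_all add: leg_eqs ev3_pure[where U=H4] D_one[where U=H4] lins)

definition inverse4 :: "('k, 'h) tensor4 \<Rightarrow> ('k, 'h) tensor4 \<Rightarrow> bool" where
  "inverse4 s t \<longleftrightarrow> s \<in> carr H4 \<and> t \<in> carr H4 \<and> s \<odot>\<^sub>4 t = pure4 H 1 1 1 1 \<and> t \<odot>\<^sub>4 s = pure4 H 1 1 1 1"

lemma inverse4_leg:
  "inverse4 (comult_id_id H (Phi H)) (comult_id_id H (Phi_inv H))"
  "inverse4 (id_comult_id H (Phi H)) (id_comult_id H (Phi_inv H))"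
  "inverse4 (id_id_comult H (Phi H)) (id_id_comult H (Phi_inv H))"
  "inverse4 (one_tensor H (Phi H)) (one_tensor H (Phi_inv H))"
  "inverse4 (tensor_one H (Phi H)) (tensor_one H (Phi_inv H))"
  unfolding inverse4_def
  by (simp_all add: lins leg_one Phi_Phi_inv Phi_inv_Phi flip: leg_mult)

lemma inverse4_cancel:
  assumes "inverse4 s t"
  shows "x \<in> carr H4 \<Longrightarrow> s \<odot>\<^sub>4 (t \<odot>\<^sub>4 x) = x" "x \<in> carr H4 \<Longrightarrow> t \<odot>\<^sub>4 (s \<odot>\<^sub>4 x) = x"
    "s \<odot>\<^sub>4 t = pure4 H 1 1 1 1" "t \<odot>\<^sub>4 s = pure4 H 1 1 1 1"
  using assms by (simp_all add: inverse4_def mult4_one flip: mult4_assoc)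

text \<open>\<open>A4\<close> and \<open>B4\<close> are the elements in the definitions of \<gamma>
  and \<delta>. The pentagon trades them for \<open>D4\<close> and \<open>E4\<close> up to one
  factor with a coproduct in legs 2 and 3, which a contraction of these legs against \<alpha> or
  \<beta> does not see.\<close>

definition A4 :: "('k, 'h) tensor4" where "A4 = tensor_one H (Phi H) \<odot>\<^sub>4 comult_id_id H (Phi_inv H)"
definition B4 :: "('k, 'h) tensor4" where "B4 = comult_id_id H (Phi H) \<odot>\<^sub>4 tensor_one H (Phi_inv H)"
definition D4 :: "('k, 'h) tensor4" where "D4 = one_tensor H (Phi_inv H) \<odot>\<^sub>4 id_id_comult H (Phi H)"
definition E4 :: "('k, 'h) tensor4" where "E4 = id_id_comult H (Phi_inv H) \<odot>\<^sub>4 one_tensor H (Phi H)"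

lemma ABDE_closed [lins]: "A4 \<in> carr H4" "B4 \<in> carr H4" "D4 \<in> carr H4" "E4 \<in> carr H4"
  by (simp_all add: A4_def B4_def D4_def E4_def lins)

lemma inverse4_unique:
  assumes "inverse4 s s'" "inverse4 t t'" "s = t"
  shows "s' = t'"
proof -
  have "s' = s' \<odot>\<^sub>4 (t \<odot>\<^sub>4 t')" using assms(1,2) by (simp add: inverse4_def mult4_one)
  also have "\<dots> = t'" using assms by (metis inverse4_cancel(2) inverse4_def)
  finally show ?thesis .
qed

lemma inverse4_mult:
  assumes "inverse4 s s'" "inverse4 t t'"
  shows "inverse4 (s \<odot>\<^sub>4 t) (t' \<odot>\<^sub>4 s')"
proof -
  have "s \<in> carr H4" "t \<in> carr H4" "s' \<in> carr H4" "t' \<in> carr H4" using assms by (simp_all add: inverse4_def)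
  then show ?thesis unfolding inverse4_def using assms
    by (simp add: mult4_assoc inverse4_cancel lins)
qed

lemma pentagon_inv:
  "tensor_one H (Phi_inv H) \<odot>\<^sub>4 (id_comult_id H (Phi_inv H) \<odot>\<^sub>4 one_tensor H (Phi_inv H))
     = comult_id_id H (Phi_inv H) \<odot>\<^sub>4 id_id_comult H (Phi_inv H)"
  by (rule inverse4_unique[OF _ _ pentagon]) (intro inverse4_mult inverse4_leg)+

text \<open>All of these are the pentagon with factors moved across. The forms differ in which leg
  coproduct of \<Phi> or \<Phi>\<inverse> stands at an end of the product, where a later contraction
  can absorb it.\<close>

lemma
  shows A4_eq: "A4 = id_comult_id H (Phi_inv H) \<odot>\<^sub>4 (one_tensor H (Phi_inv H) \<odot>\<^sub>4 id_id_comult H (Phi H))"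
    and A4_eq_D4: "A4 = id_comult_id H (Phi_inv H) \<odot>\<^sub>4 D4"
    and D4_eq: "D4 = id_comult_id H (Phi H) \<odot>\<^sub>4 (tensor_one H (Phi H) \<odot>\<^sub>4 comult_id_id H (Phi_inv H))"
    and D4_eq_A4: "D4 = id_comult_id H (Phi H) \<odot>\<^sub>4 A4"
    and B4_eq: "B4 = id_id_comult H (Phi_inv H) \<odot>\<^sub>4 (one_tensor H (Phi H) \<odot>\<^sub>4 id_comult_id H (Phi H))"
    and B4_eq_E4: "B4 = E4 \<odot>\<^sub>4 id_comult_id H (Phi H)"
    and E4_eq: "E4 = comult_id_id H (Phi H) \<odot>\<^sub>4 (tensor_one H (Phi_inv H) \<odot>\<^sub>4 id_comult_id H (Phi_inv H))"
    and tensor_one_Phi_inv_eq: "tensor_one H (Phi_inv H) = comult_id_id H (Phi_inv H) \<odot>\<^sub>4 (E4 \<odot>\<^sub>4 id_comult_id H (Phi H))"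
    and tensor_one_id_comult_id_eq: "tensor_one H (Phi_inv H) \<odot>\<^sub>4 id_comult_id H (Phi_inv H) = comult_id_id H (Phi_inv H) \<odot>\<^sub>4 E4"
    and one_tensor_id_comult_id_eq: "one_tensor H (Phi H) \<odot>\<^sub>4 id_comult_id H (Phi H) = id_id_comult H (Phi H) \<odot>\<^sub>4 B4"
    and id_comult_id_one_tensor_eq: "id_comult_id H (Phi_inv H) \<odot>\<^sub>4 one_tensor H (Phi_inv H) = A4 \<odot>\<^sub>4 id_id_comult H (Phi_inv H)"
proof -
  note c = inverse4_leg[THEN inverse4_cancel(1)] inverse4_leg[THEN inverse4_cancel(2)]
    inverse4_leg[THEN inverse4_cancel(3)] inverse4_leg[THEN inverse4_cancel(4)]
  note n = mult4_assoc mult4_one lins c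
  let ?a = "one_tensor H (Phi H)" and ?b = "id_comult_id H (Phi H)" and ?c = "tensor_one H (Phi H)"
    and ?d = "id_id_comult H (Phi H)" and ?e = "comult_id_id H (Phi H)"
    and ?a' = "one_tensor H (Phi_inv H)" and ?b' = "id_comult_id H (Phi_inv H)" and ?c' = "tensor_one H (Phi_inv H)"
    and ?d' = "id_id_comult H (Phi_inv H)" and ?e' = "comult_id_id H (Phi_inv H)"
  have pent: "?a \<odot>\<^sub>4 (?b \<odot>\<^sub>4 ?c) = ?d \<odot>\<^sub>4 ?e" using pentagon by (simp add: n)
  have "?b' \<odot>\<^sub>4 (?a' \<odot>\<^sub>4 (?a \<odot>\<^sub>4 (?b \<odot>\<^sub>4 ?c) \<odot>\<^sub>4 ?e')) = ?c \<odot>\<^sub>4 ?e'"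
    by (simp add: n)
  moreover have "?b' \<odot>\<^sub>4 (?a' \<odot>\<^sub>4 (?d \<odot>\<^sub>4 ?e \<odot>\<^sub>4 ?e')) = ?b' \<odot>\<^sub>4 (?a' \<odot>\<^sub>4 ?d)"
    by (simp add: n)
  ultimately show A: "A4 = ?b' \<odot>\<^sub>4 (?a' \<odot>\<^sub>4 ?d)" by (simp add: A4_def pent)
  then show "A4 = ?b' \<odot>\<^sub>4 D4" by (simp add: D4_def)
  then show DA: "D4 = ?b \<odot>\<^sub>4 A4" by (simp add: n)
  then show "D4 = ?b \<odot>\<^sub>4 (?c \<odot>\<^sub>4 ?e')" by (simp add: A4_def)
  have "?d' \<odot>\<^sub>4 (?d \<odot>\<^sub>4 ?e) \<odot>\<^sub>4 ?c' = B4" by (simp add: n B4_def)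
  moreover have "?d' \<odot>\<^sub>4 (?a \<odot>\<^sub>4 (?b \<odot>\<^sub>4 ?c)) \<odot>\<^sub>4 ?c' = ?d' \<odot>\<^sub>4 (?a \<odot>\<^sub>4 ?b)" by (simp add: n)
  ultimately show B: "B4 = ?d' \<odot>\<^sub>4 (?a \<odot>\<^sub>4 ?b)" by (simp add: pent)
  then show BE: "B4 = E4 \<odot>\<^sub>4 ?b" by (simp add: E4_def n)
  then have EB: "E4 = B4 \<odot>\<^sub>4 ?b'" by (simp add: n)
  then show "E4 = ?e \<odot>\<^sub>4 (?c' \<odot>\<^sub>4 ?b')" by (simp add: B4_def n)
  then show "?c' \<odot>\<^sub>4 ?b' = ?e' \<odot>\<^sub>4 E4" by (simp add: n)
  have "?c' = ?e' \<odot>\<^sub>4 B4" by (simp add: B4_def n)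
  then show "?c' = ?e' \<odot>\<^sub>4 (E4 \<odot>\<^sub>4 ?b)" by (simp add: BE)
  show "?a \<odot>\<^sub>4 ?b = ?d \<odot>\<^sub>4 B4" by (simp add: B n)
  show "?b' \<odot>\<^sub>4 ?a' = A4 \<odot>\<^sub>4 ?d'" by (simp add: A n)
qed

text \<open>Under \<open>inv\<close> the coproduct in legs 1 and 2 leaves only the counit of the
  first leg of \<open>t\<close>, and counitality of \<open>t\<close> removes what is left. The five
  variants below treat the other pairs of adjacent legs and multiplication from the right.\<close>

lemma drop_left12:
  assumes U [lins]: "is_space U" and F: "quadlin U F" and t: "counital t" and s [lins]: "s \<in> carr H4"
    and inv: "\<And>h a b c d. D h (\<lambda>h1 h2. F (h1 * a) (h2 * b) c d) = scl U (\<epsilon> h) (F a b c d)"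
  shows "ev4 (comult_id_id H t \<odot>\<^sub>4 s) F = ev4 s F"
proof -
  note [lins] = lin_quad[OF F]
  have [lins]: "t \<in> carr H3" using t by (simp add: counital_def)
  have "ev4 (comult_id_id H t \<odot>\<^sub>4 s) F
      = ev4 s (\<lambda>a b c d. ev3 t (\<lambda>X1 X2 X3. D X1 (\<lambda>h1 h2. F (h1 * a) (h2 * b) (X2 * c) (X3 * d))))"
    by (simp add: ev4_mult[where U=U] ev4_leg[where U=U] F lins swap_ev4 swap_ev3_ev4)
  also have "\<dots> = ev4 s (\<lambda>a b c d. ev3 t (\<lambda>X1 X2 X3. scl U (\<epsilon> X1) ((\<lambda>u v. F a b (u * c) (v * d)) X2 X3)))"
    by (simp add: inv)
  also have "\<dots> = ev4 s F"
    by (subst ev_counital(1)[OF U _ t]) (simp_all add: lins)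
  finally show ?thesis .
qed

lemma drop_left23:
  assumes U [lins]: "is_space U" and F: "quadlin U F" and t: "counital t" and s [lins]: "s \<in> carr H4"
    and inv: "\<And>h a b c d. D h (\<lambda>h1 h2. F a (h1 * b) (h2 * c) d) = scl U (\<epsilon> h) (F a b c d)"
  shows "ev4 (id_comult_id H t \<odot>\<^sub>4 s) F = ev4 s F"
proof -
  note [lins] = lin_quad[OF F]
  have [lins]: "t \<in> carr H3" using t by (simp add: counital_def)
  have "ev4 (id_comult_id H t \<odot>\<^sub>4 s) F
      = ev4 s (\<lambda>a b c d. ev3 t (\<lambda>X1 X2 X3. D X2 (\<lambda>h1 h2. F (X1 * a) (h1 * b) (h2 * c) (X3 * d))))"
    by (simp add: ev4_mult[where U=U] ev4_leg[where U=U] F lins swap_ev4 swap_ev3_ev4)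
  also have "\<dots> = ev4 s (\<lambda>a b c d. ev3 t (\<lambda>X1 X2 X3. scl U (\<epsilon> X2) ((\<lambda>u v. F (u * a) b c (v * d)) X1 X3)))"
    by (simp add: inv)
  also have "\<dots> = ev4 s F"
    by (subst ev_counital(2)[OF U _ t]) (simp_all add: lins)
  finally show ?thesis .
qed

lemma drop_left34:
  assumes U [lins]: "is_space U" and F: "quadlin U F" and t: "counital t" and s [lins]: "s \<in> carr H4"
    and inv: "\<And>h a b c d. D h (\<lambda>h1 h2. F a b (h1 * c) (h2 * d)) = scl U (\<epsilon> h) (F a b c d)"
  shows "ev4 (id_id_comult H t \<odot>\<^sub>4 s) F = ev4 s F"
proof -
  note [lins] = lin_quad[OF F]
  have [lins]: "t \<in> carr H3" using t by (simp add: counital_def)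
  have "ev4 (id_id_comult H t \<odot>\<^sub>4 s) F
      = ev4 s (\<lambda>a b c d. ev3 t (\<lambda>X1 X2 X3. D X3 (\<lambda>h1 h2. F (X1 * a) (X2 * b) (h1 * c) (h2 * d))))"
    by (simp add: ev4_mult[where U=U] ev4_leg[where U=U] F lins swap_ev4 swap_ev3_ev4)
  also have "\<dots> = ev4 s (\<lambda>a b c d. ev3 t (\<lambda>X1 X2 X3. scl U (\<epsilon> X3) ((\<lambda>u v. F (u * a) (v * b) c d) X1 X2)))"
    by (simp add: inv)
  also have "\<dots> = ev4 s F"
    by (subst ev_counital(3)[OF U _ t]) (simp_all add: lins)
  finally show ?thesis .
qed

lemma drop_right12:
  assumes U [lins]: "is_space U" and F: "quadlin U F" and t: "counital t" and s [lins]: "s \<in> carr H4"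
    and inv: "\<And>h a b c d. D h (\<lambda>h1 h2. F (a * h1) (b * h2) c d) = scl U (\<epsilon> h) (F a b c d)"
  shows "ev4 (s \<odot>\<^sub>4 comult_id_id H t) F = ev4 s F"
proof -
  note [lins] = lin_quad[OF F]
  have [lins]: "t \<in> carr H3" using t by (simp add: counital_def)
  have "ev4 (s \<odot>\<^sub>4 comult_id_id H t) F
      = ev4 s (\<lambda>a b c d. ev3 t (\<lambda>X1 X2 X3. D X1 (\<lambda>h1 h2. F (a * h1) (b * h2) (c * X2) (d * X3))))"
    by (simp add: ev4_mult[where U=U] ev4_leg[where U=U] F lins)
  also have "\<dots> = ev4 s (\<lambda>a b c d. ev3 t (\<lambda>X1 X2 X3. scl U (\<epsilon> X1) ((\<lambda>u v. F a b (c * u) (d * v)) X2 X3)))"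
    by (simp add: inv)
  also have "\<dots> = ev4 s F"
    by (subst ev_counital(1)[OF U _ t]) (simp_all add: lins)
  finally show ?thesis .
qed

lemma drop_right23:
  assumes U [lins]: "is_space U" and F: "quadlin U F" and t: "counital t" and s [lins]: "s \<in> carr H4"
    and inv: "\<And>h a b c d. D h (\<lambda>h1 h2. F a (b * h1) (c * h2) d) = scl U (\<epsilon> h) (F a b c d)"
  shows "ev4 (s \<odot>\<^sub>4 id_comult_id H t) F = ev4 s F"
proof -
  note [lins] = lin_quad[OF F]
  have [lins]: "t \<in> carr H3" using t by (simp add: counital_def)
  have "ev4 (s \<odot>\<^sub>4 id_comult_id H t) F
      = ev4 s (\<lambda>a b c d. ev3 t (\<lambda>X1 X2 X3. D X2 (\<lambda>h1 h2. F (a * X1) (b * h1) (c * h2) (d * X3))))"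
    by (simp add: ev4_mult[where U=U] ev4_leg[where U=U] F lins)
  also have "\<dots> = ev4 s (\<lambda>a b c d. ev3 t (\<lambda>X1 X2 X3. scl U (\<epsilon> X2) ((\<lambda>u v. F (a * u) b c (d * v)) X1 X3)))"
    by (simp add: inv)
  also have "\<dots> = ev4 s F"
    by (subst ev_counital(2)[OF U _ t]) (simp_all add: lins)
  finally show ?thesis .
qed

lemma drop_right34:
  assumes U [lins]: "is_space U" and F: "quadlin U F" and t: "counital t" and s [lins]: "s \<in> carr H4"
    and inv: "\<And>h a b c d. D h (\<lambda>h1 h2. F a b (c * h1) (d * h2)) = scl U (\<epsilon> h) (F a b c d)"
  shows "ev4 (s \<odot>\<^sub>4 id_id_comult H t) F = ev4 s F"
proof -
  note [lins] = lin_quad[OF F]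
  have [lins]: "t \<in> carr H3" using t by (simp add: counital_def)
  have "ev4 (s \<odot>\<^sub>4 id_id_comult H t) F
      = ev4 s (\<lambda>a b c d. ev3 t (\<lambda>X1 X2 X3. D X3 (\<lambda>h1 h2. F (a * X1) (b * X2) (c * h1) (d * h2))))"
    by (simp add: ev4_mult[where U=U] ev4_leg[where U=U] F lins)
  also have "\<dots> = ev4 s (\<lambda>a b c d. ev3 t (\<lambda>X1 X2 X3. scl U (\<epsilon> X3) ((\<lambda>u v. F (a * u) (b * v) c d) X1 X2)))"
    by (simp add: inv)
  also have "\<dots> = ev4 s F"
    by (subst ev_counital(3)[OF U _ t]) (simp_all add: lins)
  finally show ?thesis .
qed

lemma ABDE_ev:
  assumes U [lins]: "is_space U" and F: "quadlin U F"
  shows "ev4 A4 F = P (\<lambda>X1 X2 X3. Q (\<lambda>x1 x2 x3. D x1 (\<lambda>x11 x12. F (X1 * x11) (X2 * x12) (X3 * x2) x3)))"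
    and "ev4 B4 F = P (\<lambda>X1 X2 X3. Q (\<lambda>x1 x2 x3. D X1 (\<lambda>X11 X12. F (X11 * x1) (X12 * x2) (X2 * x3) X3)))"
    and "ev4 D4 F = P (\<lambda>X1 X2 X3. Q (\<lambda>x1 x2 x3. D X3 (\<lambda>X31 X32. F X1 (x1 * X2) (x2 * X31) (x3 * X32))))"
    and "ev4 E4 F = P (\<lambda>X1 X2 X3. Q (\<lambda>x1 x2 x3. D x3 (\<lambda>x31 x32. F x1 (x2 * X1) (x31 * X2) (x32 * X3))))"
proof -
  note [lins] = lin_quad[OF F]
  show "ev4 A4 F = P (\<lambda>X1 X2 X3. Q (\<lambda>x1 x2 x3. D x1 (\<lambda>x11 x12. F (X1 * x11) (X2 * x12) (X3 * x2) x3)))"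
    "ev4 B4 F = P (\<lambda>X1 X2 X3. Q (\<lambda>x1 x2 x3. D X1 (\<lambda>X11 X12. F (X11 * x1) (X12 * x2) (X2 * x3) X3)))"
    "ev4 D4 F = P (\<lambda>X1 X2 X3. Q (\<lambda>x1 x2 x3. D X3 (\<lambda>X31 X32. F X1 (x1 * X2) (x2 * X31) (x3 * X32))))"
    "ev4 E4 F = P (\<lambda>X1 X2 X3. Q (\<lambda>x1 x2 x3. D x3 (\<lambda>x31 x32. F x1 (x2 * X1) (x31 * X2) (x32 * X3))))"
    by (simp_all add: A4_def B4_def D4_def E4_def ev4_mult[where U=U] ev4_leg[where U=U] F lins swap_ev3
        swap_ev3_ev3[of "Phi_inv H" "Phi H"])
qed

text \<open>By the pentagon \<open>A4\<close> is 1 \<otimes> \<Phi>\<inverse> between two coproduct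
  factors. The \<alpha> joining legs 2 and 3 absorbs the left one, the \<beta> joining legs 3 and 4
  absorbs the right one, and the antipode axiom for \<Phi>\<inverse> remains. The next three lemmas
  follow the same pattern.\<close>

lemma snake_A:
  assumes U [lins]: "is_space U" and G: "bilin H H U G"
  shows "ev4 A4 (\<lambda>a b c d. G a (S b * \<alpha> * c * \<beta> * S d)) = G 1 1"
proof -
  note [lins] = lin_bi[OF G]
  let ?F = "\<lambda>a b c d. G a (S b * \<alpha> * c * \<beta> * S d)"
  have l: "D h (\<lambda>h1 h2. ?F a (h1 * b) (h2 * c) d) = scl U (\<epsilon> h) (?F a b c d)" for h a b c d
    using antip_alpha[of U "\<lambda>z. G a (S b * z * c * \<beta> * S d)" h] by (simp add: lins mult.assoc)
  have r: "D h (\<lambda>h1 h2. ?F a b (c * h1) (d * h2)) = scl U (\<epsilon> h) (?F a b c d)" for h a b c d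
    using antip_beta[of U "\<lambda>z. G a (S b * \<alpha> * c * z * S d)" h] by (simp add: lins mult.assoc)
  have "ev4 A4 ?F = ev4 (one_tensor H (Phi_inv H) \<odot>\<^sub>4 id_id_comult H (Phi H)) ?F"
    unfolding A4_eq by (rule drop_left23[OF U _ counital_Phi_inv _ l]) (intro lins)+
  also have "\<dots> = ev4 (one_tensor H (Phi_inv H)) ?F"
    by (rule drop_right34[OF U _ counital_Phi _ r]) (intro lins)+
  also have "\<dots> = G 1 1"
    using snake_Q[of U "\<lambda>z. G 1 z"] by (simp add: ev4_leg[where U=U] lins mult.assoc)
  finally show ?thesis .
qed

lemma snake_B:
  assumes U [lins]: "is_space U" and G: "bilin H H U G"
  shows "ev4 B4 (\<lambda>a b c d. G a (b * \<beta> * S c * \<alpha> * d)) = G 1 1"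
proof -
  note [lins] = lin_bi[OF G]
  let ?F = "\<lambda>a b c d. G a (b * \<beta> * S c * \<alpha> * d)"
  have l: "D h (\<lambda>h1 h2. ?F a b (h1 * c) (h2 * d)) = scl U (\<epsilon> h) (?F a b c d)" for h a b c d
    using antip_alpha[of U "\<lambda>z. G a (b * \<beta> * S c * z * d)" h] by (simp add: lins mult.assoc)
  have r: "D h (\<lambda>h1 h2. ?F a (b * h1) (c * h2) d) = scl U (\<epsilon> h) (?F a b c d)" for h a b c d
    using antip_beta[of U "\<lambda>z. G a (b * z * S c * \<alpha> * d)" h] by (simp add: lins mult.assoc)
  have "ev4 B4 ?F = ev4 (one_tensor H (Phi H) \<odot>\<^sub>4 id_comult_id H (Phi H)) ?F"
    unfolding B4_eq by (rule drop_left34[OF U _ counital_Phi_inv _ l]) (intro lins)+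
  also have "\<dots> = ev4 (one_tensor H (Phi H)) ?F"
    by (rule drop_right23[OF U _ counital_Phi _ r]) (intro lins)+
  also have "\<dots> = G 1 1"
    using snake_P[of U "\<lambda>z. G 1 z"] by (simp add: ev4_leg[where U=U] lins mult.assoc)
  finally show ?thesis .
qed

lemma snake_D:
  assumes U [lins]: "is_space U" and G: "bilin H H U G"
  shows "ev4 D4 (\<lambda>a b c d. G (a * \<beta> * S b * \<alpha> * c) d) = G 1 1"
proof -
  note [lins] = lin_bi[OF G]
  let ?F = "\<lambda>a b c d. G (a * \<beta> * S b * \<alpha> * c) d"
  have l: "D h (\<lambda>h1 h2. ?F a (h1 * b) (h2 * c) d) = scl U (\<epsilon> h) (?F a b c d)" for h a b c d
    using antip_alpha[of U "\<lambda>z. G (a * \<beta> * S b * z * c) d" h] by (simp add: lins mult.assoc)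
  have r: "D h (\<lambda>h1 h2. ?F (a * h1) (b * h2) c d) = scl U (\<epsilon> h) (?F a b c d)" for h a b c d
    using antip_beta[of U "\<lambda>z. G (a * z * S b * \<alpha> * c) d" h] by (simp add: lins mult.assoc)
  have "ev4 D4 ?F = ev4 (tensor_one H (Phi H) \<odot>\<^sub>4 comult_id_id H (Phi_inv H)) ?F"
    unfolding D4_eq by (rule drop_left23[OF U _ counital_Phi _ l]) (intro lins)+
  also have "\<dots> = ev4 (tensor_one H (Phi H)) ?F"
    by (rule drop_right12[OF U _ counital_Phi_inv _ r]) (intro lins)+
  also have "\<dots> = G 1 1"
    using snake_P[of U "\<lambda>z. G z 1"] by (simp add: ev4_leg[where U=U] lins mult.assoc)
  finally show ?thesis .
qed

lemma snake_E:
  assumes U [lins]: "is_space U" and G: "bilin H H U G"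
  shows "ev4 E4 (\<lambda>a b c d. G (S a * \<alpha> * b * \<beta> * S c) d) = G 1 1"
proof -
  note [lins] = lin_bi[OF G]
  let ?F = "\<lambda>a b c d. G (S a * \<alpha> * b * \<beta> * S c) d"
  have l: "D h (\<lambda>h1 h2. ?F (h1 * a) (h2 * b) c d) = scl U (\<epsilon> h) (?F a b c d)" for h a b c d
    using antip_alpha[of U "\<lambda>z. G (S a * z * b * \<beta> * S c) d" h] by (simp add: lins mult.assoc)
  have r: "D h (\<lambda>h1 h2. ?F a (b * h1) (c * h2) d) = scl U (\<epsilon> h) (?F a b c d)" for h a b c d
    using antip_beta[of U "\<lambda>z. G (S a * \<alpha> * b * z * S c) d" h] by (simp add: lins mult.assoc)
  have "ev4 E4 ?F = ev4 (tensor_one H (Phi_inv H) \<odot>\<^sub>4 id_comult_id H (Phi_inv H)) ?F"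
    unfolding E4_eq by (rule drop_left12[OF U _ counital_Phi _ l]) (intro lins)+
  also have "\<dots> = ev4 (tensor_one H (Phi_inv H)) ?F"
    by (rule drop_right23[OF U _ counital_Phi_inv _ r]) (intro lins)+
  also have "\<dots> = G 1 1"
    using snake_Q[of U "\<lambda>z. G z 1"] by (simp add: ev4_leg[where U=U] lins mult.assoc)
  finally show ?thesis .
qed

section \<open>The elements \<gamma> and \<delta>\<close>

abbreviation "\<gamma> \<equiv> gamma_twist H"
abbreviation "\<delta> \<equiv> delta_twist H"

lemma gamma_eq: "\<gamma> = ev4 A4 (\<lambda>a b c d. pure2 H (S b * \<alpha> * c) (S a * \<alpha> * d))"
  by (simp add: gamma_twist_def A4_def sw_evs)

lemma delta_eq: "\<delta> = ev4 B4 (\<lambda>a b c d. pure2 H (a * \<beta> * S d) (b * \<beta> * S c))"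
  by (simp add: delta_twist_def B4_def sw_evs)

text \<open>The \<alpha> between legs 2 and 3 absorbs the factor by which \<open>A4\<close> and
  \<open>D4\<close> differ. With two expansions of \<gamma>, and likewise of \<delta>, each
  computation can pick the one whose copies of \<Phi> fit the pentagon.\<close>

lemma gamma_eq_D4: "\<gamma> = ev4 D4 (\<lambda>a b c d. pure2 H (S b * \<alpha> * c) (S a * \<alpha> * d))" (is "_ = ev4 D4 ?F")
proof -
  have l: "D h (\<lambda>h1 h2. ?F a (h1 * b) (h2 * c) d) = scl H2 (\<epsilon> h) (?F a b c d)" for h a b c d
    using antip_alpha[of H2 "\<lambda>z. pure2 H (S b * z * c) (S a * \<alpha> * d)" h] by (simp add: lins mult.assoc)
  show ?thesis
    unfolding gamma_eq A4_eq_D4 by (rule drop_left23[OF _ _ counital_Phi_inv _ l]) (intro lins)+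
qed

lemma delta_eq_E4: "\<delta> = ev4 E4 (\<lambda>a b c d. pure2 H (a * \<beta> * S d) (b * \<beta> * S c))" (is "_ = ev4 E4 ?F")
proof -
  have r: "D h (\<lambda>h1 h2. ?F a (b * h1) (c * h2) d) = scl H2 (\<epsilon> h) (?F a b c d)" for h a b c d
    using antip_beta[of H2 "\<lambda>z. pure2 H (a * \<beta> * S d) (b * z * S c)" h] by (simp add: lins mult.assoc)
  show ?thesis
    unfolding delta_eq B4_eq_E4 by (rule drop_right23[OF _ _ counital_Phi _ r]) (intro lins)+
qed

lemma gamma_closed [lins]: "\<gamma> \<in> carr H2" and delta_closed [lins]: "\<delta> \<in> carr H2"
  by (simp_all add: gamma_eq delta_eq lins)

lemma ev_gamma:
  assumes U [lins]: "is_space U" and F: "bilin H H U F"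
  shows "ev H H \<gamma> F = ev4 A4 (\<lambda>a b c d. F (S b * \<alpha> * c) (S a * \<alpha> * d))"
    and "ev H H \<gamma> F = ev4 D4 (\<lambda>a b c d. F (S b * \<alpha> * c) (S a * \<alpha> * d))"
  by (subst gamma_eq gamma_eq_D4, simp add: ev_evs[where U=U] F lins ev2_pure[where U=U])+

lemma ev_delta:
  assumes U [lins]: "is_space U" and F: "bilin H H U F"
  shows "ev H H \<delta> F = ev4 B4 (\<lambda>a b c d. F (a * \<beta> * S d) (b * \<beta> * S c))"
    and "ev H H \<delta> F = ev4 E4 (\<lambda>a b c d. F (a * \<beta> * S d) (b * \<beta> * S c))"
  by (subst delta_eq delta_eq_E4, simp add: ev_evs[where U=U] F lins ev2_pure[where U=U])+

section \<open>Moving elements through \<open>p_R\<close>, \<open>q_L\<close>, \<open>q_R\<close>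
  and \<open>p_L\<close>\<close>

lemma ev_pR: "is_space U \<Longrightarrow> bilin H H U F \<Longrightarrow> ev H H (p_R H) F = Q (\<lambda>x1 x2 x3. F x1 (x2 * \<beta> * S x3))"
  and ev_qR: "is_space U \<Longrightarrow> bilin H H U F \<Longrightarrow> ev H H (q_R H) F = P (\<lambda>X1 X2 X3. F X1 (T (\<alpha> * X3) * X2))"
  and ev_pL: "is_space U \<Longrightarrow> bilin H H U F \<Longrightarrow> ev H H (p_L H) F = P (\<lambda>X1 X2 X3. F (X2 * T (X1 * \<beta>)) X3)"
  and ev_qL: "is_space U \<Longrightarrow> bilin H H U F \<Longrightarrow> ev H H (q_L H) F = Q (\<lambda>x1 x2 x3. F (S x1 * \<alpha> * x2) x3)"
  by (simp_all add: p_R_def q_R_def p_L_def q_L_def sw_evs ev_evs[where U=U] lins ev2_pure[where U=U])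

text \<open>Quasi-coassociativity brings two legs of \<open>h\<close> to either side of \<beta>,
  where they contract to a counit. This is the identity \<Delta>(h1) \<open>p_R\<close> (1 \<otimes>
  S(h2)) = \<open>p_R\<close> (h \<otimes> 1); the next three lemmas are its analogues for
  \<open>q_L\<close>, \<open>q_R\<close> and \<open>p_L\<close>.\<close>

lemma pR_move:
  assumes U [lins]: "is_space U" and G: "bilin H H U G"
  shows "Q (\<lambda>x1 x2 x3. D h (\<lambda>h1 h2. D h1 (\<lambda>h11 h12. G (h11 * x1) (h12 * x2 * \<beta> * S x3 * S h2))))
       = Q (\<lambda>x1 x2 x3. G (x1 * h) (x2 * \<beta> * S x3))"
proof -
  note [lins] = lin_bi[OF G]
  have "Q (\<lambda>x1 x2 x3. D h (\<lambda>h1 h2. D h1 (\<lambda>h11 h12. G (h11 * x1) (h12 * x2 * \<beta> * S x3 * S h2))))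
      = Q (\<lambda>x1 x2 x3. D h (\<lambda>h1 h2. D h2 (\<lambda>h21 h22. G (x1 * h1) (x2 * h21 * \<beta> * S (x3 * h22)))))"
    using coassoc_Q[OF U, of "\<lambda>a b c. G a (b * \<beta> * S c)" h] by (simp add: lins mult.assoc)
  also have "\<dots> = Q (\<lambda>x1 x2 x3. D h (\<lambda>h1 h2. scl U (\<epsilon> h2) (G (x1 * h1) (x2 * \<beta> * S x3))))"
    using antip_beta[of U "\<lambda>z. G (_ * _) (_ * z * S _)"] by (simp add: lins mult.assoc)
  also have "\<dots> = Q (\<lambda>x1 x2 x3. G (x1 * h) (x2 * \<beta> * S x3))"
    by (subst counit_D(1)[OF U]) (simp_all add: lins)
  finally show ?thesis .
qed

lemma qL_move:
  assumes U [lins]: "is_space U" and G: "bilin H H U G"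
  shows "Q (\<lambda>x1 x2 x3. D h (\<lambda>h1 h2. D h2 (\<lambda>h21 h22. G (S h1 * S x1 * \<alpha> * x2 * h21) (x3 * h22))))
       = Q (\<lambda>x1 x2 x3. G (S x1 * \<alpha> * x2) (h * x3))"
proof -
  note [lins] = lin_bi[OF G]
  have "Q (\<lambda>x1 x2 x3. D h (\<lambda>h1 h2. D h2 (\<lambda>h21 h22. G (S h1 * S x1 * \<alpha> * x2 * h21) (x3 * h22))))
      = Q (\<lambda>x1 x2 x3. D h (\<lambda>h1 h2. D h1 (\<lambda>h11 h12. G (S (h11 * x1) * \<alpha> * (h12 * x2)) (h2 * x3))))"
    using coassoc_Q[OF U, of "\<lambda>a b c. G (S a * \<alpha> * b) c" h] by (simp add: lins mult.assoc)
  also have "\<dots> = Q (\<lambda>x1 x2 x3. D h (\<lambda>h1 h2. scl U (\<epsilon> h1) (G (S x1 * \<alpha> * x2) (h2 * x3))))"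
    using antip_alpha[of U "\<lambda>z. G (S _ * z * _) (_ * _)"] by (simp add: lins mult.assoc)
  also have "\<dots> = Q (\<lambda>x1 x2 x3. G (S x1 * \<alpha> * x2) (h * x3))"
    by (subst counit_D(2)[OF U]) (simp_all add: lins)
  finally show ?thesis .
qed

lemma qR_move:
  assumes U [lins]: "is_space U" and G: "bilin H H U G"
  shows "P (\<lambda>X1 X2 X3. D h (\<lambda>h1 h2. D h1 (\<lambda>h11 h12. G (X1 * h11) (T h2 * T X3 * T \<alpha> * X2 * h12))))
       = P (\<lambda>X1 X2 X3. G (h * X1) (T X3 * T \<alpha> * X2))"
proof -
  note [lins] = lin_bi[OF G]
  have "P (\<lambda>X1 X2 X3. D h (\<lambda>h1 h2. D h1 (\<lambda>h11 h12. G (X1 * h11) (T h2 * T X3 * T \<alpha> * X2 * h12))))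
      = P (\<lambda>X1 X2 X3. D h (\<lambda>h1 h2. D h2 (\<lambda>h21 h22. G (h1 * X1) (T (\<alpha> * (h22 * X3)) * (h21 * X2)))))"
    using coassoc_P[OF U, of "\<lambda>a b c. G a (T (\<alpha> * c) * b)" h] by (simp add: lins mult.assoc)
  also have "\<dots> = P (\<lambda>X1 X2 X3. D h (\<lambda>h1 h2. scl U (\<epsilon> h2) (G (h1 * X1) (T X3 * T \<alpha> * X2))))"
    using antip_alpha[of U "\<lambda>z. G (_ * _) (T _ * T z * _)"] by (simp add: lins mult.assoc)
  also have "\<dots> = P (\<lambda>X1 X2 X3. G (h * X1) (T X3 * T \<alpha> * X2))"
    by (subst counit_D(1)[OF U]) (simp_all add: lins)
  finally show ?thesis .
qed

lemma pL_move:
  assumes U [lins]: "is_space U" and G: "bilin H H U G"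
  shows "P (\<lambda>X1 X2 X3. D h (\<lambda>h1 h2. D h2 (\<lambda>h21 h22. G (h21 * X2 * T \<beta> * T X1 * T h1) (h22 * X3))))
       = P (\<lambda>X1 X2 X3. G (X2 * T \<beta> * T X1) (X3 * h))"
proof -
  note [lins] = lin_bi[OF G]
  have "P (\<lambda>X1 X2 X3. D h (\<lambda>h1 h2. D h2 (\<lambda>h21 h22. G (h21 * X2 * T \<beta> * T X1 * T h1) (h22 * X3))))
      = P (\<lambda>X1 X2 X3. D h (\<lambda>h1 h2. D h1 (\<lambda>h11 h12. G (X2 * h12 * T (X1 * h11 * \<beta>)) (X3 * h2))))"
    using coassoc_P[OF U, of "\<lambda>a b c. G (b * T (a * \<beta>)) c" h] by (simp add: lins mult.assoc)
  also have "\<dots> = P (\<lambda>X1 X2 X3. D h (\<lambda>h1 h2. scl U (\<epsilon> h1) (G (X2 * T \<beta> * T X1) (X3 * h2))))"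
    using antip_beta[of U "\<lambda>z. G (_ * T z * T _) (_ * _)"] by (simp add: lins mult.assoc)
  also have "\<dots> = P (\<lambda>X1 X2 X3. G (X2 * T \<beta> * T X1) (X3 * h))"
    by (subst counit_D(2)[OF U]) (simp_all add: lins)
  finally show ?thesis .
qed

text \<open>\<open>snake_E\<close> with S\<inverse> applied to the first leg. For \<open>q_L\<close>
  = q1 \<otimes> q2 it says that \<Delta>(q2) \<open>p_L\<close> (S\<inverse>(q1) \<otimes> 1) is
  the unit.\<close>

lemma qL_pL_cancel:
  assumes U [lins]: "is_space U" and G: "bilin H H U G"
  shows "P (\<lambda>X1 X2 X3. Q (\<lambda>x1 x2 x3. D x3 (\<lambda>x31 x32.
           G (x31 * X2 * T \<beta> * T X1 * T x2 * T \<alpha> * x1) (x32 * X3)))) = G 1 1"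
proof -
  note [lins] = lin_bi[OF G]
  show ?thesis
    using snake_E[OF U, of "\<lambda>a b. G (T a) b"] by (simp add: ABDE_ev[where U=U] lins mult.assoc)
qed

text \<open>The left side evaluates (1 \<otimes> \<Phi>)(id \<otimes> \<Delta> \<otimes>
  id)(\<Phi>), a part of the pentagon. Trading it for \<open>B4\<close> and then for
  \<Phi>\<inverse> \<otimes> 1 costs one factor in legs 3, 4 and one in legs 1, 2, both absorbed by
  \<alpha>. The outcome turns a \<open>q_R\<close> into a \<open>q_L\<close>.\<close>

lemma qR_comult:
  assumes U [lins]: "is_space U" and G: "bilin H H U G"
  shows "P (\<lambda>Z1 Z2 Z3. P (\<lambda>X1 X2 X3. D Z2 (\<lambda>Z21 Z22.
           G (S Z1 * \<alpha> * X1 * Z21) (T Z3 * T X3 * T \<alpha> * X2 * Z22))))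
       = Q (\<lambda>x1 x2 x3. G (S x1 * \<alpha> * x2) (T \<alpha> * x3))"
proof -
  note [lins] = lin_bi[OF G]
  let ?F = "\<lambda>a b c d. G (S a * \<alpha> * b) (T (\<alpha> * d) * c)"
  have l: "D h (\<lambda>h1 h2. ?F a b (h1 * c) (h2 * d)) = scl U (\<epsilon> h) (?F a b c d)" for h a b c d
    using antip_alpha[of U "\<lambda>z. G (S a * \<alpha> * b) (T d * T z * c)" h] by (simp add: lins mult.assoc)
  have l': "D h (\<lambda>h1 h2. ?F (h1 * a) (h2 * b) c d) = scl U (\<epsilon> h) (?F a b c d)" for h a b c d
    using antip_alpha[of U "\<lambda>z. G (S a * z * b) (T (\<alpha> * d) * c)" h] by (simp add: lins mult.assoc)
  have "ev4 (one_tensor H (Phi H) \<odot>\<^sub>4 id_comult_id H (Phi H)) ?F = ev4 B4 ?F"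
    unfolding one_tensor_id_comult_id_eq by (rule drop_left34[OF U _ counital_Phi _ l]) (intro lins)+
  also have "\<dots> = ev4 (tensor_one H (Phi_inv H)) ?F"
    unfolding B4_def by (rule drop_left12[OF U _ counital_Phi _ l']) (intro lins)+
  finally show ?thesis
    by (simp add: ev4_leg[where U=U] ev4_mult[where U=U] lins mult.assoc
        swap_ev3_ev3[where F = "\<lambda>X1 X2 X3 Z1 Z2 Z3. D Z2 (\<lambda>Z21 Z22. G (S Z1 * (\<alpha> * (X1 * Z21)))
          (T Z3 * (T X3 * (T \<alpha> * (X2 * Z22)))))"])
qed

end

section \<open>The Drinfeld twist\<close>

context quasi_hopf_algebra
begin

lemma mult2_ev_right:
  assumes [lins]: "s \<in> carr H2"
  shows "t2 \<in> carr H2 \<Longrightarrow> (\<And>a b. F2 a b \<in> carr H2) \<Longrightarrow> s \<odot>\<^sub>2 ev H H t2 F2 = ev H H t2 (\<lambda>a b. s \<odot>\<^sub>2 F2 a b)"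
    and "t3 \<in> carr H3 \<Longrightarrow> (\<And>a b c. F3 a b c \<in> carr H2) \<Longrightarrow> s \<odot>\<^sub>2 ev3 t3 F3 = ev3 t3 (\<lambda>a b c. s \<odot>\<^sub>2 F3 a b c)"
  by (rule lin_ev2_apply[where X=H2 and Y=H2] lin_ev3_apply[where X=H2 and Y=H2], (simp_all add: lins)[4])+

lemma mult2_ev_left:
  assumes [lins]: "s \<in> carr H2"
  shows "t2 \<in> carr H2 \<Longrightarrow> (\<And>a b. F2 a b \<in> carr H2) \<Longrightarrow> ev H H t2 F2 \<odot>\<^sub>2 s = ev H H t2 (\<lambda>a b. F2 a b \<odot>\<^sub>2 s)"
    and "t3 \<in> carr H3 \<Longrightarrow> (\<And>a b c. F3 a b c \<in> carr H2) \<Longrightarrow> ev3 t3 F3 \<odot>\<^sub>2 s = ev3 t3 (\<lambda>a b c. F3 a b c \<odot>\<^sub>2 s)"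
  by (rule lin_ev2_apply[where X=H2 and Y=H2 and f="\<lambda>x. x \<odot>\<^sub>2 s"] lin_ev3_apply[where X=H2 and Y=H2 and f="\<lambda>x. x \<odot>\<^sub>2 s"], (simp_all add: lins)[4])+

lemma D_mult':
  assumes "is_space U" "bilin H H U F"
  shows "D (x * y) F = D y (\<lambda>c d. D x (\<lambda>a b. F (a * c) (b * d)))"
  unfolding D_mult[OF assms] by (rule ev_swap)

text \<open>\<open>(s, a, b)\<close> behaves like an antipode for \<open>\<Delta>\<close>, regarded as a homomorphism into \<open>H \<otimes> H\<close>.
  Any two such triples are conjugate; \<open>transition\<close> is the conjugating element.\<close>

definition antipode_datum :: "('h \<Rightarrow> ('k, 'h, 'h) tensor) \<Rightarrow> ('k, 'h, 'h) tensor \<Rightarrow> ('k, 'h, 'h) tensor \<Rightarrow> bool" where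
  "antipode_datum s a b \<longleftrightarrow> lin H H2 s \<and> a \<in> carr H2 \<and> b \<in> carr H2 \<and>
     (\<forall>x y. s (x * y) = s y \<odot>\<^sub>2 s x) \<and> s 1 = pure2 H 1 1 \<and>
     (\<forall>h. D h (\<lambda>h1 h2. s h1 \<odot>\<^sub>2 (a \<odot>\<^sub>2 \<Delta> h2)) = fun_scl (\<epsilon> h) a) \<and>
     (\<forall>h. D h (\<lambda>h1 h2. \<Delta> h1 \<odot>\<^sub>2 (b \<odot>\<^sub>2 s h2)) = fun_scl (\<epsilon> h) b) \<and>
     P (\<lambda>X1 X2 X3. \<Delta> X1 \<odot>\<^sub>2 (b \<odot>\<^sub>2 (s X2 \<odot>\<^sub>2 (a \<odot>\<^sub>2 \<Delta> X3)))) = pure2 H 1 1 \<and>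
     Q (\<lambda>x1 x2 x3. s x1 \<odot>\<^sub>2 (a \<odot>\<^sub>2 (\<Delta> x2 \<odot>\<^sub>2 (b \<odot>\<^sub>2 s x3)))) = pure2 H 1 1"

definition transition where
  "transition s2 a2 b1 s1 = Q (\<lambda>x1 x2 x3. s2 x1 \<odot>\<^sub>2 (a2 \<odot>\<^sub>2 (\<Delta> x2 \<odot>\<^sub>2 (b1 \<odot>\<^sub>2 s1 x3))))"

lemma antipode_datumD:
  assumes "antipode_datum s a b"
  shows "lin X H f \<Longrightarrow> lin X H2 (\<lambda>x. s (f x))" "s h \<in> carr H2" "a \<in> carr H2" "b \<in> carr H2"
    and "s (x * y) = s y \<odot>\<^sub>2 s x" "s 1 = pure2 H 1 1"
    and "lin H2 U K \<Longrightarrow> D h (\<lambda>h1 h2. K (s h1 \<odot>\<^sub>2 (a \<odot>\<^sub>2 \<Delta> h2))) = scl U (\<epsilon> h) (K a)"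
    and "lin H2 U K \<Longrightarrow> D h (\<lambda>h1 h2. K (\<Delta> h1 \<odot>\<^sub>2 (b \<odot>\<^sub>2 s h2))) = scl U (\<epsilon> h) (K b)"
    and "P (\<lambda>X1 X2 X3. \<Delta> X1 \<odot>\<^sub>2 (b \<odot>\<^sub>2 (s X2 \<odot>\<^sub>2 (a \<odot>\<^sub>2 \<Delta> X3)))) = pure2 H 1 1"
    and "Q (\<lambda>x1 x2 x3. s x1 \<odot>\<^sub>2 (a \<odot>\<^sub>2 (\<Delta> x2 \<odot>\<^sub>2 (b \<odot>\<^sub>2 s x3)))) = pure2 H 1 1"
proof -
  have [lins]: "lin X H f \<Longrightarrow> lin X H2 (\<lambda>x. s (f x))" for X :: "('k, 'z::ab_group_add, 'y) space_scheme" and f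
    using assms by (auto simp: antipode_datum_def elim: lin_comp)
  show "lin X H f \<Longrightarrow> lin X H2 (\<lambda>x. s (f x))" by (intro lins)
  have [lins]: "lin H H2 s" "a \<in> carr H2" "b \<in> carr H2" using assms by (simp_all add: antipode_datum_def)
  have [lins]: "s h \<in> carr H2" for h by (rule lin_closed[OF \<open>lin H H2 s\<close>]) simp
  show "s h \<in> carr H2" "a \<in> carr H2" "b \<in> carr H2" by (intro lins)+
  show "D h (\<lambda>h1 h2. K (s h1 \<odot>\<^sub>2 (a \<odot>\<^sub>2 \<Delta> h2))) = scl U (\<epsilon> h) (K a)" if K: "lin H2 U K"
    using lin_ev2_apply[OF is_space_tensor K comult_closed[of h], of "\<lambda>h1 h2. s h1 \<odot>\<^sub>2 (a \<odot>\<^sub>2 \<Delta> h2)"]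
      lin_scl[OF K \<open>a \<in> carr H2\<close>] assms by (simp add: antipode_datum_def lins)
  show "D h (\<lambda>h1 h2. K (\<Delta> h1 \<odot>\<^sub>2 (b \<odot>\<^sub>2 s h2))) = scl U (\<epsilon> h) (K b)" if K: "lin H2 U K"
    using lin_ev2_apply[OF is_space_tensor K comult_closed[of h], of "\<lambda>h1 h2. \<Delta> h1 \<odot>\<^sub>2 (b \<odot>\<^sub>2 s h2)"]
      lin_scl[OF K \<open>b \<in> carr H2\<close>] assms by (simp add: antipode_datum_def lins)
qed (use assms in \<open>simp_all add: antipode_datum_def\<close>)

context
  fixes s1 a1 b1 s2 a2 b2
  assumes d1: "antipode_datum s1 a1 b1" and d2: "antipode_datum s2 a2 b2"
begin

private lemmas [lins] = antipode_datumD(1)[OF d1] antipode_datumD(2)[OF d1] antipode_datumD(3)[OF d1]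
  antipode_datumD(4)[OF d1] antipode_datumD(1)[OF d2] antipode_datumD(2)[OF d2]
  antipode_datumD(3)[OF d2] antipode_datumD(4)[OF d2]

private abbreviation "F12 \<equiv> transition s2 a2 b1 s1"

lemma transition_closed: "F12 \<in> carr H2"
  by (simp add: transition_def lins)

text \<open>The element \<open>h\<close> enters at the third leg of \<Phi>\<inverse> and leaves at
  the first. It is written as \<epsilon>(h1) h2, and \<open>a2\<close> expands the counit into the
  first two legs; quasi-coassociativity moves all legs to the other side of \<Phi>\<inverse>, where
  \<open>b1\<close> contracts the last two.\<close>

lemma transition_intertwines: "F12 \<odot>\<^sub>2 s1 h = s2 h \<odot>\<^sub>2 F12"
proof -
  let ?T = "\<lambda>a b c. s2 a \<odot>\<^sub>2 (a2 \<odot>\<^sub>2 (\<Delta> b \<odot>\<^sub>2 (b1 \<odot>\<^sub>2 s1 c)))"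
  have al: "D h (\<lambda>u v. ?T (u * a) (v * b) c) = scl H2 (\<epsilon> h) (?T a b c)" for h a b c
    using antipode_datumD(7)[OF d2, of H2 "\<lambda>z. s2 a \<odot>\<^sub>2 (z \<odot>\<^sub>2 (\<Delta> b \<odot>\<^sub>2 (b1 \<odot>\<^sub>2 s1 c)))" h]
    by (simp add: lins mult2_assoc comult_mult antipode_datumD(5)[OF d2])
  have be: "D h (\<lambda>u v. ?T a (b * u) (c * v)) = scl H2 (\<epsilon> h) (?T a b c)" for h a b c
    using antipode_datumD(8)[OF d1, of H2 "\<lambda>z. s2 a \<odot>\<^sub>2 (a2 \<odot>\<^sub>2 (\<Delta> b \<odot>\<^sub>2 (z \<odot>\<^sub>2 s1 c)))" h]
    by (simp add: lins mult2_assoc comult_mult antipode_datumD(5)[OF d1])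
  have "F12 \<odot>\<^sub>2 s1 h = Q (\<lambda>x1 x2 x3. ?T x1 x2 x3 \<odot>\<^sub>2 s1 h)"
    unfolding transition_def
    by (simp add: mult2_ev_left lins)
  also have "\<dots> = Q (\<lambda>x1 x2 x3. ?T x1 x2 (h * x3))"
    by (simp add: mult2_assoc lins antipode_datumD(5)[OF d1])
  also have "\<dots> = Q (\<lambda>x1 x2 x3. D h (\<lambda>h1 h2. scl H2 (\<epsilon> h1) (?T x1 x2 (h2 * x3))))"
    by (subst counit_D(2)[where U=H2]) (simp_all add: lins)
  also have "\<dots> = Q (\<lambda>x1 x2 x3. D h (\<lambda>h1 h2. D h1 (\<lambda>h11 h12. ?T (h11 * x1) (h12 * x2) (h2 * x3))))"
    by (simp only: al)
  also have "\<dots> = Q (\<lambda>x1 x2 x3. D h (\<lambda>h1 h2. D h2 (\<lambda>h21 h22. ?T (x1 * h1) (x2 * h21) (x3 * h22))))"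
    by (rule coassoc_Q[where U=H2, symmetric]) (intro lins)+
  also have "\<dots> = Q (\<lambda>x1 x2 x3. D h (\<lambda>h1 h2. scl H2 (\<epsilon> h2) (?T (x1 * h1) x2 x3)))"
    by (simp only: be)
  also have "\<dots> = Q (\<lambda>x1 x2 x3. ?T (x1 * h) x2 x3)"
    by (subst counit_D(1)[where U=H2]) (simp_all add: lins)
  also have "\<dots> = Q (\<lambda>x1 x2 x3. s2 h \<odot>\<^sub>2 ?T x1 x2 x3)"
    by (simp add: mult2_assoc lins antipode_datumD(5)[OF d2])
  also have "\<dots> = s2 h \<odot>\<^sub>2 F12"
    unfolding transition_def
    by (simp add: mult2_ev_right lins)
  finally show ?thesis .
qed

text \<open>Multiplying by \<open>a1\<close> amounts to adding a trivial fourth leg to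
  \<Phi>\<inverse>. The pentagon exchanges \<Phi>\<inverse> \<otimes> 1 for 1 \<otimes> \<Phi> up to
  three factors, absorbed by \<open>a2\<close>, \<open>b1\<close> and \<open>a1\<close>. Then
  \<open>s2\<close> only sees 1 and the snake identity of the first datum remains.\<close>

lemma transition_alpha: "F12 \<odot>\<^sub>2 a1 = a2"
proof -
  let ?K = "\<lambda>a b c d. s2 a \<odot>\<^sub>2 (a2 \<odot>\<^sub>2 (\<Delta> b \<odot>\<^sub>2 (b1 \<odot>\<^sub>2 (s1 c \<odot>\<^sub>2 (a1 \<odot>\<^sub>2 \<Delta> d)))))"
  have l12: "D h (\<lambda>u v. ?K (u * a) (v * b) c d) = scl H2 (\<epsilon> h) (?K a b c d)" for h a b c d
    using antipode_datumD(7)[OF d2, of H2 "\<lambda>z. s2 a \<odot>\<^sub>2 (z \<odot>\<^sub>2 (\<Delta> b \<odot>\<^sub>2 (b1 \<odot>\<^sub>2 (s1 c \<odot>\<^sub>2 (a1 \<odot>\<^sub>2 \<Delta> d)))))" h]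
    by (simp add: lins mult2_assoc comult_mult antipode_datumD(5)[OF d2])
  have r23: "D h (\<lambda>u v. ?K a (b * u) (c * v) d) = scl H2 (\<epsilon> h) (?K a b c d)" for h a b c d
    using antipode_datumD(8)[OF d1, of H2 "\<lambda>z. s2 a \<odot>\<^sub>2 (a2 \<odot>\<^sub>2 (\<Delta> b \<odot>\<^sub>2 (z \<odot>\<^sub>2 (s1 c \<odot>\<^sub>2 (a1 \<odot>\<^sub>2 \<Delta> d)))))" h]
    by (simp add: lins mult2_assoc comult_mult antipode_datumD(5)[OF d1])
  have l34: "D h (\<lambda>u v. ?K a b (u * c) (v * d)) = scl H2 (\<epsilon> h) (?K a b c d)" for h a b c d
    using antipode_datumD(7)[OF d1, of H2 "\<lambda>z. s2 a \<odot>\<^sub>2 (a2 \<odot>\<^sub>2 (\<Delta> b \<odot>\<^sub>2 (b1 \<odot>\<^sub>2 (s1 c \<odot>\<^sub>2 (z \<odot>\<^sub>2 \<Delta> d)))))" h]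
    by (simp add: lins mult2_assoc comult_mult antipode_datumD(5)[OF d1])
  have "F12 \<odot>\<^sub>2 a1 = Q (\<lambda>x1 x2 x3. s2 x1 \<odot>\<^sub>2 (a2 \<odot>\<^sub>2 (\<Delta> x2 \<odot>\<^sub>2 (b1 \<odot>\<^sub>2 s1 x3))) \<odot>\<^sub>2 a1)"
    unfolding transition_def
    by (simp add: mult2_ev_left lins)
  also have "\<dots> = ev4 (tensor_one H (Phi_inv H)) ?K"
    by (simp add: ev4_leg[where U=H2] lins mult2_assoc comult_one mult2_one)
  also have "\<dots> = ev4 (E4 \<odot>\<^sub>4 id_comult_id H (Phi H)) ?K"
    unfolding tensor_one_Phi_inv_eq by (rule drop_left12[OF _ _ counital_Phi_inv _ l12]) (intro lins)+
  also have "\<dots> = ev4 E4 ?K"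
    by (rule drop_right23[OF _ _ counital_Phi _ r23]) (intro lins)+
  also have "\<dots> = ev4 (one_tensor H (Phi H)) ?K"
    unfolding E4_def by (rule drop_left34[OF _ _ counital_Phi_inv _ l34]) (intro lins)+
  also have "\<dots> = P (\<lambda>X1 X2 X3. a2 \<odot>\<^sub>2 (\<Delta> X1 \<odot>\<^sub>2 (b1 \<odot>\<^sub>2 (s1 X2 \<odot>\<^sub>2 (a1 \<odot>\<^sub>2 \<Delta> X3)))))"
    by (simp add: ev4_leg[where U=H2] lins antipode_datumD(6)[OF d2] mult2_one)
  also have "\<dots> = a2 \<odot>\<^sub>2 P (\<lambda>X1 X2 X3. \<Delta> X1 \<odot>\<^sub>2 (b1 \<odot>\<^sub>2 (s1 X2 \<odot>\<^sub>2 (a1 \<odot>\<^sub>2 \<Delta> X3))))"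
    by (simp add: mult2_ev_right lins)
  also have "\<dots> = a2"
    by (simp add: antipode_datumD(9)[OF d1] mult2_one lins)
  finally show ?thesis .
qed

text \<open>Moving \<open>F12\<close> past \<open>s1\<close> and \<open>a1\<close> turns the
  defining sum of the reverse transition into the snake identity of the second datum.\<close>

lemma transition_inverse: "F12 \<odot>\<^sub>2 transition s1 a1 b2 s2 = pure2 H 1 1"
proof -
  have [lins]: "F12 \<in> carr H2" by (rule transition_closed)
  have "F12 \<odot>\<^sub>2 transition s1 a1 b2 s2
      = Q (\<lambda>x1 x2 x3. F12 \<odot>\<^sub>2 (s1 x1 \<odot>\<^sub>2 (a1 \<odot>\<^sub>2 (\<Delta> x2 \<odot>\<^sub>2 (b2 \<odot>\<^sub>2 s2 x3)))))"
    unfolding transition_def[of s1]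
    by (simp add: mult2_ev_right lins)
  also have "\<dots> = Q (\<lambda>x1 x2 x3. s2 x1 \<odot>\<^sub>2 (F12 \<odot>\<^sub>2 a1 \<odot>\<^sub>2 (\<Delta> x2 \<odot>\<^sub>2 (b2 \<odot>\<^sub>2 s2 x3))))"
    by (simp add: lins transition_intertwines flip: mult2_assoc)
  also have "\<dots> = pure2 H 1 1"
    by (simp add: transition_alpha antipode_datumD(10)[OF d2])
  finally show ?thesis .
qed

end

section \<open>Two antipode data for \<Delta>: the image of (S, \<alpha>, \<beta>), and S \<otimes>
  S on the opposite coproduct\<close>

lemma comult_antip_datum: "antipode_datum (\<lambda>h. \<Delta> (S h)) (\<Delta> \<alpha>) (\<Delta> \<beta>)"
proof -
  have "D h (\<lambda>h1 h2. \<Delta> (S h1) \<odot>\<^sub>2 (\<Delta> \<alpha> \<odot>\<^sub>2 \<Delta> h2)) = fun_scl (\<epsilon> h) (\<Delta> \<alpha>)" for h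
    using antip_alpha[OF lin_H_comult, of h] by (simp add: comult_mult mult2_assoc lins)
  moreover have "D h (\<lambda>h1 h2. \<Delta> h1 \<odot>\<^sub>2 (\<Delta> \<beta> \<odot>\<^sub>2 \<Delta> (S h2))) = fun_scl (\<epsilon> h) (\<Delta> \<beta>)" for h
    using antip_beta[OF lin_H_comult, of h] by (simp add: comult_mult mult2_assoc lins)
  moreover have "P (\<lambda>X1 X2 X3. \<Delta> X1 \<odot>\<^sub>2 (\<Delta> \<beta> \<odot>\<^sub>2 (\<Delta> (S X2) \<odot>\<^sub>2 (\<Delta> \<alpha> \<odot>\<^sub>2 \<Delta> X3)))) = pure2 H 1 1"
    using snake_P[OF lin_H_comult] by (simp add: comult_mult mult2_assoc lins comult_one)
  moreover have "Q (\<lambda>x1 x2 x3. \<Delta> (S x1) \<odot>\<^sub>2 (\<Delta> \<alpha> \<odot>\<^sub>2 (\<Delta> x2 \<odot>\<^sub>2 (\<Delta> \<beta> \<odot>\<^sub>2 \<Delta> (S x3))))) = pure2 H 1 1"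
    using snake_Q[OF lin_H_comult] by (simp add: comult_mult mult2_assoc lins comult_one)
  ultimately show ?thesis
    by (simp add: antipode_datum_def comult_one lins comult_mult)
qed

abbreviation "sbar \<equiv> SS_comult_op H"

lemma sbar_eq: "sbar h = D h (\<lambda>a b. pure2 H (S b) (S a))"
  by (simp add: SS_comult_op_def sw_evs)

lemma lin_sbar [lins]: "lin X H f \<Longrightarrow> lin X H2 (\<lambda>x. sbar (f x))"
  by (simp add: sbar_eq lins)

lemma sbar_closed [lins]: "sbar h \<in> carr H2"
  by (simp add: sbar_eq lins)

lemma ev_sbar: "is_space U \<Longrightarrow> bilin H H U F \<Longrightarrow> ev H H (sbar h) F = D h (\<lambda>a b. F (S b) (S a))"
  by (simp add: sbar_eq ev_evs[where U=U] lins ev2_pure[where U=U])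

lemma sbar_one: "sbar 1 = pure2 H 1 1"
  by (simp add: sbar_eq D_one[where U=H2] lins)

lemma sbar_mult: "sbar (x * y) = sbar y \<odot>\<^sub>2 sbar x"
proof (rule tensor2_eqI)
  fix B assume B: "bilin H H ground B"
  note [lins] = lin_bi[OF B]
  have "ev H H (sbar (x * y)) B = D x (\<lambda>a b. D y (\<lambda>c d. B (S d * S b) (S c * S a)))"
    by (simp add: ev_sbar[where U=ground] B D_mult[where U=ground] lins)
  also have "\<dots> = D y (\<lambda>c d. D x (\<lambda>a b. B (S d * S b) (S c * S a)))" by (rule ev_swap)
  also have "\<dots> = ev H H (sbar y \<odot>\<^sub>2 sbar x) B"
    by (simp add: ev_sbar[where U=ground] ev2_mult[where U=ground] B lins)
  finally show "ev H H (sbar (x * y)) B = ev H H (sbar y \<odot>\<^sub>2 sbar x) B" .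
qed (intro lins)+

text \<open>\<gamma> joins legs 2, 3 and legs 1, 4 of \<open>A4\<close> through \<alpha>. The inner
  pair is contracted first; what is left of \<open>h\<close> then surrounds the outer pair and
  contracts as well.\<close>

lemma sbar_gamma: "D h (\<lambda>h1 h2. sbar h1 \<odot>\<^sub>2 (\<gamma> \<odot>\<^sub>2 \<Delta> h2)) = fun_scl (\<epsilon> h) \<gamma>"
proof (rule tensor2_eqI)
  fix B assume B: "bilin H H ground B"
  note [lins] = lin_bi[OF B] lin_mult_ground1 lin_mult_ground2
  let ?K = "\<lambda>a b c d. B (S b * \<alpha> * c) (S a * \<alpha> * d)"
  let ?T = "\<lambda>u v w. P (\<lambda>X1 X2 X3. D u (\<lambda>u1 u2. ?K (X1 * u1) (X2 * u2) (X3 * v) w))"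
  have g: "ev H H \<gamma> B = Q ?T"
    by (simp add: ev_gamma(1)[where U=ground] B ABDE_ev[where U=ground] lins
        swap_ev3_ev3[of "Phi_inv H" "Phi H"])
  have e: "ev H H (sbar h1 \<odot>\<^sub>2 (\<gamma> \<odot>\<^sub>2 \<Delta> h2)) B
      = D h2 (\<lambda>c d. D h1 (\<lambda>u v. P (\<lambda>X1 X2 X3. Q (\<lambda>x1 x2 x3. D x1 (\<lambda>x11 x12.
          ?K (X1 * (x11 * u)) (X2 * (x12 * v)) (X3 * (x2 * c)) (x3 * d))))))" for h1 h2
  proof -
    have "ev H H (sbar h1 \<odot>\<^sub>2 (\<gamma> \<odot>\<^sub>2 \<Delta> h2)) B
        = D h1 (\<lambda>u v. D h2 (\<lambda>c d. ev H H \<gamma> (\<lambda>g g'. B (S v * g * c) (S u * g' * d))))"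
      by (simp add: ev2_mult[where U=ground] ev_sbar[where U=ground] B lins mult.assoc ev_swap[of H H \<gamma>])
    also have "\<dots> = D h2 (\<lambda>c d. D h1 (\<lambda>u v. ev H H \<gamma> (\<lambda>g g'. B (S v * g * c) (S u * g' * d))))"
      by (rule ev_swap)
    finally show ?thesis
      by (simp add: ev_gamma(1)[where U=ground] ABDE_ev[where U=ground] lins mult.assoc)
  qed
  have "ev H H (D h (\<lambda>h1 h2. sbar h1 \<odot>\<^sub>2 (\<gamma> \<odot>\<^sub>2 \<Delta> h2))) B
      = Q (\<lambda>x1 x2 x3. D h (\<lambda>h1 h2. D h2 (\<lambda>h21 h22. ?T (x1 * h1) (x2 * h21) (x3 * h22))))"
    by (simp add: ev_evs[where U=ground] B e D_mult'[where U=ground] lins swap_ev3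
        swap_ev3_ev3[of "Phi_inv H" "Phi H"])
  also have "\<dots> = Q (\<lambda>x1 x2 x3. D h (\<lambda>h1 h2. D h1 (\<lambda>h11 h12. ?T (h11 * x1) (h12 * x2) (h2 * x3))))"
    by (rule coassoc_Q[where U=ground]) (intro lins)+
  also have "\<dots> = Q (\<lambda>x1 x2 x3. \<epsilon> h * ?T x1 x2 x3)"
  proof -
    \<comment> \<open>Contraction of the inner pair: passing \<open>h1\<close> through \<Phi>
      spreads it over legs 1, 2, 3, and the parts in legs 2 and 3 collapse to a counit.\<close>
    have *: "D h1 (\<lambda>h11 h12. ?T (h11 * x1) (h12 * x2) c) = P (\<lambda>X1 X2 X3. D x1 (\<lambda>x11 x12.
        ?K (h1 * (X1 * x11)) (X2 * x12) (X3 * x2) c))" for h1 x1 x2 c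
    proof -
      let ?F = "\<lambda>a b d. D x1 (\<lambda>x11 x12. ?K (a * x11) (b * x12) (d * x2) c)"
      have "D h1 (\<lambda>h11 h12. ?T (h11 * x1) (h12 * x2) c)
          = P (\<lambda>X1 X2 X3. D h1 (\<lambda>h11 h12. D h11 (\<lambda>u v. ?F (X1 * u) (X2 * v) (X3 * h12))))"
        by (simp add: D_mult[where U=ground] lins mult.assoc swap_ev3)
      also have "\<dots> = P (\<lambda>X1 X2 X3. D h1 (\<lambda>h11 h12. D h12 (\<lambda>u v. ?F (h11 * X1) (u * X2) (v * X3))))"
        by (rule coassoc_P[where U=ground, symmetric]) (intro lins)+
      also have "\<dots> = P (\<lambda>X1 X2 X3. D h1 (\<lambda>h11 h12. D x1 (\<lambda>x11 x12. D h12 (\<lambda>u v.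
          ?K (h11 * X1 * x11) (u * X2 * x12) (v * X3 * x2) c))))"
        by (subst ev_swap) (rule refl)
      also have "\<dots> = P (\<lambda>X1 X2 X3. D h1 (\<lambda>h11 h12. scl ground (\<epsilon> h12) (?F (h11 * X1) X2 X3)))"
      proof -
        have "D k (\<lambda>u v. B (S (u * X2 * x12) * \<alpha> * (v * X3 * x2)) y) = \<epsilon> k * B (S (X2 * x12) * \<alpha> * (X3 * x2)) y" for k y X2 X3 x12
          using antip_alpha[of ground "\<lambda>z. B (S (X2 * x12) * z * (X3 * x2)) y" k]
          by (simp add: lins mult.assoc)
        then show ?thesis by (simp add: mult_ev lins mult.assoc)
      qed
      also have "\<dots> = P (\<lambda>X1 X2 X3. ?F (h1 * X1) X2 X3)"
        by (subst counit_D(1)[where U=ground]) (simp_all add: lins)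
      finally show ?thesis by (simp add: mult.assoc)
    qed
    have **: "D h (\<lambda>h1 h2. B y (S (h1 * (a * b)) * \<alpha> * (h2 * d))) = \<epsilon> h * B y (S (a * b) * \<alpha> * d)" for a b d y
      using antip_alpha[of ground "\<lambda>z. B y (S (a * b) * z * d)" h] by (simp add: lins mult.assoc)
    show ?thesis
      using ** by (simp only: *) (simp add: swap_ev3 ev_swap[of H H "\<Delta> h"] mult_ev3 mult_ev lins mult.assoc)
  qed
  also have "\<dots> = ev H H (fun_scl (\<epsilon> h) \<gamma>) B"
    by (simp add: ev2_scl[where U=ground] B lins g mult_ev3)
  finally show "ev H H (D h (\<lambda>h1 h2. sbar h1 \<odot>\<^sub>2 (\<gamma> \<odot>\<^sub>2 \<Delta> h2))) B = ev H H (fun_scl (\<epsilon> h) \<gamma>) B" .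
qed (intro lins)+

text \<open>Mirror image of \<open>sbar_gamma\<close>, with \<beta> for \<alpha>, \<open>B4\<close>
  for \<open>A4\<close> and the factors in the opposite order.\<close>

lemma sbar_delta: "D h (\<lambda>h1 h2. \<Delta> h1 \<odot>\<^sub>2 (\<delta> \<odot>\<^sub>2 sbar h2)) = fun_scl (\<epsilon> h) \<delta>"
proof (rule tensor2_eqI)
  fix B assume B: "bilin H H ground B"
  note [lins] = lin_bi[OF B] lin_mult_ground1 lin_mult_ground2
  let ?K = "\<lambda>a b c d. B (a * \<beta> * S d) (b * \<beta> * S c)"
  let ?T = "\<lambda>u v w. Q (\<lambda>x1 x2 x3. D u (\<lambda>u1 u2. ?K (u1 * x1) (u2 * x2) (v * x3) w))"
  have g: "ev H H \<delta> B = P ?T"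
    by (simp add: ev_delta(1)[where U=ground] B ABDE_ev[where U=ground] lins)
  have e: "ev H H (\<Delta> h1 \<odot>\<^sub>2 (\<delta> \<odot>\<^sub>2 sbar h2)) B
      = D h2 (\<lambda>c d. D h1 (\<lambda>u v. P (\<lambda>X1 X2 X3. Q (\<lambda>x1 x2 x3. D X1 (\<lambda>X11 X12.
          ?K (u * (X11 * x1)) (v * (X12 * x2)) (c * (X2 * x3)) (d * X3))))))" for h1 h2
  proof -
    have "ev H H (\<Delta> h1 \<odot>\<^sub>2 (\<delta> \<odot>\<^sub>2 sbar h2)) B
        = D h1 (\<lambda>u v. D h2 (\<lambda>c d. ev H H \<delta> (\<lambda>g g'. B (u * g * S d) (v * g' * S c))))"
      by (simp add: ev2_mult[where U=ground] ev_sbar[where U=ground] B lins mult.assoc ev_swap[of H H \<delta>])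
    also have "\<dots> = D h2 (\<lambda>c d. D h1 (\<lambda>u v. ev H H \<delta> (\<lambda>g g'. B (u * g * S d) (v * g' * S c))))"
      by (rule ev_swap)
    finally show ?thesis
      by (simp add: ev_delta(1)[where U=ground] ABDE_ev[where U=ground] lins mult.assoc)
  qed
  have "ev H H (D h (\<lambda>h1 h2. \<Delta> h1 \<odot>\<^sub>2 (\<delta> \<odot>\<^sub>2 sbar h2))) B
      = P (\<lambda>X1 X2 X3. D h (\<lambda>h1 h2. D h2 (\<lambda>h21 h22. ?T (h1 * X1) (h21 * X2) (h22 * X3))))"
    by (simp add: ev_evs[where U=ground] B e D_mult[where U=ground] lins swap_ev3 mult.assoc
        swap_ev3_ev3[of "Phi_inv H" "Phi H"])
  also have "\<dots> = P (\<lambda>X1 X2 X3. D h (\<lambda>h1 h2. D h1 (\<lambda>h11 h12. ?T (X1 * h11) (X2 * h12) (X3 * h2))))"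
    by (rule coassoc_P[where U=ground]) (intro lins)+
  also have "\<dots> = P (\<lambda>X1 X2 X3. \<epsilon> h * ?T X1 X2 X3)"
  proof -
    have *: "D h1 (\<lambda>h11 h12. ?T (X1 * h11) (X2 * h12) c) = Q (\<lambda>x1 x2 x3. D X1 (\<lambda>X11 X12.
        ?K (X11 * x1 * h1) (X12 * x2) (X2 * x3) c))" for h1 X1 X2 c
    proof -
      let ?F = "\<lambda>a b d. D X1 (\<lambda>X11 X12. ?K (X11 * a) (X12 * b) (X2 * d) c)"
      have "D h1 (\<lambda>h11 h12. ?T (X1 * h11) (X2 * h12) c)
          = Q (\<lambda>x1 x2 x3. D h1 (\<lambda>h11 h12. D h11 (\<lambda>u v. ?F (u * x1) (v * x2) (h12 * x3))))"
        by (simp add: D_mult'[where U=ground] lins mult.assoc swap_ev3)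
      also have "\<dots> = Q (\<lambda>x1 x2 x3. D h1 (\<lambda>h11 h12. D h12 (\<lambda>u v. ?F (x1 * h11) (x2 * u) (x3 * v))))"
        by (rule coassoc_Q[where U=ground, symmetric]) (intro lins)+
      also have "\<dots> = Q (\<lambda>x1 x2 x3. D h1 (\<lambda>h11 h12. D X1 (\<lambda>X11 X12. D h12 (\<lambda>u v.
          ?K (X11 * (x1 * h11)) (X12 * (x2 * u)) (X2 * (x3 * v)) c))))"
        by (subst ev_swap) (rule refl)
      also have "\<dots> = Q (\<lambda>x1 x2 x3. D h1 (\<lambda>h11 h12. scl ground (\<epsilon> h12) (?F (x1 * h11) x2 x3)))"
      proof -
        have "D k (\<lambda>u v. B y (X12 * (x2 * u) * \<beta> * S (X2 * (x3 * v)))) = \<epsilon> k * B y (X12 * x2 * \<beta> * S (X2 * x3))" for k y X2 X12 x2 x3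
          using antip_beta[of ground "\<lambda>z. B y (X12 * x2 * z * S (X2 * x3))" k]
          by (simp add: lins mult.assoc)
        then show ?thesis by (simp add: mult_ev lins mult.assoc)
      qed
      also have "\<dots> = Q (\<lambda>x1 x2 x3. ?F (x1 * h1) x2 x3)"
        by (subst counit_D(1)[where U=ground]) (simp_all add: lins)
      finally show ?thesis by (simp add: mult.assoc)
    qed
    have **: "D h (\<lambda>h1 h2. B (a * b * h1 * \<beta> * S (d * h2)) y) = \<epsilon> h * B (a * b * \<beta> * S d) y" for a b d y
      using antip_beta[of ground "\<lambda>z. B (a * b * z * S d) y" h] by (simp add: lins mult.assoc)
    show ?thesis
      using ** by (simp only: *) (simp add: swap_ev3 ev_swap[of H H "\<Delta> h"] mult_ev3 mult_ev lins mult.assoc)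
  qed
  also have "\<dots> = ev H H (fun_scl (\<epsilon> h) \<delta>) B"
    by (simp add: ev2_scl[where U=ground] B lins g mult_ev3)
  finally show "ev H H (D h (\<lambda>h1 h2. \<Delta> h1 \<odot>\<^sub>2 (\<delta> \<odot>\<^sub>2 sbar h2))) B = ev H H (fun_scl (\<epsilon> h) \<delta>) B" .
qed (intro lins)+

lemma ev_eqI: "(\<And>a b. F a b = G a b) \<Longrightarrow> ev V W t F = ev V W t G"
  and ev3_eqI: "(\<And>a b c. F' a b c = G' a b c) \<Longrightarrow> ev3 u F' = ev3 u G'"
  by presburger+

lemmas outer = swap_ev3 swap_ev3_ev3[of "Phi_inv H" "Phi H"]

text \<open>With \<delta> expanded by \<open>B4\<close> and \<gamma> by \<open>D4\<close>, the
  copies of \<Phi> form the left side of the pentagon. After its use the surplus legs are absorbed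
  by a \<open>p_R\<close> and a \<open>q_L\<close> contained in the two expansions, which leaves
  \<open>snake_D\<close> inside \<open>snake_B\<close>.\<close>

lemma delta_gamma:
  "P (\<lambda>X1 X2 X3. \<Delta> X1 \<odot>\<^sub>2 (\<delta> \<odot>\<^sub>2 (sbar X2 \<odot>\<^sub>2 (\<gamma> \<odot>\<^sub>2 \<Delta> X3)))) = pure2 H 1 1"
proof (rule tensor2_eqI)
  fix B assume B: "bilin H H ground B"
  note [lins] = lin_bi[OF B]
  note e = ev_evs[where U=ground] ev2_mult[where U=ground] ev_sbar[where U=ground] D_mult[where U=ground]
    ev_gamma(2)[where U=ground] ev_delta(1)[where U=ground] ABDE_ev[where U=ground] mult.assoc lins B
  let ?B = "\<lambda>y1 y2 y3 w1 w2 w3 b c a1 a2 d1 d2. B (a1 * y1 * \<beta> * S c * (S w1 * \<alpha> * w2) * d1)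
    (a2 * y2 * \<beta> * S y3 * S b * \<alpha> * w3 * d2)"
  let ?F = "\<lambda>a b c d. Q (\<lambda>w1 w2 w3. Q (\<lambda>y1 y2 y3. D a (\<lambda>a1 a2. D d (\<lambda>d1 d2. ?B y1 y2 y3 w1 w2 w3 b c a1 a2 d1 d2))))"
  have "ev H H (P (\<lambda>X1 X2 X3. \<Delta> X1 \<odot>\<^sub>2 (\<delta> \<odot>\<^sub>2 (sbar X2 \<odot>\<^sub>2 (\<gamma> \<odot>\<^sub>2 \<Delta> X3))))) B
      = P (\<lambda>X1 X2 X3. P (\<lambda>W1 W2 W3. P (\<lambda>Z1 Z2 Z3. Q (\<lambda>w1 w2 w3. Q (\<lambda>y1 y2 y3. D (X1 * Z1) (\<lambda>a1 a2. D X2 (\<lambda>X21 X22.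
          D (W3 * X3) (\<lambda>d1 d2. ?B y1 y2 y3 w1 w2 w3 (W1 * X21 * Z2) (W2 * X22 * Z3) a1 a2 d1 d2))))))))"
    by (simp add: e outer)
  also have "\<dots> = P (\<lambda>X1 X2 X3. P (\<lambda>W1 W2 W3. P (\<lambda>Z1 Z2 Z3. Q (\<lambda>w1 w2 w3. Q (\<lambda>y1 y2 y3. D X2 (\<lambda>X21 X22. D (X1 * Z1) (\<lambda>a1 a2.
          D (W3 * X3) (\<lambda>d1 d2. ?B y1 y2 y3 w1 w2 w3 (W1 * X21 * Z2) (W2 * X22 * Z3) a1 a2 d1 d2))))))))"
    by ((rule ev3_eqI)+, rule ev_swap)
  also have "\<dots> = P (\<lambda>W1 W2 W3. P (\<lambda>X1 X2 X3. P (\<lambda>Z1 Z2 Z3. D X2 (\<lambda>X21 X22.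
          ?F (X1 * Z1) (W1 * X21 * Z2) (W2 * X22 * Z3) (W3 * X3)))))"
    unfolding swap_ev3 by (rule swap_ev3_ev3)
  also have "\<dots> = P (\<lambda>X1 X2 X3. P (\<lambda>Y1 Y2 Y3. D X3 (\<lambda>X31 X32. D Y1 (\<lambda>Y11 Y12.
           ?F (X1 * Y11) (X2 * Y12) (X31 * Y2) (X32 * Y3)))))"
    by (rule pentagon_ev[where U=ground]) (intro lins)+
  also have "\<dots> = P (\<lambda>X1 X2 X3. P (\<lambda>Y1 Y2 Y3. Q (\<lambda>w1 w2 w3. D X3 (\<lambda>X31 X32.
      Q (\<lambda>y1 y2 y3. D Y1 (\<lambda>Y11 Y12. D X1 (\<lambda>a1 a2. D Y11 (\<lambda>Y111 Y112. D (X32 * Y3) (\<lambda>d1 d2.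
        B (a1 * (Y111 * y1) * \<beta> * S (X31 * Y2) * (S w1 * \<alpha> * w2) * d1)
          (a2 * (Y112 * y2 * \<beta> * S y3 * S Y12) * S X2 * \<alpha> * w3 * d2))))))))))"
    by (simp add: lins mult.assoc outer D_mult[where U=ground])
  also have "\<dots> = P (\<lambda>X1 X2 X3. P (\<lambda>Y1 Y2 Y3. Q (\<lambda>w1 w2 w3. D X3 (\<lambda>X31 X32.
      Q (\<lambda>y1 y2 y3. D Y1 (\<lambda>Y11 Y12. D Y11 (\<lambda>Y111 Y112.
      (\<lambda>u v. D X1 (\<lambda>a1 a2. D (X32 * Y3) (\<lambda>d1 d2. B (a1 * u * \<beta> * S (X31 * Y2) * (S w1 * \<alpha> * w2) * d1) (a2 * v * S X2 * \<alpha> * w3 * d2))))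
        (Y111 * y1) (Y112 * y2 * \<beta> * S y3 * S Y12))))))))"
    by (intro ev3_eqI ev_eqI) (rule ev_swap)
  \<comment> \<open>The sum over \<open>y1\<close>, \<open>y2\<close>, \<open>y3\<close> with its
    \<beta> is a copy of \<open>p_R\<close>; the legs of \<open>Y1\<close> around it
    collapse.\<close>
  also have "\<dots> = P (\<lambda>X1 X2 X3. P (\<lambda>Y1 Y2 Y3. Q (\<lambda>w1 w2 w3. D X3 (\<lambda>X31 X32.
      Q (\<lambda>y1 y2 y3. D X1 (\<lambda>a1 a2. D (X32 * Y3) (\<lambda>d1 d2.
        B (a1 * (y1 * Y1) * \<beta> * S (X31 * Y2) * (S w1 * \<alpha> * w2) * d1) (a2 * (y2 * \<beta> * S y3) * S X2 * \<alpha> * w3 * d2))))))))"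
  proof (rule ev3_eqI, rule ev3_eqI, rule ev3_eqI, rule ev_eqI, goal_cases)
    case (1 X1 X2 X3 Y1 Y2 Y3 w1 w2 w3 X31 X32)
    show ?case
      by (rule pR_move[where U=ground and G="\<lambda>u v. D X1 (\<lambda>a1 a2. D (X32 * Y3) (\<lambda>d1 d2.
          B (a1 * u * \<beta> * S (X31 * Y2) * (S w1 * \<alpha> * w2) * d1) (a2 * v * S X2 * \<alpha> * w3 * d2)))"]) (intro lins)+
  qed
  also have "\<dots> = P (\<lambda>X1 X2 X3. P (\<lambda>Y1 Y2 Y3. Q (\<lambda>w1 w2 w3. D X3 (\<lambda>X31 X32.
      Q (\<lambda>y1 y2 y3. D (X32 * Y3) (\<lambda>d1 d2. D X1 (\<lambda>a1 a2.
        B (a1 * (y1 * Y1) * \<beta> * S (X31 * Y2) * (S w1 * \<alpha> * w2) * d1) (a2 * (y2 * \<beta> * S y3) * S X2 * \<alpha> * w3 * d2))))))))"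
    by (intro ev3_eqI ev_eqI) (rule ev_swap)
  also have "\<dots> = P (\<lambda>X1 X2 X3. P (\<lambda>Y1 Y2 Y3. Q (\<lambda>y1 y2 y3. Q (\<lambda>w1 w2 w3. D X3 (\<lambda>X31 X32. D X32 (\<lambda>h21 h22.
      (\<lambda>u v. D Y3 (\<lambda>d1 d2. D X1 (\<lambda>a1 a2. B (a1 * y1 * Y1 * \<beta> * S Y2 * u * d1) (a2 * y2 * \<beta> * S y3 * S X2 * \<alpha> * v * d2))))
        (S X31 * S w1 * \<alpha> * w2 * h21) (w3 * h22)))))))"
    unfolding swap_ev3 by (rule ev3_eqI, rule ev3_eqI, rule trans[OF swap_ev3_ev3])
      (simp add: lins mult.assoc D_mult[where U=ground])
  \<comment> \<open>Likewise the sum over \<open>w1\<close>, \<open>w2\<close>, \<open>w3\<close>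
    with its \<alpha> is a copy of \<open>q_L\<close>, around which the legs of \<open>X3\<close>
    collapse.\<close>
  also have "\<dots> = P (\<lambda>X1 X2 X3. P (\<lambda>Y1 Y2 Y3. Q (\<lambda>y1 y2 y3. Q (\<lambda>w1 w2 w3.
      D Y3 (\<lambda>d1 d2. D X1 (\<lambda>a1 a2. B (a1 * y1 * Y1 * \<beta> * S Y2 * (S w1 * \<alpha> * w2) * d1)
        (a2 * y2 * \<beta> * S y3 * S X2 * \<alpha> * (X3 * w3) * d2)))))))"
  proof (rule ev3_eqI, rule ev3_eqI, rule ev3_eqI, goal_cases)
    case (1 X1 X2 X3 Y1 Y2 Y3 y1 y2 y3)
    show ?case
      by (rule qL_move[where U=ground and G="\<lambda>u v. D Y3 (\<lambda>d1 d2. D X1 (\<lambda>a1 a2.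
          B (a1 * y1 * Y1 * \<beta> * S Y2 * u * d1) (a2 * y2 * \<beta> * S y3 * S X2 * \<alpha> * v * d2)))"]) (intro lins)+
  qed
  also have "\<dots> = P (\<lambda>X1 X2 X3. Q (\<lambda>y1 y2 y3. ev4 D4 (\<lambda>a b c d.
      D X1 (\<lambda>a1 a2. B (a1 * y1 * (a * \<beta> * S b * \<alpha> * c)) (a2 * y2 * \<beta> * S y3 * S X2 * \<alpha> * X3 * d)))))"
    by (simp add: e outer)
  also have "\<dots> = P (\<lambda>X1 X2 X3. Q (\<lambda>y1 y2 y3. D X1 (\<lambda>a1 a2. B (a1 * y1 * 1) (a2 * y2 * \<beta> * S y3 * S X2 * \<alpha> * X3 * 1))))"
  proof (rule ev3_eqI, rule ev3_eqI, goal_cases)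
    case (1 X1 X2 X3 y1 y2 y3)
    show ?case
      by (rule snake_D[where U=ground and G="\<lambda>u v. D X1 (\<lambda>a1 a2. B (a1 * y1 * u) (a2 * y2 * \<beta> * S y3 * S X2 * \<alpha> * X3 * v))"])
        (intro lins)+
  qed
  also have "\<dots> = ev4 B4 (\<lambda>a b c d. B a (b * \<beta> * S c * \<alpha> * d))"
    by (simp add: e)
  also have "\<dots> = ev H H (pure2 H 1 1) B"
    by (simp add: snake_B[where U=ground] B ev2_pure[where U=ground])
  finally show "ev H H (P (\<lambda>X1 X2 X3. \<Delta> X1 \<odot>\<^sub>2 (\<delta> \<odot>\<^sub>2 (sbar X2 \<odot>\<^sub>2 (\<gamma> \<odot>\<^sub>2 \<Delta> X3))))) B
      = ev H H (pure2 H 1 1) B" .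
qed (intro lins)+

lemma pentagon_inv_ev:
  assumes U [lins]: "is_space U" and F: "quadlin U F"
  shows "Q (\<lambda>x1 x2 x3. Q (\<lambda>y1 y2 y3. Q (\<lambda>z1 z2 z3. D y2 (\<lambda>y21 y22.
           F (x1 * y1) (x2 * y21 * z1) (x3 * y22 * z2) (y3 * z3)))))
       = Q (\<lambda>x1 x2 x3. Q (\<lambda>y1 y2 y3. D y3 (\<lambda>y31 y32. D x1 (\<lambda>x11 x12.
           F (x11 * y1) (x12 * y2) (x2 * y31) (x3 * y32)))))"
proof -
  note [lins] = lin_quad[OF F]
  from arg_cong[OF pentagon_inv, of "\<lambda>t. ev4 t F"]
  have "Q (\<lambda>x1 x2 x3. Q (\<lambda>y1 y2 y3. Q (\<lambda>z1 z2 z3. D y2 (\<lambda>y21 y22.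
           F (x1 * y1) (x2 * y21 * z1) (x3 * y22 * z2) (y3 * z3)))))
       = Q (\<lambda>x1 x2 x3. Q (\<lambda>y1 y2 y3. D x1 (\<lambda>x11 x12. D y3 (\<lambda>y31 y32.
           F (x11 * y1) (x12 * y2) (x2 * y31) (x3 * y32)))))"
    by (simp add: ev4_mult[where U=U] ev4_leg[where U=U] F lins swap_ev3 mult.assoc)
  also have "\<dots> = Q (\<lambda>x1 x2 x3. Q (\<lambda>y1 y2 y3. D y3 (\<lambda>y31 y32. D x1 (\<lambda>x11 x12.
           F (x11 * y1) (x12 * y2) (x2 * y31) (x3 * y32)))))"
    by (intro ev3_eqI) (rule ev_swap)
  finally show ?thesis .
qed

text \<open>Counterpart of \<open>delta_gamma\<close> for \<Phi>\<inverse>. Here \<gamma> is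
  expanded by \<open>A4\<close> and \<delta> by \<open>E4\<close>, the inverse pentagon regroups the
  copies of \<Phi>\<inverse>, and after one contraction at \<alpha> and one at \<beta>
  \<open>snake_A\<close> sits inside \<open>snake_E\<close>.\<close>

lemma gamma_delta:
  "Q (\<lambda>x1 x2 x3. sbar x1 \<odot>\<^sub>2 (\<gamma> \<odot>\<^sub>2 (\<Delta> x2 \<odot>\<^sub>2 (\<delta> \<odot>\<^sub>2 sbar x3)))) = pure2 H 1 1"
proof (rule tensor2_eqI)
  fix B assume B: "bilin H H ground B"
  note [lins] = lin_bi[OF B]
  note e = ev_evs[where U=ground] ev2_mult[where U=ground] ev_sbar[where U=ground]
    ev_gamma(1)[where U=ground] ev_delta(2)[where U=ground] ABDE_ev[where U=ground] mult.assoc lins B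
  let ?B = "\<lambda>X1 X2 X3 Y1 Y2 Y3 b c a1 a2 d1 d2. B (S a2 * (S Y2 * \<alpha> * Y3) * b * (\<beta> * S X3) * S d2)
    (S a1 * (S Y1 * \<alpha>) * c * (X1 * \<beta> * S X2) * S d1)"
  let ?F = "\<lambda>a b c d. P (\<lambda>X1 X2 X3. P (\<lambda>Y1 Y2 Y3. D a (\<lambda>a1 a2. D d (\<lambda>d1 d2. ?B X1 X2 X3 Y1 Y2 Y3 b c a1 a2 d1 d2))))"
  have "ev H H (Q (\<lambda>x1 x2 x3. sbar x1 \<odot>\<^sub>2 (\<gamma> \<odot>\<^sub>2 (\<Delta> x2 \<odot>\<^sub>2 (\<delta> \<odot>\<^sub>2 sbar x3))))) B
      = P (\<lambda>X1 X2 X3. P (\<lambda>Y1 Y2 Y3. Q (\<lambda>x1 x2 x3. Q (\<lambda>z1 z2 z3. Q (\<lambda>y1 y2 y3. D (y1 * x1) (\<lambda>a1 a2. D x2 (\<lambda>x21 x22.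
          D (x3 * z3) (\<lambda>d1 d2. ?B X1 X2 X3 Y1 Y2 Y3 (y2 * x21 * z1) (y3 * x22 * z2) a1 a2 d1 d2))))))))"
    by (simp add: e outer D_mult'[where U=ground])
  also have "\<dots> = P (\<lambda>X1 X2 X3. P (\<lambda>Y1 Y2 Y3. Q (\<lambda>y1 y2 y3. Q (\<lambda>x1 x2 x3. Q (\<lambda>z1 z2 z3. D (y1 * x1) (\<lambda>a1 a2. D x2 (\<lambda>x21 x22.
          D (x3 * z3) (\<lambda>d1 d2. ?B X1 X2 X3 Y1 Y2 Y3 (y2 * x21 * z1) (y3 * x22 * z2) a1 a2 d1 d2))))))))"
    by (rule ev3_eqI, rule ev3_eqI, rule trans[OF _ swap_ev3_ev3], rule ev3_eqI, rule swap_ev3_ev3)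
  also have "\<dots> = P (\<lambda>X1 X2 X3. P (\<lambda>Y1 Y2 Y3. Q (\<lambda>y1 y2 y3. Q (\<lambda>x1 x2 x3. Q (\<lambda>z1 z2 z3. D x2 (\<lambda>x21 x22. D (y1 * x1) (\<lambda>a1 a2.
          D (x3 * z3) (\<lambda>d1 d2. ?B X1 X2 X3 Y1 Y2 Y3 (y2 * x21 * z1) (y3 * x22 * z2) a1 a2 d1 d2))))))))"
    by ((rule ev3_eqI)+, rule ev_swap)
  also have "\<dots> = Q (\<lambda>y1 y2 y3. Q (\<lambda>x1 x2 x3. Q (\<lambda>z1 z2 z3. D x2 (\<lambda>x21 x22.
           ?F (y1 * x1) (y2 * x21 * z1) (y3 * x22 * z2) (x3 * z3)))))"
    by (simp only: outer)
  also have "\<dots> = Q (\<lambda>x1 x2 x3. Q (\<lambda>y1 y2 y3. D y3 (\<lambda>y31 y32. D x1 (\<lambda>x11 x12.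
           ?F (x11 * y1) (x12 * y2) (x2 * y31) (x3 * y32)))))"
    by (rule pentagon_inv_ev[where U=ground]) (intro lins)+
  also have "\<dots> = P (\<lambda>X1 X2 X3. Q (\<lambda>x1 x2 x3. Q (\<lambda>y1 y2 y3. D y3 (\<lambda>y31 y32. P (\<lambda>Y1 Y2 Y3.
      D x1 (\<lambda>x11 x12. D x11 (\<lambda>p q. (\<lambda>u v w. D y1 (\<lambda>r1 r2. D (x3 * y32) (\<lambda>d1 d2.
        ?B X1 X2 X3 u v w y2 (x2 * y31) r1 r2 d1 d2))) (Y1 * p) (Y2 * q) (Y3 * x12))))))))"
    by (simp add: lins mult.assoc outer D_mult[where U=ground])
  also have "\<dots> = P (\<lambda>X1 X2 X3. Q (\<lambda>x1 x2 x3. Q (\<lambda>y1 y2 y3. D y3 (\<lambda>y31 y32. P (\<lambda>Y1 Y2 Y3.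
      D x1 (\<lambda>x11 x12. D x12 (\<lambda>p q. D y1 (\<lambda>r1 r2. D (x3 * y32) (\<lambda>d1 d2.
        ?B X1 X2 X3 (x11 * Y1) (p * Y2) (q * Y3) y2 (x2 * y31) r1 r2 d1 d2)))))))))"
  proof (rule ev3_eqI, rule ev3_eqI, rule ev3_eqI, rule ev_eqI, goal_cases)
    case (1 X1 X2 X3 x1 x2 x3 y1 y2 y3 y31 y32)
    show ?case
      by (rule coassoc_P[where U=ground and F="\<lambda>u v w. D y1 (\<lambda>r1 r2. D (x3 * y32) (\<lambda>d1 d2.
        ?B X1 X2 X3 u v w y2 (x2 * y31) r1 r2 d1 d2))", symmetric]) (intro lins)+
  qed
  also have "\<dots> = P (\<lambda>X1 X2 X3. Q (\<lambda>x1 x2 x3. Q (\<lambda>y1 y2 y3. D y3 (\<lambda>y31 y32. P (\<lambda>Y1 Y2 Y3.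
      D x1 (\<lambda>x11 x12. scl ground (\<epsilon> x12) (D y1 (\<lambda>r1 r2. D (x3 * y32) (\<lambda>d1 d2.
        ?B X1 X2 X3 (x11 * Y1) Y2 Y3 y2 (x2 * y31) r1 r2 d1 d2)))))))))"
  proof (intro ev3_eqI ev_eqI)
    fix X1 X2 X3 x1 x2 x3 y1 y2 y3 y31 y32 Y1 Y2 Y3 x11 x12
    show "D x12 (\<lambda>p q. D y1 (\<lambda>r1 r2. D (x3 * y32) (\<lambda>d1 d2.
        ?B X1 X2 X3 (x11 * Y1) (p * Y2) (q * Y3) y2 (x2 * y31) r1 r2 d1 d2)))
      = scl ground (\<epsilon> x12) (D y1 (\<lambda>r1 r2. D (x3 * y32) (\<lambda>d1 d2.
        ?B X1 X2 X3 (x11 * Y1) Y2 Y3 y2 (x2 * y31) r1 r2 d1 d2)))"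
      using antip_alpha[of ground "\<lambda>z. D y1 (\<lambda>r1 r2. D (x3 * y32) (\<lambda>d1 d2.
        B (S r2 * (S Y2 * z * Y3) * y2 * (\<beta> * S X3) * S d2)
          (S r1 * (S (x11 * Y1) * \<alpha>) * (x2 * y31) * (X1 * \<beta> * S X2) * S d1)))" x12]
      by (simp add: lins mult.assoc)
  qed
  also have "\<dots> = P (\<lambda>X1 X2 X3. Q (\<lambda>x1 x2 x3. Q (\<lambda>y1 y2 y3. D y3 (\<lambda>y31 y32. P (\<lambda>Y1 Y2 Y3.
      D y1 (\<lambda>r1 r2. D (x3 * y32) (\<lambda>d1 d2. ?B X1 X2 X3 (x1 * Y1) Y2 Y3 y2 (x2 * y31) r1 r2 d1 d2)))))))"
    by (intro ev3_eqI ev_eqI, rule counit_D(1)[where U=ground]) (intro lins)+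
  also have "\<dots> = P (\<lambda>X1 X2 X3. Q (\<lambda>x1 x2 x3. Q (\<lambda>y1 y2 y3. D y3 (\<lambda>y31 y32. P (\<lambda>Y1 Y2 Y3.
      D (x3 * y32) (\<lambda>d1 d2. D y1 (\<lambda>r1 r2. ?B X1 X2 X3 (x1 * Y1) Y2 Y3 y2 (x2 * y31) r1 r2 d1 d2)))))))"
    by (intro ev3_eqI ev_eqI) (rule ev_swap)
  also have "\<dots> = P (\<lambda>Y1 Y2 Y3. Q (\<lambda>x1 x2 x3. Q (\<lambda>y1 y2 y3. P (\<lambda>X1 X2 X3. D y3 (\<lambda>y31 y32. D y32 (\<lambda>p q.
      (\<lambda>u v w. D x3 (\<lambda>e1 e2. D y1 (\<lambda>r1 r2. B (S r2 * (S Y2 * \<alpha> * Y3) * y2 * (\<beta> * S w) * S e2)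
        (S r1 * (S (x1 * Y1) * \<alpha>) * x2 * (u * \<beta> * S v) * S e1)))) (y31 * X1) (p * X2) (q * X3)))))))"
    unfolding outer by (rule trans[OF swap_ev3_ev3]) (simp add: lins mult.assoc D_mult'[where U=ground])
  also have "\<dots> = P (\<lambda>Y1 Y2 Y3. Q (\<lambda>x1 x2 x3. Q (\<lambda>y1 y2 y3. P (\<lambda>X1 X2 X3. D y3 (\<lambda>y31 y32. D y31 (\<lambda>p q.
      D x3 (\<lambda>e1 e2. D y1 (\<lambda>r1 r2. B (S r2 * (S Y2 * \<alpha> * Y3) * y2 * (\<beta> * S (X3 * y32)) * S e2)
        (S r1 * (S (x1 * Y1) * \<alpha>) * x2 * (X1 * p * \<beta> * S (X2 * q)) * S e1)))))))))"
  proof (rule ev3_eqI, rule ev3_eqI, rule ev3_eqI, goal_cases)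
    case (1 Y1 Y2 Y3 x1 x2 x3 y1 y2 y3)
    show ?case
      by (rule coassoc_P[where U=ground and F="\<lambda>u v w. D x3 (\<lambda>e1 e2. D y1 (\<lambda>r1 r2.
        B (S r2 * (S Y2 * \<alpha> * Y3) * y2 * (\<beta> * S w) * S e2) (S r1 * (S (x1 * Y1) * \<alpha>) * x2 * (u * \<beta> * S v) * S e1)))"])
        (intro lins)+
  qed
  also have "\<dots> = P (\<lambda>Y1 Y2 Y3. Q (\<lambda>x1 x2 x3. Q (\<lambda>y1 y2 y3. P (\<lambda>X1 X2 X3. D y3 (\<lambda>y31 y32. scl ground (\<epsilon> y31) (
      D x3 (\<lambda>e1 e2. D y1 (\<lambda>r1 r2. B (S r2 * (S Y2 * \<alpha> * Y3) * y2 * (\<beta> * S (X3 * y32)) * S e2)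
        (S r1 * (S (x1 * Y1) * \<alpha>) * x2 * (X1 * \<beta> * S X2) * S e1)))))))))"
  proof (intro ev3_eqI ev_eqI)
    fix Y1 Y2 Y3 x1 x2 x3 y1 y2 y3 X1 X2 X3 y31 y32
    show "D y31 (\<lambda>p q. D x3 (\<lambda>e1 e2. D y1 (\<lambda>r1 r2. B (S r2 * (S Y2 * \<alpha> * Y3) * y2 * (\<beta> * S (X3 * y32)) * S e2)
        (S r1 * (S (x1 * Y1) * \<alpha>) * x2 * (X1 * p * \<beta> * S (X2 * q)) * S e1))))
      = scl ground (\<epsilon> y31) (D x3 (\<lambda>e1 e2. D y1 (\<lambda>r1 r2. B (S r2 * (S Y2 * \<alpha> * Y3) * y2 * (\<beta> * S (X3 * y32)) * S e2)
        (S r1 * (S (x1 * Y1) * \<alpha>) * x2 * (X1 * \<beta> * S X2) * S e1))))"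
      using antip_beta[of ground "\<lambda>z. D x3 (\<lambda>e1 e2. D y1 (\<lambda>r1 r2. B (S r2 * (S Y2 * \<alpha> * Y3) * y2 * (\<beta> * S (X3 * y32)) * S e2)
        (S r1 * (S (x1 * Y1) * \<alpha>) * x2 * (X1 * z * S X2) * S e1)))" y31]
      by (simp add: lins mult.assoc)
  qed
  also have "\<dots> = P (\<lambda>Y1 Y2 Y3. Q (\<lambda>x1 x2 x3. Q (\<lambda>y1 y2 y3. P (\<lambda>X1 X2 X3. 
      D x3 (\<lambda>e1 e2. D y1 (\<lambda>r1 r2. B (S r2 * (S Y2 * \<alpha> * Y3) * y2 * (\<beta> * S (X3 * y3)) * S e2)
        (S r1 * (S (x1 * Y1) * \<alpha>) * x2 * (X1 * \<beta> * S X2) * S e1)))))))"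
    by (intro ev3_eqI, rule counit_D(2)[where U=ground]) (intro lins)+
  also have "\<dots> = P (\<lambda>Y1 Y2 Y3. Q (\<lambda>x1 x2 x3. Q (\<lambda>y1 y2 y3. P (\<lambda>X1 X2 X3. 
      D y1 (\<lambda>r1 r2. D x3 (\<lambda>e1 e2. B (S r2 * (S Y2 * \<alpha> * Y3) * y2 * (\<beta> * S (X3 * y3)) * S e2)
        (S r1 * (S (x1 * Y1) * \<alpha>) * x2 * (X1 * \<beta> * S X2) * S e1)))))))"
    by (intro ev3_eqI) (rule ev_swap)
  also have "\<dots> = P (\<lambda>X1 X2 X3. Q (\<lambda>x1 x2 x3. ev4 A4 (\<lambda>a b c d.
      (\<lambda>u v. D x3 (\<lambda>e1 e2. B (v * S X3 * S e2) (S u * (S x1 * \<alpha> * x2 * X1 * \<beta> * S X2) * S e1))) a (S b * \<alpha> * c * \<beta> * S d))))"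
    unfolding outer by (rule trans[OF swap_ev3_ev3]) (simp add: e outer)
  also have "\<dots> = P (\<lambda>X1 X2 X3. Q (\<lambda>x1 x2 x3. D x3 (\<lambda>e1 e2. B (1 * S X3 * S e2) (S 1 * (S x1 * \<alpha> * x2 * X1 * \<beta> * S X2) * S e1))))"
  proof (rule ev3_eqI, rule ev3_eqI, goal_cases)
    case (1 X1 X2 X3 x1 x2 x3)
    show ?case
      by (rule snake_A[where U=ground and G="\<lambda>u v. D x3 (\<lambda>e1 e2. B (v * S X3 * S e2) (S u * (S x1 * \<alpha> * x2 * X1 * \<beta> * S X2) * S e1))"])
        (intro lins)+
  qed
  also have "\<dots> = ev4 E4 (\<lambda>a b c d. (\<lambda>u v. B (S v) u) (S a * \<alpha> * b * \<beta> * S c) d)"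
    by (simp add: e)
  also have "\<dots> = ev H H (pure2 H 1 1) B"
    by (subst snake_E[where U=ground and G="\<lambda>u v. B (S v) u"]) (simp_all add: lins B ev2_pure[where U=ground])
  finally show "ev H H (Q (\<lambda>x1 x2 x3. sbar x1 \<odot>\<^sub>2 (\<gamma> \<odot>\<^sub>2 (\<Delta> x2 \<odot>\<^sub>2 (\<delta> \<odot>\<^sub>2 sbar x3))))) B
      = ev H H (pure2 H 1 1) B" .
qed (intro lins)+

lemma sbar_datum: "antipode_datum sbar \<gamma> \<delta>"
  by (simp add: antipode_datum_def lins sbar_mult sbar_one sbar_gamma sbar_delta gamma_delta delta_gamma)

abbreviation "f2 \<equiv> twist H"
abbreviation "g2 \<equiv> twist_inv H"

text \<open>Drinfeld's formulas for f and its inverse are the two transitions between one pair of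
  antipode data, in opposite directions. Invertibility, intertwining and f \<Delta>(\<alpha>) =
  \<gamma> thereby become instances of the general lemmas on transitions.\<close>

lemma twist_eq: "f2 = transition sbar \<gamma> (\<Delta> \<beta>) (\<lambda>h. \<Delta> (S h))"
  and twist_inv_eq: "g2 = transition (\<lambda>h. \<Delta> (S h)) (\<Delta> \<alpha>) \<delta> sbar"
  by (simp_all add: twist_def twist_inv_def transition_def sw_evs comult_mult mult2_assoc lins)

lemma twist_closed [lins]: "f2 \<in> carr H2" "g2 \<in> carr H2"
  unfolding twist_eq twist_inv_eq
  using transition_closed[OF comult_antip_datum sbar_datum] transition_closed[OF sbar_datum comult_antip_datum]
  by simp_all

lemma twist_inverse: "f2 \<odot>\<^sub>2 g2 = pure2 H 1 1" "g2 \<odot>\<^sub>2 f2 = pure2 H 1 1"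
  unfolding twist_eq twist_inv_eq
  by (intro transition_inverse comult_antip_datum sbar_datum)+

lemma twist_comult_antip: "f2 \<odot>\<^sub>2 \<Delta> (S h) = sbar h \<odot>\<^sub>2 f2"
  unfolding twist_eq by (rule transition_intertwines[OF comult_antip_datum sbar_datum])

lemma twist_comult_alpha: "f2 \<odot>\<^sub>2 \<Delta> \<alpha> = \<gamma>"
  unfolding twist_eq by (rule transition_alpha[OF comult_antip_datum sbar_datum])

text \<open>Both legs of \<gamma> have the form S(u) \<alpha> v, so f times the coproduct of such a
  leg is computed here without expanding f.\<close>

lemma twist_comult: "f2 \<odot>\<^sub>2 \<Delta> (S u * \<alpha> * v) = sbar u \<odot>\<^sub>2 (\<gamma> \<odot>\<^sub>2 \<Delta> v)"
proof -
  have "f2 \<odot>\<^sub>2 \<Delta> (S u * \<alpha> * v) = f2 \<odot>\<^sub>2 \<Delta> (S u) \<odot>\<^sub>2 (\<Delta> \<alpha> \<odot>\<^sub>2 \<Delta> v)"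
    by (simp add: comult_mult mult2_assoc lins)
  also have "\<dots> = sbar u \<odot>\<^sub>2 (f2 \<odot>\<^sub>2 \<Delta> \<alpha> \<odot>\<^sub>2 \<Delta> v)"
    unfolding twist_comult_antip by (simp add: mult2_assoc lins)
  finally show ?thesis by (simp add: twist_comult_alpha)
qed

lemma contr_ev:
  assumes U [lins]: "is_space U" and K: "bilin H H U K"
  shows "ev H H (sbar a \<odot>\<^sub>2 (\<gamma> \<odot>\<^sub>2 \<Delta> d)) K
       = D a (\<lambda>a1 a2. D d (\<lambda>d1 d2. ev H H \<gamma> (\<lambda>g g'. K (S a2 * g * d1) (S a1 * g' * d2))))"
    and "ev H H (sbar a \<odot>\<^sub>2 (\<gamma> \<odot>\<^sub>2 \<Delta> d)) K
       = ev H H \<gamma> (\<lambda>g g'. D d (\<lambda>d1 d2. D a (\<lambda>a1 a2. K (S a2 * g * d1) (S a1 * g' * d2))))"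
proof -
  note [lins] = lin_bi[OF K]
  show "ev H H (sbar a \<odot>\<^sub>2 (\<gamma> \<odot>\<^sub>2 \<Delta> d)) K
       = D a (\<lambda>a1 a2. D d (\<lambda>d1 d2. ev H H \<gamma> (\<lambda>g g'. K (S a2 * g * d1) (S a1 * g' * d2))))"
    by (simp add: ev2_mult[where U=U] ev_sbar[where U=U] K lins mult.assoc ev_swap[of H H \<gamma>])
  also have "\<dots> = D d (\<lambda>d1 d2. D a (\<lambda>a1 a2. ev H H \<gamma> (\<lambda>g g'. K (S a2 * g * d1) (S a1 * g' * d2))))"
    by (rule ev_swap)
  finally show "ev H H (sbar a \<odot>\<^sub>2 (\<gamma> \<odot>\<^sub>2 \<Delta> d)) K
       = ev H H \<gamma> (\<lambda>g g'. D d (\<lambda>d1 d2. D a (\<lambda>a1 a2. K (S a2 * g * d1) (S a1 * g' * d2))))"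
    by (simp only: ev_swap[of H H \<gamma>])
qed

lemma contr_mult:
  assumes U [lins]: "is_space U" and K: "bilin H H U K"
  shows "ev H H (sbar (x * a) \<odot>\<^sub>2 (\<gamma> \<odot>\<^sub>2 \<Delta> (y * c))) K
       = D a (\<lambda>a1 a2. D c (\<lambda>c1 c2. ev H H (sbar x \<odot>\<^sub>2 (\<gamma> \<odot>\<^sub>2 \<Delta> y)) (\<lambda>p q. K (S a2 * p * c1) (S a1 * q * c2))))"
proof -
  note [lins] = lin_bi[OF K]
  have "sbar (x * a) \<odot>\<^sub>2 (\<gamma> \<odot>\<^sub>2 \<Delta> (y * c)) = sbar a \<odot>\<^sub>2 ((sbar x \<odot>\<^sub>2 (\<gamma> \<odot>\<^sub>2 \<Delta> y)) \<odot>\<^sub>2 \<Delta> c)"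
    by (simp add: sbar_mult comult_mult mult2_assoc lins)
  moreover have "ev H H (sbar a \<odot>\<^sub>2 (W \<odot>\<^sub>2 \<Delta> c)) K
      = D a (\<lambda>a1 a2. D c (\<lambda>c1 c2. ev H H W (\<lambda>p q. K (S a2 * p * c1) (S a1 * q * c2))))"
    if [lins]: "W \<in> carr H2" for W
    by (simp add: ev2_mult[where U=U] ev_sbar[where U=U] K lins mult.assoc ev_swap[of H H W])
  ultimately show ?thesis by (simp add: lins)
qed

text \<open>By \<open>twist_comult\<close> the left side evaluates (f \<otimes> 1)(\<Delta>
  \<otimes> id)(\<open>q_L\<close>). Passing from \<open>A4\<close> to \<open>D4\<close> leaves a
  coproduct that \<open>qL_move\<close> absorbs; the result contains no \<gamma> but two copies of
  \<open>q_L\<close>, with legs \<open>u\<close> and \<open>v\<close>.\<close>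

lemma contr_Q:
  assumes U [lins]: "is_space U" and K: "trilin U K"
  shows "Q (\<lambda>x1 x2 x3. ev H H (sbar x1 \<odot>\<^sub>2 (\<gamma> \<odot>\<^sub>2 \<Delta> x2)) (\<lambda>p q. K p q x3))
       = P (\<lambda>Z1 Z2 Z3. Q (\<lambda>v1 v2 v3. Q (\<lambda>w1 w2 w3. Q (\<lambda>u1 u2 u3. D Z3 (\<lambda>Z31 Z32. D (w2 * Z31) (\<lambda>r1 r2.
           K (S (w1 * Z2) * (S u1 * \<alpha> * u2) * r1) (S Z1 * (S v1 * \<alpha> * v2) * u3 * r2) (v3 * w3 * Z32)))))))"
proof -
  note [lins] = lin_tri[OF K]
  let ?F = "\<lambda>a b c d. Q (\<lambda>w1 w2 w3. D c (\<lambda>c1 c2. K (S (w1 * b) * \<alpha> * w2 * c1) (S a * \<alpha> * w3 * c2) d))"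
  note e = ev_gamma(2)[where U=U] ABDE_ev[where U=U] lins mult.assoc outer
  have "Q (\<lambda>x1 x2 x3. ev H H (sbar x1 \<odot>\<^sub>2 (\<gamma> \<odot>\<^sub>2 \<Delta> x2)) (\<lambda>p q. K p q x3)) = ev4 A4 ?F"
    by (simp add: contr_ev(1)[where U=U] D_mult'[where U=U] e)
  also have "\<dots> = P (\<lambda>Z1 Z2 Z3. Q (\<lambda>y1 y2 y3. Q (\<lambda>w1 w2 w3. Q (\<lambda>u1 u2 u3. D y2 (\<lambda>y21 y22. D Z3 (\<lambda>Z31 Z32. D y22 (\<lambda>h1 h2. D (w2 * Z31) (\<lambda>r1 r2.
      K (S (u1 * (y21 * (w1 * Z2))) * \<alpha> * u2 * (h1 * r1)) (S (y1 * Z1) * \<alpha> * u3 * (h2 * r2)) (y3 * (w3 * Z32))))))))))"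
    unfolding A4_eq_D4 by (simp add: ev4_mult[where U=U] ev4_leg[where U=U] D_mult[where U=U] e)
  also have "\<dots> = P (\<lambda>Z1 Z2 Z3. Q (\<lambda>y1 y2 y3. Q (\<lambda>w1 w2 w3. Q (\<lambda>u1 u2 u3. D Z3 (\<lambda>Z31 Z32. D y2 (\<lambda>y21 y22. D y22 (\<lambda>h1 h2. D (w2 * Z31) (\<lambda>r1 r2.
      K (S (u1 * (y21 * (w1 * Z2))) * \<alpha> * u2 * (h1 * r1)) (S (y1 * Z1) * \<alpha> * u3 * (h2 * r2)) (y3 * (w3 * Z32))))))))))"
    by (rule ev3_eqI, rule ev3_eqI, rule ev3_eqI, rule ev3_eqI, rule ev_swap)
  also have "\<dots> = P (\<lambda>Z1 Z2 Z3. Q (\<lambda>y1 y2 y3. Q (\<lambda>w1 w2 w3. D Z3 (\<lambda>Z31 Z32. Q (\<lambda>u1 u2 u3. D y2 (\<lambda>y21 y22. D y22 (\<lambda>h1 h2.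
      (\<lambda>s t. D (w2 * Z31) (\<lambda>r1 r2. K (S (w1 * Z2) * s * r1) (S (y1 * Z1) * \<alpha> * t * r2) (y3 * w3 * Z32)))
        (S y21 * S u1 * \<alpha> * u2 * h1) (u3 * h2))))))))"
    by (simp add: e)
  also have "\<dots> = P (\<lambda>Z1 Z2 Z3. Q (\<lambda>y1 y2 y3. Q (\<lambda>w1 w2 w3. D Z3 (\<lambda>Z31 Z32. Q (\<lambda>u1 u2 u3.
      D (w2 * Z31) (\<lambda>r1 r2. K (S (w1 * Z2) * (S u1 * \<alpha> * u2) * r1) (S (y1 * Z1) * \<alpha> * (y2 * u3) * r2) (y3 * w3 * Z32)))))))"
  proof (rule ev3_eqI, rule ev3_eqI, rule ev3_eqI, rule ev_eqI, goal_cases)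
    case (1 Z1 Z2 Z3 y1 y2 y3 w1 w2 w3 Z31 Z32)
    show ?case
      by (rule qL_move[where U=U and G="\<lambda>s t. D (w2 * Z31) (\<lambda>r1 r2. K (S (w1 * Z2) * s * r1)
          (S (y1 * Z1) * \<alpha> * t * r2) (y3 * w3 * Z32))"]) (intro lins)+
  qed
  finally show ?thesis by (simp add: e)
qed

section \<open>The reassociator twisted by f\<close>

definition tens21 :: "('k, 'h, 'h) tensor \<Rightarrow> 'h \<Rightarrow> ('k, 'h) tensor3" where
  "tens21 u b = ev H H u (\<lambda>p q. pure3 H p q b)"

definition tens12 :: "'h \<Rightarrow> ('k, 'h, 'h) tensor \<Rightarrow> ('k, 'h) tensor3" where
  "tens12 a u = ev H H u (\<lambda>p q. pure3 H a p q)"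

definition flip_antip :: "('h \<Rightarrow> 'h) \<Rightarrow> ('k, 'h) tensor3 \<Rightarrow> ('k, 'h) tensor3" where
  "flip_antip s t = ev3 t (\<lambda>a b c. pure3 H (s c) (s b) (s a))"

lemma tens_closed [lins]: "u \<in> carr H2 \<Longrightarrow> tens21 u b \<in> carr H3" "u \<in> carr H2 \<Longrightarrow> tens12 b u \<in> carr H3"
  by (simp_all add: tens21_def tens12_def lins)

lemma lin_tens [lins]:
  "lin X H2 f \<Longrightarrow> lin X H3 (\<lambda>x. tens21 (f x) b)" "is_space X \<Longrightarrow> u \<in> carr H2 \<Longrightarrow> lin X H h \<Longrightarrow> lin X H3 (\<lambda>x. tens21 u (h x))"
  "lin X H2 f \<Longrightarrow> lin X H3 (\<lambda>x. tens12 b (f x))" "is_space X \<Longrightarrow> u \<in> carr H2 \<Longrightarrow> lin X H h \<Longrightarrow> lin X H3 (\<lambda>x. tens12 (h x) u)"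
  by (simp_all add: tens21_def tens12_def lins)

lemma ev3_tens:
  assumes U [lins]: "is_space U" and F: "trilin U F" and [lins]: "u \<in> carr H2"
  shows "ev3 (tens21 u b) F = ev H H u (\<lambda>p q. F p q b)" "ev3 (tens12 a u) F = ev H H u (\<lambda>p q. F a p q)"
  by (simp_all add: tens21_def tens12_def ev_evs[where U=U] F lins ev3_pure[where U=U])

lemma tens_mult:
  assumes [lins]: "u \<in> carr H2" "v \<in> carr H2"
  shows "tens21 u a \<odot>\<^sub>3 tens21 v b = tens21 (u \<odot>\<^sub>2 v) (a * b)" (is "?a = ?a'")
    and "tens12 a u \<odot>\<^sub>3 tens12 b v = tens12 (a * b) (u \<odot>\<^sub>2 v)" (is "?b = ?b'")
    and "comult_id H (u \<odot>\<^sub>2 v) = comult_id H u \<odot>\<^sub>3 comult_id H v" (is "?c = ?c'")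
    and "id_comult H (u \<odot>\<^sub>2 v) = id_comult H u \<odot>\<^sub>3 id_comult H v" (is "?d = ?d'")
proof -
  have "ev3 ?a B = ev3 ?a' B" "ev3 ?b B = ev3 ?b' B" "ev3 ?c B = ev3 ?c' B" "ev3 ?d B = ev3 ?d' B"
    if B: "trilin ground B" for B :: "'h \<Rightarrow> 'h \<Rightarrow> 'h \<Rightarrow> 'k"
  proof -
    note [lins] = lin_tri[OF B]
    note e = ev3_mult[where U=ground] ev2_mult[where U=ground] ev3_tens[where U=ground] ev3_leg[where U=ground]
      D_mult[where U=ground] B lins
    show "ev3 ?a B = ev3 ?a' B" "ev3 ?b B = ev3 ?b' B" by (simp_all add: e)
    show "ev3 ?c B = ev3 ?c' B" "ev3 ?d B = ev3 ?d' B" by (simp_all add: e ev_swap[of H H "\<Delta> x" H H v for x])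
  qed
  note * = this
  show "?a = ?a'" by (rule tensor3_eqI[OF _ _ *(1)]) (intro lins, assumption?)+
  show "?b = ?b'" by (rule tensor3_eqI[OF _ _ *(2)]) (intro lins, assumption?)+
  show "?c = ?c'" by (rule tensor3_eqI[OF _ _ *(3)]) (intro lins, assumption?)+
  show "?d = ?d'" by (rule tensor3_eqI[OF _ _ *(4)]) (intro lins, assumption?)+
qed

lemma comult_id_tens: "comult_id H t = ev H H t (\<lambda>a b. tens21 (\<Delta> a) b)"
  and id_comult_tens: "id_comult H t = ev H H t (\<lambda>a b. tens12 a (\<Delta> b))"
  by (simp_all add: leg_eqs tens21_def tens12_def)

lemma mult3_ev_right:
  assumes [lins]: "s \<in> carr H3"
  shows "t2 \<in> carr H2 \<Longrightarrow> (\<And>a b. F2 a b \<in> carr H3) \<Longrightarrow> s \<odot>\<^sub>3 ev H H t2 F2 = ev H H t2 (\<lambda>a b. s \<odot>\<^sub>3 F2 a b)"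
    and "t3 \<in> carr H3 \<Longrightarrow> (\<And>a b c. F3 a b c \<in> carr H3) \<Longrightarrow> s \<odot>\<^sub>3 ev3 t3 F3 = ev3 t3 (\<lambda>a b c. s \<odot>\<^sub>3 F3 a b c)"
  by (rule lin_ev2_apply[where X=H3 and Y=H3] lin_ev3_apply[where X=H3 and Y=H3], (simp_all add: lins)[4])+

lemma mult3_ev_left:
  assumes [lins]: "s \<in> carr H3"
  shows "t2 \<in> carr H2 \<Longrightarrow> (\<And>a b. F2 a b \<in> carr H3) \<Longrightarrow> ev H H t2 F2 \<odot>\<^sub>3 s = ev H H t2 (\<lambda>a b. F2 a b \<odot>\<^sub>3 s)"
    and "t3 \<in> carr H3 \<Longrightarrow> (\<And>a b c. F3 a b c \<in> carr H3) \<Longrightarrow> ev3 t3 F3 \<odot>\<^sub>3 s = ev3 t3 (\<lambda>a b c. F3 a b c \<odot>\<^sub>3 s)"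
  by (rule lin_ev2_apply[where X=H3 and Y=H3 and f="\<lambda>x. x \<odot>\<^sub>3 s"] lin_ev3_apply[where X=H3 and Y=H3 and f="\<lambda>x. x \<odot>\<^sub>3 s"], (simp_all add: lins)[4])+

lemma comult_id_ev: "t \<in> carr H2 \<Longrightarrow> (\<And>a b. F a b \<in> carr H2) \<Longrightarrow> comult_id H (ev H H t F) = ev H H t (\<lambda>a b. comult_id H (F a b))"
  and id_comult_ev: "t \<in> carr H2 \<Longrightarrow> (\<And>a b. F a b \<in> carr H2) \<Longrightarrow> id_comult H (ev H H t F) = ev H H t (\<lambda>a b. id_comult H (F a b))"
  by (rule lin_ev2_apply[where X=H2 and Y=H3], (simp_all add: leg_eqs lins)[4])+

lemma leg_pure2: "comult_id H (pure2 H a b) = tens21 (\<Delta> a) b" "id_comult H (pure2 H a b) = tens12 a (\<Delta> b)"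
  by (simp_all add: comult_id_tens id_comult_tens ev2_pure[where U=H3] lins)

lemma flip_antip_closed:
  "t \<in> carr H3 \<Longrightarrow> flip_antip s t \<in> carr H3"
  by (simp add: flip_antip_def lins)

lemma ev3_flip_S:
  assumes U [lins]: "is_space U" and F: "trilin U F" and [lins]: "t \<in> carr H3"
  shows "ev3 (flip_antip S t) F = ev3 t (\<lambda>a b c. F (S c) (S b) (S a))"
  by (simp add: flip_antip_def ev_evs[where U=U] F lins ev3_pure[where U=U])

text \<open>The coproduct falls on a single leg of \<gamma>, where \<open>twist_comult\<close>
  trades the outer twist for a second \<gamma>.\<close>

lemma tens_gamma_ev:
  assumes U [lins]: "is_space U" and F: "trilin U F"
  shows "ev3 (tens12 1 f2 \<odot>\<^sub>3 id_comult H \<gamma>) F = ev4 D4 (\<lambda>a b c d. ev H H (sbar a \<odot>\<^sub>2 (\<gamma> \<odot>\<^sub>2 \<Delta> d)) (F (S b * \<alpha> * c)))"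
    and "ev3 (tens21 f2 1 \<odot>\<^sub>3 comult_id H \<gamma>) F = ev4 D4 (\<lambda>a b c d. ev H H (sbar b \<odot>\<^sub>2 (\<gamma> \<odot>\<^sub>2 \<Delta> c)) (\<lambda>p q. F p q (S a * \<alpha> * d)))"
proof -
  note [lins] = lin_tri[OF F]
  have "tens12 1 f2 \<odot>\<^sub>3 id_comult H \<gamma> = ev H H \<gamma> (\<lambda>a b. tens12 a (f2 \<odot>\<^sub>2 \<Delta> b))"
    "tens21 f2 1 \<odot>\<^sub>3 comult_id H \<gamma> = ev H H \<gamma> (\<lambda>a b. tens21 (f2 \<odot>\<^sub>2 \<Delta> a) b)"
    by (simp_all add: id_comult_tens comult_id_tens mult3_ev_right tens_mult lins)
  then show "ev3 (tens12 1 f2 \<odot>\<^sub>3 id_comult H \<gamma>) F = ev4 D4 (\<lambda>a b c d. ev H H (sbar a \<odot>\<^sub>2 (\<gamma> \<odot>\<^sub>2 \<Delta> d)) (F (S b * \<alpha> * c)))"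
    "ev3 (tens21 f2 1 \<odot>\<^sub>3 comult_id H \<gamma>) F = ev4 D4 (\<lambda>a b c d. ev H H (sbar b \<odot>\<^sub>2 (\<gamma> \<odot>\<^sub>2 \<Delta> c)) (\<lambda>p q. F p q (S a * \<alpha> * d)))"
    by (simp_all add: ev_evs[where U=U] F lins ev3_tens[where U=U] ev_gamma(2)[where U=U] twist_comult)
qed

text \<open>The reassociator identity for f after multiplication by the image of \<alpha>, which
  replaces an f by \<gamma> on either side. Both sides are brought to the common expression
  \<open>?E\<close>, a sum over \<gamma> and \<Phi> around \<open>E4\<close>.\<close>

lemma gamma_reassoc:
  "tens12 1 f2 \<odot>\<^sub>3 (id_comult H \<gamma> \<odot>\<^sub>3 Phi H) = flip_antip S (Phi H) \<odot>\<^sub>3 (tens21 f2 1 \<odot>\<^sub>3 comult_id H \<gamma>)" (is "?L = ?R")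
proof (rule tensor3_eqI)
  fix B :: "'h \<Rightarrow> 'h \<Rightarrow> 'h \<Rightarrow> 'k" assume B: "trilin ground B"
  note [lins] = lin_tri[OF B] flip_antip_closed
  note \<gamma>_out = ev_swap[of H H "\<Delta> x" H H \<gamma> for x]
  let ?K4 = "\<lambda>g g' Y1 Y2 Y311 Y312 Y32 a b c d. D Y1 (\<lambda>m1 m2.
    B (S (a * Y2) * \<alpha> * b * Y311) (S m2 * g * c * Y312) (S m1 * g' * d * Y32))"
  let ?E = "ev H H \<gamma> (\<lambda>g g'. P (\<lambda>Y1 Y2 Y3. D Y3 (\<lambda>Y31 Y32. D Y31 (\<lambda>Y311 Y312.
    ev4 E4 (?K4 g g' Y1 Y2 Y311 Y312 Y32)))))"
  have "ev3 ?L B = ev3 (tens12 1 f2 \<odot>\<^sub>3 id_comult H \<gamma> \<odot>\<^sub>3 Phi H) B" by (simp add: mult3_assoc lins)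
  also have "\<dots> = ev3 (tens12 1 f2 \<odot>\<^sub>3 id_comult H \<gamma>) (\<lambda>a b c. P (\<lambda>X1 X2 X3. B (a * X1) (b * X2) (c * X3)))"
    by (rule ev3_mult[where U=ground]) (intro lins B gamma_closed)+
  also have "\<dots> = ev H H \<gamma> (\<lambda>g g'. P (\<lambda>Y1 Y2 Y3. Q (\<lambda>z1 z2 z3. P (\<lambda>X1 X2 X3. D Y3 (\<lambda>Y31 Y32. D Y32 (\<lambda>p q.
      (\<lambda>u v w. D z3 (\<lambda>z31 z32. D Y1 (\<lambda>m1 m2. B (S (z1 * Y2) * \<alpha> * z2 * u) (S m2 * g * z31 * v) (S m1 * g' * z32 * w))))
        (Y31 * X1) (p * X2) (q * X3)))))))"
    by (simp add: tens_gamma_ev[where U=ground] contr_ev(2)[where U=ground] ABDE_ev[where U=ground]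
        lins mult.assoc outer \<gamma>_out D_mult'[where U=ground])
  also have "\<dots> = ev H H \<gamma> (\<lambda>g g'. P (\<lambda>Y1 Y2 Y3. Q (\<lambda>z1 z2 z3. P (\<lambda>X1 X2 X3. D Y3 (\<lambda>Y31 Y32. D Y31 (\<lambda>p q.
      D z3 (\<lambda>z31 z32. D Y1 (\<lambda>m1 m2. B (S (z1 * Y2) * \<alpha> * z2 * (X1 * p)) (S m2 * g * z31 * (X2 * q)) (S m1 * g' * z32 * (X3 * Y32))))))))))"
  proof (rule ev_eqI, rule ev3_eqI, rule ev3_eqI, goal_cases)
    case (1 g g' Y1 Y2 Y3 z1 z2 z3)
    show ?case
      by (rule coassoc_P[where U=ground and F="\<lambda>u v w. D z3 (\<lambda>z31 z32. D Y1 (\<lambda>m1 m2.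
          B (S (z1 * Y2) * \<alpha> * z2 * u) (S m2 * g * z31 * v) (S m1 * g' * z32 * w)))"]) (intro lins)+
  qed
  also have "\<dots> = ?E"
    by (simp add: ABDE_ev[where U=ground] lins mult.assoc outer)
  finally have L: "ev3 ?L B = ?E" .
  let ?B = "\<lambda>u1 u2 u3 v1 v2 v3 w1 w3 a b c d2 r1 r2. B (S (w1 * c) * (S u1 * \<alpha> * u2) * r1)
    (S b * (S v1 * \<alpha> * v2) * u3 * r2) (S a * \<alpha> * v3 * w3 * d2)"
  let ?F = "\<lambda>a b c d. Q (\<lambda>v1 v2 v3. Q (\<lambda>w1 w2 w3. Q (\<lambda>u1 u2 u3. D d (\<lambda>d1 d2. D (w2 * d1) (\<lambda>r1 r2.
    ?B u1 u2 u3 v1 v2 v3 w1 w3 a b c d2 r1 r2)))))"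
  have "ev3 ?R B = ev3 (flip_antip S (Phi H)) (\<lambda>a b c. ev3 (tens21 f2 1 \<odot>\<^sub>3 comult_id H \<gamma>) (\<lambda>p q r. B (a * p) (b * q) (c * r)))"
    by (rule ev3_mult[where U=ground]) (intro lins B gamma_closed)+
  also have "\<dots> = P (\<lambda>Y1 Y2 Y3. P (\<lambda>X1 X2 X3. D X3 (\<lambda>X31 X32. D X2 (\<lambda>X21 X22. D X31 (\<lambda>o1 o2.
      Q (\<lambda>x1 x2 x3. ev H H (sbar x1 \<odot>\<^sub>2 (\<gamma> \<odot>\<^sub>2 \<Delta> x2)) (\<lambda>p q.
        (\<lambda>p q r. B (S Y3 * S X22 * p * o1) (S Y2 * S X21 * q * o2) (S Y1 * S X1 * \<alpha> * r * X32)) p q x3)))))))"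
    by (simp add: tens_gamma_ev[where U=ground] contr_mult[where U=ground] ABDE_ev[where U=ground]
        ev3_flip_S[where U=ground] lins mult.assoc outer)
  also have "\<dots> = P (\<lambda>Y1 Y2 Y3. P (\<lambda>X1 X2 X3. D X3 (\<lambda>X31 X32. D X2 (\<lambda>X21 X22. D X31 (\<lambda>o1 o2.
      P (\<lambda>Z1 Z2 Z3. Q (\<lambda>v1 v2 v3. Q (\<lambda>w1 w2 w3. Q (\<lambda>u1 u2 u3. D Z3 (\<lambda>Z31 Z32. D (w2 * Z31) (\<lambda>r1 r2.
        B (S Y3 * S X22 * (S (w1 * Z2) * (S u1 * \<alpha> * u2) * r1) * o1) (S Y2 * S X21 * (S Z1 * (S v1 * \<alpha> * v2) * u3 * r2) * o2)
          (S Y1 * S X1 * \<alpha> * (v3 * w3 * Z32) * X32))))))))))))"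
  proof (rule ev3_eqI, rule ev3_eqI, rule ev_eqI, rule ev_eqI, rule ev_eqI, goal_cases)
    case (1 Y1 Y2 Y3 X1 X2 X3 X31 X32 X21 X22 o1 o2)
    show ?case
      by (rule contr_Q[where U=ground and K="\<lambda>p q r. B (S Y3 * S X22 * p * o1) (S Y2 * S X21 * q * o2) (S Y1 * S X1 * \<alpha> * r * X32)"])
        (intro lins)+
  qed
  also have "\<dots> = P (\<lambda>Y1 Y2 Y3. P (\<lambda>X1 X2 X3. P (\<lambda>Z1 Z2 Z3. Q (\<lambda>v1 v2 v3. Q (\<lambda>w1 w2 w3. Q (\<lambda>u1 u2 u3.
      D X3 (\<lambda>X31 X32. D X2 (\<lambda>X21 X22. D X31 (\<lambda>o1 o2. D Z3 (\<lambda>Z31 Z32. D (w2 * Z31) (\<lambda>r1 r2.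
        ?B u1 u2 u3 v1 v2 v3 w1 w3 (X1 * Y1) (Z1 * X21 * Y2) (Z2 * X22 * Y3) (Z32 * X32) (r1 * o1) (r2 * o2))))))))))))"
    by (simp add: outer mult.assoc)
  also have "\<dots> = P (\<lambda>Z1 Z2 Z3. P (\<lambda>X1 X2 X3. P (\<lambda>Y1 Y2 Y3. Q (\<lambda>v1 v2 v3. Q (\<lambda>w1 w2 w3. Q (\<lambda>u1 u2 u3.
      D X3 (\<lambda>X31 X32. D X2 (\<lambda>X21 X22. D X31 (\<lambda>o1 o2. D Z3 (\<lambda>Z31 Z32. D (w2 * Z31) (\<lambda>r1 r2.
        ?B u1 u2 u3 v1 v2 v3 w1 w3 (X1 * Y1) (Z1 * X21 * Y2) (Z2 * X22 * Y3) (Z32 * X32) (r1 * o1) (r2 * o2))))))))))))"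
    by (rule trans[OF swap_ev3_ev3], rule trans[OF _ swap_ev3_ev3], rule ev3_eqI, rule swap_ev3_ev3)
  also have "\<dots> = P (\<lambda>Z1 Z2 Z3. P (\<lambda>X1 X2 X3. P (\<lambda>Y1 Y2 Y3. Q (\<lambda>v1 v2 v3. Q (\<lambda>w1 w2 w3. Q (\<lambda>u1 u2 u3.
      D X2 (\<lambda>X21 X22. D X3 (\<lambda>X31 X32. D X31 (\<lambda>o1 o2. D Z3 (\<lambda>Z31 Z32. D (w2 * Z31) (\<lambda>r1 r2.
        ?B u1 u2 u3 v1 v2 v3 w1 w3 (X1 * Y1) (Z1 * X21 * Y2) (Z2 * X22 * Y3) (Z32 * X32) (r1 * o1) (r2 * o2))))))))))))"
    by ((rule ev3_eqI)+, rule ev_swap)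
  also have "\<dots> = P (\<lambda>Z1 Z2 Z3. P (\<lambda>X1 X2 X3. P (\<lambda>Y1 Y2 Y3. Q (\<lambda>v1 v2 v3. Q (\<lambda>w1 w2 w3. Q (\<lambda>u1 u2 u3.
      D X2 (\<lambda>X21 X22. D X3 (\<lambda>X31 X32. D Z3 (\<lambda>Z31 Z32. D X31 (\<lambda>o1 o2. D (w2 * Z31) (\<lambda>r1 r2.
        ?B u1 u2 u3 v1 v2 v3 w1 w3 (X1 * Y1) (Z1 * X21 * Y2) (Z2 * X22 * Y3) (Z32 * X32) (r1 * o1) (r2 * o2))))))))))))"
    by ((rule ev3_eqI)+, rule ev_eqI, rule ev_eqI, rule ev_swap)
  \<comment> \<open>The copies of \<Phi> contributed by the reversed reassociator, by \<gamma> and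
    by \<open>contr_Q\<close> now stand in the order of the left side of the pentagon.\<close>
  also have "\<dots> = P (\<lambda>Z1 Z2 Z3. P (\<lambda>X1 X2 X3. P (\<lambda>Y1 Y2 Y3. D X2 (\<lambda>X21 X22.
      ?F (X1 * Y1) (Z1 * X21 * Y2) (Z2 * X22 * Y3) (Z3 * X3)))))"
    by (simp add: outer mult.assoc lins D_mult'[where U=ground])
  also have "\<dots> = P (\<lambda>X1 X2 X3. P (\<lambda>Y1 Y2 Y3. D X3 (\<lambda>X31 X32. D Y1 (\<lambda>Y11 Y12.
      ?F (X1 * Y11) (X2 * Y12) (X31 * Y2) (X32 * Y3)))))"
    by (rule pentagon_ev[where U=ground]) (intro lins)+
  also have "\<dots> = P (\<lambda>X1 X2 X3. P (\<lambda>Y1 Y2 Y3. Q (\<lambda>v1 v2 v3. Q (\<lambda>w1 w2 w3. Q (\<lambda>u1 u2 u3.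
      D X3 (\<lambda>X31 X32. D Y1 (\<lambda>Y11 Y12. D (X32 * Y3) (\<lambda>d1 d2. D (w2 * d1) (\<lambda>r1 r2.
        ?B u1 u2 u3 v1 v2 v3 w1 w3 (X1 * Y11) (X2 * Y12) (X31 * Y2) d2 r1 r2)))))))))"
    by (simp only: outer)
  also have "\<dots> = P (\<lambda>X1 X2 X3. P (\<lambda>Y1 Y2 Y3. Q (\<lambda>v1 v2 v3. Q (\<lambda>w1 w2 w3. Q (\<lambda>u1 u2 u3.
      D X3 (\<lambda>X31 X32. D (X32 * Y3) (\<lambda>d1 d2. D Y1 (\<lambda>Y11 Y12. D (w2 * d1) (\<lambda>r1 r2.
        ?B u1 u2 u3 v1 v2 v3 w1 w3 (X1 * Y11) (X2 * Y12) (X31 * Y2) d2 r1 r2)))))))))"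
    by ((rule ev3_eqI)+, rule ev_eqI, rule ev_swap)
  also have "\<dots> = P (\<lambda>X1 X2 X3. P (\<lambda>Y1 Y2 Y3. Q (\<lambda>v1 v2 v3. Q (\<lambda>w1 w2 w3. Q (\<lambda>u1 u2 u3.
      D X3 (\<lambda>X31 X32. D (X32 * Y3) (\<lambda>d1 d2. D (w2 * d1) (\<lambda>r1 r2. D Y1 (\<lambda>Y11 Y12.
        ?B u1 u2 u3 v1 v2 v3 w1 w3 (X1 * Y11) (X2 * Y12) (X31 * Y2) d2 r1 r2)))))))))"
    by ((rule ev3_eqI)+, rule ev_eqI, rule ev_eqI, rule ev_swap)
  also have "\<dots> = P (\<lambda>X1 X2 X3. P (\<lambda>Y1 Y2 Y3. Q (\<lambda>v1 v2 v3. Q (\<lambda>w1 w2 w3. D X3 (\<lambda>X31 X32. D X32 (\<lambda>e1 e2.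
      (\<lambda>p q r. D Y3 (\<lambda>Y31 Y32. Q (\<lambda>u1 u2 u3. D (q * Y31) (\<lambda>r1 r2. D Y1 (\<lambda>Y11 Y12.
        B (S (p * Y2) * (S u1 * \<alpha> * u2) * r1) (S (X2 * Y12) * (S v1 * \<alpha> * v2) * u3 * r2) (S (X1 * Y11) * \<alpha> * v3 * r * Y32))))))
        (w1 * X31) (w2 * e1) (w3 * e2)))))))"
    by (simp add: outer mult.assoc lins D_mult[where U=ground])
  also have "\<dots> = P (\<lambda>X1 X2 X3. P (\<lambda>Y1 Y2 Y3. Q (\<lambda>v1 v2 v3. Q (\<lambda>w1 w2 w3. D X3 (\<lambda>X31 X32. D X31 (\<lambda>h11 h12.
      D Y3 (\<lambda>Y31 Y32. Q (\<lambda>u1 u2 u3. D (h12 * w2 * Y31) (\<lambda>r1 r2. D Y1 (\<lambda>Y11 Y12.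
        B (S (h11 * w1 * Y2) * (S u1 * \<alpha> * u2) * r1) (S (X2 * Y12) * (S v1 * \<alpha> * v2) * u3 * r2)
          (S (X1 * Y11) * \<alpha> * v3 * (X32 * w3) * Y32)))))))))))"
  proof (rule ev3_eqI, rule ev3_eqI, rule ev3_eqI, goal_cases)
    case (1 X1 X2 X3 Y1 Y2 Y3 v1 v2 v3)
    show ?case
      by (rule coassoc_Q[where U=ground and F="\<lambda>p q r. D Y3 (\<lambda>Y31 Y32. Q (\<lambda>u1 u2 u3. D (q * Y31) (\<lambda>r1 r2. D Y1 (\<lambda>Y11 Y12.
        B (S (p * Y2) * (S u1 * \<alpha> * u2) * r1) (S (X2 * Y12) * (S v1 * \<alpha> * v2) * u3 * r2) (S (X1 * Y11) * \<alpha> * v3 * r * Y32)))))"])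
        (intro lins)+
  qed
  also have "\<dots> = P (\<lambda>X1 X2 X3. P (\<lambda>Y1 Y2 Y3. Q (\<lambda>v1 v2 v3. Q (\<lambda>w1 w2 w3. Q (\<lambda>u1 u2 u3. D X3 (\<lambda>X31 X32. D X31 (\<lambda>h11 h12.
      D Y3 (\<lambda>Y31 Y32. D h12 (\<lambda>k1 k2. D (w2 * Y31) (\<lambda>r1 r2. D Y1 (\<lambda>Y11 Y12.
        B (S (h11 * w1 * Y2) * (S u1 * \<alpha> * u2) * (k1 * r1)) (S (X2 * Y12) * (S v1 * \<alpha> * v2) * u3 * (k2 * r2))
          (S (X1 * Y11) * \<alpha> * v3 * (X32 * w3) * Y32))))))))))))"
    by (simp add: outer mult.assoc lins D_mult[where U=ground])
  also have "\<dots> = P (\<lambda>X1 X2 X3. P (\<lambda>Y1 Y2 Y3. Q (\<lambda>v1 v2 v3. Q (\<lambda>w1 w2 w3. Q (\<lambda>u1 u2 u3. D X3 (\<lambda>X31 X32. D X31 (\<lambda>h11 h12.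
      D h12 (\<lambda>k1 k2. D Y3 (\<lambda>Y31 Y32. D (w2 * Y31) (\<lambda>r1 r2. D Y1 (\<lambda>Y11 Y12.
        B (S (h11 * w1 * Y2) * (S u1 * \<alpha> * u2) * (k1 * r1)) (S (X2 * Y12) * (S v1 * \<alpha> * v2) * u3 * (k2 * r2))
          (S (X1 * Y11) * \<alpha> * v3 * (X32 * w3) * Y32))))))))))))"
    by ((rule ev3_eqI)+, rule ev_eqI, rule ev_eqI, rule ev_swap)
  also have "\<dots> = P (\<lambda>X1 X2 X3. P (\<lambda>Y1 Y2 Y3. Q (\<lambda>v1 v2 v3. Q (\<lambda>w1 w2 w3. D X3 (\<lambda>X31 X32. Q (\<lambda>u1 u2 u3. D X31 (\<lambda>h11 h12.
      D h12 (\<lambda>k1 k2. (\<lambda>s t. D Y3 (\<lambda>Y31 Y32. D (w2 * Y31) (\<lambda>r1 r2. D Y1 (\<lambda>Y11 Y12.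
        B (S (w1 * Y2) * s * r1) (S (X2 * Y12) * (S v1 * \<alpha> * v2) * t * r2)
          (S (X1 * Y11) * \<alpha> * v3 * (X32 * w3) * Y32))))) (S h11 * S u1 * \<alpha> * u2 * k1) (u3 * k2)))))))))"
    by (simp add: outer mult.assoc)
  also have "\<dots> = P (\<lambda>X1 X2 X3. P (\<lambda>Y1 Y2 Y3. Q (\<lambda>v1 v2 v3. Q (\<lambda>w1 w2 w3. D X3 (\<lambda>X31 X32. Q (\<lambda>u1 u2 u3.
      D Y3 (\<lambda>Y31 Y32. D (w2 * Y31) (\<lambda>r1 r2. D Y1 (\<lambda>Y11 Y12.
        B (S (w1 * Y2) * (S u1 * \<alpha> * u2) * r1) (S (X2 * Y12) * (S v1 * \<alpha> * v2) * (X31 * u3) * r2)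
          (S (X1 * Y11) * \<alpha> * v3 * (X32 * w3) * Y32))))))))))"
  proof (rule ev3_eqI, rule ev3_eqI, rule ev3_eqI, rule ev3_eqI, rule ev_eqI, goal_cases)
    case (1 X1 X2 X3 Y1 Y2 Y3 v1 v2 v3 w1 w2 w3 X31 X32)
    show ?case
      by (rule qL_move[where U=ground and G="\<lambda>s t. D Y3 (\<lambda>Y31 Y32. D (w2 * Y31) (\<lambda>r1 r2. D Y1 (\<lambda>Y11 Y12.
        B (S (w1 * Y2) * s * r1) (S (X2 * Y12) * (S v1 * \<alpha> * v2) * t * r2)
          (S (X1 * Y11) * \<alpha> * v3 * (X32 * w3) * Y32))))"]) (intro lins)+
  qed
  \<comment> \<open>The sums over \<open>X\<close> and \<open>v\<close> reassemble into one copy of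
    \<gamma>, in its \<open>D4\<close> expansion.\<close>
  also have "\<dots> = ev4 D4 (\<lambda>a b c d. P (\<lambda>Y1 Y2 Y3. Q (\<lambda>w1 w2 w3. Q (\<lambda>u1 u2 u3.
      D Y3 (\<lambda>Y31 Y32. D (w2 * Y31) (\<lambda>r1 r2. D Y1 (\<lambda>Y11 Y12.
        B (S (w1 * Y2) * (S u1 * \<alpha> * u2) * r1) (S Y12 * (S b * \<alpha> * c) * u3 * r2) (S Y11 * (S a * \<alpha> * d) * w3 * Y32))))))))"
    by (simp add: ABDE_ev[where U=ground] lins mult.assoc outer)
  also have "\<dots> = ev H H \<gamma> (\<lambda>g g'. P (\<lambda>Y1 Y2 Y3. Q (\<lambda>w1 w2 w3. Q (\<lambda>u1 u2 u3.
      D Y3 (\<lambda>Y31 Y32. D (w2 * Y31) (\<lambda>r1 r2. D Y1 (\<lambda>Y11 Y12.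
        B (S (w1 * Y2) * (S u1 * \<alpha> * u2) * r1) (S Y12 * g * u3 * r2) (S Y11 * g' * w3 * Y32))))))))"
    by (rule ev_gamma(2)[where U=ground, symmetric]) (intro lins)+
  also have "\<dots> = ev H H \<gamma> (\<lambda>g g'. P (\<lambda>Y1 Y2 Y3. Q (\<lambda>u1 u2 u3. Q (\<lambda>w1 w2 w3.
      D Y3 (\<lambda>Y31 Y32. D (w2 * Y31) (\<lambda>r1 r2. D Y1 (\<lambda>Y11 Y12.
        B (S (w1 * Y2) * (S u1 * \<alpha> * u2) * r1) (S Y12 * g * u3 * r2) (S Y11 * g' * w3 * Y32))))))))"
    by (rule ev_eqI, rule ev3_eqI, rule swap_ev3_ev3)
  also have "\<dots> = ev H H \<gamma> (\<lambda>g g'. P (\<lambda>Y1 Y2 Y3. D Y3 (\<lambda>Y31 Y32. D Y31 (\<lambda>Y311 Y312.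
    ev4 (tensor_one H (Phi_inv H) \<odot>\<^sub>4 id_comult_id H (Phi_inv H)) (?K4 g g' Y1 Y2 Y311 Y312 Y32)))))"
    by (simp add: ev4_mult[where U=ground] ev4_leg[where U=ground] D_mult'[where U=ground] lins mult.assoc outer)
  also have "\<dots> = ?E"
  proof (rule ev_eqI, rule ev3_eqI, rule ev_eqI, rule ev_eqI, goal_cases)
    case (1 g g' Y1 Y2 Y3 Y31 Y32 Y311 Y312)
    \<comment> \<open>The \<alpha> between legs 1 and 2 absorbs the coproduct factor by which the
      product above differs from \<open>E4\<close>.\<close>
    have l: "D h (\<lambda>h1 h2. ?K4 g g' Y1 Y2 Y311 Y312 Y32 (h1 * a) (h2 * b) c d)
        = scl ground (\<epsilon> h) (?K4 g g' Y1 Y2 Y311 Y312 Y32 a b c d)" for h a b c d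
      using antip_alpha[of ground "\<lambda>z. D Y1 (\<lambda>m1 m2.
          B (S (a * Y2) * z * b * Y311) (S m2 * g * c * Y312) (S m1 * g' * d * Y32))" h]
      by (simp add: lins mult.assoc)
    show ?case
      unfolding tensor_one_id_comult_id_eq by (rule drop_left12[OF is_space_ground _ counital_Phi_inv _ l]) (intro lins)+
  qed
  finally show "ev3 ?L B = ev3 ?R B" using L by simp
qed (use flip_antip_closed in \<open>simp_all add: lins\<close>)

lemma tens_one: "tens21 (pure2 H 1 1) 1 = pure3 H 1 1 1" "tens12 1 (pure2 H 1 1) = pure3 H 1 1 1"
  by (simp_all add: tens21_def tens12_def ev2_pure[where U=H3] lins)

lemma leg_one3: "comult_id H (pure2 H 1 1) = pure3 H 1 1 1" "id_comult H (pure2 H 1 1) = pure3 H 1 1 1"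
  by (simp_all add: leg_pure2 comult_one tens_one)

lemma lin_leg [lins]:
  "lin X H2 f \<Longrightarrow> lin X H3 (\<lambda>x. comult_id H (f x))" "lin X H2 f \<Longrightarrow> lin X H3 (\<lambda>x. id_comult H (f x))"
  by (simp_all add: leg_eqs lins)

text \<open>A twist is determined by its value on \<open>\<alpha>\<close> once it intertwines with the antipode, so the two
  sides may be compared there, where they no longer involve \<open>\<beta>\<close>.\<close>

lemma twist_reassoc:
  "tens12 1 f2 \<odot>\<^sub>3 (id_comult H f2 \<odot>\<^sub>3 Phi H) = flip_antip S (Phi H) \<odot>\<^sub>3 (tens21 f2 1 \<odot>\<^sub>3 comult_id H f2)"
    (is "?F1 = ?F2")
proof -
  note [lins] = flip_antip_closed
  \<comment> \<open>\<open>?G\<close> is the coproduct into three legs and \<open>?s\<close>,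
    defined through \<open>sbar\<close>, its antipode. Both candidates are shown to intertwine them
    before they are compared at \<alpha>.\<close>
  let ?G = "\<lambda>h. comult_id H (\<Delta> h)" and ?O = "flip_antip S (Phi H)"
  let ?s = "\<lambda>h. D h (\<lambda>h1 h2. tens12 (S h2) (sbar h1))"
  have Gm: "?G (x * y) = ?G x \<odot>\<^sub>3 ?G y" for x y by (simp add: comult_mult tens_mult lins)
  have [lins]: "?F1 \<in> carr H3" "?F2 \<in> carr H3" "?s h \<in> carr H3" for h by (simp_all add: lins)
  have F1: "?F1 \<odot>\<^sub>3 ?G (S h) = ?s h \<odot>\<^sub>3 ?F1" for h
  proof -
    have t: "tens12 1 f2 \<odot>\<^sub>3 id_comult H (sbar h) = ?s h \<odot>\<^sub>3 tens12 1 f2"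
      by (simp add: sbar_eq[of h] id_comult_ev lins leg_pure2 mult3_ev_right mult3_ev_left tens_mult twist_comult_antip)
    have "?F1 \<odot>\<^sub>3 ?G (S h) = tens12 1 f2 \<odot>\<^sub>3 (id_comult H f2 \<odot>\<^sub>3 (id_comult H (\<Delta> (S h)) \<odot>\<^sub>3 Phi H))"
      by (simp add: mult3_assoc lins coassoc_mult(1))
    also have "\<dots> = tens12 1 f2 \<odot>\<^sub>3 (id_comult H (f2 \<odot>\<^sub>2 \<Delta> (S h)) \<odot>\<^sub>3 Phi H)"
      by (simp add: mult3_assoc lins tens_mult)
    also have "\<dots> = tens12 1 f2 \<odot>\<^sub>3 id_comult H (sbar h) \<odot>\<^sub>3 (id_comult H f2 \<odot>\<^sub>3 Phi H)"
      by (simp add: twist_comult_antip mult3_assoc lins tens_mult)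
    also have "\<dots> = ?s h \<odot>\<^sub>3 ?F1" unfolding t by (simp add: mult3_assoc lins)
    finally show ?thesis .
  qed
  have F2: "?F2 \<odot>\<^sub>3 ?G (S h) = ?s h \<odot>\<^sub>3 ?F2" for h
  proof -
    let ?r = "D h (\<lambda>h1 h2. tens21 (sbar h2) (S h1))"
    have [lins]: "?r \<in> carr H3" by (simp add: lins)
    have t: "tens21 f2 1 \<odot>\<^sub>3 comult_id H (sbar h) = ?r \<odot>\<^sub>3 tens21 f2 1"
      by (simp add: sbar_eq[of h] comult_id_ev lins leg_pure2 mult3_ev_right mult3_ev_left tens_mult twist_comult_antip)
    have u: "?O \<odot>\<^sub>3 ?r = ?s h \<odot>\<^sub>3 ?O"
    proof (rule tensor3_eqI)
      fix B :: "'h \<Rightarrow> 'h \<Rightarrow> 'h \<Rightarrow> 'k" assume B: "trilin ground B"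
      note [lins] = lin_tri[OF B]
      note e = ev3_mult[where U=ground] ev3_flip_S[where U=ground] ev_evs[where U=ground] ev3_tens[where U=ground]
        ev_sbar[where U=ground] B lins outer mult.assoc
      have "ev3 (?O \<odot>\<^sub>3 ?r) B = P (\<lambda>X1 X2 X3. D h (\<lambda>h1 h2. D h2 (\<lambda>h21 h22.
          (\<lambda>a b c. B (S c) (S b) (S a)) (h1 * X1) (h21 * X2) (h22 * X3))))"
        by (simp add: e)
      also have "\<dots> = P (\<lambda>X1 X2 X3. D h (\<lambda>h1 h2. D h1 (\<lambda>h11 h12.
          (\<lambda>a b c. B (S c) (S b) (S a)) (X1 * h11) (X2 * h12) (X3 * h2))))"
        by (rule coassoc_P[where U=ground and F="\<lambda>a b c. B (S c) (S b) (S a)"]) (intro lins)+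
      also have "\<dots> = ev3 (?s h \<odot>\<^sub>3 ?O) B" by (simp add: e)
      finally show "ev3 (?O \<odot>\<^sub>3 ?r) B = ev3 (?s h \<odot>\<^sub>3 ?O) B" .
    qed (intro lins)+
    have "?F2 \<odot>\<^sub>3 ?G (S h) = ?O \<odot>\<^sub>3 (tens21 f2 1 \<odot>\<^sub>3 comult_id H (f2 \<odot>\<^sub>2 \<Delta> (S h)))"
      by (simp add: mult3_assoc lins tens_mult)
    also have "\<dots> = ?O \<odot>\<^sub>3 (tens21 f2 1 \<odot>\<^sub>3 comult_id H (sbar h) \<odot>\<^sub>3 comult_id H f2)"
      by (simp add: twist_comult_antip mult3_assoc lins tens_mult)
    also have "\<dots> = ?O \<odot>\<^sub>3 ?r \<odot>\<^sub>3 (tens21 f2 1 \<odot>\<^sub>3 comult_id H f2)" unfolding t by (simp add: mult3_assoc lins)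
    also have "\<dots> = ?s h \<odot>\<^sub>3 ?F2" unfolding u by (simp add: mult3_assoc lins)
    finally show ?thesis .
  qed
  have a: "?F1 \<odot>\<^sub>3 ?G \<alpha> = ?F2 \<odot>\<^sub>3 ?G \<alpha>"
  proof -
    have "?F1 \<odot>\<^sub>3 ?G \<alpha> = tens12 1 f2 \<odot>\<^sub>3 (id_comult H f2 \<odot>\<^sub>3 (id_comult H (\<Delta> \<alpha>) \<odot>\<^sub>3 Phi H))"
      by (simp add: mult3_assoc lins coassoc_mult(1))
    also have "\<dots> = tens12 1 f2 \<odot>\<^sub>3 (id_comult H (f2 \<odot>\<^sub>2 \<Delta> \<alpha>) \<odot>\<^sub>3 Phi H)"
      by (simp add: mult3_assoc lins tens_mult)
    also have "\<dots> = ?O \<odot>\<^sub>3 (tens21 f2 1 \<odot>\<^sub>3 comult_id H (f2 \<odot>\<^sub>2 \<Delta> \<alpha>))"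
      unfolding twist_comult_alpha by (rule gamma_reassoc)
    also have "\<dots> = ?F2 \<odot>\<^sub>3 ?G \<alpha>" by (simp add: mult3_assoc lins tens_mult)
    finally show ?thesis .
  qed
  \<comment> \<open>Multiplying F by the image under \<open>?G\<close> of the snake identity for
    \<Phi>\<inverse> returns F, while intertwining rewrites the sum so that F occurs only together
    with the image of \<alpha>.\<close>
  have *: "Q (\<lambda>x1 x2 x3. ?s x1 \<odot>\<^sub>3 (F \<odot>\<^sub>3 ?G \<alpha> \<odot>\<^sub>3 ?G (x2 * \<beta> * S x3))) = F"
    if [lins]: "F \<in> carr H3" and F: "\<And>h. F \<odot>\<^sub>3 ?G (S h) = ?s h \<odot>\<^sub>3 F" for F
  proof -
    have "Q (\<lambda>x1 x2 x3. F \<odot>\<^sub>3 ?G (S x1 * \<alpha> * x2 * \<beta> * S x3)) = F \<odot>\<^sub>3 ?G 1"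
      by (rule snake_Q[where U=H3]) (intro lins, assumption?)+
    moreover have "F \<odot>\<^sub>3 ?G (S x1 * \<alpha> * x2 * \<beta> * S x3) = ?s x1 \<odot>\<^sub>3 (F \<odot>\<^sub>3 ?G \<alpha> \<odot>\<^sub>3 ?G (x2 * \<beta> * S x3))" for x1 x2 x3
    proof -
      have "F \<odot>\<^sub>3 ?G (S x1 * \<alpha> * x2 * \<beta> * S x3) = F \<odot>\<^sub>3 ?G (S x1) \<odot>\<^sub>3 (?G \<alpha> \<odot>\<^sub>3 ?G (x2 * \<beta> * S x3))"
        by (simp only: Gm mult.assoc) (simp add: mult3_assoc lins)
      then show ?thesis unfolding F by (simp add: mult3_assoc lins)
    qed
    ultimately show ?thesis by (simp add: comult_one leg_one3 mult3_one lins)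
  qed
  have "?F1 \<in> carr H3" "?F2 \<in> carr H3" by (intro lins)+
  from *[OF this(1) F1] *[OF this(2) F2] show ?thesis unfolding a by (rule trans[OF sym])
qed

section \<open>Twists adapted to S and to its inverse\<close>

definition flip2 :: "('h \<Rightarrow> 'h) \<Rightarrow> ('k, 'h, 'h) tensor \<Rightarrow> ('k, 'h, 'h) tensor" where
  "flip2 s t = ev H H t (\<lambda>a b. pure2 H (s b) (s a))"

text \<open>The left dual uses \<open>(S, f)\<close>, the right dual uses \<open>S\<inverse>\<close> together with
  \<open>S\<inverse>(f\<^sup>2) \<otimes> S\<inverse>(f\<^sup>1)\<close>; both are instances of the following notion.\<close>

definition antipodal_twist :: "('h \<Rightarrow> 'h) \<Rightarrow> ('h \<Rightarrow> 'h) \<Rightarrow> ('k, 'h, 'h) tensor \<Rightarrow> ('k, 'h, 'h) tensor \<Rightarrow> bool" where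
  "antipodal_twist s r f g \<longleftrightarrow> lin H H s \<and> (\<forall>x y. s (x * y) = s y * s x) \<and> s 1 = 1 \<and> (\<forall>x. s (r x) = x) \<and> (\<forall>x. r (s x) = x) \<and>
     f \<in> carr H2 \<and> g \<in> carr H2 \<and> f \<odot>\<^sub>2 g = pure2 H 1 1 \<and> g \<odot>\<^sub>2 f = pure2 H 1 1 \<and>
     (\<forall>h. f \<odot>\<^sub>2 \<Delta> (s h) = flip2 s (\<Delta> h) \<odot>\<^sub>2 f) \<and>
     tens12 1 f \<odot>\<^sub>3 (id_comult H f \<odot>\<^sub>3 Phi H) = flip_antip s (Phi H) \<odot>\<^sub>3 (tens21 f 1 \<odot>\<^sub>3 comult_id H f)"

lemma antipodal_twist_left: "antipodal_twist S T f2 g2"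
  unfolding antipodal_twist_def
  using twist_reassoc by (simp add: lin_H_antip lins twist_inverse twist_comult_antip flip2_def flip: sbar_eq)

lemma lin_flip [lins]:
  "lin X H3 f \<Longrightarrow> lin X H3 (\<lambda>x. flip_antip T (f x))"
  by (simp add: flip_antip_def lins)

lemma flip_closed [lins]:
  "t \<in> carr H2 \<Longrightarrow> flip2 s t \<in> carr H2" "u \<in> carr H3 \<Longrightarrow> flip_antip s u \<in> carr H3"
  by (simp_all add: flip2_def flip_antip_def lins)

lemma ev2_flip2:
  assumes U [lins]: "is_space U" and F: "bilin H H U F" and [lins]: "t \<in> carr H2"
  shows "ev H H (flip2 s t) F = ev H H t (\<lambda>a b. F (s b) (s a))"
  by (simp add: flip2_def ev_evs[where U=U] F lins ev2_pure[where U=U])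

lemma ev3_flip_antip:
  assumes U [lins]: "is_space U" and F: "trilin U F" and [lins]: "t \<in> carr H3"
  shows "ev3 (flip_antip s t) F = ev3 t (\<lambda>a b c. F (s c) (s b) (s a))"
  by (simp add: flip_antip_def ev_evs[where U=U] F lins ev3_pure[where U=U])

lemma flip2_mult:
  assumes [lins]: "u \<in> carr H2" "v \<in> carr H2"
  shows "flip2 T (u \<odot>\<^sub>2 v) = flip2 T v \<odot>\<^sub>2 flip2 T u"
proof (rule tensor2_eqI)
  fix B assume B: "bilin H H ground B"
  note [lins] = lin_bi[OF B]
  note e = ev2_mult[where U=ground] ev2_flip2[where U=ground] B lins
  have "ev H H (flip2 T (u \<odot>\<^sub>2 v)) B = ev H H u (\<lambda>a b. ev H H v (\<lambda>a' b'. B (T b' * T b) (T a' * T a)))" by (simp add: e)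
  also have "\<dots> = ev H H v (\<lambda>a' b'. ev H H u (\<lambda>a b. B (T b' * T b) (T a' * T a)))" by (rule ev_swap)
  also have "\<dots> = ev H H (flip2 T v \<odot>\<^sub>2 flip2 T u) B" by (simp add: e)
  finally show "ev H H (flip2 T (u \<odot>\<^sub>2 v)) B = ev H H (flip2 T v \<odot>\<^sub>2 flip2 T u) B" .
qed (intro lins)+

lemma flip_antip_mult:
  assumes s: "lin H H s" and m: "\<And>x y. s (x * y) = s y * s x"
    and [lins]: "u \<in> carr H3" "v \<in> carr H3"
  shows "flip_antip s (u \<odot>\<^sub>3 v) = flip_antip s v \<odot>\<^sub>3 flip_antip s u"
proof (rule tensor3_eqI)
  fix B :: "'h \<Rightarrow> 'h \<Rightarrow> 'h \<Rightarrow> 'k" assume B: "trilin ground B"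
  note [lins] = lin_tri[OF B] lin_uni[OF s]
  note e = ev3_mult[where U=ground] ev3_flip_antip[where U=ground] B lins m
  have "ev3 (flip_antip s (u \<odot>\<^sub>3 v)) B = ev3 u (\<lambda>a b c. ev3 v (\<lambda>a' b' c'. B (s c' * s c) (s b' * s b) (s a' * s a)))" by (simp add: e)
  also have "\<dots> = ev3 v (\<lambda>a' b' c'. ev3 u (\<lambda>a b c. B (s c' * s c) (s b' * s b) (s a' * s a)))" by (rule swap_ev3_ev3)
  also have "\<dots> = ev3 (flip_antip s v \<odot>\<^sub>3 flip_antip s u) B" by (simp add: e)
  finally show "ev3 (flip_antip s (u \<odot>\<^sub>3 v)) B = ev3 (flip_antip s v \<odot>\<^sub>3 flip_antip s u) B" .
qed (intro lins)+

lemma flip2_pure: "flip2 T (pure2 H a b) = pure2 H (T b) (T a)"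
  by (simp add: flip2_def ev2_pure[where U=H2] lins)

lemma flip2_ev: "t \<in> carr H2 \<Longrightarrow> (\<And>a b. F a b \<in> carr H2) \<Longrightarrow> flip2 T (ev H H t F) = ev H H t (\<lambda>a b. flip2 T (F a b))"
  by (simp add: flip2_def ev_evs[where U=H2] lins)

lemma flip_antip_ev: "t \<in> carr H2 \<Longrightarrow> (\<And>a b. F a b \<in> carr H3) \<Longrightarrow> flip_antip T (ev H H t F) = ev H H t (\<lambda>a b. flip_antip T (F a b))"
  by (simp add: flip_antip_def ev_evs[where U=H3] lins)

lemma flip_antip_tens:
  assumes [lins]: "u \<in> carr H2"
  shows "flip_antip T (tens21 u b) = tens12 (T b) (flip2 T u)" "flip_antip T (tens12 a u) = tens21 (flip2 T u) (T a)"
  by (simp_all add: flip_antip_def flip2_def tens21_def tens12_def ev_evs[where U=H3] lins ev3_pure[where U=H3] ev2_pure[where U=H3])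

text \<open>Applying S\<inverse> to all legs and reversing them is anti-multiplicative and undoes
  the reversal by S. It therefore carries the identities for f to identities for the reversed twist,
  with the factors in the opposite order.\<close>

lemma antipodal_twist_right: "antipodal_twist T S (flip2 T f2) (flip2 T g2)"
proof -
  let ?f = "flip2 T f2"
  have i: "?f \<odot>\<^sub>2 \<Delta> (T h) = flip2 T (\<Delta> h) \<odot>\<^sub>2 ?f" for h
  proof -
    have "flip2 T (sbar (T h)) = \<Delta> (T h)"
      by (simp add: sbar_eq flip2_ev lins flip2_pure) (simp add: pure2_def[abs_def] ev_pure_self lins)
    then show ?thesis
      using flip2_mult[of f2 "\<Delta> (S (T h))"] flip2_mult[of "sbar (T h)" f2] by (simp add: twist_comult_antip[of "T h", simplified] lins)
  qed
  \<comment> \<open>The reversed coproducts of f come out on the wrong side of the reversed twist.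
    The intertwining \<open>i\<close>, applied leg by leg, moves them across here and in
    \<open>d\<close>.\<close>
  have c: "flip_antip T (id_comult H f2) \<odot>\<^sub>3 tens21 ?f 1 = tens21 ?f 1 \<odot>\<^sub>3 comult_id H ?f"
    unfolding flip2_def[of T f2, THEN arg_cong, of "comult_id H"]
    by (simp add: id_comult_tens comult_id_ev flip_antip_ev flip_antip_tens mult3_ev_left mult3_ev_right tens_mult lins leg_pure2 i)
  have d: "flip_antip T (comult_id H f2) \<odot>\<^sub>3 tens12 1 ?f = tens12 1 ?f \<odot>\<^sub>3 id_comult H ?f"
    unfolding flip2_def[of T f2, THEN arg_cong, of "id_comult H"]
    by (simp add: comult_id_tens id_comult_ev flip_antip_ev flip_antip_tens mult3_ev_left mult3_ev_right tens_mult lins leg_pure2 i)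
  note m = flip_antip_mult[of T, OF lin_H_T T_mult]
  have p: "flip_antip T (flip_antip S (Phi H)) = Phi H"
    by (rule tensor3_eqI) (simp_all add: lins ev3_flip_antip[where U=ground] lin_tri trilin_def)
  have "flip_antip T (tens12 1 f2 \<odot>\<^sub>3 (id_comult H f2 \<odot>\<^sub>3 Phi H))
      = flip_antip T (flip_antip S (Phi H) \<odot>\<^sub>3 (tens21 f2 1 \<odot>\<^sub>3 comult_id H f2))"
    by (simp only: twist_reassoc)
  then have "flip_antip T (Phi H) \<odot>\<^sub>3 (flip_antip T (id_comult H f2) \<odot>\<^sub>3 tens21 ?f 1)
      = flip_antip T (comult_id H f2) \<odot>\<^sub>3 tens12 1 ?f \<odot>\<^sub>3 Phi H"
    by (simp add: m lins flip_antip_tens p mult3_assoc)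
  then have r: "tens12 1 ?f \<odot>\<^sub>3 (id_comult H ?f \<odot>\<^sub>3 Phi H) = flip_antip T (Phi H) \<odot>\<^sub>3 (tens21 ?f 1 \<odot>\<^sub>3 comult_id H ?f)"
    by (simp add: c d mult3_assoc lins)
  have "?f \<odot>\<^sub>2 flip2 T g2 = pure2 H 1 1" "flip2 T g2 \<odot>\<^sub>2 ?f = pure2 H 1 1"
    by (simp_all add: twist_inverse lins flip2_pure flip: flip2_mult)
  then show ?thesis by (simp add: antipodal_twist_def lin_H_T lins i r)
qed

end

section \<open>Yetter-Drinfeld modules\<close>

definition multilin3 where
  "multilin3 V W X U G \<longleftrightarrow> (\<forall>w\<in>carr W. \<forall>x\<in>carr X. lin V U (\<lambda>v. G v w x)) \<and>
     (\<forall>v\<in>carr V. \<forall>x\<in>carr X. lin W U (\<lambda>w. G v w x)) \<and> (\<forall>v\<in>carr V. \<forall>w\<in>carr W. lin X U (\<lambda>x. G v w x))"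

lemma multilin3I [lins]:
  "(\<And>w x. w \<in> carr W \<Longrightarrow> x \<in> carr X \<Longrightarrow> lin V U (\<lambda>v. G v w x)) \<Longrightarrow>
   (\<And>v x. v \<in> carr V \<Longrightarrow> x \<in> carr X \<Longrightarrow> lin W U (\<lambda>w. G v w x)) \<Longrightarrow>
   (\<And>v w. v \<in> carr V \<Longrightarrow> w \<in> carr W \<Longrightarrow> lin X U (\<lambda>x. G v w x)) \<Longrightarrow> multilin3 V W X U G"
  by (simp add: multilin3_def)

lemma multilin3_lin:
  assumes "multilin3 V W X U G"
  shows "w \<in> carr W \<Longrightarrow> x \<in> carr X \<Longrightarrow> lin Y V f \<Longrightarrow> lin Y U (\<lambda>y. G (f y) w x)"
    "v \<in> carr V \<Longrightarrow> x \<in> carr X \<Longrightarrow> lin Y W f' \<Longrightarrow> lin Y U (\<lambda>y. G v (f' y) x)"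
    "v \<in> carr V \<Longrightarrow> w \<in> carr W \<Longrightarrow> lin Y X f'' \<Longrightarrow> lin Y U (\<lambda>y. G v w (f'' y))"
  using assms by (auto simp: multilin3_def intro: lin_comp)

context quasi_hopf_algebra
begin

text \<open>\<open>ac\<close> is the action with junk arguments mapped to \<open>0\<close>, so that its values always lie in the
  module and the module laws hold without membership conditions under binders.\<close>

definition ac :: "('k, 'h, 'm::ab_group_add) ydm \<Rightarrow> 'h \<Rightarrow> 'm \<Rightarrow> 'm" where
  "ac M h m = act M h (if m \<in> carr M then m else 0)"

abbreviation "C M m \<equiv> ev H M (coact M m)"

lemma left_module_space [lins]: "left_module H M \<Longrightarrow> is_space M"
  by (simp add: left_module_def)

lemma yd_left_module [lins]: "yd_module H M \<Longrightarrow> left_module H M"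
  by (simp add: yd_module_def)

text \<open>A module with a linear coaction, without the Yetter-Drinfeld axioms. This much is
  established for tensor products and duals, and it provides the closure facts that the morphism
  conditions call for.\<close>

definition premodule :: "('k, 'h, 'm::ab_group_add) ydm \<Rightarrow> bool" where
  "premodule M \<longleftrightarrow> left_module H M \<and> lin M (tensor_space H M) (coact M)"

lemma premodule_left [lins]: "premodule M \<Longrightarrow> left_module H M"
  by (simp add: premodule_def)

lemma yd_premodule [lins]: "yd_module H M \<Longrightarrow> premodule M"
  by (simp add: premodule_def yd_module_def)

lemma ac_eq: "m \<in> carr M \<Longrightarrow> ac M h m = act M h m"
  by (simp add: ac_def)

lemma act_closed: "left_module H M \<Longrightarrow> m \<in> carr M \<Longrightarrow> act M h m \<in> carr M"
  by (auto simp: left_module_def bilin_def lin_def)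

lemma ac_closed [lins]: "left_module H M \<Longrightarrow> ac M h m \<in> carr M"
  by (simp add: ac_def act_closed is_space_zero[OF left_module_space])

lemma ac_ac [simp]: "left_module H M \<Longrightarrow> ac M h (ac M k m) = ac M (h * k) m"
  using ac_closed[of M k m] is_space_zero[OF left_module_space, of M]
  by (auto simp: ac_def left_module_def)

lemma ac_one: "left_module H M \<Longrightarrow> m \<in> carr M \<Longrightarrow> ac M 1 m = m"
  by (simp add: ac_def left_module_def)

lemma lin_ac [lins]:
  "left_module H M \<Longrightarrow> lin V H f \<Longrightarrow> lin V M (\<lambda>x. ac M (f x) m)"
  "left_module H M \<Longrightarrow> lin V M g \<Longrightarrow> lin V M (\<lambda>x. ac M h (g x))"
proof -
  assume M: "left_module H M"
  then have b: "bilin H M M (act M)" by (simp add: left_module_def)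
  show "lin V M (\<lambda>x. ac M (f x) m)" if "lin V H f"
    unfolding ac_def using is_space_zero[OF left_module_space[OF M]] by (intro bilin_lin1[OF b] that) simp
  have "lin M M (\<lambda>m. ac M h m)"
    using bilin_lin2[OF b _ lin_ident, of h] is_space_add[OF left_module_space[OF M]] is_space_scl[OF left_module_space[OF M]]
    by (simp add: lin_def ac_def)
  then show "lin V M (\<lambda>x. ac M h (g x))" if "lin V M g"
    using that by (rule lin_comp[rotated])
qed

lemma lin_coact [lins]: "premodule M \<Longrightarrow> lin V M f \<Longrightarrow> lin V (tensor_space H M) (\<lambda>x. coact M (f x))"
  by (rule lin_comp[of V M f]) (simp_all add: premodule_def)

lemma coact_closed [lins]: "premodule M \<Longrightarrow> m \<in> carr M \<Longrightarrow> coact M m \<in> carr (tensor_space H M)"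
  by (rule lin_closed[of M]) (simp_all add: premodule_def)

lemma C_cong:
  "premodule M \<Longrightarrow> m \<in> carr M \<Longrightarrow> (\<And>a m0. m0 \<in> carr M \<Longrightarrow> F a m0 = G a m0) \<Longrightarrow> C M m F = C M m G"
  by (rule ev_cong) (simp_all add: lins)

text \<open>The axioms are tested on forms, with module elements written as \<open>ac M k m\<close>.
  The acting element absorbs whatever multiplies it, and \<open>ac M 1\<close> keeps this shape
  after a rewriting, so the identities apply under binders.\<close>

lemma YD2:
  assumes M: "yd_module H M" and G: "lin M U G"
  shows "C M (ac M k m) (\<lambda>a m0. scl U (\<epsilon> a) (G (ac M 1 m0))) = G (ac M k m)"
proof -
  note [lins] = M
  have "C M (ac M k m) (\<lambda>a m0. scl M (\<epsilon> a) m0) = ac M k m"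
    using M ac_closed[OF yd_left_module[OF M], of k m] unfolding yd_module_def by (simp add: ev_def)
  then have "G (ac M k m) = G (C M (ac M k m) (\<lambda>a m0. scl M (\<epsilon> a) m0))" by simp
  also have "\<dots> = C M (ac M k m) (\<lambda>a m0. G (scl M (\<epsilon> a) m0))"
    by (rule lin_ev_apply[OF _ _ G]) (simp_all add: lins is_space_scl)
  also have "\<dots> = C M (ac M k m) (\<lambda>a m0. scl U (\<epsilon> a) (G (ac M 1 m0)))"
    by (rule C_cong) (simp_all add: lins lin_scl[OF G] ac_one)
  finally show ?thesis by simp
qed

lemma YD3:
  assumes M: "yd_module H M" and U: "is_space U" and G: "bilin H M U G"
  shows "D h (\<lambda>h1 h2. C M (ac M k m) (\<lambda>a m0. G (h1 * a) (ac M h2 m0)))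
       = D h (\<lambda>h1 h2. C M (ac M (h1 * k) m) (\<lambda>a m0. G (a * h2) (ac M 1 m0)))"
proof -
  note [lins] = M U
  let ?m = "ac M k m"
  have m: "?m \<in> carr M" by (simp add: lins)
  have "D h (\<lambda>h1 h2. C M ?m (\<lambda>a m0. pure H M (h1 * a) (act M h2 m0)))
      = D h (\<lambda>h1 h2. C M (act M h1 ?m) (\<lambda>a m0. pure H M (a * h2) m0))"
    using M m unfolding yd_module_def by (simp add: sw_evs) (simp add: ev_def)
  from arg_cong[OF this, of "\<lambda>t. ev H M t G"]
  have "D h (\<lambda>h1 h2. C M ?m (\<lambda>a m0. ev H M (pure H M (h1 * a) (act M h2 m0)) G))
      = D h (\<lambda>h1 h2. C M (act M h1 ?m) (\<lambda>a m0. ev H M (pure H M (a * h2) m0) G))"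
    by (simp add: ev_ev[OF is_space_H U G] lins ev_closed[OF is_space_H is_space_tensor] pure_in_tensor act_closed)
  moreover have "C M ?m (\<lambda>a m0. ev H M (pure H M (h1 * a) (act M h2 m0)) G) = C M ?m (\<lambda>a m0. G (h1 * a) (ac M h2 m0))" for h1 h2
    by (rule C_cong[OF yd_premodule[OF M] m]) (simp add: ev_pure[OF is_space_H U G] act_closed lins ac_eq)
  moreover have "C M (act M h1 ?m) (\<lambda>a m0. ev H M (pure H M (a * h2) m0) G) = C M (ac M (h1 * k) m) (\<lambda>a m0. G (a * h2) (ac M 1 m0))" for h1 h2
  proof -
    have "act M h1 ?m = ac M (h1 * k) m" using m by (simp add: lins flip: ac_eq)
    then show ?thesis by (simp, intro C_cong[OF yd_premodule[OF M]]) (simp_all add: ev_pure[OF is_space_H U G] lins ac_one)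
  qed
  ultimately show ?thesis by simp
qed

lemma YD1:
  assumes M: "yd_module H M" and U: "is_space U" and G: "multilin3 H H M U G"
  shows "P (\<lambda>X1 X2 X3. C M (ac M k m) (\<lambda>a m0. C M (ac M X2 m0) (\<lambda>b m1. G (X1 * a) (b * X3) (ac M 1 m1))))
       = P (\<lambda>X1 X2 X3. P (\<lambda>Y1 Y2 Y3. C M (ac M (Y1 * k) m) (\<lambda>a m0. D a (\<lambda>a1 a2. G (X1 * a1 * Y2) (X2 * a2 * Y3) (ac M X3 m0)))))"
proof -
  note [lins] = M U
  note [lins] = multilin3_lin[OF G]
  let ?m = "ac M k m" and ?HM = "tensor_space H M"
  have m: "?m \<in> carr M" by (simp add: lins)
  let ?p = "\<lambda>a b n. pure H ?HM a (pure H M b n)" and ?E = "\<lambda>t. ev H ?HM t (\<lambda>a u. ev H M u (G a))"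
  have E: "lin (tensor_space H ?HM) U ?E" by (simp add: lins)
  have Ep: "?E (?p a b n) = G a b n" if "n \<in> carr M" for a b n
    using that by (subst ev_pure[OF is_space_H U]) (simp_all add: lins ev_pure[OF is_space_H U] pure_in_tensor)
  have "P (\<lambda>X1 X2 X3. C M ?m (\<lambda>a m0. C M (act M X2 m0) (\<lambda>b m1. ?p (X1 * a) (b * X3) m1)))
      = P (\<lambda>X1 X2 X3. P (\<lambda>Y1 Y2 Y3. C M (act M Y1 ?m) (\<lambda>a m0. D a (\<lambda>a1 a2. ?p (X1 * a1 * Y2) (X2 * a2 * Y3) (act M X3 m0)))))"
    using M m unfolding yd_module_def by (simp add: sw_evs) (simp add: ev_def)
  from arg_cong[OF this, of ?E]
  have "P (\<lambda>X1 X2 X3. ?E (C M ?m (\<lambda>a m0. C M (act M X2 m0) (\<lambda>b m1. ?p (X1 * a) (b * X3) m1))))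
      = P (\<lambda>X1 X2 X3. P (\<lambda>Y1 Y2 Y3. ?E (C M (act M Y1 ?m) (\<lambda>a m0. D a (\<lambda>a1 a2. ?p (X1 * a1 * Y2) (X2 * a2 * Y3) (act M X3 m0))))))"
    by (simp add: lin_ev3_apply[OF is_space_tensor E] lins ev_closed[OF _ is_space_tensor] pure_in_tensor act_closed)
  moreover have "?E (C M ?m (\<lambda>a m0. C M (act M X2 m0) (\<lambda>b m1. ?p (X1 * a) (b * X3) m1)))
      = C M ?m (\<lambda>a m0. C M (ac M X2 m0) (\<lambda>b m1. G (X1 * a) (b * X3) (ac M 1 m1)))" for X1 X2 X3
  proof -
    have "?E (C M ?m (\<lambda>a m0. C M (act M X2 m0) (\<lambda>b m1. ?p (X1 * a) (b * X3) m1)))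
        = C M ?m (\<lambda>a m0. ?E (C M (act M X2 m0) (\<lambda>b m1. ?p (X1 * a) (b * X3) m1)))"
      by (rule lin_ev_apply[OF _ is_space_tensor E]) (simp_all add: lins ev_closed[OF _ is_space_tensor] pure_in_tensor act_closed)
    also have "\<dots> = C M ?m (\<lambda>a m0. C M (ac M X2 m0) (\<lambda>b m1. G (X1 * a) (b * X3) (ac M 1 m1)))"
    proof (rule C_cong[OF yd_premodule[OF M] m])
      fix a m0 assume m0: "m0 \<in> carr M"
      have "?E (C M (act M X2 m0) (\<lambda>b m1. ?p (X1 * a) (b * X3) m1)) = C M (act M X2 m0) (\<lambda>b m1. ?E (?p (X1 * a) (b * X3) m1))"
        by (rule lin_ev_apply[OF _ is_space_tensor E]) (simp_all add: lins m0 pure_in_tensor act_closed)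
      also have "\<dots> = C M (ac M X2 m0) (\<lambda>b m1. G (X1 * a) (b * X3) (ac M 1 m1))"
        unfolding ac_eq[OF m0] by (rule C_cong[OF yd_premodule[OF M]]) (simp_all add: lins m0 act_closed Ep ac_one)
      finally show "?E (C M (act M X2 m0) (\<lambda>b m1. ?p (X1 * a) (b * X3) m1))
          = C M (ac M X2 m0) (\<lambda>b m1. G (X1 * a) (b * X3) (ac M 1 m1))" .
    qed
    finally show ?thesis .
  qed
  moreover have "?E (C M (act M Y1 ?m) (\<lambda>a m0. D a (\<lambda>a1 a2. ?p (X1 * a1 * Y2) (X2 * a2 * Y3) (act M X3 m0))))
      = C M (ac M (Y1 * k) m) (\<lambda>a m0. D a (\<lambda>a1 a2. G (X1 * a1 * Y2) (X2 * a2 * Y3) (ac M X3 m0)))" for X1 X2 X3 Y1 Y2 Y3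
  proof -
    have y: "act M Y1 ?m = ac M (Y1 * k) m" using m by (simp add: lins flip: ac_eq)
    have "?E (C M (act M Y1 ?m) (\<lambda>a m0. D a (\<lambda>a1 a2. ?p (X1 * a1 * Y2) (X2 * a2 * Y3) (act M X3 m0))))
        = C M (act M Y1 ?m) (\<lambda>a m0. ?E (D a (\<lambda>a1 a2. ?p (X1 * a1 * Y2) (X2 * a2 * Y3) (act M X3 m0))))"
      by (rule lin_ev_apply[OF _ is_space_tensor E]) (simp_all add: lins y ev_closed[OF _ is_space_tensor] pure_in_tensor act_closed)
    also have "\<dots> = C M (ac M (Y1 * k) m) (\<lambda>a m0. D a (\<lambda>a1 a2. G (X1 * a1 * Y2) (X2 * a2 * Y3) (ac M X3 m0)))"
      unfolding y
    proof (rule C_cong[OF yd_premodule[OF M]])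
      fix a m0 assume m0: "m0 \<in> carr M"
      show "?E (D a (\<lambda>a1 a2. ?p (X1 * a1 * Y2) (X2 * a2 * Y3) (act M X3 m0))) = D a (\<lambda>a1 a2. G (X1 * a1 * Y2) (X2 * a2 * Y3) (ac M X3 m0))"
        by (subst lin_ev2_apply[OF is_space_tensor E]) (simp_all add: lins m0 pure_in_tensor act_closed Ep ac_eq)
    qed (simp add: lins)
    finally show ?thesis .
  qed
  ultimately show ?thesis by simp
qed

text \<open>Two successive coactions of \<open>n\<close> sit on either side of \<alpha>.
  \<open>YD3\<close> moves the coproduct legs of \<open>x1\<close> out of the way,
  \<open>YD1\<close> merges the coactions into the coproduct of a single one, this contracts at
  \<alpha>, and \<open>YD2\<close> removes the counit. \<open>coform_coform_inv\<close> and
  \<open>coform_right_gamma\<close> both come down to this.\<close>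

lemma coact_core:
  assumes [lins]: "yd_module H N" and G: "multilin3 H H N ground G"
  shows "ev4 A4 (\<lambda>a b c d. Q (\<lambda>y1 y2 y3. C N (ac N 1 n) (\<lambda>e n0. C N (ac N b n0) (\<lambda>a' n1.
           G (S (y1 * a * e) * \<alpha> * (y2 * a' * c)) d (ac N y3 n1)))))
       = ev4 A4 (\<lambda>a b c d. G (S b * \<alpha> * c) d (ac N a n))"
proof -
  note [lins] = multilin3_lin[OF G]
  have 3: "D h (\<lambda>h1 h2. C N (ac N 1 n) (\<lambda>e n0. C N (ac N (X2 * h2) n0) (\<lambda>a' n1.
          G (S (h1 * e) * u * a' * v) w (ac N z n1))))
      = D h (\<lambda>h1 h2. C N (ac N h1 n) (\<lambda>e n0. C N (ac N X2 n0) (\<lambda>a' n1.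
          G (S (e * h2) * u * a' * v) w (ac N z n1))))" for h X2 u v w z
    using YD3[where U=ground and M=N and h=h and k=1 and m=n and G="\<lambda>x n0. C N (ac N X2 n0) (\<lambda>a' n1.
          G (S x * u * a' * v) w (ac N z n1))"] by (simp add: lins)
  have 1: "P (\<lambda>X1 X2 X3. C N (ac N k n) (\<lambda>e n0. C N (ac N X2 n0) (\<lambda>a' n1.
          G (r * S e * S X1 * u * a' * X3 * v) w (ac N z n1))))
      = P (\<lambda>X1 X2 X3. P (\<lambda>Y1 Y2 Y3. C N (ac N (Y1 * k) n) (\<lambda>e n0. D e (\<lambda>e1 e2.
          G (r * S Y2 * S e1 * S X1 * u * X2 * e2 * Y3 * v) w (ac N (z * X3) n0)))))" for k r u v w z
    using YD1[where U=ground and M=N and k=k and m=n and G="\<lambda>x y n0. G (r * S x * u * y * v) w (ac N z n0)"]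
    by (simp add: lins mult.assoc)
  have 4: "D e (\<lambda>e1 e2. G (r * S e1 * \<alpha> * e2 * v) w nn) = \<epsilon> e * G (r * \<alpha> * v) w nn" if "nn \<in> carr N" for e r v w nn
    using antip_alpha[where U=ground and h=e and G="\<lambda>z. G (r * z * v) w nn"] that by (simp add: lins mult.assoc)
  have 2: "C N (ac N k n) (\<lambda>e n0. \<epsilon> e * G v w (ac N 1 n0)) = G v w (ac N k n)" for k v w
    using YD2[where U=ground and M=N and k=k and m=n and G="G v w"] by (simp add: lins)
  have c: "P (\<lambda>X1 X2 X3. P (\<lambda>Y1 Y2 Y3. Q (\<lambda>y1 y2 y3. C N (ac N (Y1 * k) n) (\<lambda>e n0. D e (\<lambda>e1 e2.
          G (r * S Y2 * S e1 * S (y1 * X1) * \<alpha> * (y2 * X2) * e2 * Y3 * v) w (ac N (y3 * X3) n0))))))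
      = P (\<lambda>Y1 Y2 Y3. G (r * S Y2 * \<alpha> * Y3 * v) w (ac N (Y1 * k) n))" for k r v w
  proof -
    have "P (\<lambda>X1 X2 X3. P (\<lambda>Y1 Y2 Y3. Q (\<lambda>y1 y2 y3. C N (ac N (Y1 * k) n) (\<lambda>e n0. D e (\<lambda>e1 e2.
          G (r * S Y2 * S e1 * S (y1 * X1) * \<alpha> * (y2 * X2) * e2 * Y3 * v) w (ac N (y3 * X3) n0))))))
       = P (\<lambda>X1 X2 X3. Q (\<lambda>y1 y2 y3. P (\<lambda>Y1 Y2 Y3. C N (ac N (Y1 * k) n) (\<lambda>e n0. D e (\<lambda>e1 e2.
          G (r * S Y2 * S e1 * S (y1 * X1) * \<alpha> * (y2 * X2) * e2 * Y3 * v) w (ac N (y3 * X3) n0))))))"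
      by (intro ev3_eqI) (rule swap_ev3_ev3)
    also have "\<dots> = P (\<lambda>Y1 Y2 Y3. C N (ac N (Y1 * k) n) (\<lambda>e n0. D e (\<lambda>e1 e2.
          G (r * S Y2 * S e1 * S 1 * \<alpha> * 1 * e2 * Y3 * v) w (ac N 1 n0))))"
      by (subst P_Q(2)[where U=ground and F="\<lambda>y1 y2 y3. P (\<lambda>Y1 Y2 Y3. C N (ac N (Y1 * k) n) (\<lambda>e n0. D e (\<lambda>e1 e2.
          G (r * S Y2 * S e1 * S y1 * \<alpha> * y2 * e2 * Y3 * v) w (ac N y3 n0))))"]) (simp_all add: lins)
    also have "\<dots> = P (\<lambda>Y1 Y2 Y3. G (r * S Y2 * \<alpha> * Y3 * v) w (ac N (Y1 * k) n))"
      using 4[of "ac N 1 _" _ "r * S _" "_ * v"] by (simp add: lins mult.assoc 2)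
    finally show ?thesis .
  qed
  have "ev4 A4 (\<lambda>a b c d. Q (\<lambda>y1 y2 y3. C N (ac N 1 n) (\<lambda>e n0. C N (ac N b n0) (\<lambda>a' n1.
           G (S (y1 * a * e) * \<alpha> * (y2 * a' * c)) d (ac N y3 n1)))))
      = P (\<lambda>X1 X2 X3. Q (\<lambda>x1 x2 x3. Q (\<lambda>y1 y2 y3. D x1 (\<lambda>x11 x12. C N (ac N 1 n) (\<lambda>e n0. C N (ac N (X2 * x12) n0) (\<lambda>a' n1.
           G (S (x11 * e) * (S X1 * S y1 * \<alpha> * y2) * a' * (X3 * x2)) x3 (ac N y3 n1)))))))"
    by (simp add: ABDE_ev[where U=ground] lins mult.assoc swap_ev3)
  also have "\<dots> = P (\<lambda>X1 X2 X3. Q (\<lambda>x1 x2 x3. Q (\<lambda>y1 y2 y3. D x1 (\<lambda>x11 x12. C N (ac N x11 n) (\<lambda>e n0. C N (ac N X2 n0) (\<lambda>a' n1.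
           G (S (e * x12) * (S X1 * S y1 * \<alpha> * y2) * a' * (X3 * x2)) x3 (ac N y3 n1)))))))"
    unfolding 3 ..
  also have "\<dots> = Q (\<lambda>x1 x2 x3. Q (\<lambda>y1 y2 y3. D x1 (\<lambda>x11 x12. P (\<lambda>X1 X2 X3. C N (ac N x11 n) (\<lambda>e n0. C N (ac N X2 n0) (\<lambda>a' n1.
           G (S x12 * S e * S X1 * (S y1 * \<alpha> * y2) * a' * X3 * x2) x3 (ac N y3 n1)))))))"
    by (simp add: mult.assoc swap_ev3 swap_ev3_ev3[of "Phi_inv H" "Phi H"])
  also have "\<dots> = Q (\<lambda>x1 x2 x3. Q (\<lambda>y1 y2 y3. D x1 (\<lambda>x11 x12. P (\<lambda>X1 X2 X3. P (\<lambda>Y1 Y2 Y3. C N (ac N (Y1 * x11) n) (\<lambda>e n0. D e (\<lambda>e1 e2.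
           G (S x12 * S Y2 * S e1 * S X1 * (S y1 * \<alpha> * y2) * X2 * e2 * Y3 * x2) x3 (ac N (y3 * X3) n0))))))))"
    unfolding 1 ..
  also have "\<dots> = Q (\<lambda>x1 x2 x3. D x1 (\<lambda>x11 x12. P (\<lambda>X1 X2 X3. P (\<lambda>Y1 Y2 Y3. Q (\<lambda>y1 y2 y3. C N (ac N (Y1 * x11) n) (\<lambda>e n0. D e (\<lambda>e1 e2.
           G (S x12 * S Y2 * S e1 * S (y1 * X1) * \<alpha> * (y2 * X2) * e2 * Y3 * x2) x3 (ac N (y3 * X3) n0))))))))"
    by (simp add: mult.assoc swap_ev3 swap_ev3_ev3[of "Phi H" "Phi_inv H"])
  also have "\<dots> = ev4 A4 (\<lambda>a b c d. G (S b * \<alpha> * c) d (ac N a n))"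
    unfolding c by (simp add: ABDE_ev[where U=ground] lins mult.assoc swap_ev3 swap_ev3_ev3[of "Phi_inv H" "Phi H"])
  finally show ?thesis .
qed

end

section \<open>Transposition of forms along the braiding\<close>

locale yd_pair = quasi_hopf_algebra H for H :: "('k::field, 'h::ring_1) qhopf" +
  fixes M :: "('k, 'h, 'm::ab_group_add) ydm" and N :: "('k, 'h, 'n::ab_group_add) ydm"
  assumes yd_M: "yd_module H M" and yd_N: "yd_module H N"
begin

lemmas yd_modules [lins] = yd_M yd_N

lemmas C_out = ev_swap[of H H _ H N]

text \<open>Transposing a bilinear form along the braiding \<open>n \<otimes> m \<mapsto> n\<^sub>-\<^sub>1 \<cdot> m \<otimes> n\<^sub>0\<close>; both maps
  \<open>\<sigma>\<inverse>\<close> are \<open>coform\<close> followed by a twist.  \<open>coform_inv\<close> is the formula for \<open>\<sigma>\<^sup>*\<close> with \<open>f\<close> removed.\<close>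

definition coform :: "('m \<Rightarrow> 'n \<Rightarrow> 'k) \<Rightarrow> 'm \<Rightarrow> 'n \<Rightarrow> 'k" where
  "coform b m n = C N (ac N 1 n) (\<lambda>a n0. b (ac M a m) (ac N 1 n0))"

definition coform_inv :: "('m \<Rightarrow> 'n \<Rightarrow> 'k) \<Rightarrow> 'm \<Rightarrow> 'n \<Rightarrow> 'k" where
  "coform_inv b m n = Q (\<lambda>y1 y2 y3. D y3 (\<lambda>y31 y32. P (\<lambda>X1 X2 X3. Q (\<lambda>x1 x2 x3. C N (ac N x1 n) (\<lambda>a n0.
     b (ac M (y32 * X3 * T (S y1 * \<alpha> * y2 * X1 * a * x2 * \<beta> * S x3)) m) (ac N (y31 * X2) n0))))))"

text \<open>\<open>YD3\<close> carries the coproduct of \<open>y3\<close> past the second coaction,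
  \<open>YD1\<close> merges the two coactions, and the merged one contracts at the \<beta> of
  \<open>p_R\<close>. What is left is the cancellation of \<open>q_L\<close> against the
  \<open>p_L\<close> formed by the remaining copy of \<Phi>.\<close>

lemma coform_inv_coform:
  assumes b: "bilin M N ground b"
  shows "coform_inv (coform b) m n = b (ac M 1 m) (ac N 1 n)"
proof -
  note [lins] = bilin_lin1[OF b] bilin_lin2[OF b]
  have 3: "D h (\<lambda>h1 h2. C N (ac N (h1 * k) w) (\<lambda>a n1. b (ac M (a * (h2 * u)) m) (ac N 1 n1)))
      = D h (\<lambda>h1 h2. C N (ac N k w) (\<lambda>a n1. b (ac M (h1 * (a * u)) m) (ac N h2 n1)))" for h k u w
    using YD3[where U=ground and M=N and h=h and k=k and m=w and G="\<lambda>x w. b (ac M (x * u) m) (ac N 1 w)"]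
    by (simp add: lins mult.assoc)
  have 1: "P (\<lambda>X1 X2 X3. C N (ac N k n) (\<lambda>a n0. C N (ac N X2 n0) (\<lambda>a' n1.
          D h (\<lambda>h1 h2. b (ac M (h1 * a' * X3 * r * T a * T X1 * s) m) (ac N h2 n1)))))
      = P (\<lambda>X1 X2 X3. P (\<lambda>Z1 Z2 Z3. C N (ac N (Z1 * k) n) (\<lambda>a n0. D a (\<lambda>a1 a2.
          D h (\<lambda>h1 h2. b (ac M (h1 * X2 * a2 * Z3 * r * T Z2 * T a1 * T X1 * s) m) (ac N (h2 * X3) n0))))))" for k h r s
    using YD1[where U=ground and M=N and k=k and m=n
        and G="\<lambda>x y w. D h (\<lambda>h1 h2. b (ac M (h1 * y * r * T x * s) m) (ac N h2 w))"]
    by (simp add: lins mult.assoc)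
  have 4: "D a (\<lambda>a1 a2. D h (\<lambda>h1 h2. b (ac M (h1 * X * a2 * T \<beta> * T a1 * s) m) (ac N (h2 * Y) w)))
      = \<epsilon> a * D h (\<lambda>h1 h2. b (ac M (h1 * X * T \<beta> * s) m) (ac N (h2 * Y) w))" for a h X s Y w
    using antip_beta[where U=ground and h=a and G="\<lambda>z. D h (\<lambda>h1 h2. b (ac M (h1 * X * T z * s) m) (ac N (h2 * Y) w))"]
    by (simp add: lins mult.assoc)
  have 2: "C N (ac N 1 n) (\<lambda>a n0. \<epsilon> a * D h (\<lambda>h1 h2. b (ac M (h1 * u) m) (ac N (h2 * Y) n0)))
      = D h (\<lambda>h1 h2. b (ac M (h1 * u) m) (ac N (h2 * Y) n))" for h u Y
    using YD2[where U=ground and M=N and k=1 and m=n and G="\<lambda>w. D h (\<lambda>h1 h2. b (ac M (h1 * u) m) (ac N (h2 * Y) w))"]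
    by (simp add: lins)
  \<comment> \<open>The \<Phi> produced by \<open>YD1\<close> meets the \<Phi>\<inverse> of
    \<open>p_R\<close>; their cancellation brings the legs of \<open>a\<close> to either side of
    \<beta>.\<close>
  have c: "P (\<lambda>Z1 Z2 Z3. Q (\<lambda>x1 x2 x3. C N (ac N (Z1 * x1) n) (\<lambda>a n0. D a (\<lambda>a1 a2.
          D h (\<lambda>h1 h2. b (ac M (h1 * X * a2 * (Z3 * x3) * T \<beta> * T (Z2 * x2) * T a1 * s) m) (ac N (h2 * Y) n0))))))
      = D h (\<lambda>h1 h2. b (ac M (h1 * X * T \<beta> * s) m) (ac N (h2 * Y) n))" for h X s Y
    using P_Q(1)[where U=ground and F="\<lambda>z1 z2 z3. C N (ac N z1 n) (\<lambda>a n0. D a (\<lambda>a1 a2.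
          D h (\<lambda>h1 h2. b (ac M (h1 * X * a2 * z3 * T \<beta> * T z2 * T a1 * s) m) (ac N (h2 * Y) n0))))"]
    by (simp add: lins mult.assoc 4[simplified mult.assoc] 2)
  have "coform_inv (coform b) m n = Q (\<lambda>y1 y2 y3. P (\<lambda>X1 X2 X3. Q (\<lambda>x1 x2 x3. C N (ac N x1 n) (\<lambda>a n0. D y3 (\<lambda>y31 y32.
      C N (ac N (y31 * X2) n0) (\<lambda>a' n1.
      b (ac M (a' * (y32 * (X3 * (x3 * T \<beta> * T x2) * T a * T X1 * (T y2 * T \<alpha> * y1)))) m) (ac N 1 n1)))))))"
    by (simp add: coform_inv_def coform_def lins mult.assoc swap_ev3 C_out)
  also have "\<dots> = Q (\<lambda>y1 y2 y3. Q (\<lambda>x1 x2 x3. P (\<lambda>X1 X2 X3. C N (ac N x1 n) (\<lambda>a n0.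
      C N (ac N X2 n0) (\<lambda>a' n1. D y3 (\<lambda>y31 y32.
      b (ac M (y31 * a' * X3 * (x3 * T \<beta> * T x2) * T a * T X1 * (T y2 * T \<alpha> * y1)) m) (ac N y32 n1)))))))"
    unfolding 3 by (simp add: mult.assoc swap_ev3 C_out swap_ev3_ev3[of "Phi H" "Phi_inv H"])
  also have "\<dots> = Q (\<lambda>y1 y2 y3. P (\<lambda>X1 X2 X3. P (\<lambda>Z1 Z2 Z3. Q (\<lambda>x1 x2 x3. C N (ac N (Z1 * x1) n) (\<lambda>a n0. D a (\<lambda>a1 a2.
          D y3 (\<lambda>h1 h2. b (ac M (h1 * X2 * a2 * (Z3 * x3) * T \<beta> * T (Z2 * x2) * T a1 * (T X1 * T y2 * T \<alpha> * y1)) m) (ac N (h2 * X3) n0))))))))"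
    unfolding 1 by (simp add: mult.assoc outer)
  also have "\<dots> = Q (\<lambda>y1 y2 y3. P (\<lambda>X1 X2 X3. 
          D y3 (\<lambda>h1 h2. b (ac M (h1 * X2 * T \<beta> * (T X1 * T y2 * T \<alpha> * y1)) m) (ac N (h2 * X3) n))))"
    unfolding c ..
  also have "\<dots> = b (ac M 1 m) (ac N 1 n)"
    using qL_pL_cancel[where U=ground and G="\<lambda>x y. b (ac M x m) (ac N y n)"]
    by (simp add: lins mult.assoc outer)
  finally show ?thesis .
qed

text \<open>The composite is a form evaluated at \<open>E4\<close>. An \<alpha> absorbs one factor
  of it, \<open>YD3\<close> carries the middle coproduct past a coaction, and \<beta> absorbs the
  surplus factor of what has become \<open>A4\<close>. \<open>coact_core\<close> then removes the
  coactions and \<open>snake_A\<close> concludes.\<close>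

lemma coform_coform_inv:
  assumes b: "bilin M N ground b"
  shows "coform (coform_inv b) m n = b (ac M 1 m) (ac N 1 n)"
proof -
  note [lins] = bilin_lin1[OF b] bilin_lin2[OF b]
  let ?F = "\<lambda>p q r s. Q (\<lambda>x1 x2 x3. C N (ac N 1 n) (\<lambda>e n0. C N (ac N x1 n0) (\<lambda>a n1.
      b (ac M (s * x3 * T \<beta> * T x2 * T a * T q * T \<alpha> * p * e) m) (ac N r n1))))"
  have a: "D h (\<lambda>h1 h2. ?F (h1 * p) (h2 * q) r s) = scl ground (\<epsilon> h) (?F p q r s)" for h p q r s
    using antip_alpha[where U=ground and h=h and G="\<lambda>z. Q (\<lambda>x1 x2 x3. C N (ac N 1 n) (\<lambda>e n0. C N (ac N x1 n0) (\<lambda>a n1.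
      b (ac M (s * x3 * T \<beta> * T x2 * T a * T q * T z * p * e) m) (ac N r n1))))"]
    by (simp add: lins mult.assoc)
  let ?G = "\<lambda>p q r s. Q (\<lambda>u1 u2 u3. C N (ac N 1 n) (\<lambda>e n0. C N (ac N q n0) (\<lambda>a n1.
      b (ac M (s * T \<beta> * T r * T a * T u2 * T \<alpha> * u1 * p * e) m) (ac N u3 n1))))"
  have d: "D h (\<lambda>h1 h2. ?G p q (r * h1) (s * h2)) = scl ground (\<epsilon> h) (?G p q r s)" for h p q r s
    using antip_beta[where U=ground and h=h and G="\<lambda>z. Q (\<lambda>u1 u2 u3. C N (ac N 1 n) (\<lambda>e n0. C N (ac N q n0) (\<lambda>a n1.
      b (ac M (s * T z * T r * T a * T u2 * T \<alpha> * u1 * p * e) m) (ac N u3 n1))))"]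
    by (simp add: lins mult.assoc)
  have 3: "D h (\<lambda>h1 h2. C N (ac N k w) (\<lambda>a n1. b (ac M (r * T a * T h1 * s) m) (ac N (u * h2) n1)))
      = D h (\<lambda>h1 h2. C N (ac N (h1 * k) w) (\<lambda>a n1. b (ac M (r * T h2 * T a * s) m) (ac N u n1)))" for h k r s u w
    using YD3[where U=ground and M=N and h=h and k=k and m=w and G="\<lambda>x w. b (ac M (r * T x * s) m) (ac N u w)"]
    by (simp add: lins mult.assoc)
  have "coform (coform_inv b) m n = ev4 E4 ?F"
    by (simp add: ABDE_ev[where U=ground] coform_inv_def coform_def lins mult.assoc outer C_out)
  also have "\<dots> = ev4 (tensor_one H (Phi_inv H) \<odot>\<^sub>4 id_comult_id H (Phi_inv H)) ?F"
    unfolding E4_eq by (rule drop_left12[OF is_space_ground _ counital_Phi _ a]) (simp_all add: lins)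
  also have "\<dots> = Q (\<lambda>u1 u2 u3. Q (\<lambda>z1 z2 z3. Q (\<lambda>x1 x2 x3. C N (ac N 1 n) (\<lambda>e n0. D z2 (\<lambda>z21 z22. C N (ac N x1 n0) (\<lambda>a n1.
      b (ac M (z3 * x3 * T \<beta> * T x2 * T a * T z21 * (T u2 * T \<alpha> * u1 * z1 * e)) m) (ac N (u3 * z22) n1)))))))"
    by (simp add: ev4_mult[where U=ground] ev4_leg[where U=ground] lins mult.assoc outer C_out)
  also have "\<dots> = Q (\<lambda>z1 z2 z3. D z2 (\<lambda>z21 z22. Q (\<lambda>x1 x2 x3. ?G z1 (z21 * x1) (z22 * x2) (z3 * x3))))"
    unfolding 3
    by (simp add: mult.assoc swap_ev3 C_out) (rule trans[OF swap_ev3_ev3], rule ev3_eqI, rule swap_ev3_ev3)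
  also have "\<dots> = ev4 (id_comult_id H (Phi_inv H) \<odot>\<^sub>4 one_tensor H (Phi_inv H)) ?G"
    by (simp add: ev4_mult[where U=ground] ev4_leg[where U=ground] lins outer)
  also have "\<dots> = ev4 A4 ?G"
    unfolding id_comult_id_one_tensor_eq by (rule drop_right34[OF is_space_ground _ counital_Phi_inv _ d]) (simp_all add: lins)
  also have "\<dots> = ev4 A4 (\<lambda>a b' c d. b (ac M (d * T \<beta> * T (S b' * \<alpha> * c)) m) (ac N a n))"
    using coact_core[of N "\<lambda>x d w. b (ac M (d * T \<beta> * T x) m) (ac N 1 w)" n] by (simp add: lins mult.assoc)
  also have "\<dots> = b (ac M 1 m) (ac N 1 n)"
    using snake_A[where U=ground and G="\<lambda>x y. b (ac M (T y) m) (ac N x n)"] by (simp add: lins mult.assoc)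
  finally show ?thesis .
qed

end

context quasi_hopf_algebra
begin

lemma ev4_eqI: "(\<And>a b c d. F a b c d = G a b c d) \<Longrightarrow> ev4 t F = ev4 t G"
  by presburger

end

context yd_pair
begin

text \<open>H \<otimes> H acts on forms from the right, through their arguments. The reversed
  version \<open>act21\<close> is needed because \<open>coform\<close> exchanges the two on
  coproducts, in \<open>coform_comult\<close>.\<close>

definition act12 :: "('k, 'h, 'h) tensor \<Rightarrow> ('m \<Rightarrow> 'n \<Rightarrow> 'k) \<Rightarrow> 'm \<Rightarrow> 'n \<Rightarrow> 'k" where
  "act12 t b m n = ev H H t (\<lambda>p q. b (ac M p m) (ac N q n))"

definition act21 :: "('k, 'h, 'h) tensor \<Rightarrow> ('m \<Rightarrow> 'n \<Rightarrow> 'k) \<Rightarrow> 'm \<Rightarrow> 'n \<Rightarrow> 'k" where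
  "act21 t b m n = ev H H t (\<lambda>p q. b (ac M q m) (ac N p n))"

lemma bilin_act:
  assumes b: "bilin M N ground b" and [lins]: "t \<in> carr H2"
  shows "bilin M N ground (act12 t b)" "bilin M N ground (act21 t b)"
proof -
  note [lins] = bilin_lin1[OF b] bilin_lin2[OF b]
  show "bilin M N ground (act12 t b)" "bilin M N ground (act21 t b)"
    by (simp_all add: act12_def[abs_def] act21_def[abs_def] lins)
qed

lemma bilin_coform:
  assumes b: "bilin M N ground b"
  shows "bilin M N ground (coform b)" "bilin M N ground (coform_inv b)"
proof -
  note [lins] = bilin_lin1[OF b] bilin_lin2[OF b]
  show "bilin M N ground (coform b)" "bilin M N ground (coform_inv b)"
    by (simp_all add: coform_def[abs_def] coform_inv_def[abs_def] lins)
qed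

lemma act12_ac [simp]: "act12 t b (ac M 1 m) (ac N 1 n) = act12 t b m n"
  and act21_ac [simp]: "act21 t b (ac M 1 m) (ac N 1 n) = act21 t b m n"
  by (simp_all add: act12_def act21_def lins)

lemma act_mult:
  assumes b: "bilin M N ground b" and [lins]: "s \<in> carr H2" "t \<in> carr H2"
  shows "act12 (s \<odot>\<^sub>2 t) b = act12 t (act12 s b)" "act21 (s \<odot>\<^sub>2 t) b = act21 t (act21 s b)"
proof -
  note [lins] = bilin_lin1[OF b] bilin_lin2[OF b]
  have "act12 (s \<odot>\<^sub>2 t) b m n = act12 t (act12 s b) m n" "act21 (s \<odot>\<^sub>2 t) b m n = act21 t (act21 s b) m n" for m n
    by (simp_all add: act12_def act21_def ev2_mult[where U=ground] lins ev_swap[of H H s H H t])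
  then show "act12 (s \<odot>\<^sub>2 t) b = act12 t (act12 s b)" "act21 (s \<odot>\<^sub>2 t) b = act21 t (act21 s b)"
    by (simp_all add: fun_eq_iff)
qed

text \<open>The compatibility axiom \<open>YD3\<close> read on forms: H-linearity of the
  braiding.\<close>

lemma coform_comult:
  assumes b: "bilin M N ground b"
  shows "coform (act12 (\<Delta> h) b) = act21 (\<Delta> h) (coform b)"
proof (intro ext)
  note [lins] = bilin_lin1[OF b] bilin_lin2[OF b]
  fix m n
  show "coform (act12 (\<Delta> h) b) m n = act21 (\<Delta> h) (coform b) m n"
    using YD3[where U=ground and M=N and h=h and k=1 and m=n and G="\<lambda>x w. b (ac M x m) (ac N 1 w)"]
    by (simp add: coform_def act12_def act21_def lins C_out)
qed

text \<open>\<open>right_form\<close> is the formula for \<open>\<^sup>*\<sigma>\<close> with \<open>f\<close> removed; its \<open>p\<^sub>L\<close> enters only through \<open>u\<close>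
  and \<open>v\<close> in \<open>rcore\<close>.\<close>

definition rcore :: "('m \<Rightarrow> 'n \<Rightarrow> 'k) \<Rightarrow> 'h \<Rightarrow> 'h \<Rightarrow> 'h \<Rightarrow> 'm \<Rightarrow> 'n \<Rightarrow> 'k" where
  "rcore b u v r m n = P (\<lambda>X1 X2 X3. Q (\<lambda>x1 x2 x3. C N (ac N (x1 * u) n) (\<lambda>a n0. D v (\<lambda>v1 v2.
     b (ac M (T v1 * T x2 * T a * T X1 * r) m) (ac N (T v2 * T x3 * T X3 * T \<alpha> * X2) n0)))))"

definition right_form :: "('m \<Rightarrow> 'n \<Rightarrow> 'k) \<Rightarrow> 'm \<Rightarrow> 'n \<Rightarrow> 'k" where
  "right_form b m n = P (\<lambda>Z1 Z2 Z3. rcore b (Z2 * T \<beta> * T Z1) Z3 1 m n)"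

lemma lin_rcore:
  assumes b: "bilin M N ground b" and [lins]: "is_space X"
  shows "lin X H f \<Longrightarrow> lin X ground (\<lambda>x. rcore b (f x) v r m n)"
    "lin X H f \<Longrightarrow> lin X ground (\<lambda>x. rcore b u (f x) r m n)"
    "lin X H f \<Longrightarrow> lin X ground (\<lambda>x. rcore b u v (f x) m n)"
    "lin X M g \<Longrightarrow> lin X ground (\<lambda>x. rcore b u v r (g x) n)"
    "lin X N g' \<Longrightarrow> lin X ground (\<lambda>x. rcore b u v r m (g' x))"
proof -
  note [lins] = bilin_lin1[OF b] bilin_lin2[OF b]
  show "lin X H f \<Longrightarrow> lin X ground (\<lambda>x. rcore b (f x) v r m n)"
    "lin X H f \<Longrightarrow> lin X ground (\<lambda>x. rcore b u (f x) r m n)"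
    "lin X H f \<Longrightarrow> lin X ground (\<lambda>x. rcore b u v (f x) m n)"
    "lin X M g \<Longrightarrow> lin X ground (\<lambda>x. rcore b u v r (g x) n)"
    "lin X N g' \<Longrightarrow> lin X ground (\<lambda>x. rcore b u v r m (g' x))"
    by (simp_all add: rcore_def lins)
qed

lemma rcore_ac: "rcore b u v r (ac M k m) (ac N l n) = rcore b (u * l) v (r * k) m n"
  by (simp add: rcore_def lins mult.assoc)

text \<open>A factor S\<inverse>(h) on M enters \<open>q_R\<close> by \<open>qR_move\<close>,
  crosses the coaction by \<open>YD3\<close> and \<Phi>\<inverse> by quasi-coassociativity, and
  comes out as \<Delta>(h) multiplying \<open>u\<close> and \<open>v\<close> from the left.\<close>

lemma rcore_shift:
  assumes b: "bilin M N ground b"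
  shows "rcore b u v (T h * r) m n = D h (\<lambda>h1 h2. rcore b (h1 * u) (h2 * v) r m n)"
proof -
  note [lins] = bilin_lin1[OF b] bilin_lin2[OF b]
  have q: "P (\<lambda>X1 X2 X3. C N k (\<lambda>a n0. D v (\<lambda>v1 v2.
        b (ac M (T v1 * T x2 * T a * T X1 * T h * r) m) (ac N (T v2 * T x3 * T X3 * T \<alpha> * X2) n0))))
      = P (\<lambda>X1 X2 X3. D h (\<lambda>h1 h2. D h1 (\<lambda>h11 h12. C N k (\<lambda>a n0. D v (\<lambda>v1 v2.
        b (ac M (T v1 * T x2 * T a * T h11 * T X1 * r) m) (ac N (T v2 * T x3 * T h2 * T X3 * T \<alpha> * X2 * h12) n0))))))"
    if "k \<in> carr N" for k x2 x3
    using qR_move[where U=ground and h=h and G="\<lambda>x y. C N k (\<lambda>a n0. D v (\<lambda>v1 v2.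
        b (ac M (T v1 * T x2 * T a * T x * r) m) (ac N (T v2 * T x3 * y) n0)))"] that by (simp add: lins mult.assoc)
  have 3: "D h (\<lambda>h1 h2. C N (ac N k n) (\<lambda>a n0. D v (\<lambda>v1 v2.
        b (ac M (T v1 * T x2 * T a * T h1 * s) m) (ac N (T v2 * T x3 * w * h2) n0))))
      = D h (\<lambda>h1 h2. C N (ac N (h1 * k) n) (\<lambda>a n0. D v (\<lambda>v1 v2.
        b (ac M (T v1 * T x2 * T h2 * T a * s) m) (ac N (T v2 * T x3 * w) n0))))" for k x2 x3 w s h
    using YD3[where U=ground and M=N and h=h and k=k and m=n and G="\<lambda>x w'. D v (\<lambda>v1 v2.
        b (ac M (T v1 * T x2 * T x * s) m) (ac N (T v2 * T x3 * w) w'))"] by (simp add: lins mult.assoc)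
  have c: "Q (\<lambda>x1 x2 x3. D h (\<lambda>h1 h2. D h1 (\<lambda>h11 h12. C N (ac N (h11 * x1 * u) n) (\<lambda>a n0. D v (\<lambda>v1 v2.
        b (ac M (T v1 * T x2 * T h12 * T a * s) m) (ac N (T v2 * T x3 * T h2 * w) n0))))))
      = Q (\<lambda>x1 x2 x3. D h (\<lambda>h1 h2. D h2 (\<lambda>h21 h22. C N (ac N (x1 * h1 * u) n) (\<lambda>a n0. D v (\<lambda>v1 v2.
        b (ac M (T v1 * T h21 * T x2 * T a * s) m) (ac N (T v2 * T h22 * T x3 * w) n0))))))" for s w
    using coassoc_Q[where U=ground and h=h and F="\<lambda>x1 x2 x3. C N (ac N (x1 * u) n) (\<lambda>a n0. D v (\<lambda>v1 v2.
        b (ac M (T v1 * T x2 * T a * s) m) (ac N (T v2 * T x3 * w) n0)))"] by (simp add: lins mult.assoc)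
  have "rcore b u v (T h * r) m n = Q (\<lambda>x1 x2 x3. P (\<lambda>X1 X2 X3. C N (ac N (x1 * u) n) (\<lambda>a n0. D v (\<lambda>v1 v2.
     b (ac M (T v1 * T x2 * T a * T X1 * T h * r) m) (ac N (T v2 * T x3 * T X3 * T \<alpha> * X2) n0)))))"
    by (simp add: rcore_def mult.assoc outer)
  also have "\<dots> = Q (\<lambda>x1 x2 x3. P (\<lambda>X1 X2 X3. D h (\<lambda>h1 h2. D h1 (\<lambda>h11 h12. C N (ac N (x1 * u) n) (\<lambda>a n0. D v (\<lambda>v1 v2.
        b (ac M (T v1 * T x2 * T a * T h11 * (T X1 * r)) m) (ac N (T v2 * T x3 * (T h2 * T X3 * T \<alpha> * X2) * h12) n0)))))))"
    by (simp add: q lins) (simp add: mult.assoc)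
  also have "\<dots> = Q (\<lambda>x1 x2 x3. P (\<lambda>X1 X2 X3. D h (\<lambda>h1 h2. D h1 (\<lambda>h11 h12. C N (ac N (h11 * (x1 * u)) n) (\<lambda>a n0. D v (\<lambda>v1 v2.
        b (ac M (T v1 * T x2 * T h12 * T a * (T X1 * r)) m) (ac N (T v2 * T x3 * (T h2 * T X3 * T \<alpha> * X2)) n0)))))))"
    unfolding 3 ..
  also have "\<dots> = P (\<lambda>X1 X2 X3. Q (\<lambda>x1 x2 x3. D h (\<lambda>h1 h2. D h1 (\<lambda>h11 h12. C N (ac N (h11 * x1 * u) n) (\<lambda>a n0. D v (\<lambda>v1 v2.
        b (ac M (T v1 * T x2 * T h12 * T a * (T X1 * r)) m) (ac N (T v2 * T x3 * T h2 * (T X3 * T \<alpha> * X2)) n0)))))))"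
    by (simp add: mult.assoc outer)
  also have "\<dots> = P (\<lambda>X1 X2 X3. Q (\<lambda>x1 x2 x3. D h (\<lambda>h1 h2. D h2 (\<lambda>h21 h22. C N (ac N (x1 * h1 * u) n) (\<lambda>a n0. D v (\<lambda>v1 v2.
        b (ac M (T v1 * T h21 * T x2 * T a * (T X1 * r)) m) (ac N (T v2 * T h22 * T x3 * (T X3 * T \<alpha> * X2)) n0)))))))"
    unfolding c ..
  also have "\<dots> = D h (\<lambda>h1 h2. rcore b (h1 * u) (h2 * v) r m n)"
    by (simp add: rcore_def mult.assoc D_mult[where U=ground] lins C_out outer)
  finally show ?thesis .
qed

text \<open>\<open>pL_move\<close> distributes \<open>h\<close> over the ends of \<open>p_L\<close>,
  and \<open>rcore_shift\<close> carries the part h2 over to M. It is the counterpart of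
  \<open>coform_comult\<close> for the map in the opposite direction.\<close>

lemma right_form_comult:
  assumes b: "bilin M N ground b"
  shows "right_form (act21 (flip2 T (\<Delta> h)) b) = act12 (flip2 T (\<Delta> h)) (right_form b)"
proof (intro ext)
  note [lins] = bilin_lin1[OF b] bilin_lin2[OF b] lin_rcore[OF b]
  fix m n
  have "right_form (act21 (flip2 T (\<Delta> h)) b) m n = P (\<lambda>Z1 Z2 Z3. rcore b (Z2 * T \<beta> * T Z1) (Z3 * h) 1 m n)"
    by (simp add: right_form_def rcore_def act21_def ev2_flip2[where U=ground] lins D_mult[where U=ground] mult.assoc)
  also have "\<dots> = P (\<lambda>Z1 Z2 Z3. D h (\<lambda>h1 h2. rcore b (Z2 * T \<beta> * T Z1 * T h1) Z3 (T h2 * 1) m n))"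
    using pL_move[where U=ground and h=h and G="\<lambda>x y. rcore b x y 1 m n"]
    by (simp add: lins mult.assoc rcore_shift[OF b, where r=1, symmetric, simplified])
  also have "\<dots> = act12 (flip2 T (\<Delta> h)) (right_form b) m n"
    by (simp add: right_form_def act12_def ev2_flip2[where U=ground] lins rcore_ac outer)
  finally show "right_form (act21 (flip2 T (\<Delta> h)) b) m n = act12 (flip2 T (\<Delta> h)) (right_form b) m n" .
qed

lemma bilin_right_form:
  assumes b: "bilin M N ground b"
  shows "bilin M N ground (right_form b)"
proof -
  note [lins] = lin_rcore[OF b]
  show ?thesis by (simp add: right_form_def[abs_def] lins)
qed

text \<open>The \<open>q_L\<close> inside the \<open>D4\<close> expansion of \<gamma> cancels the
  \<open>p_L\<close> inside \<open>right_form\<close>, so that a single \<open>rcore\<close>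
  remains. Rewriting \<open>D4\<close> through \<open>A4\<close> then makes \<open>qR_comult\<close>
  and \<open>coact_core\<close> applicable.\<close>

lemma coform_right_gamma:
  assumes b: "bilin M N ground b"
  shows "coform (act12 (flip2 T \<gamma>) (right_form b)) = act21 (flip2 T \<gamma>) b"
proof (intro ext)
  note [lins] = bilin_lin1[OF b] bilin_lin2[OF b] lin_rcore[OF b] bilin_lin1[OF bilin_right_form[OF b]] bilin_lin2[OF bilin_right_form[OF b]]
  fix m n
  have s: "D h (\<lambda>h1 h2. right_form b (ac M (T h2 * r) m) (ac N (T h1 * s) w))
      = P (\<lambda>Z1 Z2 Z3. rcore b (Z2 * (T \<beta> * (T Z1 * s))) (Z3 * h) r m w)" for h r s w
    using fun_cong[OF fun_cong[OF right_form_comult[OF b, of h]], of "ac M r m" "ac N s w"]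
    by (simp add: act12_def ev2_flip2[where U=ground] lins act21_def right_form_def rcore_ac mult.assoc rcore_def D_mult[where U=ground])
  have l: "P (\<lambda>Z1 Z2 Z3. Q (\<lambda>y1 y2 y3. rcore b (Z2 * (T \<beta> * (T Z1 * (T y2 * (T \<alpha> * (y1 * u)))))) (Z3 * v) (T y3 * r) m w))
      = rcore b u v r m w" for u v r w
    using qL_pL_cancel[where U=ground and G="\<lambda>x y. rcore b (x * u) (y * v) r m w"]
    by (simp add: lins mult.assoc rcore_shift[OF b])
  have "coform (act12 (flip2 T \<gamma>) (right_form b)) m n
      = P (\<lambda>X1 X2 X3. C N (ac N 1 n) (\<lambda>e n0. Q (\<lambda>y1 y2 y3. D X3 (\<lambda>X31 X32.
          right_form b (ac M (T X32 * (T y3 * (T \<alpha> * (X1 * e)))) m) (ac N (T X31 * (T y2 * (T \<alpha> * (y1 * X2)))) n0)))))"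
    by (simp add: coform_def act12_def ev2_flip2[where U=ground] lins ev_gamma(2)[where U=ground] ABDE_ev[where U=ground] mult.assoc outer)
  also have "\<dots> = P (\<lambda>X1 X2 X3. C N (ac N 1 n) (\<lambda>e n0. rcore b X2 X3 (T \<alpha> * (X1 * e)) m n0))"
    unfolding s by (simp add: l outer)
  also have "\<dots> = ev4 D4 (\<lambda>p q r s. C N (ac N 1 n) (\<lambda>e n0. P (\<lambda>W1 W2 W3. C N (ac N q n0) (\<lambda>a n1.
      b (ac M (T r * T a * T W1 * T \<alpha> * p * e) m) (ac N (T s * T W3 * T \<alpha> * W2) n1)))))"
    by (simp add: rcore_def ABDE_ev[where U=ground] lins mult.assoc outer C_out)
  \<comment> \<open>The factor between \<open>D4\<close> and \<open>A4\<close> is kept here: after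
    \<open>YD3\<close> its coproduct is what \<open>qR_comult\<close> consumes.\<close>
  also have "\<dots> = ev4 A4 (\<lambda>p q r s. P (\<lambda>Z1 Z2 Z3. D Z2 (\<lambda>Z21 Z22. C N (ac N 1 n) (\<lambda>e n0. P (\<lambda>W1 W2 W3. C N (ac N (Z21 * q) n0) (\<lambda>a n1.
      b (ac M (T r * T Z22 * T a * T W1 * T \<alpha> * Z1 * p * e) m) (ac N (T s * T Z3 * T W3 * T \<alpha> * W2) n1)))))))"
    by (simp add: D4_eq_A4 ev4_mult[where U=ground] ev4_leg[where U=ground] lins mult.assoc swap_ev4 swap_ev3_ev4)
  also have "\<dots> = ev4 A4 (\<lambda>p q r s. C N (ac N 1 n) (\<lambda>e n0. C N (ac N q n0) (\<lambda>a n1. Q (\<lambda>y1 y2 y3.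
      b (ac M (T (S (y1 * p * e) * \<alpha> * (y2 * a * r))) m) (ac N (T s * T \<alpha> * y3) n1)))))"
  proof (rule ev4_eqI)
    fix p q r s
    have 3: "D h (\<lambda>h1 h2. C N (ac N (h1 * q) w) (\<lambda>a n1. b (ac M (T r * (T h2 * (T a * u))) m) (ac N (T s * v) n1)))
        = D h (\<lambda>h1 h2. C N (ac N q w) (\<lambda>a n1. b (ac M (T r * (T a * (T h1 * u))) m) (ac N (T s * (v * h2)) n1)))" for h w u v
      using YD3[where U=ground and M=N and h=h and k=q and m=w and G="\<lambda>x w. b (ac M (T r * T x * u) m) (ac N (T s * v) w)"]
      by (simp add: lins mult.assoc)
    have "P (\<lambda>Z1 Z2 Z3. D Z2 (\<lambda>Z21 Z22. C N (ac N 1 n) (\<lambda>e n0. P (\<lambda>W1 W2 W3. C N (ac N (Z21 * q) n0) (\<lambda>a n1.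
        b (ac M (T r * T Z22 * T a * T W1 * T \<alpha> * Z1 * p * e) m) (ac N (T s * T Z3 * T W3 * T \<alpha> * W2) n1))))))
      = P (\<lambda>Z1 Z2 Z3. P (\<lambda>W1 W2 W3. C N (ac N 1 n) (\<lambda>e n0. D Z2 (\<lambda>Z21 Z22. C N (ac N (Z21 * q) n0) (\<lambda>a n1.
        b (ac M (T r * (T Z22 * (T a * (T W1 * T \<alpha> * Z1 * p * e)))) m) (ac N (T s * (T Z3 * T W3 * T \<alpha> * W2)) n1))))))"
      by (simp add: mult.assoc swap_ev3 C_out)
    also have "\<dots> = C N (ac N 1 n) (\<lambda>e n0. C N (ac N q n0) (\<lambda>a n1. Q (\<lambda>y1 y2 y3.
      b (ac M (T (S (y1 * p * e) * \<alpha> * (y2 * a * r))) m) (ac N (T s * T \<alpha> * y3) n1))))"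
      unfolding 3
      using qR_comult[where U=ground and G="\<lambda>x y. C N (ac N 1 n) (\<lambda>e n0. C N (ac N q n0) (\<lambda>a n1. 
        b (ac M (T r * T a * T x * p * e) m) (ac N (T s * y) n1)))"]
      by (simp add: lins mult.assoc swap_ev3 C_out)
    finally show "P (\<lambda>Z1 Z2 Z3. D Z2 (\<lambda>Z21 Z22. C N (ac N 1 n) (\<lambda>e n0. P (\<lambda>W1 W2 W3. C N (ac N (Z21 * q) n0) (\<lambda>a n1.
        b (ac M (T r * T Z22 * T a * T W1 * T \<alpha> * Z1 * p * e) m) (ac N (T s * T Z3 * T W3 * T \<alpha> * W2) n1))))))
      = C N (ac N 1 n) (\<lambda>e n0. C N (ac N q n0) (\<lambda>a n1. Q (\<lambda>y1 y2 y3.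
      b (ac M (T (S (y1 * p * e) * \<alpha> * (y2 * a * r))) m) (ac N (T s * T \<alpha> * y3) n1))))" .
  qed
  also have "\<dots> = ev4 A4 (\<lambda>p q r s. b (ac M (T (S q * \<alpha> * r)) m) (ac N (T s * T \<alpha> * p) n))"
    using coact_core[of N "\<lambda>x d w. b (ac M (T x) m) (ac N (T d * T \<alpha>) w)" n] by (simp add: lins mult.assoc outer)
  also have "\<dots> = act21 (flip2 T \<gamma>) b m n"
    by (simp add: act21_def ev2_flip2[where U=ground] lins ev_gamma(1)[where U=ground] mult.assoc)
  finally show "coform (act12 (flip2 T \<gamma>) (right_form b)) m n = act21 (flip2 T \<gamma>) b m n" .
qed

text \<open>S\<inverse> of the snake identity, multiplied by the reversed twist, writes that twist
  as a sum of products of a reversed coproduct, the reversed \<gamma> and a coproduct. The claim is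
  known for each of the three kinds of factor, hence for their products, and by linearity for the
  twist.\<close>

lemma coform_right_twist:
  assumes b: "bilin M N ground b"
  shows "coform (act12 (flip2 T f2) (right_form b)) = act21 (flip2 T f2) b"
proof -
  let ?f = "flip2 T f2"
  note r = antipodal_twist_right[unfolded antipodal_twist_def]
  have a: "?f \<odot>\<^sub>2 \<Delta> (T \<alpha>) = flip2 T \<gamma>"
    using r by (simp add: lins flip: twist_comult_alpha flip2_mult)
  have i: "?f \<odot>\<^sub>2 \<Delta> (T h) = flip2 T (\<Delta> h) \<odot>\<^sub>2 ?f" for h using r by simp
  have F: "Q (\<lambda>x1 x2 x3. flip2 T (\<Delta> (x2 * \<beta> * S x3)) \<odot>\<^sub>2 (flip2 T \<gamma> \<odot>\<^sub>2 \<Delta> x1)) = ?f"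
  proof -
    have "Q (\<lambda>x1 x2 x3. ?f \<odot>\<^sub>2 \<Delta> (T (S x1 * \<alpha> * x2 * \<beta> * S x3))) = ?f \<odot>\<^sub>2 \<Delta> (T 1)"
      by (rule snake_Q[where U=H2]) (intro lins)+
    moreover have "?f \<odot>\<^sub>2 \<Delta> (T (S x1 * \<alpha> * x2 * \<beta> * S x3)) = flip2 T (\<Delta> (x2 * \<beta> * S x3)) \<odot>\<^sub>2 (flip2 T \<gamma> \<odot>\<^sub>2 \<Delta> x1)" for x1 x2 x3
    proof -
      have "?f \<odot>\<^sub>2 \<Delta> (T (S x1 * \<alpha> * x2 * \<beta> * S x3)) = ?f \<odot>\<^sub>2 \<Delta> (T (x2 * \<beta> * S x3)) \<odot>\<^sub>2 (\<Delta> (T \<alpha>) \<odot>\<^sub>2 \<Delta> x1)"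
        by (simp only: mult2_assoc lins flip: comult_mult) (simp add: mult.assoc)
      also have "\<dots> = flip2 T (\<Delta> (x2 * \<beta> * S x3)) \<odot>\<^sub>2 (?f \<odot>\<^sub>2 \<Delta> (T \<alpha>) \<odot>\<^sub>2 \<Delta> x1)"
        unfolding i[of "x2 * \<beta> * S x3"] by (simp only: mult2_assoc lins)
      finally show ?thesis unfolding a .
    qed
    ultimately show ?thesis by (simp add: comult_one mult2_one lins)
  qed
  let ?F = "\<lambda>x1 x2 x3. flip2 T (\<Delta> (x2 * \<beta> * S x3)) \<odot>\<^sub>2 (flip2 T \<gamma> \<odot>\<^sub>2 \<Delta> x1)"
  have act: "act12 ?f B m n = Q (\<lambda>x1 x2 x3. act12 (?F x1 x2 x3) B m n)" "act21 ?f B m n = Q (\<lambda>x1 x2 x3. act21 (?F x1 x2 x3) B m n)"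
    if B: "bilin M N ground B" for B m n
  proof -
    note [lins] = bilin_lin1[OF B] bilin_lin2[OF B]
    have "act12 (Q ?F) B m n = Q (\<lambda>x1 x2 x3. act12 (?F x1 x2 x3) B m n)" "act21 (Q ?F) B m n = Q (\<lambda>x1 x2 x3. act21 (?F x1 x2 x3) B m n)"
      by (simp_all add: act12_def act21_def ev_evs[where U=ground] lins)
    then show "act12 ?f B m n = Q (\<lambda>x1 x2 x3. act12 (?F x1 x2 x3) B m n)" "act21 ?f B m n = Q (\<lambda>x1 x2 x3. act21 (?F x1 x2 x3) B m n)"
      unfolding F .
  qed
  note R = bilin_right_form[OF b]
  have c: "coform (act12 (?F x1 x2 x3) (right_form b)) = act21 (?F x1 x2 x3) b" for x1 x2 x3
    by (simp add: act_mult b R bilin_act bilin_right_form lins coform_comult coform_right_gamma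
        right_form_comult[OF b, symmetric])
  show ?thesis
  proof (intro ext)
    fix m n
    have "coform (act12 ?f (right_form b)) m n = Q (\<lambda>x1 x2 x3. coform (act12 (?F x1 x2 x3) (right_form b)) m n)"
      by (simp only: coform_def act[OF R] swap_ev3)
    then show "coform (act12 ?f (right_form b)) m n = act21 ?f b m n"
      by (simp only: c act(2)[OF b])
  qed
qed

text \<open>Both sides have the same image under \<open>coform\<close>, which
  \<open>coform_inv\<close> inverts from the left. This identifies the formula stated for right
  duals with the one that serves both kinds of dual.\<close>

lemma right_form_eq:
  assumes b: "bilin M N ground b"
  shows "act12 (flip2 T f2) (right_form b) m n = coform_inv (act21 (flip2 T f2) b) m n"
  using coform_inv_coform[OF bilin_act(1)[OF bilin_right_form[OF b]], of "flip2 T f2" m n] coform_right_twist[OF b]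
  by (simp add: lins)

end

context quasi_hopf_algebra
begin

text \<open>The coaction on V \<otimes> W, tested on \<open>R\<close>, with arbitrary elements in
  the places of \<Phi>, \<Phi>\<inverse>, \<Phi>. The duals put twisted reassociators there.\<close>

definition tcoact where
  "tcoact s t u V W v w R = ev3 s (\<lambda>X1 X2 X3. ev3 t (\<lambda>x1 x2 x3. ev3 u (\<lambda>Y1 Y2 Y3.
     C V (ac V (x1 * Y1) v) (\<lambda>a v0. C W (ac W Y2 w) (\<lambda>b w0.
       R (X1 * a * x2 * b * Y3) (ac V X2 v0) (ac W (X3 * x3) w0))))))"

context
  fixes s r :: "'h \<Rightarrow> 'h" and f g :: "('k, 'h, 'h) tensor"
  assumes at: "antipodal_twist s r f g"
begin

lemma antipodal_twistD:
  shows "lin X H F \<Longrightarrow> lin X H (\<lambda>x. s (F x))" "s (a * b) = s b * s a" "s 1 = 1"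
    "f \<in> carr H2" "g \<in> carr H2" "f \<odot>\<^sub>2 g = pure2 H 1 1" "g \<odot>\<^sub>2 f = pure2 H 1 1"
    "f \<odot>\<^sub>2 \<Delta> (s h) = flip2 s (\<Delta> h) \<odot>\<^sub>2 f" "s (r h) = h"
    "lin X H F \<Longrightarrow> lin X H (\<lambda>x. r (F x))" "r (s h) = h"
proof -
  show sr: "s (r h) = h" and rs: "r (s h) = h" for h using at by (simp_all add: antipodal_twist_def)
  show s: "lin X H F \<Longrightarrow> lin X H (\<lambda>x. s (F x))" for X :: "('k, 'w::ab_group_add, 'z) space_scheme" and F
    using at by (auto simp: antipodal_twist_def intro: lin_comp)
  have "r (x + y) = r x + r y" "r (scl H c x) = scl H c (r x)" for x y c
    using rs[of "r x + r y"] rs[of "scl H c (r x)"] lin_add[OF s[OF lin_ident], of "r x" "r y"] lin_scl[OF s[OF lin_ident], of "r x" c]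
    by (simp_all add: sr)
  then show "lin X H F \<Longrightarrow> lin X H (\<lambda>x. r (F x))" for X :: "('k, 'w::ab_group_add, 'z) space_scheme" and F
    by (auto intro: lin_comp simp: lin_def)
qed (use at in \<open>simp_all add: antipodal_twist_def\<close>)

abbreviation "\<Omega> \<equiv> flip_antip s (Phi H)"
abbreviation "\<Omega>i \<equiv> flip_antip s (Phi_inv H)"

text \<open>The first three are the reassociator identity solved for the third, second and first
  place of \<open>tcoact\<close>. In each a coproduct of a twist is isolated, so that
  \<open>tcoact_twist\<close> can hand it from one place to the next.\<close>

lemma twisted_reassociator:
  shows "Phi H \<odot>\<^sub>3 (comult_id H g \<odot>\<^sub>3 tens21 g 1) = id_comult H g \<odot>\<^sub>3 (tens12 1 g \<odot>\<^sub>3 \<Omega>)"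
    and "Phi_inv H \<odot>\<^sub>3 id_comult H g = comult_id H g \<odot>\<^sub>3 (tens21 g 1 \<odot>\<^sub>3 (\<Omega>i \<odot>\<^sub>3 tens12 1 f))"
    and "id_comult H f \<odot>\<^sub>3 Phi H \<odot>\<^sub>3 comult_id H g = tens12 1 g \<odot>\<^sub>3 (\<Omega> \<odot>\<^sub>3 tens21 f 1)"
    and "\<Delta> (s h) \<odot>\<^sub>2 g = g \<odot>\<^sub>2 flip2 s (\<Delta> h)"
proof -
  note [lins] = antipodal_twistD(4,5)
  let ?F = "id_comult H f" and ?F' = "id_comult H g" and ?G = "comult_id H f" and ?G' = "comult_id H g"
  let ?a = "tens12 1 f" and ?a' = "tens12 1 g" and ?b = "tens21 f 1" and ?b' = "tens21 g 1"
  have E: "?a \<odot>\<^sub>3 (?F \<odot>\<^sub>3 Phi H) = \<Omega> \<odot>\<^sub>3 (?b \<odot>\<^sub>3 ?G)" using at by (simp add: antipodal_twist_def)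
  have one: "?F \<odot>\<^sub>3 ?F' = pure3 H 1 1 1" "?F' \<odot>\<^sub>3 ?F = pure3 H 1 1 1" "?G \<odot>\<^sub>3 ?G' = pure3 H 1 1 1" "?G' \<odot>\<^sub>3 ?G = pure3 H 1 1 1"
    "?a \<odot>\<^sub>3 ?a' = pure3 H 1 1 1" "?a' \<odot>\<^sub>3 ?a = pure3 H 1 1 1" "?b \<odot>\<^sub>3 ?b' = pure3 H 1 1 1" "?b' \<odot>\<^sub>3 ?b = pure3 H 1 1 1"
    using tens_mult(3)[of f g] tens_mult(3)[of g f] tens_mult(4)[of f g] tens_mult(4)[of g f]
      tens_mult(2)[of f g 1 1] tens_mult(2)[of g f 1 1] tens_mult(1)[of f g 1 1] tens_mult(1)[of g f 1 1]
    by (simp_all add: lins antipodal_twistD(6,7) leg_one3 tens_one)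
  have "flip_antip s (pure3 H 1 1 1) = pure3 H 1 1 1"
    by (simp add: flip_antip_def ev3_pure[where U=H3] lins antipodal_twistD(1,3))
  then have \<Omega>one: "\<Omega>i \<odot>\<^sub>3 \<Omega> = pure3 H 1 1 1" "\<Omega> \<odot>\<^sub>3 \<Omega>i = pure3 H 1 1 1"
    using flip_antip_mult[of s "Phi H" "Phi_inv H"] flip_antip_mult[of s "Phi_inv H" "Phi H"] at
    by (simp_all add: antipodal_twist_def lins Phi_Phi_inv Phi_inv_Phi)
  have c: "x \<odot>\<^sub>3 (y \<odot>\<^sub>3 z) = z" if "x \<odot>\<^sub>3 y = pure3 H 1 1 1" "x \<in> carr H3" "y \<in> carr H3" "z \<in> carr H3" for x y z
    using that by (simp add: mult3_one flip: mult3_assoc)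
  have one': "Phi H \<odot>\<^sub>3 Phi_inv H = pure3 H 1 1 1" "Phi_inv H \<odot>\<^sub>3 Phi H = pure3 H 1 1 1" by (rule Phi_Phi_inv Phi_inv_Phi)+
  note cs = c[OF one(1)] c[OF one(2)] c[OF one(3)] c[OF one(4)] c[OF one(5)] c[OF one(6)] c[OF one(7)] c[OF one(8)]
    c[OF \<Omega>one(1)] c[OF \<Omega>one(2)] c[OF one'(1)] c[OF one'(2)]
  have E1: "Phi H = ?F' \<odot>\<^sub>3 (?a' \<odot>\<^sub>3 (\<Omega> \<odot>\<^sub>3 (?b \<odot>\<^sub>3 ?G)))"
    unfolding E[symmetric] by (simp add: cs lins)
  show W1: "Phi H \<odot>\<^sub>3 (?G' \<odot>\<^sub>3 ?b') = ?F' \<odot>\<^sub>3 (?a' \<odot>\<^sub>3 \<Omega>)"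
    by (subst E1) (simp add: mult3_assoc cs one mult3_one lins)
  have E2: "Phi H \<odot>\<^sub>3 (?G' \<odot>\<^sub>3 (?b' \<odot>\<^sub>3 (\<Omega>i \<odot>\<^sub>3 ?a))) = ?F'"
    using arg_cong[OF W1, of "\<lambda>x. x \<odot>\<^sub>3 (\<Omega>i \<odot>\<^sub>3 ?a)"] by (simp add: mult3_assoc cs one mult3_one lins)
  show "?F \<odot>\<^sub>3 Phi H \<odot>\<^sub>3 ?G' = ?a' \<odot>\<^sub>3 (\<Omega> \<odot>\<^sub>3 ?b)"
    by (subst E1) (simp add: mult3_assoc cs one mult3_one lins)
  show "Phi_inv H \<odot>\<^sub>3 ?F' = ?G' \<odot>\<^sub>3 (?b' \<odot>\<^sub>3 (\<Omega>i \<odot>\<^sub>3 ?a))"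
    unfolding E2[symmetric] by (simp add: cs lins)
  have "g \<odot>\<^sub>2 f \<odot>\<^sub>2 (\<Delta> (s h) \<odot>\<^sub>2 g) = g \<odot>\<^sub>2 (f \<odot>\<^sub>2 \<Delta> (s h) \<odot>\<^sub>2 g)"
    by (simp only: mult2_assoc lins)
  also have "\<dots> = g \<odot>\<^sub>2 (flip2 s (\<Delta> h) \<odot>\<^sub>2 (f \<odot>\<^sub>2 g))"
    unfolding antipodal_twistD(8) by (simp only: mult2_assoc lins)
  finally show "\<Delta> (s h) \<odot>\<^sub>2 g = g \<odot>\<^sub>2 flip2 s (\<Delta> h)"
    by (simp add: antipodal_twistD(6,7) mult2_one lins)
qed

text \<open>A coproduct of \<open>g\<close> starts in the third place, crosses the coaction of
  \<open>W\<close> by \<open>YD3\<close> into the second, then that of \<open>V\<close> into the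
  first, where it meets the coproduct of \<open>f\<close>. Each place is left with a reversed
  reassociator and plain twists.\<close>

lemma tcoact_twist:
  assumes [lins]: "yd_module H V" "yd_module H W" and R: "multilin3 H V W ground R"
  shows "tcoact (id_comult H f \<odot>\<^sub>3 Phi H) (Phi_inv H) (Phi H \<odot>\<^sub>3 (comult_id H g \<odot>\<^sub>3 tens21 g 1)) V W v w R
    = tcoact (tens12 1 g \<odot>\<^sub>3 (\<Omega> \<odot>\<^sub>3 tens21 f 1)) (tens21 g 1 \<odot>\<^sub>3 (\<Omega>i \<odot>\<^sub>3 tens12 1 f)) (tens12 1 g \<odot>\<^sub>3 \<Omega>) V W v w R"
    (is "tcoact ?U _ _ _ _ _ _ _ = tcoact ?J ?L ?K _ _ _ _ _")
proof -
  note [lins] = antipodal_twistD(4,5) multilin3_lin[OF R]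
  have [lins]: "?U \<in> carr H3" "?L \<in> carr H3" "?K \<in> carr H3" by (simp_all add: lins)
  have W: "D h (\<lambda>h1 h2. C W (ac W (h1 * k) w) (\<lambda>b w0. R (p * (b * (h2 * q))) (ac V z' v') (ac W z w0)))
      = D h (\<lambda>h1 h2. C W (ac W k w) (\<lambda>b w0. R (p * (h1 * (b * q))) (ac V z' v') (ac W (z * h2) w0)))"
    for h k p q z' v' z
    using YD3[where U=ground and M=W and h=h and k=k and m=w and G="\<lambda>x y. R (p * (x * q)) (ac V z' v') (ac W z y)"]
    by (simp add: lins mult.assoc)
  have V: "D h (\<lambda>h1 h2. C V (ac V (h1 * k) v) (\<lambda>a v0. C W (ac W l w) (\<lambda>b w0. R (p * (a * (h2 * (q * (b * y))))) (ac V z v0) (ac W z' w0))))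
      = D h (\<lambda>h1 h2. C V (ac V k v) (\<lambda>a v0. C W (ac W l w) (\<lambda>b w0. R (p * (h1 * (a * (q * (b * y))))) (ac V (z * h2) v0) (ac W z' w0))))"
    for h k p q y l z z'
    using YD3[where U=ground and M=V and h=h and k=k and m=v
        and G="\<lambda>x v0. C W (ac W l w) (\<lambda>b w0. R (p * (x * (q * (b * y)))) (ac V z v0) (ac W z' w0))"]
    by (simp add: lins mult.assoc)
  have "tcoact ?U (Phi_inv H) (Phi H \<odot>\<^sub>3 (comult_id H g \<odot>\<^sub>3 tens21 g 1)) V W v w R
     = ev3 ?U (\<lambda>u1 u2 u3. Q (\<lambda>x1 x2 x3. ev H H g (\<lambda>g1 g2. ev3 ?K (\<lambda>W1 W2 W3.
         C V (ac V (x1 * g1 * W1) v) (\<lambda>a v0. D g2 (\<lambda>g21 g22. C W (ac W (g21 * W2) w) (\<lambda>b w0.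
           R (u1 * a * x2 * (b * (g22 * W3))) (ac V u2 v0) (ac W (u3 * x3) w0))))))))"
    unfolding tcoact_def twisted_reassociator(1)
    by (simp add: ev3_mult[where U=ground and s="id_comult H g"] ev3_leg[where U=ground] lins mult.assoc swap_ev3 ev_swap[of H H _ H V])
  also have "\<dots> = ev3 ?U (\<lambda>u1 u2 u3. ev3 ?K (\<lambda>W1 W2 W3. Q (\<lambda>x1 x2 x3. ev H H g (\<lambda>g1 g2. D g2 (\<lambda>g21 g22.
         C V (ac V (x1 * g1 * W1) v) (\<lambda>a v0. C W (ac W W2 w) (\<lambda>b w0.
           R (u1 * a * (x2 * g21) * b * W3) (ac V u2 v0) (ac W (u3 * (x3 * g22)) w0))))))))"
    unfolding W by (simp add: mult.assoc swap_ev3 ev_swap[of H H _ H V] swap_ev3_ev3[of "Phi_inv H" "?K"])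
  also have "\<dots> = ev3 ?U (\<lambda>u1 u2 u3. ev3 ?K (\<lambda>W1 W2 W3. ev3 (Phi_inv H \<odot>\<^sub>3 id_comult H g) (\<lambda>x1 x2 x3.
         C V (ac V (x1 * W1) v) (\<lambda>a v0. C W (ac W W2 w) (\<lambda>b w0.
           R (u1 * a * x2 * b * W3) (ac V u2 v0) (ac W (u3 * x3) w0))))))"
    by (simp add: ev3_mult[where U=ground and t="id_comult H g"] ev3_leg[where U=ground] lins)
  also have "\<dots> = ev3 ?U (\<lambda>u1 u2 u3. ev3 ?K (\<lambda>W1 W2 W3. ev H H g (\<lambda>G1 G2. ev3 ?L (\<lambda>x1 x2 x3. D G1 (\<lambda>G11 G12.
         C V (ac V (G11 * (x1 * W1)) v) (\<lambda>a v0. C W (ac W W2 w) (\<lambda>b w0.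
           R (u1 * (a * (G12 * (x2 * (b * W3))))) (ac V u2 v0) (ac W (u3 * (G2 * x3)) w0))))))))"
    unfolding twisted_reassociator(2)
    by (simp add: ev3_mult[where U=ground and s="comult_id H g"] ev3_leg[where U=ground] lins mult.assoc swap_ev3)
  also have "\<dots> = ev3 ?K (\<lambda>W1 W2 W3. ev3 ?L (\<lambda>x1 x2 x3. ev3 (?U \<odot>\<^sub>3 comult_id H g) (\<lambda>u1 u2 u3. 
         C V (ac V (x1 * W1) v) (\<lambda>a v0. C W (ac W W2 w) (\<lambda>b w0.
           R (u1 * a * x2 * b * W3) (ac V u2 v0) (ac W (u3 * x3) w0))))))"
    unfolding V by (simp add: ev3_mult[where U=ground and s="?U" and t="comult_id H g"] ev3_leg[where U=ground] lins mult.assoc swap_ev3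
        swap_ev3_ev3[of "?U" "?K"] swap_ev3_ev3[of "?U" "?L"])
  also have "\<dots> = tcoact (tens12 1 g \<odot>\<^sub>3 (\<Omega> \<odot>\<^sub>3 tens21 f 1)) ?L ?K V W v w R"
    unfolding twisted_reassociator(3) tcoact_def
    by (simp only: swap_ev3_ev3[of "?L" "?J"] swap_ev3_ev3[of "?K" "?J"] swap_ev3_ev3[of "?K" "?L"])
  finally show ?thesis .
qed

end
end

context yd_pair
begin

text \<open>Colinearity of the braiding, read on forms. On either side \<open>YD1\<close> merges two
  coactions of N and a copy of \<Phi> cancels against \<Phi>\<inverse>; the sides meet in an
  expression with one coaction of N, split by a coproduct, and one of M.\<close>

lemma coform_tcoact:
  assumes G: "multilin3 H M N ground G"
  shows "coform (\<lambda>m n. tcoact (Phi H) (Phi_inv H) (Phi H) M N m n G) m n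
       = tcoact (Phi H) (Phi_inv H) (Phi H) N M n m (\<lambda>h n' m'. coform (G h) m' n')"
proof -
  note [lins] = multilin3_lin[OF G]
  have 3: "D h (\<lambda>h1 h2. C M (ac M (h1 * k) m) (\<lambda>a m0. G (p * (a * (h2 * q))) (ac M z m0) (ac N z' n')))
      = D h (\<lambda>h1 h2. C M (ac M k m) (\<lambda>a m0. G (p * (h1 * (a * q))) (ac M (z * h2) m0) (ac N z' n')))"
    for h k p q z z' n'
    using YD3[where U=ground and M=M and h=h and k=k and m=m and G="\<lambda>x m0. G (p * (x * q)) (ac M z m0) (ac N z' n')"]
    by (simp add: lins mult.assoc)
  have 1: "P (\<lambda>Y1 Y2 Y3. C N (ac N 1 n) (\<lambda>e n0. C N (ac N Y2 n0) (\<lambda>b n1. C M (ac M (x * (Y1 * e)) m) (\<lambda>a m0.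
        G (p * (a * (q * (b * Y3)))) (ac M z m0) (ac N z' n1)))))
      = P (\<lambda>Y1 Y2 Y3. P (\<lambda>Z1 Z2 Z3. C N (ac N Z1 n) (\<lambda>e n0. D e (\<lambda>e1 e2. C M (ac M (x * (Y1 * (e1 * Z2))) m) (\<lambda>a m0.
        G (p * (a * (q * (Y2 * (e2 * Z3))))) (ac M z m0) (ac N (z' * Y3) n0))))))" for x p q z z'
    using YD1[where U=ground and M=N and k=1 and m=n and G="\<lambda>x' y w. C M (ac M (x * x') m) (\<lambda>a m0.
        G (p * (a * (q * y))) (ac M z m0) (ac N z' w))"]
    by (simp add: lins mult.assoc)
  have 5: "P (\<lambda>X1 X2 X3. C N (ac N k n) (\<lambda>a n0. C N (ac N X2 n0) (\<lambda>c n1. C M (ac M l m) (\<lambda>b m0.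
        G (X1 * (a * (p * (b * q)))) (ac M (c * (X3 * z)) m0) (ac N 1 n1)))))
      = P (\<lambda>X1 X2 X3. P (\<lambda>Z1 Z2 Z3. C N (ac N (Z1 * k) n) (\<lambda>a n0. D a (\<lambda>a1 a2. C M (ac M l m) (\<lambda>b m0.
        G (X1 * (a1 * (Z2 * (p * (b * q))))) (ac M (X2 * (a2 * (Z3 * z))) m0) (ac N X3 n0))))))" for k l p q z
    using YD1[where U=ground and M=N and k=k and m=n and G="\<lambda>x y w. C M (ac M l m) (\<lambda>b m0.
        G (x * (p * (b * q))) (ac M (y * z) m0) (ac N 1 w))"]
    by (simp add: lins mult.assoc)
  have c: "P (\<lambda>Y1 Y2 Y3. Q (\<lambda>x1 x2 x3. C N (ac N k n) (\<lambda>e n0. D e (\<lambda>e1 e2. C M (ac M (x1 * (Y1 * (e1 * l))) m) (\<lambda>a m0.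
        G (p * (a * (x2 * (Y2 * (e2 * q))))) (ac M z m0) (ac N (z' * (x3 * Y3)) n0))))))
      = C N (ac N k n) (\<lambda>e n0. D e (\<lambda>e1 e2. C M (ac M (e1 * l) m) (\<lambda>a m0. G (p * (a * (e2 * q))) (ac M z m0) (ac N z' n0))))"
    for k l p q z z'
    using P_Q(2)[where U=ground and F="\<lambda>x1 x2 x3. C N (ac N k n) (\<lambda>e n0. D e (\<lambda>e1 e2. C M (ac M (x1 * (e1 * l)) m) (\<lambda>a m0.
        G (p * (a * (x2 * (e2 * q)))) (ac M z m0) (ac N (z' * x3) n0))))"]
    by (simp add: lins mult.assoc)
  have c': "P (\<lambda>Z1 Z2 Z3. Q (\<lambda>x1 x2 x3. C N (ac N (Z1 * (x1 * k)) n) (\<lambda>a n0. D a (\<lambda>a1 a2. C M (ac M l m) (\<lambda>b m0.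
        G (p * (a1 * (Z2 * (x2 * (b * q))))) (ac M (z * (a2 * (Z3 * x3))) m0) (ac N z' n0))))))
      = C N (ac N k n) (\<lambda>a n0. D a (\<lambda>a1 a2. C M (ac M l m) (\<lambda>b m0. G (p * (a1 * (b * q))) (ac M (z * a2) m0) (ac N z' n0))))"
    for k l p q z z'
    using P_Q(1)[where U=ground and F="\<lambda>x1 x2 x3. C N (ac N (x1 * k) n) (\<lambda>a n0. D a (\<lambda>a1 a2. C M (ac M l m) (\<lambda>b m0.
        G (p * (a1 * (x2 * (b * q)))) (ac M (z * (a2 * x3)) m0) (ac N z' n0))))"]
    by (simp add: lins mult.assoc)
  have "coform (\<lambda>m n. tcoact (Phi H) (Phi_inv H) (Phi H) M N m n G) m n
      = P (\<lambda>X1 X2 X3. Q (\<lambda>x1 x2 x3. P (\<lambda>Y1 Y2 Y3. C N (ac N 1 n) (\<lambda>e n0. C N (ac N Y2 n0) (\<lambda>b n1. C M (ac M (x1 * (Y1 * e)) m) (\<lambda>a m0.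
        G (X1 * (a * (x2 * (b * Y3)))) (ac M X2 m0) (ac N (X3 * x3) n1)))))))"
    by (simp add: coform_def tcoact_def lins mult.assoc swap_ev3 ev_swap[of H M _ H N])
  also have "\<dots> = P (\<lambda>X1 X2 X3. P (\<lambda>Z1 Z2 Z3. P (\<lambda>Y1 Y2 Y3. Q (\<lambda>x1 x2 x3. C N (ac N Z1 n) (\<lambda>e n0. D e (\<lambda>e1 e2.
        C M (ac M (x1 * (Y1 * (e1 * Z2))) m) (\<lambda>a m0. G (X1 * (a * (x2 * (Y2 * (e2 * Z3))))) (ac M X2 m0) (ac N (X3 * (x3 * Y3)) n0))))))))"
    unfolding 1 by (simp add: mult.assoc swap_ev3_ev3[of "Phi_inv H" "Phi H"]) (rule ev3_eqI, rule swap_ev3_ev3)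
  also have "\<dots> = P (\<lambda>X1 X2 X3. P (\<lambda>Z1 Z2 Z3. C N (ac N Z1 n) (\<lambda>e n0. D e (\<lambda>e1 e2.
        C M (ac M Z2 m) (\<lambda>a m0. G (X1 * (e1 * (a * Z3))) (ac M (X2 * e2) m0) (ac N X3 n0))))))"
    unfolding c 3 ..
  also have "\<dots> = P (\<lambda>Y1 Y2 Y3. P (\<lambda>X1 X2 X3. C N (ac N Y1 n) (\<lambda>e n0. D e (\<lambda>e1 e2.
        C M (ac M Y2 m) (\<lambda>a m0. G (X1 * (e1 * (a * Y3))) (ac M (X2 * e2) m0) (ac N X3 n0))))))"
    by (rule swap_ev3_ev3)
  \<comment> \<open>From the meeting point the argument runs backwards: a pair \<Phi>,
    \<Phi>\<inverse> is inserted and \<open>YD1\<close> splits the coaction of N again.\<close>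
  also have "\<dots> = P (\<lambda>Y1 Y2 Y3. P (\<lambda>X1 X2 X3. P (\<lambda>Z1 Z2 Z3. Q (\<lambda>x1 x2 x3. C N (ac N (Z1 * (x1 * Y1)) n) (\<lambda>a n0. D a (\<lambda>a1 a2. C M (ac M Y2 m) (\<lambda>b m0.
        G (X1 * (a1 * (Z2 * (x2 * (b * Y3))))) (ac M (X2 * (a2 * (Z3 * x3))) m0) (ac N X3 n0))))))))"
    unfolding c' ..
  also have "\<dots> = P (\<lambda>Y1 Y2 Y3. Q (\<lambda>x1 x2 x3. P (\<lambda>X1 X2 X3. C N (ac N (x1 * Y1) n) (\<lambda>a n0. C N (ac N X2 n0) (\<lambda>c n1. C M (ac M Y2 m) (\<lambda>b m0.
        G (X1 * (a * (x2 * (b * Y3)))) (ac M (c * (X3 * x3)) m0) (ac N 1 n1)))))))"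
    unfolding 5 by (simp add: swap_ev3_ev3[of "Phi_inv H" "Phi H"])
  also have "\<dots> = P (\<lambda>X1 X2 X3. P (\<lambda>Y1 Y2 Y3. Q (\<lambda>x1 x2 x3. C N (ac N (x1 * Y1) n) (\<lambda>a n0. C N (ac N X2 n0) (\<lambda>c n1. C M (ac M Y2 m) (\<lambda>b m0.
        G (X1 * (a * (x2 * (b * Y3)))) (ac M (c * (X3 * x3)) m0) (ac N 1 n1)))))))"
    by (subst swap_ev3_ev3[of "Phi_inv H" "Phi H"]) (rule swap_ev3_ev3)
  also have "\<dots> = tcoact (Phi H) (Phi_inv H) (Phi H) N M n m (\<lambda>h n' m'. coform (G h) m' n')"
    by (simp add: coform_def tcoact_def lins mult.assoc swap_ev3 ev_swap[of H M _ H N] swap_ev3_ev3[of "Phi_inv H" "Phi H"])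
  finally show ?thesis .
qed

end

section \<open>Duals\<close>

lemma dual_bases_exist:
  assumes V: "is_space V" and B: "finite B" "module.span (scl V) B = carr V"
  shows "\<exists>s e e'. dual_bases V s e e'"
proof -
  interpret vector_space "scl V" using V by (simp add: is_space_def)
  obtain C where C: "C \<subseteq> B" "independent C" "B \<subseteq> span C" by (rule maximal_independent_subset)
  have sp: "span C = carr V"
    using span_mono[OF C(1)] span_minimal[OF C(3) subspace_span] B(2) by auto
  have "finite C" using C(1) B(1) by (rule finite_subset)
  from ex_bij_betw_nat_finite_1[OF this] obtain e where e: "bij_betw e {1..card C} C" by blast
  \<comment> \<open>Coordinates are cut off outside the carrier, as membership in
    \<open>dual_space\<close> demands.\<close>
  let ?r = "\<lambda>i v. if v \<in> carr V then representation C v (e i) else 0"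
  have i: "inj_on e {1..card C}" and im: "e ` {1..card C} = C" using e by (simp_all add: bij_betw_def)
  have "dual_bases V (card C) e ?r" unfolding dual_bases_def im
  proof (intro conjI ballI i C(2) sp)
    show "?r i \<in> carr (dual_space V)" for i
      using C(2) sp is_space_add[OF V] is_space_scl[OF V]
      by (simp add: dual_space_def lin_def representation_add representation_scale)
    fix j k assume jk: "j \<in> {1..card C}" "k \<in> {1..card C}"
    then have "e k \<in> C" "e k = e j \<longleftrightarrow> k = j" using im i by (auto dest: inj_onD)
    moreover have "e k \<in> carr V" using calculation(1) sp span_superset[of C] by auto
    ultimately show "?r j (e k) = (if j = k then 1 else 0)"
      using C(2) by (auto simp: representation_basis)
  qed
  then show ?thesis by blast
qed

lemma dual_space_simps [simp]: "scl (dual_space V) = fun_scl"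
  by (simp add: dual_space_def)

lemma dual_lin: "\<phi> \<in> carr (dual_space V) \<Longrightarrow> lin V ground \<phi>"
  by (simp add: dual_space_def)

lemma is_space_dual: "is_space V \<Longrightarrow> is_space (dual_space V)"
proof -
  assume V: "is_space V"
  have "module.subspace fun_scl (carr (dual_space V))"
    using is_space_add[OF V] is_space_scl[OF V]
    by (subst module.subspace_def[OF module_fun_scl])
      (auto simp: dual_space_def lin_def fun_scl_def algebra_simps)
  then show ?thesis by (simp add: is_space_def vector_space_fun_scl)
qed

lemma lin_dual_apply: "lin X (dual_space V) f \<Longrightarrow> lin X ground (\<lambda>x. f x v)"
  by (auto simp: lin_def dual_space_def fun_scl_def)

lemma dual_bases_closed:
  assumes "is_space V" "dual_bases V s e e'" "i \<in> {1..s}"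
  shows "e i \<in> carr V" "e' i \<in> carr (dual_space V)"
proof -
  interpret vector_space "scl V" using assms(1) by (simp add: is_space_def)
  show "e i \<in> carr V" "e' i \<in> carr (dual_space V)"
    using assms(2,3) span_superset[of "e ` {1..s}"] by (auto simp: dual_bases_def)
qed

lemma dual_bases_expand:
  assumes V: "is_space V" and d: "dual_bases V s e e'" and v: "v \<in> carr V"
  shows "(\<Sum>i=1..s. scl V (e' i v) (e i)) = v"
proof -
  interpret vector_space "scl V" using V by (simp add: is_space_def)
  note cl = dual_bases_closed[OF V d]
  have l: "lin V V (\<lambda>v. \<Sum>i=1..s. scl V (e' i v) (e i))"
    by (intro lin_sum_body V lin_scl_left dual_lin cl)
  let ?S = "{v \<in> carr V. (\<Sum>i=1..s. scl V (e' i v) (e i)) = v}"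
  have "span (e ` {1..s}) \<subseteq> ?S"
  proof (rule span_minimal)
    show "subspace ?S"
      using lin_add[OF l] lin_scl[OF l] lin_zero[OF V l] is_space_zero[OF V] is_space_add[OF V] is_space_scl[OF V]
      by (auto simp: subspace_def)
    have "(\<Sum>i=1..s. scl V (e' i (e j)) (e i)) = e j" if "j \<in> {1..s}" for j
    proof -
      have "(\<Sum>i=1..s. scl V (e' i (e j)) (e i)) = (\<Sum>i=1..s. if i = j then e j else 0)"
        using d that by (intro sum.cong) (auto simp: dual_bases_def)
      then show ?thesis using that by simp
    qed
    then show "e ` {1..s} \<subseteq> ?S" using cl(1) by auto
  qed
  then show ?thesis using d v by (auto simp: dual_bases_def)
qed

lemma dual_bases_apply:
  assumes V: "is_space V" and d: "dual_bases V s e e'" and v: "v \<in> carr V" and f: "lin V U f"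
  shows "(\<Sum>i=1..s. scl U (e' i v) (f (e i))) = f v"
proof -
  note cl = dual_bases_closed[OF V d]
  have "f v = f (\<Sum>i=1..s. scl V (e' i v) (e i))" by (simp only: dual_bases_expand[OF V d v])
  also have "\<dots> = (\<Sum>i=1..s. scl U (e' i v) (f (e i)))"
    by (subst lin_sum[OF V f]) (auto intro!: sum.cong is_space_scl[OF V] lin_scl[OF f] cl)
  finally show ?thesis by simp
qed

lemma dual_expand:
  assumes V: "is_space V" and d: "dual_bases V s e e'" and \<phi>: "\<phi> \<in> carr (dual_space V)"
  shows "(\<Sum>i=1..s. fun_scl (\<phi> (e i)) (e' i)) = \<phi>"
proof
  fix v
  have *: "(\<Sum>i\<in>A. fun_scl (\<phi> (e i)) (e' i)) v = (\<Sum>i\<in>A. e' i v * \<phi> (e i))" for A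
    by (induction A rule: infinite_finite_induct) (simp_all add: fun_scl_def mult.commute)
  show "(\<Sum>i=1..s. fun_scl (\<phi> (e i)) (e' i)) v = \<phi> v"
  proof (cases "v \<in> carr V")
    case True
    then show ?thesis using dual_bases_apply[OF V d True dual_lin[OF \<phi>]] by (simp add: *)
  next
    case False
    then have "\<phi> v = 0" "\<And>i. i \<in> {1..s} \<Longrightarrow> e' i v = 0"
      using \<phi> dual_bases_closed(2)[OF V d] by (auto simp: dual_space_def)
    then show ?thesis by (simp add: *)
  qed
qed

text \<open>Expanding the second leg in coordinates splits every bilinear form into products of a
  functional on \<open>V\<close> with a coordinate of \<open>X\<close>, so these products suffice
  for testing.\<close>

lemma tensor_coord_eqI:
  assumes V: "is_space V" and X: "is_space X" and t: "t \<in> carr (tensor_space V X)" "t' \<in> carr (tensor_space V X)"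
    and b: "\<And>k. k \<in> K \<Longrightarrow> b k \<in> carr X" and x: "\<And>x. x \<in> carr X \<Longrightarrow> (\<Sum>k\<in>K. scl X (E k x) (b k)) = x"
    and eq: "\<And>k B. k \<in> K \<Longrightarrow> lin V ground B \<Longrightarrow> ev V X t (\<lambda>a x. B a * E k x) = ev V X t' (\<lambda>a x. B a * E k x)"
  shows "t = t'"
proof (rule tensor_eqI[OF V t])
  fix B assume B: "bilin V X ground B"
  have "ev V X u B = (\<Sum>k\<in>K. ev V X u (\<lambda>a x. B a (b k) * E k x))" if u: "u \<in> carr (tensor_space V X)" for u
  proof -
    have "B a x = (\<Sum>k\<in>K. B a (b k) * E k x)" if a: "a \<in> carr V" and x': "x \<in> carr X" for a x
    proof -
      have l: "lin X ground (B a)" using bilin_lin2[OF B a lin_ident] .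
      have "B a x = B a (\<Sum>k\<in>K. scl X (E k x) (b k))" by (simp add: x[OF x'])
      also have "\<dots> = (\<Sum>k\<in>K. B a (b k) * E k x)"
        by (simp add: lin_sum[OF X l] is_space_scl[OF X] b lin_scl[OF l] mult.commute)
      finally show ?thesis .
    qed
    then have "ev V X u B = ev V X u (\<lambda>a x. \<Sum>k\<in>K. B a (b k) * E k x)" by (intro ev_cong[OF V u])
    then show ?thesis by (simp add: ev_sum)
  qed
  note * = this
  show "ev V X t B = ev V X t' B"
    unfolding *[OF t(1)] *[OF t(2)] by (intro sum.cong refl eq bilin_lin1[OF B] b lin_ident)
qed

text \<open>The constructions see a space only through its carrier and scalars. This identifies what
  is built over a Yetter-Drinfeld record with what is built over the bare space.\<close>

lemma space_cong:
  assumes "carr V = carr V'" "scl V = scl V'" "carr W = carr W'" "scl W = scl W'"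
  shows "lin V W = lin V' W'" "pure V W = pure V' W'" "tensor_space V W = tensor_space V' W'" "sw V W = sw V' W'"
    "dual_space V = dual_space V'"
proof -
  show l: "lin V W = lin V' W'" using assms by (simp add: lin_def fun_eq_iff)
  have "bilin V W (ground :: ('b, 'b) space) = bilin V' W' ground"
    using assms by (simp add: bilin_def lin_def fun_eq_iff)
  then show p: "pure V W = pure V' W'" by (simp add: pure_def fun_eq_iff)
  then show t: "tensor_space V W = tensor_space V' W'" using assms by (simp add: tensor_space_def)
  show "sw V W = sw V' W'" by (rule ext) (simp only: sw_def assms p)
  show "dual_space V = dual_space V'" using assms by (simp add: dual_space_def lin_def)
qed

lemma lin_cong:
  assumes "is_space V" "\<And>v. v \<in> carr V \<Longrightarrow> f v = g v"
  shows "lin V W f = lin V W g"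
  using assms(2) is_space_add[OF assms(1)] is_space_scl[OF assms(1)] by (simp add: lin_def)

context quasi_hopf_algebra
begin

text \<open>The dual coaction is recorded by evaluating its second leg at a vector and its first leg
  under \<open>s\<close>. This mentions no bases, and \<open>s\<close> cancels the antipode or
  inverse antipode in the definitions, so that left and right duals obey one formula.\<close>

definition is_dual :: "('h \<Rightarrow> 'h) \<Rightarrow> ('k, 'h, 'h) tensor \<Rightarrow> ('k, 'h, 'h) tensor \<Rightarrow> ('k, 'h, 'v::ab_group_add) ydm
    \<Rightarrow> ('k, 'h, 'v \<Rightarrow> 'k) ydm \<Rightarrow> bool" where
  "is_dual s f g V V' \<longleftrightarrow> carr V' = carr (dual_space V) \<and> scl V' = fun_scl \<and> premodule V' \<and>
     (\<forall>\<phi>\<in>carr V'. \<forall>v\<in>carr V. \<forall>h. act V' h \<phi> v = \<phi> (ac V (s h) v)) \<and>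
     (\<forall>\<phi>\<in>carr V'. \<forall>v\<in>carr V. \<forall>B. lin H ground B \<longrightarrow> C V' \<phi> (\<lambda>a \<chi>. B (s a) * \<chi> v)
       = ev H H f (\<lambda>f1 f2. ev H H g (\<lambda>g1 g2. C V (ac V g1 v) (\<lambda>a v0. B (f1 * a * g2) * \<phi> (ac V f2 v0)))))"

lemma is_dualI:
  fixes V :: "('k, 'h, 'v::ab_group_add) ydm"
  assumes at: "antipodal_twist s r f g" and V [lins]: "premodule V" and d: "dual_bases V n e e'"
    and V': "carr V' = carr (dual_space V)" "scl V' = fun_scl"
    and act: "\<And>h \<phi>. act V' h \<phi> = (\<lambda>m. if m \<in> carr V then \<phi> (act V (s h) m) else 0)"
    and coact: "\<And>\<phi>. \<phi> \<in> carr (dual_space V) \<Longrightarrow> coact V' \<phi> = (\<Sum>i=1..n. ev H H f (\<lambda>f1 f2. ev H H g (\<lambda>g1 g2.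
      C V (ac V g1 (e i)) (\<lambda>a m0. pure H (dual_space V) (scl H (\<phi> (ac V f2 m0)) (r (f1 * a * g2))) (e' i)))))"
  shows "is_dual s f g V V'"
proof -
  have sp: "is_space V" by (simp add: lins)
  note [lins] = antipodal_twistD(1,4,5,10)[OF at] dual_bases_closed[OF sp d]
  have isp: "is_space V'" using is_space_dual[OF sp] V' by (simp add: is_space_def)
  have eqs: "pure H (dual_space V) = pure H V'"
    by (rule space_cong; simp add: V')
  have cl [lins]: "i \<in> {1..n} \<Longrightarrow> e' i \<in> carr V'" for i using dual_bases_closed[OF sp d] V' by simp
  have ap [lins]: "lin V' ground (\<lambda>\<phi>. \<phi> v)" for v
    using lin_dual_apply[of V' V "\<lambda>\<phi>. \<phi>" v] V' lin_ident[of V'] by (simp add: lin_def)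
  note [lins] = isp
  have \<phi>l: "\<phi> \<in> carr V' \<Longrightarrow> lin V ground \<phi>" for \<phi> using V' by (simp add: dual_lin)
  have ac: "act V' h \<phi> = (\<lambda>m. if m \<in> carr V then \<phi> (ac V (s h) m) else 0)" for h \<phi>
    by (simp add: act ac_def fun_eq_iff)
  have acl: "act V' h \<phi> \<in> carr V'" if "\<phi> \<in> carr V'" for h \<phi>
  proof -
    note [lins] = lin_comp[OF _ \<phi>l[OF that]]
    have "lin V ground (\<lambda>m. \<phi> (ac V (s h) m))" by (simp add: lins)
    then have "lin V ground (act V' h \<phi>)" by (subst lin_cong[OF sp]) (simp_all add: ac)
    then show ?thesis unfolding V' by (simp add: dual_space_def ac)
  qed
  have "left_module H V'"
  proof -
    have "bilin H V' V' (act V')"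
    proof (intro bilinI)
      fix \<phi> assume \<phi>: "\<phi> \<in> carr V'"
      note [lins] = lin_comp[OF _ \<phi>l[OF \<phi>]]
      have "lin H ground (\<lambda>h. \<phi> (ac V (s h) m))" for m by (simp add: lins)
      then show "lin H V' (\<lambda>h. act V' h \<phi>)"
        using acl[OF \<phi>] by (auto simp: lin_def ac V' fun_scl_def fun_eq_iff)
    next
      fix h
      show "lin V' V' (act V' h)"
        using acl by (auto simp: lin_def ac V' fun_scl_def fun_eq_iff)
    qed
    moreover have "act V' (h * h') \<phi> = act V' h (act V' h' \<phi>)" for h h' \<phi>
      by (simp add: ac fun_eq_iff antipodal_twistD(2)[OF at] lins)
    moreover have "act V' 1 \<phi> = \<phi>" if "\<phi> \<in> carr V'" for \<phi>
      using that V' by (auto simp: ac fun_eq_iff antipodal_twistD(3)[OF at] ac_one lins dual_space_def)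
    ultimately show ?thesis using isp by (simp add: left_module_def)
  qed
  moreover have "lin V' (tensor_space H V') (coact V')"
  proof -
    have eq: "v \<in> carr V' \<Longrightarrow> coact V' v = (\<Sum>i=1..n. ev H H f (\<lambda>f1 f2. ev H H g (\<lambda>g1 g2.
      C V (ac V g1 (e i)) (\<lambda>a m0. pure H V' (scl H (v (ac V f2 m0)) (r (f1 * a * g2))) (e' i)))))" for v
      unfolding eqs[symmetric] using coact V' by simp
    have "lin V' (tensor_space H V') (\<lambda>v. \<Sum>i=1..n. ev H H f (\<lambda>f1 f2. ev H H g (\<lambda>g1 g2.
      C V (ac V g1 (e i)) (\<lambda>a m0. pure H V' (scl H (v (ac V f2 m0)) (r (f1 * a * g2))) (e' i)))))"
      by (intro lin_sum_body lin_ev_body lin_pure1 lin_scl_left ap isp is_space_tensor is_space_H antipodal_twistD(4,5)[OF at]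
          coact_closed ac_closed premodule_left V sp cl in_carr_H)
    then show ?thesis by (simp only: lin_cong[of V' "coact V'", OF isp eq])
  qed
  ultimately have pre: "premodule V'" by (simp add: premodule_def)
  have ev: "C V' \<phi> (\<lambda>a \<chi>. B (s a) * \<chi> v)
       = ev H H f (\<lambda>f1 f2. ev H H g (\<lambda>g1 g2. C V (ac V g1 v) (\<lambda>a v0. B (f1 * a * g2) * \<phi> (ac V f2 v0))))"
    if \<phi>: "\<phi> \<in> carr V'" and v: "v \<in> carr V" and B: "lin H ground B" for \<phi> v B
  proof -
    note [lins] = lin_comp[OF _ \<phi>l[OF \<phi>]] lin_comp[OF _ B] lin_mult_ground1 lin_mult_ground2
    let ?F = "\<lambda>v. ev H H f (\<lambda>f1 f2. ev H H g (\<lambda>g1 g2. C V (ac V g1 v) (\<lambda>a v0. B (f1 * a * g2) * \<phi> (ac V f2 v0))))"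
    have b: "bilin H V' ground (\<lambda>a \<chi>. B (s a) * \<chi> v)" by (simp add: lins)
    have p: "pure H V' x (e' i) \<in> carr (tensor_space H V')" if "i \<in> {1..n}" for x i
      using that by (simp add: pure_in_tensor cl)
    have c: "C V (ac V g1 (e i)) (\<lambda>a m0. pure H V' (x a m0) (e' i)) \<in> carr (tensor_space H V')" if "i \<in> {1..n}" for x i g1
      using that by (intro ev_closed) (simp_all add: lins p)
    have "C V' \<phi> (\<lambda>a \<chi>. B (s a) * \<chi> v) = (\<Sum>i=1..n. ev H V' (ev H H f (\<lambda>f1 f2. ev H H g (\<lambda>g1 g2.
      C V (ac V g1 (e i)) (\<lambda>a m0. pure H V' (scl H (\<phi> (ac V f2 m0)) (r (f1 * a * g2))) (e' i))))) (\<lambda>a \<chi>. B (s a) * \<chi> v))"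
      unfolding coact[OF \<phi>[unfolded V']] eqs
      by (rule ev_sum_arg[OF is_space_H is_space_ground b]) (intro ev2_closed is_space_tensor antipodal_twistD(4,5)[OF at] c)
    \<comment> \<open>Since \<open>s\<close> undoes \<open>r\<close>, the summand is
      \<open>?F\<close> at a basis vector times a coordinate of \<open>v\<close>; linearity of
      \<open>?F\<close> then reassembles \<open>v\<close>.\<close>
    also have "\<dots> = (\<Sum>i=1..n. scl ground (e' i v) (?F (e i)))"
    proof (rule sum.cong[OF refl])
      fix i assume i: "i \<in> {1..n}"
      have ee: "ev H V' (ev X Y t G) (\<lambda>a \<chi>. B (s a) * \<chi> v) = ev X Y t (\<lambda>x y. ev H V' (G x y) (\<lambda>a \<chi>. B (s a) * \<chi> v))"
        if "is_space X" "t \<in> carr (tensor_space X Y)" "\<And>x y. G x y \<in> carr (tensor_space H V')"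
        for X :: "('k, 'w::ab_group_add, 'z) space_scheme" and Y :: "('k, 'w'::ab_group_add, 'z') space_scheme" and t G
        using ev_ev[OF is_space_H is_space_ground b that(1,2)] that(3) by blast
      show "ev H V' (ev H H f (\<lambda>f1 f2. ev H H g (\<lambda>g1 g2. C V (ac V g1 (e i)) (\<lambda>a m0.
          pure H V' (scl H (\<phi> (ac V f2 m0)) (r (f1 * a * g2))) (e' i))))) (\<lambda>a \<chi>. B (s a) * \<chi> v) = scl ground (e' i v) (?F (e i))"
        using i antipodal_twistD(9)[OF at] 
        by (simp add: ee ev_pure[OF is_space_H is_space_ground b] lins p c ev_scl[of ground, simplified])
          (simp add: lin_scl[OF lin_comp[OF antipodal_twistD(1)[OF at lin_ident] B]] lin_scl[OF antipodal_twistD(1)[OF at lin_ident]] lin_scl[OF B] mult.commute mult.left_commute)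
    qed
    also have "\<dots> = ?F v"
      by (rule dual_bases_apply[OF sp d v]) (simp add: lins)
    finally show ?thesis .
  qed
  show ?thesis unfolding is_dual_def using V' pre ev by (simp add: ac)
qed

lemma some_dual_bases:
  assumes "\<exists>s e e'. dual_bases V s e e'"
  obtains s e e' where "(SOME (s, e, e'). dual_bases V s e e') = (s, e, e')" "dual_bases V s e e'"
proof -
  obtain s e e' where s: "(SOME (s, e, e'). dual_bases V s e e') = (s, e, e')" by (metis prod_cases3)
  have "case SOME (s, e, e'). dual_bases V s e e' of (s, e, e') \<Rightarrow> dual_bases V s e e'"
    using assms by (intro someI_ex[where P="\<lambda>(s, e, e'). dual_bases V s e e'"]) simp
  with s show ?thesis by (intro that) simp_all
qed

lemma is_dual_left:
  assumes V [lins]: "premodule V" and d: "\<exists>s e e'. dual_bases V s e e'"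
  shows "is_dual S f2 g2 V (yd_left_dual H V)"
proof -
  obtain n e e' where s: "(SOME (s, e, e'). dual_bases V s e e') = (n, e, e')" and d: "dual_bases V n e e'"
    using some_dual_bases[OF d] .
  have sp: "is_space V" by (simp add: lins)
  note [lins] = dual_bases_closed[OF sp d]
  show ?thesis
  proof (rule is_dualI[OF antipodal_twist_left V d])
    fix \<phi>
    have "ev H H f2 (\<lambda>f1 f2. ev H H g2 (\<lambda>g1 g2. C V (act V g1 (e i)) (\<lambda>a m0. pure H (dual_space V) (scl H (\<phi> (act V f2 m0)) (T (f1 * a * g2))) (e' i))))
      = ev H H f2 (\<lambda>f1 f2. ev H H g2 (\<lambda>g1 g2. C V (ac V g1 (e i)) (\<lambda>a m0. pure H (dual_space V) (scl H (\<phi> (ac V f2 m0)) (T (f1 * a * g2))) (e' i))))"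
      if "i \<in> {1..n}" for i
      unfolding ac_eq[OF dual_bases_closed(1)[OF sp d that]]
      by (intro ev_eqI C_cong V act_closed premodule_left dual_bases_closed(1)[OF sp d that]) (simp only: ac_eq)
    then show "coact (yd_left_dual H V) \<phi> = (\<Sum>i=1..n. ev H H f2 (\<lambda>f1 f2. ev H H g2 (\<lambda>g1 g2.
      C V (ac V g1 (e i)) (\<lambda>a m0. pure H (dual_space V) (scl H (\<phi> (ac V f2 m0)) (T (f1 * a * g2))) (e' i)))))"
      by (simp add: yd_left_dual_def s sw_evs) (simp add: ev_def)
  qed (simp_all add: yd_left_dual_def)
qed

lemma is_dual_right:
  assumes V [lins]: "premodule V" and d: "\<exists>s e e'. dual_bases V s e e'"
  shows "is_dual T (flip2 T f2) (flip2 T g2) V (yd_right_dual H V)"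
proof -
  obtain n e e' where s: "(SOME (s, e, e'). dual_bases V s e e') = (n, e, e')" and d: "dual_bases V n e e'"
    using some_dual_bases[OF d] .
  have sp: "is_space V" by (simp add: lins)
  note [lins] = dual_bases_closed[OF sp d]
  show ?thesis
  proof (rule is_dualI[OF antipodal_twist_right V d])
    fix \<phi> assume \<phi>: "\<phi> \<in> carr (dual_space V)"
    note [lins] = lin_comp[OF _ dual_lin[OF \<phi>]] is_space_dual[OF sp] lin_pure1
    have "ev H H f2 (\<lambda>f1 f2. ev H H g2 (\<lambda>g1 g2. C V (act V (T g2) (e i)) (\<lambda>a m0. pure H (dual_space V) (scl H (\<phi> (act V (T f1) m0)) (g1 * S a * f2)) (e' i))))
      = ev H H f2 (\<lambda>f1 f2. ev H H g2 (\<lambda>g1 g2. C V (ac V (T g2) (e i)) (\<lambda>a m0. pure H (dual_space V) (scl H (\<phi> (ac V (T f1) m0)) (g1 * S a * f2)) (e' i))))"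
      if "i \<in> {1..n}" for i
      unfolding ac_eq[OF dual_bases_closed(1)[OF sp d that]]
      by (intro ev_eqI C_cong V act_closed premodule_left dual_bases_closed(1)[OF sp d that]) (simp only: ac_eq)
    then have "coact (yd_right_dual H V) \<phi> = (\<Sum>i=1..n. ev H H f2 (\<lambda>f1 f2. ev H H g2 (\<lambda>g1 g2. C V (ac V (T g2) (e i)) (\<lambda>a m0. pure H (dual_space V) (scl H (\<phi> (ac V (T f1) m0)) (g1 * S a * f2)) (e' i)))))"
      by (simp add: yd_right_dual_def s sw_evs) (simp add: ev_def)
    \<comment> \<open>With the reversed twists, S(T(f2) a T(g1)) = g1 S(a) f2: the right dual takes
      the shape of the left one.\<close>
    then show "coact (yd_right_dual H V) \<phi> = (\<Sum>i=1..n. ev H H (flip2 T f2) (\<lambda>f1 f2. ev H H (flip2 T g2) (\<lambda>g1 g2.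
      C V (ac V g1 (e i)) (\<lambda>a m0. pure H (dual_space V) (scl H (\<phi> (ac V f2 m0)) (S (f1 * a * g2))) (e' i)))))"
      by (simp add: ev2_flip2[where U="tensor_space H (dual_space V)"] lins mult.assoc)
  qed (simp_all add: yd_right_dual_def)
qed

section \<open>Tensor products as modules with a coaction\<close>

lemma yd_tensor_simps [simp]:
  "carr (yd_tensor H V W) = carr (tensor_space V W)" "scl (yd_tensor H V W) = fun_scl"
  by (simp_all add: yd_tensor_def)

lemma yd_tensor_space [lins]: "is_space (yd_tensor H V W)"
  using is_space_tensor[of V W] by (simp add: is_space_def)

lemma yd_tensor_cong:
  "lin (yd_tensor H V W) = lin (tensor_space V W)" "lin X (yd_tensor H V W) = lin X (tensor_space V W)"
  "pure X (yd_tensor H V W) = pure X (tensor_space V W)"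
  "tensor_space X (yd_tensor H V W) = tensor_space X (tensor_space V W)"
  "sw X (yd_tensor H V W) = sw X (tensor_space V W)" "ev X (yd_tensor H V W) = ev X (tensor_space V W)"
  "dual_space (yd_tensor H V W) = dual_space (tensor_space V W)"
proof -
  show "sw X (yd_tensor H V W) = sw X (tensor_space V W)" by (rule space_cong(4)) simp_all
  then show "ev X (yd_tensor H V W) = ev X (tensor_space V W)" by (simp add: ev_def fun_eq_iff)
  show "lin (yd_tensor H V W) = lin (tensor_space V W)" "lin X (yd_tensor H V W) = lin X (tensor_space V W)"
    by (simp_all add: lin_def fun_eq_iff)
qed (rule space_cong; simp)+

lemma lin_pure [lins]:
  "w \<in> carr W \<Longrightarrow> lin X V f \<Longrightarrow> lin X (tensor_space V W) (\<lambda>x. pure V W (f x) w)"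
  "v \<in> carr V \<Longrightarrow> lin X W g \<Longrightarrow> lin X (tensor_space V W) (\<lambda>x. pure V W v (g x))"
  by (simp_all add: lin_pure1 lin_pure2)

lemma lin_tcoact [lins]:
  assumes [lins]: "premodule V" "premodule W" "is_space U" "is_space X" and R: "multilin3 H V W U R"
    and [lins]: "s \<in> carr H3" "t \<in> carr H3" "u \<in> carr H3"
  shows "lin X V f \<Longrightarrow> lin X U (\<lambda>x. tcoact s t u V W (f x) w R)"
    "lin X W g \<Longrightarrow> lin X U (\<lambda>x. tcoact s t u V W v (g x) R)"
proof -
  note [lins] = multilin3_lin[OF R]
  show "lin X V f \<Longrightarrow> lin X U (\<lambda>x. tcoact s t u V W (f x) w R)"
    "lin X W g \<Longrightarrow> lin X U (\<lambda>x. tcoact s t u V W v (g x) R)"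
    by (simp_all add: tcoact_def lins)
qed

lemma tcoact_apply:
  assumes [lins]: "premodule V" "premodule W" and U: "is_space U" and L: "lin U U' L"
    and R: "\<And>h v w. v \<in> carr V \<Longrightarrow> w \<in> carr W \<Longrightarrow> R h v w \<in> carr U"
    and [lins]: "s \<in> carr H3" "t \<in> carr H3" "u \<in> carr H3"
  shows "L (tcoact s t u V W v w R) = tcoact s t u V W v w (\<lambda>h v w. L (R h v w))"
    and "tcoact s t u V W v w R \<in> carr U"
proof -
  have 2: "C W (ac W l w) (\<lambda>b w0. R (p b) (ac V X2 v0) (ac W q w0)) \<in> carr U" for p X2 q l v0
    by (rule ev_closed[OF is_space_H U]) (simp_all add: lins R)
  have 1: "C V (ac V k v) (\<lambda>a v0. C W (ac W l w) (\<lambda>b w0. R (p a b) (ac V X2 v0) (ac W q w0))) \<in> carr U" for p X2 q k l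
    by (rule ev_closed[OF is_space_H U]) (simp_all add: lins 2)
  show "tcoact s t u V W v w R \<in> carr U" unfolding tcoact_def by (intro ev3_closed U 1) (simp_all add: lins)
  have e: "L (C V (ac V k v) (\<lambda>a v0. C W (ac W l w) (\<lambda>b w0. R (p a b) (ac V X2 v0) (ac W q w0))))
      = C V (ac V k v) (\<lambda>a v0. C W (ac W l w) (\<lambda>b w0. L (R (p a b) (ac V X2 v0) (ac W q w0))))" for p X2 q k l
    by (simp add: lin_ev_apply[OF is_space_H U L] 2 lins R)
  show "L (tcoact s t u V W v w R) = tcoact s t u V W v w (\<lambda>h v w. L (R h v w))"
    unfolding tcoact_def by (simp add: lin_ev3_apply[OF U L] 1 ev3_closed U lins e)
qed

context
  fixes V :: "('k, 'h, 'v::ab_group_add) ydm" and W :: "('k, 'h, 'w::ab_group_add) ydm"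
  assumes V [lins]: "premodule V" and W [lins]: "premodule W"
begin

abbreviation "VW \<equiv> tensor_space V W"

lemma act_tensor:
  assumes t: "t \<in> carr VW"
  shows "act (yd_tensor H V W) h t = ev V W t (\<lambda>v w. D h (\<lambda>h1 h2. pure V W (ac V h1 v) (ac W h2 w)))"
proof -
  have "act (yd_tensor H V W) h t = ev V W t (\<lambda>v w. D h (\<lambda>h1 h2. pure V W (act V h1 v) (act W h2 w)))"
    by (simp add: yd_tensor_def sw_evs) (simp add: ev_def)
  also have "\<dots> = ev V W t (\<lambda>v w. D h (\<lambda>h1 h2. pure V W (ac V h1 v) (ac W h2 w)))"
    by (rule ev_cong[OF _ t]) (simp_all add: lins ac_eq)
  finally show ?thesis .
qed

lemma coact_tensor:
  assumes t: "t \<in> carr VW"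
  shows "coact (yd_tensor H V W) t = ev V W t (\<lambda>v w. tcoact (Phi H) (Phi_inv H) (Phi H) V W v w
    (\<lambda>h v w. pure H VW h (pure V W v w)))"
proof -
  have "coact (yd_tensor H V W) t = ev V W t (\<lambda>v w. P (\<lambda>X1 X2 X3. Q (\<lambda>x1 x2 x3. P (\<lambda>Y1 Y2 Y3.
      C V (act V (x1 * Y1) v) (\<lambda>a v0. C W (act W Y2 w) (\<lambda>b w0. pure H VW (X1 * a * x2 * b * Y3)
        (pure V W (act V X2 v0) (act W (X3 * x3) w0))))))))"
    by (simp add: yd_tensor_def sw_evs) (simp add: ev_def)
  also have "\<dots> = ev V W t (\<lambda>v w. tcoact (Phi H) (Phi_inv H) (Phi H) V W v w
    (\<lambda>h v w. pure H VW h (pure V W v w)))"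
    unfolding tcoact_def
  proof (rule ev_cong[OF _ t], goal_cases)
    case (2 v w)
    show ?case unfolding ac_eq[OF 2(1)] ac_eq[OF 2(2)]
      by (intro ev3_eqI C_cong V W act_closed premodule_left 2) (simp only: ac_eq)
  qed (simp add: lins)
  finally show ?thesis .
qed

lemma premodule_tensor: "premodule (yd_tensor H V W)"
proof -
  have sp: "is_space V" "is_space W" by (simp_all add: lins)
  have b: "bilin V W VW (\<lambda>v w. D h (\<lambda>h1 h2. pure V W (ac V h1 v) (ac W h2 w)))" for h by (simp add: lins)
  have cl: "act (yd_tensor H V W) h t \<in> carr VW" if "t \<in> carr VW" for h t
    unfolding act_tensor[OF that] by (rule ev_closed[OF sp(1) _ that]) (simp_all add: lins pure_in_tensor)
  have "bilin H (yd_tensor H V W) (yd_tensor H V W) (act (yd_tensor H V W))"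
  proof (intro bilinI)
    fix t assume "t \<in> carr (yd_tensor H V W)"
    then have t [lins]: "t \<in> carr VW" by simp
    show "lin H (yd_tensor H V W) (\<lambda>h. act (yd_tensor H V W) h t)"
      unfolding yd_tensor_cong act_tensor[OF t] by (simp add: lins)
  next
    fix h
    show "lin (yd_tensor H V W) (yd_tensor H V W) (act (yd_tensor H V W) h)"
      unfolding yd_tensor_cong
      by (simp only: lin_cong[of VW "act (yd_tensor H V W) h", OF is_space_tensor act_tensor]) (simp add: lins)
  qed
  moreover have "act (yd_tensor H V W) (h * h') t = act (yd_tensor H V W) h (act (yd_tensor H V W) h' t)"
    if t: "t \<in> carr VW" for h h' t
    unfolding act_tensor[OF cl[OF t]] unfolding act_tensor[OF t]
  proof (subst ev_ev[OF sp(1) is_space_tensor b sp(1) t], goal_cases)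
    case 2
    show ?case
    proof (rule ev_cong[OF sp(1) t])
      fix v w assume vw: "v \<in> carr V" "w \<in> carr W"
      have "ev V W (D h' (\<lambda>h1 h2. pure V W (ac V h1 v) (ac W h2 w))) (\<lambda>v w. D h (\<lambda>h1 h2. pure V W (ac V h1 v) (ac W h2 w)))
          = D h' (\<lambda>k1 k2. D h (\<lambda>h1 h2. pure V W (ac V (h1 * k1) v) (ac W (h2 * k2) w)))"
        by (subst ev_ev[OF sp(1) is_space_tensor b]) (simp_all add: lins pure_in_tensor ev_pure[OF sp(1) is_space_tensor b])
      then show "D (h * h') (\<lambda>h1 h2. pure V W (ac V h1 v) (ac W h2 w))
          = ev V W (D h' (\<lambda>h1 h2. pure V W (ac V h1 v) (ac W h2 w))) (\<lambda>v w. D h (\<lambda>h1 h2. pure V W (ac V h1 v) (ac W h2 w)))"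
        by (simp add: D_mult'[where U=VW] lins)
    qed
  qed (simp add: lins pure_in_tensor)
  moreover have "act (yd_tensor H V W) 1 t = t" if t: "t \<in> carr VW" for t
  proof -
    have "act (yd_tensor H V W) 1 t = ev V W t (pure V W)"
      unfolding act_tensor[OF t] by (rule ev_cong[OF sp(1) t]) (simp add: D_one[where U=VW] lins ac_one)
    then show ?thesis by (simp add: ev_pure_self[OF sp(1) t])
  qed
  ultimately have l: "left_module H (yd_tensor H V W)" by (simp add: left_module_def lins)
  have m: "multilin3 H V W (tensor_space H VW) (\<lambda>h v w. pure H VW h (pure V W v w))"
    by (simp add: lins pure_in_tensor)
  have "lin (yd_tensor H V W) (tensor_space H (yd_tensor H V W)) (coact (yd_tensor H V W))"
    unfolding yd_tensor_cong using m
    by (simp only: lin_cong[of VW "coact (yd_tensor H V W)", OF is_space_tensor coact_tensor]) (simp add: lins)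
  then show ?thesis using l by (simp add: premodule_def)
qed

end

text \<open>The coaction on the dual of a tensor product is defined through chosen dual bases, so
  their existence has to be secured for the tensor product too; tensors of basis vectors span
  it.\<close>

lemma dual_bases_tensor_exist:
  fixes V :: "('k, 'h, 'v::ab_group_add) ydm" and W :: "('k, 'h, 'w::ab_group_add) ydm"
  assumes V: "is_space V" and W: "is_space W" and dV: "dual_bases V p e e'" and dW: "dual_bases W q d d'"
  shows "\<exists>s e e'. dual_bases (yd_tensor H V W) s e e'"
proof (rule dual_bases_exist[OF yd_tensor_space])
  let ?B = "(\<lambda>(i, j). pure V W (e i) (d j)) ` ({1..p} \<times> {1..q})"
  note cV = dual_bases_closed[OF V dV] and cW = dual_bases_closed[OF W dW]
  show "finite ?B" by simp
  interpret vector_space "fun_scl :: 'k \<Rightarrow> (('v \<Rightarrow> 'w \<Rightarrow> 'k) \<Rightarrow> 'k) \<Rightarrow> _" by (rule vector_space_fun_scl)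
  have "span ?B \<subseteq> carr (tensor_space V W)"
    using is_space_tensor[of V W] cV cW by (intro span_minimal) (auto simp: is_space_def intro!: pure_in_tensor)
  moreover have "pure V W v w \<in> span ?B" if v: "v \<in> carr V" and w: "w \<in> carr W" for v w
  proof -
    have "pure V W v w = (\<Sum>i=1..p. fun_scl (e' i v) (pure V W (e i) w))"
      using dual_bases_apply[OF V dV v, of "tensor_space V W" "\<lambda>v. pure V W v w"] w by (simp add: lin_pure1 lin_ident)
    also have "\<dots> = (\<Sum>i=1..p. fun_scl (e' i v) (\<Sum>j=1..q. fun_scl (d' j w) (pure V W (e i) (d j))))"
      using dual_bases_apply[OF W dW w, of "tensor_space V W" "\<lambda>w. pure V W (e i) w" for i] cV
      by (intro sum.cong refl arg_cong[where f="fun_scl _"]) (simp add: lin_pure2 lin_ident)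
    also have "\<dots> \<in> span ?B"
      by (intro span_sum span_scale span_base) force
    finally show ?thesis .
  qed
  note pure = this
  have "{pure V W v w | v w. v \<in> carr V \<and> w \<in> carr W} \<subseteq> span ?B"
    by (rule subsetI) (elim CollectE exE conjE, simp only: pure)
  then have "span {pure V W v w | v w. v \<in> carr V \<and> w \<in> carr W} \<subseteq> span ?B"
    by (rule span_minimal) (rule subspace_span)
  then have "carr (tensor_space V W) \<subseteq> span ?B" by (simp only: tensor_space_def space.simps)
  ultimately show "module.span (scl (yd_tensor H V W)) ?B = carr (yd_tensor H V W)"
    unfolding yd_tensor_simps by (rule equalityI)
qed

end

section \<open>The isomorphisms\<close>

text \<open>\<open>M'\<close>, \<open>N'\<close>, \<open>X'\<close> stand for the duals of M, N and
  M \<otimes> N, known only through \<open>is_dual\<close>. The locale is interpreted once with left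
  and once with right duals.\<close>

locale dual_pair = yd_pair H M N
  for H :: "('k::field, 'h::ring_1) qhopf" and M :: "('k, 'h, 'm::ab_group_add) ydm" and N :: "('k, 'h, 'n::ab_group_add) ydm" +
  fixes s r :: "'h \<Rightarrow> 'h" and f g :: "('k, 'h, 'h) tensor" and M' :: "('k, 'h, 'm \<Rightarrow> 'k) ydm" and N' :: "('k, 'h, 'n \<Rightarrow> 'k) ydm"
    and X' :: "('k, 'h, ('k, 'm, 'n) tensor \<Rightarrow> 'k) ydm"
    and p q :: nat and em :: "nat \<Rightarrow> 'm" and em' :: "nat \<Rightarrow> 'm \<Rightarrow> 'k" and en :: "nat \<Rightarrow> 'n" and en' :: "nat \<Rightarrow> 'n \<Rightarrow> 'k"
  assumes at: "antipodal_twist s r f g" and dM: "dual_bases M p em em'" and dN: "dual_bases N q en en'"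
    and M': "is_dual s f g M M'" and N': "is_dual s f g N N'" and X': "is_dual s f g (yd_tensor H M N) X'"
begin

abbreviation "MN \<equiv> yd_tensor H M N"
abbreviation "T' \<equiv> yd_tensor H M' N'"
abbreviation "TT \<equiv> tensor_space M' N'"

lemmas at_lins [lins] = antipodal_twistD(1,4,5)[OF at]

lemma space_M [lins]: "is_space M" and space_N [lins]: "is_space N"
  by (simp_all add: lins)

lemma carr_duals: "carr M' = carr (dual_space M)" "scl M' = fun_scl" "carr N' = carr (dual_space N)" "scl N' = fun_scl"
    "carr X' = carr (dual_space (tensor_space M N))" "scl X' = fun_scl"
  and pre_duals [lins]: "premodule M'" "premodule N'" "premodule X'"
  using M' N' X' by (simp_all add: is_dual_def yd_tensor_cong)

lemma space_duals [lins]: "is_space M'" "is_space N'" "is_space X'"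
  by (rule left_module_space, rule premodule_left, simp add: lins)+

lemma pre_MN [lins]: "premodule MN"
  by (rule premodule_tensor) (simp_all add: lins)

lemma dual_apply_lin [lins]: "lin M' ground (\<lambda>\<phi>. \<phi> m)" "lin N' ground (\<lambda>\<psi>. \<psi> n)" "lin X' ground (\<lambda>\<mu>. \<mu> u)"
  by (simp_all add: lin_def carr_duals fun_scl_def)

lemma dual_elem_lin: "\<phi> \<in> carr M' \<Longrightarrow> lin M ground \<phi>" "\<psi> \<in> carr N' \<Longrightarrow> lin N ground \<psi>"
    "\<mu> \<in> carr X' \<Longrightarrow> lin (tensor_space M N) ground \<mu>"
  by (simp_all add: carr_duals dual_lin)

lemma act_duals:
  "\<phi> \<in> carr M' \<Longrightarrow> m \<in> carr M \<Longrightarrow> ac M' h \<phi> m = \<phi> (ac M (s h) m)"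
  "\<psi> \<in> carr N' \<Longrightarrow> n \<in> carr N \<Longrightarrow> ac N' h \<psi> n = \<psi> (ac N (s h) n)"
  "\<mu> \<in> carr X' \<Longrightarrow> u \<in> carr (tensor_space M N) \<Longrightarrow> ac X' h \<mu> u = \<mu> (ac MN (s h) u)"
  using M' N' X' by (simp_all add: is_dual_def ac_eq)

lemma bases_closed [lins]:
  "i \<in> {1..p} \<Longrightarrow> em i \<in> carr M" "i \<in> {1..p} \<Longrightarrow> em' i \<in> carr M'"
  "j \<in> {1..q} \<Longrightarrow> en j \<in> carr N" "j \<in> {1..q} \<Longrightarrow> en' j \<in> carr N'"
  using dual_bases_closed[OF space_M dM] dual_bases_closed[OF space_N dN] carr_duals by simp_all

lemma bilin_eval: "bilin M' N' ground (\<lambda>\<phi> \<psi>. \<phi> m * \<psi> n)"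
  by (simp add: lins lin_mult_ground1 lin_mult_ground2)

text \<open>Identifies \<open>M'\<close> \<otimes> \<open>N'\<close> with the bilinear forms on M
  \<times> N. Finite dimension makes this bijective, with inverse \<open>from_form\<close>.\<close>

definition pairing :: "('k, 'm \<Rightarrow> 'k, 'n \<Rightarrow> 'k) tensor \<Rightarrow> 'm \<Rightarrow> 'n \<Rightarrow> 'k" where
  "pairing t m n = ev M' N' t (\<lambda>\<phi> \<psi>. \<phi> m * \<psi> n)"

lemma lin_pairing [lins]: "lin X TT F \<Longrightarrow> lin X ground (\<lambda>x. pairing (F x) m n)"
  using bilin_eval by (simp add: pairing_def lins)

lemma bilin_pairing:
  assumes t [lins]: "t \<in> carr TT"
  shows "bilin M N ground (pairing t)"
proof (intro bilinI)
  fix n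
  show "lin M ground (\<lambda>m. pairing t m n)" unfolding pairing_def
    by (intro lin_ev_body) (simp_all add: lins lin_mult_ground1 dual_elem_lin)
next
  fix m
  show "lin N ground (pairing t m)" unfolding pairing_def[abs_def]
    by (intro lin_ev_body) (simp_all add: lins lin_mult_ground2 dual_elem_lin)
qed

lemma pairing_pure: "\<phi> \<in> carr M' \<Longrightarrow> \<psi> \<in> carr N' \<Longrightarrow> pairing (pure M' N' \<phi> \<psi>) m n = \<phi> m * \<psi> n"
  unfolding pairing_def by (rule ev_pure[OF space_duals(1) is_space_ground bilin_eval])

definition from_form :: "('m \<Rightarrow> 'n \<Rightarrow> 'k) \<Rightarrow> ('k, 'm \<Rightarrow> 'k, 'n \<Rightarrow> 'k) tensor" where
  "from_form b = (\<Sum>i=1..p. \<Sum>j=1..q. fun_scl (b (em i) (en j)) (pure M' N' (em' i) (en' j)))"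

lemma from_form_closed [lins]: "from_form b \<in> carr TT"
  unfolding from_form_def by (intro sum_closed is_space_tensor) (simp add: lins pure_in_tensor)

lemma pairing_from_form:
  assumes b: "bilin M N ground b" and m: "m \<in> carr M" and n: "n \<in> carr N"
  shows "pairing (from_form b) m n = b m n"
proof -
  note [lins] = bilin_lin1[OF b] bilin_lin2[OF b] m n
  have l: "lin TT ground (\<lambda>t. pairing t m n)" by (simp add: lins)
  have "pairing (from_form b) m n = (\<Sum>i=1..p. pairing (\<Sum>j=1..q. fun_scl (b (em i) (en j)) (pure M' N' (em' i) (en' j))) m n)"
    unfolding from_form_def
    by (rule lin_sum[OF is_space_tensor l]) (intro sum_closed is_space_tensor fun_scl_closed pure_in_tensor bases_closed)
  also have "\<dots> = (\<Sum>i=1..p. \<Sum>j=1..q. pairing (fun_scl (b (em i) (en j)) (pure M' N' (em' i) (en' j))) m n)"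
    by (intro sum.cong refl lin_sum[OF is_space_tensor l] fun_scl_closed pure_in_tensor bases_closed)
  also have "\<dots> = (\<Sum>i=1..p. scl ground (em' i m) (\<Sum>j=1..q. scl ground (en' j n) (b (em i) (en j))))"
    unfolding sum_scl[OF is_space_ground]
  proof (intro sum.cong refl)
    fix i j assume ij: "i \<in> {1..p}" "j \<in> {1..q}"
    have "pairing (fun_scl (b (em i) (en j)) (pure M' N' (em' i) (en' j))) m n = b (em i) (en j) * pairing (pure M' N' (em' i) (en' j)) m n"
      using lin_scl[OF l pure_in_tensor[OF bases_closed(2)[OF ij(1)] bases_closed(4)[OF ij(2)]]] by simp
    then show "pairing (fun_scl (b (em i) (en j)) (pure M' N' (em' i) (en' j))) m n
        = scl ground (em' i m) (scl ground (en' j n) (b (em i) (en j)))"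
      using pairing_pure[OF bases_closed(2)[OF ij(1)] bases_closed(4)[OF ij(2)]] by simp
  qed
  also have "\<dots> = (\<Sum>i=1..p. scl ground (em' i m) (b (em i) n))"
    by (intro sum.cong refl arg_cong[where f="scl ground _"] dual_bases_apply[OF space_N dN n] bilin_lin2[OF b] bases_closed lin_ident)
  also have "\<dots> = b m n"
    by (intro dual_bases_apply[OF space_M dM m] bilin_lin1[OF b] n lin_ident)
  finally show ?thesis .
qed

lemma tensor_dual_eqI:
  assumes t: "t \<in> carr TT" and t': "t' \<in> carr TT"
    and eq: "\<And>m n. m \<in> carr M \<Longrightarrow> n \<in> carr N \<Longrightarrow> pairing t m n = pairing t' m n"
  shows "t = t'"
proof (rule tensor_coord_eqI[OF space_duals(1,2) t t', where K="{1..q}" and b=en' and E="\<lambda>k \<psi>. \<psi> (en k)"])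
  show "k \<in> {1..q} \<Longrightarrow> en' k \<in> carr N'" for k by (rule bases_closed)
  show "x \<in> carr N' \<Longrightarrow> (\<Sum>k=1..q. scl N' (x (en k)) (en' k)) = x" for x
    unfolding carr_duals by (rule dual_expand[OF space_N dN])
  fix k B assume k: "k \<in> {1..q}" and B: "lin M' ground B"
  have "ev M' N' u (\<lambda>\<phi> \<psi>. B \<phi> * \<psi> (en k)) = (\<Sum>i=1..p. B (em' i) * pairing u (em i) (en k))" if u: "u \<in> carr TT" for u
  proof -
    have "B \<phi> = (\<Sum>i=1..p. B (em' i) * \<phi> (em i))" if \<phi>: "\<phi> \<in> carr M'" for \<phi>
    proof -
      have "B \<phi> = B (\<Sum>i=1..p. scl M' (\<phi> (em i)) (em' i))"
        using dual_expand[OF space_M dM] \<phi> unfolding carr_duals by simp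
      also have "\<dots> = (\<Sum>i=1..p. B (scl M' (\<phi> (em i)) (em' i)))"
        by (intro lin_sum[OF space_duals(1) B] is_space_scl[OF space_duals(1)] bases_closed)
      also have "\<dots> = (\<Sum>i=1..p. B (em' i) * \<phi> (em i))"
        using lin_scl[OF B bases_closed(2)] by (intro sum.cong refl) (simp add: mult.commute)
      finally show ?thesis .
    qed
    then have "ev M' N' u (\<lambda>\<phi> \<psi>. B \<phi> * \<psi> (en k)) = ev M' N' u (\<lambda>\<phi> \<psi>. \<Sum>i=1..p. B (em' i) * (\<phi> (em i) * \<psi> (en k)))"
      by (intro ev_cong[OF space_duals(1) u]) (simp add: sum_distrib_right mult.assoc)
    then show ?thesis by (simp only: ev_sum pairing_def mult_ev)
  qed
  then show "ev M' N' t (\<lambda>\<phi> \<psi>. B \<phi> * \<psi> (en k)) = ev M' N' t' (\<lambda>\<phi> \<psi>. B \<phi> * \<psi> (en k))"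
    using eq bases_closed(1) bases_closed(3)[OF k] by (simp add: t t')
qed

lemma from_form_pairing: "t \<in> carr TT \<Longrightarrow> from_form (pairing t) = t"
  by (rule tensor_dual_eqI) (simp_all add: lins pairing_from_form bilin_pairing)

text \<open>Testing with \<open>B (s a)\<close> loses nothing because \<open>s\<close> is
  invertible, and it is the form in which \<open>is_dual\<close> delivers dual coactions.\<close>

lemma coact_tensor_dual_eqI:
  assumes t: "t \<in> carr (tensor_space H TT)" and t': "t' \<in> carr (tensor_space H TT)"
    and eq: "\<And>m n B. m \<in> carr M \<Longrightarrow> n \<in> carr N \<Longrightarrow> lin H ground B \<Longrightarrow>
      ev H TT t (\<lambda>a u. B (s a) * pairing u m n) = ev H TT t' (\<lambda>a u. B (s a) * pairing u m n)"
  shows "t = t'"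
proof (rule tensor_coord_eqI[OF is_space_H is_space_tensor t t', where K="{1..p} \<times> {1..q}"
      and b="\<lambda>(i, j). pure M' N' (em' i) (en' j)" and E="\<lambda>(i, j) u. pairing u (em i) (en j)"])
  show "k \<in> {1..p} \<times> {1..q} \<Longrightarrow> (case k of (i, j) \<Rightarrow> pure M' N' (em' i) (en' j)) \<in> carr TT" for k
    by (auto intro!: pure_in_tensor bases_closed)
  show "u \<in> carr TT \<Longrightarrow> (\<Sum>k\<in>{1..p} \<times> {1..q}. scl TT ((case k of (i, j) \<Rightarrow> \<lambda>u. pairing u (em i) (en j)) u)
      (case k of (i, j) \<Rightarrow> pure M' N' (em' i) (en' j))) = u" for u
    using from_form_pairing[of u] by (simp add: from_form_def sum.cartesian_product case_prod_unfold)
  fix k B assume k: "k \<in> {1..p} \<times> {1..q}" and B: "lin H ground B"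
  have "lin H ground (\<lambda>x. B (r x))" using lin_comp[OF antipodal_twistD(10)[OF at lin_ident] B] .
  from eq[OF _ _ this] k show "ev H TT t (\<lambda>a x. B a * (case k of (i, j) \<Rightarrow> \<lambda>u. pairing u (em i) (en j)) x)
      = ev H TT t' (\<lambda>a x. B a * (case k of (i, j) \<Rightarrow> \<lambda>u. pairing u (em i) (en j)) x)"
    by (auto simp: antipodal_twistD(11)[OF at] bases_closed)
qed

definition hat :: "(('k, 'm, 'n) tensor \<Rightarrow> 'k) \<Rightarrow> 'm \<Rightarrow> 'n \<Rightarrow> 'k" where
  "hat \<mu> m n = \<mu> (pure M N m n)"

lemma bilin_hat:
  assumes \<mu>: "\<mu> \<in> carr X'"
  shows "bilin M N ground (hat \<mu>)"
proof -
  note [lins] = lin_comp[OF _ dual_elem_lin(3)[OF \<mu>]]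
  show ?thesis by (simp add: hat_def[abs_def] lins)
qed

text \<open>The stated inverse map: its coefficients are the values of
  \<open>act21 g (coform (hat \<mu>))\<close> at pairs of basis vectors.\<close>

definition tau :: "(('k, 'm, 'n) tensor \<Rightarrow> 'k) \<Rightarrow> ('k, 'm \<Rightarrow> 'k, 'n \<Rightarrow> 'k) tensor" where
  "tau \<mu> = from_form (act21 g (coform (hat \<mu>)))"

lemma pairing_tau: "\<mu> \<in> carr X' \<Longrightarrow> m \<in> carr M \<Longrightarrow> n \<in> carr N \<Longrightarrow> pairing (tau \<mu>) m n = act21 g (coform (hat \<mu>)) m n"
  unfolding tau_def by (rule pairing_from_form) (simp_all add: bilin_act bilin_coform bilin_hat lins)

lemma lin_tau: "lin X' TT tau"
  unfolding tau_def[abs_def] from_form_def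
proof (intro lin_sum_body space_duals is_space_tensor)
  fix i j assume "i \<in> {1..p}" "j \<in> {1..q}"
  then have c: "pure M' N' (em' i) (en' j) \<in> carr TT" by (intro pure_in_tensor bases_closed)
  have "lin X' ground (\<lambda>\<mu>. act21 g (coform (hat \<mu>)) m n)" for m n
    by (simp add: act21_def coform_def hat_def lins)
  then show "lin X' TT (\<lambda>\<mu>. fun_scl (act21 g (coform (hat \<mu>)) (em i) (en j)) (pure M' N' (em' i) (en' j)))"
    by (rule lin_fun_scl(2)[OF _ c])
qed

lemma act_pure: "m \<in> carr M \<Longrightarrow> n \<in> carr N \<Longrightarrow> act MN h (pure M N m n) = D h (\<lambda>h1 h2. pure M N (ac M h1 m) (ac N h2 n))"
  by (simp add: act_tensor lins pure_in_tensor) (subst ev_pure[where U="tensor_space M N"], simp_all add: lins)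

lemma hat_act:
  assumes \<mu>: "\<mu> \<in> carr X'" and mn: "m \<in> carr M" "n \<in> carr N"
  shows "\<mu> (act MN h (pure M N m n)) = act12 (\<Delta> h) (hat \<mu>) m n"
  unfolding act_pure[OF mn]
  by (subst lin_ev2_apply[OF is_space_tensor dual_elem_lin(3)[OF \<mu>]]) (simp_all add: lins pure_in_tensor act12_def hat_def)

lemma coform_cong:
  "(\<And>m n. m \<in> carr M \<Longrightarrow> n \<in> carr N \<Longrightarrow> b m n = b' m n) \<Longrightarrow> coform b = coform b'"
  by (simp add: coform_def fun_eq_iff lins)

lemma act21_cong:
  "(\<And>m n. m \<in> carr M \<Longrightarrow> n \<in> carr N \<Longrightarrow> b m n = b' m n) \<Longrightarrow> act21 t b = act21 t b'"
  by (simp add: act21_def fun_eq_iff lins)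

text \<open>Acting on \<mu> precomposes its form with \<Delta>(s(h)), whose legs
  \<open>coform\<close> exchanges. Moving this past \<open>g\<close> produces the reversed coproduct
  under \<open>s\<close>, which is the action on \<open>M'\<close> \<otimes>
  \<open>N'\<close>.\<close>

lemma tau_act:
  assumes \<mu>: "\<mu> \<in> carr X'"
  shows "tau (act X' h \<mu>) = act T' h (tau \<mu>)"
proof -
  have t: "tau \<mu> \<in> carr TT" by (simp add: tau_def lins)
  have a: "act X' h \<mu> \<in> carr X'" using act_closed[OF premodule_left[OF pre_duals(3)] \<mu>] .
  have c: "act T' h (tau \<mu>) \<in> carr TT"
    using act_closed[OF premodule_left[OF premodule_tensor[OF pre_duals(1,2)]], of "tau \<mu>" h] t by simp
  have h: "coform (hat (act X' h \<mu>)) = act21 (\<Delta> (s h)) (coform (hat \<mu>))"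
  proof -
    have "coform (hat (act X' h \<mu>)) = coform (act12 (\<Delta> (s h)) (hat \<mu>))"
    proof (rule coform_cong)
      fix m n assume mn: "m \<in> carr M" "n \<in> carr N"
      have "hat (act X' h \<mu>) m n = \<mu> (act MN (s h) (pure M N m n))"
        using act_duals(3)[OF \<mu>, of "pure M N m n" h] \<mu> pure_in_tensor[OF mn] by (simp add: hat_def ac_eq)
      then show "hat (act X' h \<mu>) m n = act12 (\<Delta> (s h)) (hat \<mu>) m n" by (simp add: hat_act[OF \<mu> mn])
    qed
    then show ?thesis by (simp add: coform_comult bilin_hat \<mu>)
  qed
  note b = bilin_coform(1)[OF bilin_hat[OF \<mu>]]
  show ?thesis
  proof (rule tensor_dual_eqI[OF _ c])
    show "tau (act X' h \<mu>) \<in> carr TT" by (simp add: tau_def lins)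
    fix m n assume mn: "m \<in> carr M" "n \<in> carr N"
    have "pairing (act T' h (tau \<mu>)) m n = ev M' N' (tau \<mu>) (\<lambda>\<phi> \<psi>. D h (\<lambda>h1 h2. pairing (pure M' N' (ac M' h1 \<phi>) (ac N' h2 \<psi>)) m n))"
    proof -
      have l: "lin TT ground (\<lambda>t. pairing t m n)" by (simp add: lins)
      show ?thesis unfolding act_tensor[OF pre_duals(1,2) t]
        by (subst lin_ev_apply[OF space_duals(1) is_space_tensor l t])
          (simp_all add: lin_ev2_apply[OF is_space_tensor l] lins pure_in_tensor)
    qed
    also have "\<dots> = ev M' N' (tau \<mu>) (\<lambda>\<phi> \<psi>. D h (\<lambda>h1 h2. \<phi> (ac M (s h1) m) * \<psi> (ac N (s h2) n)))"
      by (rule ev_cong[OF space_duals(1) t]) (simp add: pairing_pure lins act_duals mn)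
    also have "\<dots> = D h (\<lambda>h1 h2. pairing (tau \<mu>) (ac M (s h1) m) (ac N (s h2) n))"
      unfolding pairing_def by (rule ev_swap)
    also have "\<dots> = act21 (flip2 s (\<Delta> h)) (act21 g (coform (hat \<mu>))) m n"
    proof -
      note [lins] = bilin_lin1[OF bilin_act(2)[OF b]] bilin_lin2[OF bilin_act(2)[OF b]]
      show ?thesis by (simp add: pairing_tau \<mu> lins act21_def[of "flip2 s _"] ev2_flip2[where U=ground])
    qed
    also have "\<dots> = act21 (g \<odot>\<^sub>2 flip2 s (\<Delta> h)) (coform (hat \<mu>)) m n"
      by (simp add: act_mult(2)[OF b] lins)
    also have "\<dots> = pairing (tau (act X' h \<mu>)) m n"
      by (simp add: pairing_tau a mn h twisted_reassociator(4)[OF at, symmetric] act_mult(2)[OF b] lins)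
    finally show "pairing (tau (act X' h \<mu>)) m n = pairing (act T' h (tau \<mu>)) m n" by (rule sym)
  qed
qed

section \<open>Colinearity of \<open>tau\<close>\<close>

definition twisted_coact where
  "twisted_coact V v F = ev H H f (\<lambda>f1 f2. ev H H g (\<lambda>g1 g2. C V (ac V g1 v) (\<lambda>a v0. F (f1 * a * g2) (ac V f2 v0))))"

lemma twisted_coact_swap: "ev V W t (\<lambda>a b. twisted_coact U v (F a b)) = twisted_coact U v (\<lambda>x y. ev V W t (\<lambda>a b. F a b x y))"
  by (simp only: twisted_coact_def ev_swap[of V W t])

lemma twisted_coact_cong: "premodule V \<Longrightarrow> (\<And>a v0. v0 \<in> carr V \<Longrightarrow> F a v0 = G a v0) \<Longrightarrow> twisted_coact V v F = twisted_coact V v G"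
  by (simp add: twisted_coact_def lins)

lemma coact_dual:
  "\<phi> \<in> carr M' \<Longrightarrow> m \<in> carr M \<Longrightarrow> lin H ground B \<Longrightarrow> C M' \<phi> (\<lambda>a \<chi>. B (s a) * \<chi> m) = twisted_coact M m (\<lambda>a m0. B a * \<phi> m0)"
  "\<psi> \<in> carr N' \<Longrightarrow> n \<in> carr N \<Longrightarrow> lin H ground B \<Longrightarrow> C N' \<psi> (\<lambda>a \<chi>. B (s a) * \<chi> n) = twisted_coact N n (\<lambda>a n0. B a * \<psi> n0)"
  "\<mu> \<in> carr X' \<Longrightarrow> u \<in> carr (tensor_space M N) \<Longrightarrow> lin H ground B \<Longrightarrow> C X' \<mu> (\<lambda>a \<chi>. B (s a) * \<chi> u) = twisted_coact MN u (\<lambda>a u. B a * \<mu> u)"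
  using M' N' X' by (simp_all add: is_dual_def twisted_coact_def)

lemma tcoact_cong:
  "premodule V \<Longrightarrow> premodule W \<Longrightarrow> (\<And>h v w. v \<in> carr V \<Longrightarrow> w \<in> carr W \<Longrightarrow> R h v w = R' h v w) \<Longrightarrow>
    tcoact t1 t2 t3 V W v w R = tcoact t1 t2 t3 V W v w R'"
  by (simp add: tcoact_def lins)

lemma coact_tensor_ev:
  assumes [lins]: "premodule V" "premodule W" and F: "bilin H (tensor_space V W) ground F" and t: "t \<in> carr (tensor_space V W)"
  shows "ev H (tensor_space V W) (coact (yd_tensor H V W) t) F
      = ev V W t (\<lambda>v w. tcoact (Phi H) (Phi_inv H) (Phi H) V W v w (\<lambda>h v w. F h (pure V W v w)))"
proof -
  let ?VW = "tensor_space V W"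
  have sp: "is_space V" "is_space W" by (simp_all add: lins)
  have l: "lin (tensor_space H ?VW) ground (\<lambda>t. ev H ?VW t F)" using F by (simp add: lins)
  have "ev H ?VW (coact (yd_tensor H V W) t) F = ev V W t (\<lambda>v w. ev H ?VW
      (tcoact (Phi H) (Phi_inv H) (Phi H) V W v w (\<lambda>h v w. pure H ?VW h (pure V W v w))) F)"
    unfolding coact_tensor[OF assms(1,2) t]
    by (rule lin_ev_apply[OF sp(1) is_space_tensor l t], rule tcoact_apply(2)[OF assms(1,2) is_space_tensor l]) (simp_all add: lins pure_in_tensor)
  also have "\<dots> = ev V W t (\<lambda>v w. tcoact (Phi H) (Phi_inv H) (Phi H) V W v w (\<lambda>h v w. F h (pure V W v w)))"
  proof (rule ev_cong[OF sp(1) t])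
    fix v w
    have "ev H ?VW (tcoact (Phi H) (Phi_inv H) (Phi H) V W v w (\<lambda>h v w. pure H ?VW h (pure V W v w))) F
        = tcoact (Phi H) (Phi_inv H) (Phi H) V W v w (\<lambda>h v w. ev H ?VW (pure H ?VW h (pure V W v w)) F)"
      by (rule tcoact_apply(1)[OF assms(1,2) is_space_tensor l]) (simp_all add: lins pure_in_tensor)
    also have "\<dots> = tcoact (Phi H) (Phi_inv H) (Phi H) V W v w (\<lambda>h v w. F h (pure V W v w))"
      by (rule tcoact_cong[OF assms(1,2)]) (simp add: ev_pure[OF is_space_H is_space_ground F] pure_in_tensor)
    finally show "ev H ?VW (tcoact (Phi H) (Phi_inv H) (Phi H) V W v w (\<lambda>h v w. pure H ?VW h (pure V W v w))) F
        = tcoact (Phi H) (Phi_inv H) (Phi H) V W v w (\<lambda>h v w. F h (pure V W v w))" .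
  qed
  finally show ?thesis .
qed

text \<open>Evaluation replaces the coactions of \<open>M'\<close> and \<open>N'\<close> by twisted
  coactions of M and N. Applying \<open>s\<close> reverses the product in H, so the factor coming
  from N now stands to the left of the one from M.\<close>

lemma coact_pairing:
  assumes t: "t \<in> carr TT" and m [lins]: "m \<in> carr M" and n [lins]: "n \<in> carr N" and B: "lin H ground B"
  shows "ev H TT (coact T' t) (\<lambda>a u. B (s a) * pairing u m n)
    = P (\<lambda>X1 X2 X3. Q (\<lambda>x1 x2 x3. P (\<lambda>Y1 Y2 Y3. twisted_coact N (ac N (s (X3 * x3)) n) (\<lambda>b n0. twisted_coact M (ac M (s X2) m) (\<lambda>a m0.
        B (s Y3 * (b * (s x2 * (a * s X1)))) * pairing t (ac M (s (x1 * Y1)) m0) (ac N (s Y2) n0))))))"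
proof -
  note [lins] = lin_comp[OF _ B] lin_mult_ground1 lin_mult_ground2
  have "ev H TT (coact T' t) (\<lambda>a u. B (s a) * pairing u m n)
      = ev M' N' t (\<lambda>\<phi> \<psi>. tcoact (Phi H) (Phi_inv H) (Phi H) M' N' \<phi> \<psi> (\<lambda>h \<phi> \<psi>. B (s h) * pairing (pure M' N' \<phi> \<psi>) m n))"
    by (rule coact_tensor_ev[OF pre_duals(1,2) _ t]) (simp add: lins)
  also have "\<dots> = ev M' N' t (\<lambda>\<phi> \<psi>. P (\<lambda>X1 X2 X3. Q (\<lambda>x1 x2 x3. P (\<lambda>Y1 Y2 Y3.
      twisted_coact N (ac N (s (X3 * x3)) n) (\<lambda>b n0. twisted_coact M (ac M (s X2) m) (\<lambda>a m0.
        B (s Y3 * (b * (s x2 * (a * s X1)))) * (\<phi> (ac M (s (x1 * Y1)) m0) * \<psi> (ac N (s Y2) n0))))))))"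
  proof (rule ev_cong[OF space_duals(1) t])
    fix \<phi> \<psi> assume \<phi> [lins]: "\<phi> \<in> carr M'" and \<psi> [lins]: "\<psi> \<in> carr N'"
    have "C M' (ac M' (x1 * Y1) \<phi>) (\<lambda>a \<phi>0. C N' (ac N' Y2 \<psi>) (\<lambda>b \<psi>0. B (s (X1 * a * x2 * b * Y3)) *
          pairing (pure M' N' (ac M' X2 \<phi>0) (ac N' (X3 * x3) \<psi>0)) m n))
        = twisted_coact N (ac N (s (X3 * x3)) n) (\<lambda>b n0. twisted_coact M (ac M (s X2) m) (\<lambda>a m0.
        B (s Y3 * (b * (s x2 * (a * s X1)))) * (\<phi> (ac M (s (x1 * Y1)) m0) * \<psi> (ac N (s Y2) n0))))"
      (is "?l = ?r") for X1 X2 X3 x1 x2 x3 Y1 Y2 Y3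
    proof -
      have "?l = C M' (ac M' (x1 * Y1) \<phi>) (\<lambda>a \<phi>0. C N' (ac N' Y2 \<psi>) (\<lambda>b \<psi>0.
          (\<lambda>z. B (s Y3 * (z * (s x2 * (s a * s X1)))) * \<phi>0 (ac M (s X2) m)) (s b) * \<psi>0 (ac N (s (X3 * x3)) n)))"
        by (intro C_cong) (simp_all add: lins pairing_pure act_duals antipodal_twistD(2)[OF at] mult.assoc)
      also have "\<dots> = C M' (ac M' (x1 * Y1) \<phi>) (\<lambda>a \<phi>0. twisted_coact N (ac N (s (X3 * x3)) n) (\<lambda>b n0.
          B (s Y3 * (b * (s x2 * (s a * s X1)))) * \<phi>0 (ac M (s X2) m) * (ac N' Y2 \<psi>) n0))"
        by (intro C_cong coact_dual(2)) (simp_all add: lins)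
      also have "\<dots> = twisted_coact N (ac N (s (X3 * x3)) n) (\<lambda>b n0. C M' (ac M' (x1 * Y1) \<phi>) (\<lambda>a \<phi>0.
          (\<lambda>z. B (s Y3 * (b * (s x2 * (z * s X1)))) * (ac N' Y2 \<psi>) n0) (s a) * \<phi>0 (ac M (s X2) m)))"
        by (simp add: twisted_coact_swap mult.commute mult.left_commute)
      also have "\<dots> = twisted_coact N (ac N (s (X3 * x3)) n) (\<lambda>b n0. twisted_coact M (ac M (s X2) m) (\<lambda>a m0.
          (B (s Y3 * (b * (s x2 * (a * s X1)))) * (ac N' Y2 \<psi>) n0) * (ac M' (x1 * Y1) \<phi>) m0))"
        by (intro twisted_coact_cong coact_dual(1)) (simp_all add: lins)
      also have "\<dots> = ?r"
        by (intro twisted_coact_cong) (simp_all add: lins act_duals mult.commute mult.left_commute)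
      finally show ?thesis .
    qed
    then show "tcoact (Phi H) (Phi_inv H) (Phi H) M' N' \<phi> \<psi> (\<lambda>h \<phi> \<psi>. B (s h) * pairing (pure M' N' \<phi> \<psi>) m n)
      = P (\<lambda>X1 X2 X3. Q (\<lambda>x1 x2 x3. P (\<lambda>Y1 Y2 Y3.
      twisted_coact N (ac N (s (X3 * x3)) n) (\<lambda>b n0. twisted_coact M (ac M (s X2) m) (\<lambda>a m0.
        B (s Y3 * (b * (s x2 * (a * s X1)))) * (\<phi> (ac M (s (x1 * Y1)) m0) * \<psi> (ac N (s Y2) n0)))))))"
      by (simp only: tcoact_def)
  qed
  also have "\<dots> = P (\<lambda>X1 X2 X3. Q (\<lambda>x1 x2 x3. P (\<lambda>Y1 Y2 Y3. twisted_coact N (ac N (s (X3 * x3)) n) (\<lambda>b n0. twisted_coact M (ac M (s X2) m) (\<lambda>a m0.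
        B (s Y3 * (b * (s x2 * (a * s X1)))) * pairing t (ac M (s (x1 * Y1)) m0) (ac N (s Y2) n0))))))"
    by (simp only: swap_ev3 twisted_coact_swap pairing_def mult_ev)
  finally show ?thesis .
qed

text \<open>The reversal makes this a coaction on N \<otimes> M with reversed reassociators, to
  which the twists of the two dual coactions and of \<open>act21 g\<close> attach.\<close>

lemma tcoact_dual:
  assumes c: "bilin M N ground c" and B: "lin H ground B"
  shows "P (\<lambda>X1 X2 X3. Q (\<lambda>x1 x2 x3. P (\<lambda>Y1 Y2 Y3. twisted_coact N (ac N (s (X3 * x3)) n) (\<lambda>b n0. twisted_coact M (ac M (s X2) m) (\<lambda>a m0.
        B (s Y3 * (b * (s x2 * (a * s X1)))) * act21 g c (ac M (s (x1 * Y1)) m0) (ac N (s Y2) n0))))))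
    = tcoact (tens12 1 g \<odot>\<^sub>3 (flip_antip s (Phi H) \<odot>\<^sub>3 tens21 f 1)) (tens21 g 1 \<odot>\<^sub>3 (flip_antip s (Phi_inv H) \<odot>\<^sub>3 tens12 1 f))
        (tens12 1 g \<odot>\<^sub>3 flip_antip s (Phi H)) N M n m (\<lambda>h n m. B h * c m n)"
proof -
  note [lins] = lin_comp[OF _ B] lin_mult_ground1 lin_mult_ground2 bilin_lin1[OF c] bilin_lin2[OF c]
  show ?thesis
    by (simp add: twisted_coact_def act21_def tcoact_def ev3_mult[where U=ground] ev3_tens[where U=ground] ev3_flip_antip[where U=ground] lins
        antipodal_twistD(2)[OF at] mult.assoc mult_ev swap_ev3 swap_ev3_ev3[of "Phi_inv H" "Phi H"]
        ev_swap[of H N _ H H f] ev_swap[of H N _ H H g] ev_swap[of H M _ H H f] ev_swap[of H M _ H H g])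
      (rule trans[OF swap_ev3_ev3], rule ev3_eqI, rule ev3_eqI, rule ev3_eqI, rule sym, rule trans[OF ev_swap], rule ev_eqI,
       rule trans[OF ev_swap], rule ev_eqI, rule trans[OF ev_swap], rule ev_eqI, rule ev_swap)
qed

lemma coact_hat:
  assumes \<mu>: "\<mu> \<in> carr X'" and m [lins]: "m \<in> carr M" and n [lins]: "n \<in> carr N" and B: "lin H ground B"
  shows "C MN (ac MN k (pure M N m n)) (\<lambda>h u. B h * \<mu> (ac MN l u))
    = act12 (\<Delta> k) (\<lambda>m n. tcoact (Phi H) (Phi_inv H) (Phi H) M N m n (\<lambda>h m n. B h * act12 (\<Delta> l) (hat \<mu>) m n)) m n"
proof -
  let ?MN = "tensor_space M N"
  let ?F = "\<lambda>h u. B h * \<mu> (ac MN l u)"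
  have pr: "premodule M" "premodule N" by (simp_all add: lins)
  have "lin ?MN ground (\<lambda>u. \<mu> (ac MN l u))"
    using lin_comp[OF lin_ac(2)[OF premodule_left[OF pre_MN] lin_ident, of l] , of ground \<mu>] dual_elem_lin(3)[OF \<mu>]
    by (simp add: yd_tensor_cong)
  then have F: "bilin H ?MN ground ?F"
    using B by (intro bilinI) (simp_all add: lin_mult_ground1 lin_mult_ground2)
  have b: "bilin M N ground (\<lambda>m n. tcoact (Phi H) (Phi_inv H) (Phi H) M N m n (\<lambda>h m n. ?F h (pure M N m n)))"
  proof -
    note [lins] = bilin_lin1[OF F] bilin_lin2[OF F] pure_in_tensor
    show ?thesis by (intro bilinI lin_tcoact multilin3I) (simp_all add: lins)
  qed
  have "C MN (ac MN k (pure M N m n)) ?F = ev M N (D k (\<lambda>k1 k2. pure M N (ac M k1 m) (ac N k2 n)))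
      (\<lambda>m n. tcoact (Phi H) (Phi_inv H) (Phi H) M N m n (\<lambda>h m n. ?F h (pure M N m n)))"
  proof -
    have cl: "D k (\<lambda>k1 k2. pure M N (ac M k1 m) (ac N k2 n)) \<in> carr ?MN" by (simp add: lins pure_in_tensor)
    have "ac MN k (pure M N m n) = D k (\<lambda>k1 k2. pure M N (ac M k1 m) (ac N k2 n))"
      by (simp only: ac_eq yd_tensor_simps pure_in_tensor m n act_pure)
    then show ?thesis by (simp only: yd_tensor_cong coact_tensor_ev[OF pr F cl])
  qed
  also have "\<dots> = D k (\<lambda>k1 k2. tcoact (Phi H) (Phi_inv H) (Phi H) M N (ac M k1 m) (ac N k2 n) (\<lambda>h m n. ?F h (pure M N m n)))"
    by (subst ev_ev[OF space_M is_space_ground b is_space_H comult_closed])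
      (simp_all add: pure_in_tensor lins ev_pure[OF space_M is_space_ground b])
  also have "\<dots> = D k (\<lambda>k1 k2. tcoact (Phi H) (Phi_inv H) (Phi H) M N (ac M k1 m) (ac N k2 n) (\<lambda>h m n. B h * act12 (\<Delta> l) (hat \<mu>) m n))"
    by (intro ev_eqI tcoact_cong pr) (simp add: ac_eq pure_in_tensor hat_act[OF \<mu>])
  finally show ?thesis by (simp only: act12_def)
qed

text \<open>Gathers the twists around the coaction on N \<otimes> M into its first and third places,
  in the form that \<open>tcoact_twist\<close> expects.\<close>

lemma tcoact_coform:
  assumes c: "bilin M N ground c" and B: "lin H ground B"
  shows "ev H H f (\<lambda>f1 f2. ev H H g (\<lambda>G1 G2. act21 g (act21 (\<Delta> G1) (\<lambda>m n. tcoact (Phi H) (Phi_inv H) (Phi H) N M n m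
      (\<lambda>h n m. B (f1 * h * G2) * act21 (\<Delta> f2) c m n))) m n))
    = tcoact (id_comult H f \<odot>\<^sub>3 Phi H) (Phi_inv H) (Phi H \<odot>\<^sub>3 (comult_id H g \<odot>\<^sub>3 tens21 g 1)) N M n m (\<lambda>h n m. B h * c m n)"
proof -
  note [lins] = lin_comp[OF _ B] lin_mult_ground1 lin_mult_ground2 bilin_lin1[OF c] bilin_lin2[OF c]
  show ?thesis
    by (simp add: act21_def tcoact_def ev3_mult[where U=ground] ev3_tens[where U=ground] ev3_leg[where U=ground] lins
        mult.assoc mult_ev swap_ev3 swap_ev3_ev3[of "Phi_inv H" "Phi H"]
        ev_swap[of H H "\<Delta> _" H H g])
      (rule ev3_eqI, rule ev3_eqI, rule ev3_eqI, rule ev_eqI, rule ev_eqI, rule ev_eqI, rule sym, rule trans[OF ev_swap],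
       rule ev_eqI, rule trans[OF ev_swap], rule ev_eqI, rule ev_swap)
qed

text \<open>The other side of colinearity. The coaction on the dual of M \<otimes> N is a twisted
  coaction on M \<otimes> N itself, which \<open>coform_tcoact\<close> and
  \<open>coform_comult\<close> carry over to N \<otimes> M.\<close>

lemma coact_tau:
  assumes \<mu>: "\<mu> \<in> carr X'" and m [lins]: "m \<in> carr M" and n [lins]: "n \<in> carr N" and B: "lin H ground B"
  shows "C X' \<mu> (\<lambda>a \<nu>. B (s a) * act21 g (coform (hat \<nu>)) m n)
    = tcoact (id_comult H f \<odot>\<^sub>3 Phi H) (Phi_inv H) (Phi H \<odot>\<^sub>3 (comult_id H g \<odot>\<^sub>3 tens21 g 1)) N M n m
        (\<lambda>h n m. B h * coform (hat \<mu>) m n)"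
proof -
  note h = bilin_hat[OF \<mu>]
  let ?R = "\<lambda>f1 f2 G2 h m n. B (f1 * h * G2) * act12 (\<Delta> f2) (hat \<mu>) m n"
  let ?b = "\<lambda>f1 f2 G2 m n. tcoact (Phi H) (Phi_inv H) (Phi H) M N m n (?R f1 f2 G2)"
  note [lins] = lin_comp[OF _ B] lin_mult_ground1 lin_mult_ground2
  have R: "multilin3 H M N ground (?R f1 f2 G2)" for f1 f2 G2
  proof -
    note [lins] = bilin_lin1[OF bilin_act(1)[OF h comult_closed]] bilin_lin2[OF bilin_act(1)[OF h comult_closed]]
    show ?thesis by (simp add: lins)
  qed
  have b: "bilin M N ground (?b f1 f2 G2)" for f1 f2 G2
    using R by (simp add: lins)
  have B': "lin H ground (\<lambda>x. B (f1 * x * G2))" for f1 G2 by (simp add: lins)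
  have "C X' \<mu> (\<lambda>a \<nu>. B (s a) * act21 g (coform (hat \<nu>)) m n)
      = ev H H g (\<lambda>g1 g2. C N (ac N g1 n) (\<lambda>b n0. C X' \<mu> (\<lambda>a \<nu>. B (s a) * \<nu> (pure M N (ac M (b * g2) m) (ac N 1 n0)))))"
    by (simp add: act21_def coform_def hat_def mult_ev lins ev_swap[of H X'])
  also have "\<dots> = ev H H g (\<lambda>g1 g2. C N (ac N g1 n) (\<lambda>b n0. ev H H f (\<lambda>f1 f2. ev H H g (\<lambda>G1 G2.
      act12 (\<Delta> G1) (?b f1 f2 G2) (ac M (b * g2) m) (ac N 1 n0)))))"
    by (simp add: coact_dual(3)[OF \<mu> _ B] twisted_coact_def pure_in_tensor lins coact_hat[OF \<mu> _ _ B'])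
  also have "\<dots> = ev H H f (\<lambda>f1 f2. ev H H g (\<lambda>G1 G2. act21 g (coform (act12 (\<Delta> G1) (?b f1 f2 G2))) m n))"
    by (simp add: act21_def[of g] coform_def lins ev_swap[of H N _ H H f] ev_swap[of H N _ H H g])
      (rule trans[OF ev_swap], rule ev_eqI, rule ev_swap)
  also have "\<dots> = ev H H f (\<lambda>f1 f2. ev H H g (\<lambda>G1 G2. act21 g (act21 (\<Delta> G1) (\<lambda>m n. tcoact (Phi H) (Phi_inv H) (Phi H) N M n m
      (\<lambda>h n m. B (f1 * h * G2) * act21 (\<Delta> f2) (coform (hat \<mu>)) m n))) m n))"
  proof -
    have "coform (act12 (\<Delta> G1) (?b f1 f2 G2)) = act21 (\<Delta> G1) (\<lambda>m n. tcoact (Phi H) (Phi_inv H) (Phi H) N M n m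
      (\<lambda>h n m. B (f1 * h * G2) * act21 (\<Delta> f2) (coform (hat \<mu>)) m n))" for f1 f2 G1 G2
    proof -
      have "coform (?R f1 f2 G2 h) m n = B (f1 * h * G2) * act21 (\<Delta> f2) (coform (hat \<mu>)) m n" for h m n
        unfolding coform_comult[OF h, symmetric] by (simp add: coform_def mult_ev)
      then show ?thesis by (simp add: coform_comult[OF b] coform_tcoact[OF R, abs_def])
    qed
    then show ?thesis by simp
  qed
  also have "\<dots> = tcoact (id_comult H f \<odot>\<^sub>3 Phi H) (Phi_inv H) (Phi H \<odot>\<^sub>3 (comult_id H g \<odot>\<^sub>3 tens21 g 1)) N M n m
        (\<lambda>h n m. B h * coform (hat \<mu>) m n)"
    by (rule tcoact_coform[OF bilin_coform(1)[OF h] B])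
  finally show ?thesis .
qed

text \<open>Both sides of colinearity have become coactions on N \<otimes> M, one by
  \<open>tcoact_dual\<close> and one by \<open>coact_tau\<close>; \<open>tcoact_twist\<close>
  equates them.\<close>

lemma tau_hom: "yd_hom H X' T' tau"
proof -
  have col: "coact T' (tau \<mu>) = C X' \<mu> (\<lambda>a \<nu>. pure H TT a (tau \<nu>))" if \<mu>: "\<mu> \<in> carr X'" for \<mu>
  proof -
    have t: "tau \<mu> \<in> carr TT" for \<mu> by (simp add: tau_def lins)
    have c: "coact T' (tau \<mu>) \<in> carr (tensor_space H TT)"
      using coact_closed[OF premodule_tensor[OF pre_duals(1,2)], of "tau \<mu>"] t by (simp add: yd_tensor_cong)
    have mem: "coact X' \<mu> \<in> carr (tensor_space H X')" using \<mu> by (simp add: lins)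
    have c': "C X' \<mu> (\<lambda>a \<nu>. pure H TT a (tau \<nu>)) \<in> carr (tensor_space H TT)"
      by (intro ev_closed is_space_H is_space_tensor mem pure_in_tensor t) simp
    show ?thesis
    proof (rule coact_tensor_dual_eqI[OF c c'])
      fix m n B assume m: "m \<in> carr M" and n: "n \<in> carr N" and B: "lin H ground B"
      note [lins] = lin_comp[OF _ B] lin_mult_ground1 lin_mult_ground2
      have F: "bilin H TT ground (\<lambda>a u. B (s a) * pairing u m n)" by (simp add: lins)
      have bc: "bilin M N ground (coform (hat \<mu>))" by (rule bilin_coform(1)[OF bilin_hat[OF \<mu>]])
      have mm: "multilin3 H N M ground (\<lambda>h n m. B h * coform (hat \<mu>) m n)"
      proof -
        note [lins] = bilin_lin1[OF bc] bilin_lin2[OF bc]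
        show ?thesis by (simp add: lins)
      qed
      have "ev H TT (coact T' (tau \<mu>)) (\<lambda>a u. B (s a) * pairing u m n)
          = P (\<lambda>X1 X2 X3. Q (\<lambda>x1 x2 x3. P (\<lambda>Y1 Y2 Y3. twisted_coact N (ac N (s (X3 * x3)) n) (\<lambda>b n0. twisted_coact M (ac M (s X2) m) (\<lambda>a m0.
        B (s Y3 * (b * (s x2 * (a * s X1)))) * act21 g (coform (hat \<mu>)) (ac M (s (x1 * Y1)) m0) (ac N (s Y2) n0))))))"
        by (simp add: coact_pairing[OF t m n B] pairing_tau \<mu> lins)
      also have "\<dots> = C X' \<mu> (\<lambda>a \<nu>. B (s a) * act21 g (coform (hat \<nu>)) m n)"
        unfolding tcoact_dual[OF bc B] coact_tau[OF \<mu> m n B]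
        by (rule tcoact_twist[OF at yd_N yd_M mm, symmetric])
      also have "\<dots> = C X' \<mu> (\<lambda>a \<nu>. ev H TT (pure H TT a (tau \<nu>)) (\<lambda>a u. B (s a) * pairing u m n))"
        by (rule ev_cong[OF is_space_H mem]) (simp add: ev_pure[OF is_space_H is_space_ground F] t pairing_tau m n)
      also have "\<dots> = ev H TT (C X' \<mu> (\<lambda>a \<nu>. pure H TT a (tau \<nu>))) (\<lambda>a u. B (s a) * pairing u m n)"
        by (rule ev_ev[OF is_space_H is_space_ground F is_space_H mem, symmetric]) (simp add: pure_in_tensor t)
      finally show "ev H TT (coact T' (tau \<mu>)) (\<lambda>a u. B (s a) * pairing u m n)
          = ev H TT (C X' \<mu> (\<lambda>a \<nu>. pure H TT a (tau \<nu>))) (\<lambda>a u. B (s a) * pairing u m n)" .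
    qed
  qed
  show ?thesis unfolding yd_hom_def yd_tensor_cong
    using lin_tau tau_act col by (simp add: ev_def)
qed

text \<open>Undoes \<open>tau\<close> factor by factor: \<open>act21 f\<close> inverts
  \<open>act21 g\<close> and \<open>coform_inv\<close> inverts \<open>coform\<close>. The value 0
  off the carrier puts the result into the dual space.\<close>

definition sigma :: "('k, 'm \<Rightarrow> 'k, 'n \<Rightarrow> 'k) tensor \<Rightarrow> ('k, 'm, 'n) tensor \<Rightarrow> 'k" where
  "sigma t u = (if u \<in> carr (tensor_space M N) then ev M N u (coform_inv (act21 f (pairing t))) else 0)"

lemma bilin_sigma: "t \<in> carr TT \<Longrightarrow> bilin M N ground (coform_inv (act21 f (pairing t)))"
  by (simp add: bilin_coform bilin_act bilin_pairing lins)

lemma sigma_pure: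
  "t \<in> carr TT \<Longrightarrow> m \<in> carr M \<Longrightarrow> n \<in> carr N \<Longrightarrow> sigma t (pure M N m n) = coform_inv (act21 f (pairing t)) m n"
  by (simp add: sigma_def pure_in_tensor ev_pure[OF space_M is_space_ground bilin_sigma])

lemma sigma_closed: "t \<in> carr TT \<Longrightarrow> sigma t \<in> carr X'"
proof -
  assume t: "t \<in> carr TT"
  have "lin (tensor_space M N) ground (\<lambda>u. ev M N u (coform_inv (act21 f (pairing t))))"
    by (rule lin_ev_arg[OF space_M is_space_ground bilin_sigma[OF t] lin_ident])
  then have "lin (tensor_space M N) ground (sigma t)"
    by (simp only: lin_cong[of "tensor_space M N" "sigma t" "\<lambda>u. ev M N u (coform_inv (act21 f (pairing t)))"]
        sigma_def is_space_tensor if_True)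
  then show ?thesis by (simp add: carr_duals dual_space_def sigma_def)
qed

lemma lin_sigma: "lin TT X' sigma"
proof -
  have l: "lin TT ground (\<lambda>t. coform_inv (act21 f (pairing t)) m n)" for m n
    by (simp add: coform_inv_def act21_def lins)
  have "lin TT ground (\<lambda>t. sigma t u)" for u
  proof (cases "u \<in> carr (tensor_space M N)")
    case True
    show ?thesis unfolding sigma_def if_P[OF True]
      by (rule lin_ev_body[OF space_M is_space_tensor is_space_ground True l])
  qed (simp add: sigma_def lin_def)
  then show ?thesis using sigma_closed by (auto simp: lin_def carr_duals fun_scl_def fun_eq_iff)
qed

lemma coform_inv_cong:
  "(\<And>m n. m \<in> carr M \<Longrightarrow> n \<in> carr N \<Longrightarrow> b m n = b' m n) \<Longrightarrow> coform_inv b = coform_inv b'"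
  by (simp add: coform_inv_def fun_eq_iff lins)

lemma act21_inverse:
  assumes b: "bilin M N ground b" and mn: "m \<in> carr M" "n \<in> carr N"
  shows "act21 f (act21 g b) m n = b m n" "act21 g (act21 f b) m n = b m n"
proof -
  note [lins] = bilin_lin1[OF b] bilin_lin2[OF b]
  have "act21 (pure2 H 1 1) b m n = b m n"
    using mn by (simp add: act21_def ev2_pure[where U=ground] lins ac_one)
  then show "act21 f (act21 g b) m n = b m n" "act21 g (act21 f b) m n = b m n"
    by (simp_all add: act_mult(2)[OF b, symmetric] lins antipodal_twistD(6,7)[OF at])
qed

lemma hat_eval:
  assumes \<mu>: "\<mu> \<in> carr X'" and u: "u \<in> carr (tensor_space M N)"
  shows "ev M N u (hat \<mu>) = \<mu> u"
  using lin_ev_apply[OF space_M is_space_tensor dual_elem_lin(3)[OF \<mu>] u, of "pure M N"]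
  by (simp add: hat_def[abs_def] ev_pure_self[OF space_M u] pure_in_tensor)

lemma sigma_tau:
  assumes \<mu>: "\<mu> \<in> carr X'"
  shows "sigma (tau \<mu>) = \<mu>"
proof
  fix u
  show "sigma (tau \<mu>) u = \<mu> u"
  proof (cases "u \<in> carr (tensor_space M N)")
    case True
    note h = bilin_hat[OF \<mu>]
    have "act21 f (pairing (tau \<mu>)) = act21 f (act21 g (coform (hat \<mu>)))"
      by (rule act21_cong) (simp add: pairing_tau \<mu>)
    then have "coform_inv (act21 f (pairing (tau \<mu>))) = coform_inv (coform (hat \<mu>))"
      by (simp only:) (rule coform_inv_cong, rule act21_inverse(1)[OF bilin_coform(1)[OF h]])
    then have "sigma (tau \<mu>) u = ev M N u (hat \<mu>)"
      using True by (simp add: sigma_def) (rule ev_cong[OF space_M True], simp add: coform_inv_coform[OF h] ac_one lins)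
    then show ?thesis by (simp add: hat_eval[OF \<mu> True])
  next
    case False
    then show ?thesis using \<mu> by (simp add: sigma_def carr_duals dual_space_def)
  qed
qed

lemma tau_sigma:
  assumes t: "t \<in> carr TT"
  shows "tau (sigma t) = t"
proof (rule tensor_dual_eqI[OF _ t])
  note p = bilin_pairing[OF t]
  have b: "bilin M N ground (act21 f (pairing t))" by (simp add: bilin_act p lins)
  show "tau (sigma t) \<in> carr TT" by (simp add: tau_def lins)
  fix m n assume mn: "m \<in> carr M" "n \<in> carr N"
  have "coform (hat (sigma t)) = coform (coform_inv (act21 f (pairing t)))"
    by (rule coform_cong) (simp add: hat_def sigma_pure t)
  also have "\<dots> = act21 f (pairing t)" by (intro ext) (simp add: coform_coform_inv[OF b])
  finally show "pairing (tau (sigma t)) m n = pairing t m n"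
    by (simp add: pairing_tau sigma_closed t mn act21_inverse(2)[OF p mn])
qed

text \<open>The stated maps sum over representations of both \<open>t\<close> and \<open>u\<close>.
  Exchanging the two evaluations gathers the sum over \<open>t\<close> into
  \<open>pairing t\<close>.\<close>

lemma sigma_form:
  assumes t: "t \<in> carr TT" and u: "u \<in> carr (tensor_space M N)"
    and F: "\<And>\<phi> \<psi> m n. \<phi> \<in> carr M' \<Longrightarrow> \<psi> \<in> carr N' \<Longrightarrow> m \<in> carr M \<Longrightarrow> n \<in> carr N \<Longrightarrow>
      F \<phi> \<psi> m n = coform_inv (act21 f (\<lambda>m n. \<phi> m * \<psi> n)) m n"
  shows "ev M' N' t (\<lambda>\<phi> \<psi>. ev M N u (F \<phi> \<psi>)) = sigma t u"
proof -
  have "ev M' N' t (\<lambda>\<phi> \<psi>. ev M N u (F \<phi> \<psi>)) = ev M' N' t (\<lambda>\<phi> \<psi>. ev M N u (coform_inv (act21 f (\<lambda>m n. \<phi> m * \<psi> n))))"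
    by (intro ev_cong[OF space_duals(1) t] ev_cong[OF space_M u] F)
  also have "\<dots> = ev M N u (\<lambda>m n. ev M' N' t (\<lambda>\<phi> \<psi>. coform_inv (act21 f (\<lambda>m n. \<phi> m * \<psi> n)) m n))"
    by (rule ev_swap)
  also have "\<dots> = sigma t u"
    by (simp only: sigma_def u if_True coform_inv_def[abs_def] act21_def pairing_def ev_swap[of M' N' t] swap_ev3[of M' N' t])
  finally show ?thesis .
qed

lemma sigma_pure_form:
  assumes "\<phi> \<in> carr M'" "\<psi> \<in> carr N'" "m \<in> carr M" "n \<in> carr N"
  shows "sigma (pure M' N' \<phi> \<psi>) (pure M N m n) = coform_inv (act21 f (\<lambda>m n. \<phi> m * \<psi> n)) m n"
proof -
  have "pairing (pure M' N' \<phi> \<psi>) = (\<lambda>m n. \<phi> m * \<psi> n)" by (intro ext pairing_pure assms)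
  then show ?thesis by (simp add: sigma_pure pure_in_tensor assms)
qed

lemma tau_eq:
  assumes \<mu>: "\<mu> \<in> carr X'"
    and F: "\<And>i j. i \<in> {1..p} \<Longrightarrow> j \<in> {1..q} \<Longrightarrow> F i j = act21 g (coform (hat \<mu>)) (em i) (en j)"
  shows "(\<Sum>i=1..p. \<Sum>j=1..q. fun_scl (F i j) (pure M' N' (em' i) (en' j))) = tau \<mu>"
  unfolding tau_def from_form_def by (intro sum.cong refl) (simp only: F)

lemma coform_hat:
  assumes m: "m \<in> carr M" and n: "n \<in> carr N"
  shows "coform (hat \<mu>) (ac M k m) (ac N l n) = C N (act N l n) (\<lambda>a n0. \<mu> (pure M N (act M (a * k) m) n0))"
  unfolding coform_def
  by (simp add: ac_eq[OF n, symmetric] ac_eq[OF m, symmetric] lins) (rule C_cong, simp_all add: hat_def lins ac_one)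

text \<open>\<open>sg\<close> and \<open>tu\<close> need only agree with \<open>sigma\<close> and
  \<open>tau\<close> on the carriers. That \<open>sg\<close> is a morphism is deduced from
  \<open>tau\<close> being one, as the inverse of a bijective morphism.\<close>

lemma yd_iso:
  assumes sg: "\<And>t. t \<in> carr TT \<Longrightarrow> sg t = sigma t" and tu: "\<And>\<mu>. \<mu> \<in> carr X' \<Longrightarrow> tu \<mu> = tau \<mu>"
  shows "yd_iso_with_inverse H T' X' sg tu"
proof -
  have t: "tau \<mu> \<in> carr TT" for \<mu> by (simp add: tau_def lins)
  have st: "sigma (tau \<mu>) = \<mu>" if "\<mu> \<in> carr X'" for \<mu> using sigma_tau[OF that] .
  have "yd_hom H T' X' sg"
    unfolding yd_hom_def
  proof (intro conjI allI ballI)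
    show "lin T' X' sg"
      unfolding yd_tensor_cong
      by (simp only: lin_cong[of TT sg sigma] sg is_space_tensor lin_sigma)
    fix b assume "b \<in> carr T'"
    then have b: "b \<in> carr TT" by simp
    note c = sigma_closed[OF b] and tb = tau_sigma[OF b]
    show "sg (act T' h b) = act X' h (sg b)" for h
    proof -
      have a: "act X' h (sigma b) \<in> carr X'" using act_closed[OF premodule_left[OF pre_duals(3)] c] .
      have e: "act T' h b = tau (act X' h (sigma b))" using tau_act[OF c] tb by simp
      show ?thesis unfolding e sg[OF t] sg[OF b] st[OF a] ..
    qed
    have mem: "coact X' (sigma b) \<in> carr (tensor_space H X')" using c by (simp add: lins)
    have "coact T' (tau (sigma b)) = C X' (sigma b) (\<lambda>a \<nu>. pure H TT a (tau \<nu>))"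
      using tau_hom c by (simp add: yd_hom_def yd_tensor_cong ev_def)
    then have "coact T' b = C X' (sigma b) (\<lambda>a \<nu>. pure H TT a (tau \<nu>))" unfolding tb .
    moreover have F: "bilin H TT (tensor_space H X') (\<lambda>a u. pure H X' a (sigma u))"
      by (intro bilinI lin_pure lin_comp[OF _ lin_sigma] lin_ident sigma_closed) simp_all
    \<comment> \<open>\<open>sigma\<close> is applied to the second leg of the colinearity identity
      for \<open>tau\<close>.\<close>
    ultimately have "ev H TT (coact T' b) (\<lambda>a u. pure H X' a (sigma u))
        = C X' (sigma b) (\<lambda>a \<nu>. ev H TT (pure H TT a (tau \<nu>)) (\<lambda>a u. pure H X' a (sigma u)))"
      by (simp add: ev_ev[OF is_space_H is_space_tensor F is_space_H mem] pure_in_tensor t)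
    also have "\<dots> = C X' (sigma b) (pure H X')"
      by (rule ev_cong[OF is_space_H mem]) (simp add: ev_pure[OF is_space_H is_space_tensor F] t st)
    also have "\<dots> = coact X' (sigma b)" by (rule ev_pure_self[OF is_space_H mem])
    finally have "coact X' (sigma b) = ev H TT (coact T' b) (\<lambda>a u. pure H X' a (sigma u))" ..
    also have "\<dots> = ev H TT (coact T' b) (\<lambda>a u. pure H X' a (sg u))"
    proof (rule ev_cong[OF is_space_H])
      show "coact T' b \<in> carr (tensor_space H TT)"
        using coact_closed[OF premodule_tensor[OF pre_duals(1,2)], of b] b by (simp add: yd_tensor_cong)
    qed (simp add: sg)
    finally show "coact X' (sg b) = (\<Sum>(a, m0)\<leftarrow>sw H T' (coact T' b). pure H X' a (sg m0))"
      unfolding sg[OF b] yd_tensor_cong by (simp add: ev_def)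
  qed
  moreover have "yd_hom H X' T' tu"
    unfolding yd_hom_def yd_tensor_cong
  proof (intro conjI allI ballI)
    show "lin X' TT tu" by (simp only: lin_cong[of X' tu tau] tu space_duals lin_tau)
    fix \<mu> assume \<mu>: "\<mu> \<in> carr X'"
    have "act X' h \<mu> \<in> carr X'" for h using act_closed[OF premodule_left[OF pre_duals(3)] \<mu>] .
    then show "tu (act X' h \<mu>) = act T' h (tu \<mu>)" for h by (simp add: tu \<mu> tau_act)
    have "coact T' (tau \<mu>) = C X' \<mu> (\<lambda>a \<nu>. pure H TT a (tau \<nu>))"
      using tau_hom \<mu> by (simp add: yd_hom_def yd_tensor_cong ev_def)
    also have "\<dots> = C X' \<mu> (\<lambda>a \<nu>. pure H TT a (tu \<nu>))"
      by (rule C_cong[OF pre_duals(3) \<mu>]) (simp add: tu)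
    finally show "coact T' (tu \<mu>) = (\<Sum>(a, m0)\<leftarrow>sw H X' (coact X' \<mu>). pure H TT a (tu m0))"
      by (simp add: tu \<mu> ev_def)
  qed
  ultimately show ?thesis
    unfolding yd_iso_with_inverse_def using sg tu t st tau_sigma sigma_closed by simp
qed

end

section \<open>Matching the stated formulas\<close>

context yd_pair
begin

text \<open>Inserting \<open>q_L\<close> and \<open>p_R\<close> makes the stated formula
  \<open>coform_inv\<close> of the twisted product form, up to the order of the sums.\<close>

lemma sigma_left_form_eq:
  assumes \<phi>: "\<phi> \<in> carr (dual_space M)" and \<psi>: "\<psi> \<in> carr (dual_space N)" and m [lins]: "m \<in> carr M" and n [lins]: "n \<in> carr N"
  shows "sigma_left_form H M N \<phi> \<psi> m n = coform_inv (act21 f2 (\<lambda>m n. \<phi> m * \<psi> n)) m n"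
proof -
  note [lins] = lin_comp[OF _ dual_lin[OF \<phi>]] lin_comp[OF _ dual_lin[OF \<psi>]] lin_mult_ground1 lin_mult_ground2
  have "sigma_left_form H M N \<phi> \<psi> m n = ev H H f2 (\<lambda>f1 f2. ev H H (q_L H) (\<lambda>q1 q2. D q2 (\<lambda>q21 q22. P (\<lambda>X1 X2 X3.
      ev H H (p_R H) (\<lambda>p1 p2. C N (act N p1 n) (\<lambda>a n0. \<phi> (act M (f2 * q22 * X3 * T (q1 * X1 * a * p2)) m) * \<psi> (act N (f1 * q21 * X2) n0)))))))"
    unfolding sigma_left_form_def sw_evs by (simp add: ev_def)
  also have "\<dots> = ev H H f2 (\<lambda>f1 f2. ev H H (q_L H) (\<lambda>q1 q2. D q2 (\<lambda>q21 q22. P (\<lambda>X1 X2 X3.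
      ev H H (p_R H) (\<lambda>p1 p2. C N (ac N p1 n) (\<lambda>a n0. \<phi> (ac M (f2 * q22 * X3 * T (q1 * X1 * a * p2)) m) * \<psi> (ac N (f1 * q21 * X2) n0)))))))"
    unfolding ac_eq[OF m] ac_eq[OF n]
    by (intro ev_eqI ev3_eqI C_cong act_closed yd_left_module yd_premodule yd_N n) (simp only: ac_eq)
  also have "\<dots> = coform_inv (act21 f2 (\<lambda>m n. \<phi> m * \<psi> n)) m n"
    by (simp add: coform_inv_def act21_def ev_qL[where U=ground] ev_pR[where U=ground] lins mult.assoc outer
        ev_swap[of H H "\<Delta> _" H N] ev_swap[of H N _ H H f2] ev_swap[of H H "\<Delta> _" H H f2])
      (rule ev3_eqI, rule swap_ev3_ev3)
  finally show ?thesis .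
qed

text \<open>Inserting \<open>q_R\<close> and \<open>p_L\<close> gives \<open>right_form\<close> with
  the reversed twist on its arguments; \<open>right_form_eq\<close> moves the twist onto the
  form.\<close>

lemma sigma_right_form_eq:
  assumes \<phi>: "\<phi> \<in> carr (dual_space M)" and \<psi>: "\<psi> \<in> carr (dual_space N)" and m [lins]: "m \<in> carr M" and n [lins]: "n \<in> carr N"
  shows "sigma_right_form H M N \<phi> \<psi> m n = coform_inv (act21 (flip2 T f2) (\<lambda>m n. \<phi> m * \<psi> n)) m n"
proof -
  note [lins] = lin_comp[OF _ dual_lin[OF \<phi>]] lin_comp[OF _ dual_lin[OF \<psi>]] lin_mult_ground1 lin_mult_ground2
  have b: "bilin M N ground (\<lambda>m n. \<phi> m * \<psi> n)" by (simp add: lins)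
  have "sigma_right_form H M N \<phi> \<psi> m n = ev H H f2 (\<lambda>f1 f2. ev H H (q_R H) (\<lambda>q1 q2. Q (\<lambda>x1 x2 x3. ev H H (p_L H) (\<lambda>p1 p2. D p2 (\<lambda>p21 p22.
      C N (act N (x1 * p1 * T f1) n) (\<lambda>a n0. \<phi> (act M (T (f2 * q1 * a * x2 * p21)) m) * \<psi> (act N (T (x3 * p22) * q2) n0)))))))"
    unfolding sigma_right_form_def sw_evs by (simp add: ev_def)
  also have "\<dots> = ev H H f2 (\<lambda>f1 f2. ev H H (q_R H) (\<lambda>q1 q2. Q (\<lambda>x1 x2 x3. ev H H (p_L H) (\<lambda>p1 p2. D p2 (\<lambda>p21 p22.
      C N (ac N (x1 * p1 * T f1) n) (\<lambda>a n0. \<phi> (ac M (T (f2 * q1 * a * x2 * p21)) m) * \<psi> (ac N (T (x3 * p22) * q2) n0)))))))"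
    unfolding ac_eq[OF m] ac_eq[OF n]
    by (intro ev_eqI ev3_eqI C_cong act_closed yd_left_module yd_premodule yd_N n) (simp only: ac_eq)
  also have "\<dots> = act12 (flip2 T f2) (right_form (\<lambda>m n. \<phi> m * \<psi> n)) m n"
  proof -
    note [lins] = bilin_lin1[OF bilin_right_form[OF b]] bilin_lin2[OF bilin_right_form[OF b]]
    show ?thesis
      by (simp add: act12_def ev2_flip2[where U=ground] lins, simp add: right_form_def rcore_ac)
       (simp add: rcore_def ev_qR[where U=ground] ev_pL[where U=ground] lins mult.assoc outer C_out swap_ev3_ev3[of "Phi_inv H" "Phi H"])
  qed
  also have "\<dots> = coform_inv (act21 (flip2 T f2) (\<lambda>m n. \<phi> m * \<psi> n)) m n" by (rule right_form_eq[OF b])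
  finally show ?thesis .
qed

end

theorem proposition4p2:
  fixes H :: "('k::field, 'h::ring_1) qhopf"
    and M :: "('k, 'h, 'm::ab_group_add) ydm"
    and N :: "('k, 'h, 'n::ab_group_add) ydm"
    and s t :: nat
    and em :: "nat \<Rightarrow> 'm" and em' :: "nat \<Rightarrow> 'm \<Rightarrow> 'k"
    and en :: "nat \<Rightarrow> 'n" and en' :: "nat \<Rightarrow> 'n \<Rightarrow> 'k"
  assumes "quasi_hopf H"
    and "yd_module_fd H M" and "yd_module_fd H N"
    and "dual_bases M s em em'" and "dual_bases N t en en'"
  shows
    "(\<forall>\<phi>\<in>carr (dual_space M). \<forall>\<psi>\<in>carr (dual_space N). \<forall>m\<in>carr M. \<forall>n\<in>carr N.
        sigma_left H M N (pure (dual_space M) (dual_space N) \<phi> \<psi>) (pure M N m n)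
          = sigma_left_form H M N \<phi> \<psi> m n) \<and>
     yd_iso_with_inverse H
       (yd_tensor H (yd_left_dual H M) (yd_left_dual H N)) (yd_left_dual H (yd_tensor H M N))
       (sigma_left H M N) (sigma_left_inv H M N s em em' t en en') \<and>
     (\<forall>\<phi>\<in>carr (dual_space M). \<forall>\<psi>\<in>carr (dual_space N). \<forall>m\<in>carr M. \<forall>n\<in>carr N.
        sigma_right H M N (pure (dual_space M) (dual_space N) \<phi> \<psi>) (pure M N m n)
          = sigma_right_form H M N \<phi> \<psi> m n) \<and>
     yd_iso_with_inverse H
       (yd_tensor H (yd_right_dual H M) (yd_right_dual H N)) (yd_right_dual H (yd_tensor H M N))
       (sigma_right H M N) (sigma_right_inv H M N s em em' t en en')"
proof -
  interpret yd_pair H M N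
    using assms(1-3) by unfold_locales (simp_all add: yd_module_fd_def)
  have pr: "premodule M" "premodule N" "premodule (yd_tensor H M N)" by (simp_all add: lins premodule_tensor)
  have sp: "is_space M" "is_space N" by (simp_all add: lins)
  have exM: "\<exists>s e e'. dual_bases M s e e'" and exN: "\<exists>s e e'. dual_bases N s e e'" using assms(4,5) by blast+
  have exX: "\<exists>s e e'. dual_bases (yd_tensor H M N) s e e'" by (rule dual_bases_tensor_exist[OF sp assms(4,5)])
  interpret L: dual_pair H M N S T f2 g2 "yd_left_dual H M" "yd_left_dual H N" "yd_left_dual H (yd_tensor H M N)" s t em em' en en'
    by unfold_locales (intro antipodal_twist_left assms(4,5) is_dual_left pr exM exN exX)+
  interpret R: dual_pair H M N T S "flip2 T f2" "flip2 T g2" "yd_right_dual H M" "yd_right_dual H N" "yd_right_dual H (yd_tensor H M N)" s t em em' en en'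
    by unfold_locales (intro antipodal_twist_right assms(4,5) is_dual_right pr exM exN exX)+
  \<comment> \<open>The statement forms tensors over \<open>dual_space\<close>, the locale over the
    dual modules; carriers and scalars agree.\<close>
  have l: "pure (dual_space M) (dual_space N) = pure (yd_left_dual H M) (yd_left_dual H N)"
    "sw (dual_space M) (dual_space N) = sw (yd_left_dual H M) (yd_left_dual H N)"
    by (rule space_cong; simp add: L.carr_duals)+
  have r: "pure (dual_space M) (dual_space N) = pure (yd_right_dual H M) (yd_right_dual H N)"
    "sw (dual_space M) (dual_space N) = sw (yd_right_dual H M) (yd_right_dual H N)"
    by (rule space_cong; simp add: R.carr_duals)+
  have left: "sigma_left H M N u = L.sigma u" if u: "u \<in> carr (tensor_space (yd_left_dual H M) (yd_left_dual H N))" for u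
  proof
    fix x
    show "sigma_left H M N u x = L.sigma u x"
    proof (cases "x \<in> carr (tensor_space M N)")
      case True
      have "sigma_left H M N u x = ev (yd_left_dual H M) (yd_left_dual H N) u (\<lambda>\<phi> \<psi>. ev M N x (sigma_left_form H M N \<phi> \<psi>))"
        using True by (simp add: sigma_left_def l ev_def)
      also have "\<dots> = L.sigma u x"
        by (rule L.sigma_form[OF u True]) (simp add: sigma_left_form_eq L.carr_duals)
      finally show ?thesis .
    qed (simp add: sigma_left_def L.sigma_def)
  qed
  have right: "sigma_right H M N u = R.sigma u" if u: "u \<in> carr (tensor_space (yd_right_dual H M) (yd_right_dual H N))" for u
  proof
    fix x
    show "sigma_right H M N u x = R.sigma u x"
    proof (cases "x \<in> carr (tensor_space M N)")
      case True
      have "sigma_right H M N u x = ev (yd_right_dual H M) (yd_right_dual H N) u (\<lambda>\<phi> \<psi>. ev M N x (sigma_right_form H M N \<phi> \<psi>))"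
        using True by (simp add: sigma_right_def r ev_def)
      also have "\<dots> = R.sigma u x"
        by (rule R.sigma_form[OF u True]) (simp add: sigma_right_form_eq R.carr_duals)
      finally show ?thesis .
    qed (simp add: sigma_right_def R.sigma_def)
  qed
  have left_inv: "sigma_left_inv H M N s em em' t en en' \<mu> = L.tau \<mu>"
    if \<mu>: "\<mu> \<in> carr (yd_left_dual H (yd_tensor H M N))" for \<mu>
    unfolding sigma_left_inv_def l
  proof (rule L.tau_eq[OF \<mu>])
    fix i j assume "i \<in> {1..s}" "j \<in> {1..t}"
    note c = L.bases_closed(1)[OF this(1)] L.bases_closed(3)[OF this(2)]
    show "(\<Sum>(g1, g2)\<leftarrow>sw2 H g2. \<Sum>(a, n0)\<leftarrow>sw H N (coact N (act N g1 (en j))). \<mu> (pure M N (act M (a * g2) (em i)) n0))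
        = act21 g2 (coform (L.hat \<mu>)) (em i) (en j)"
      by (simp add: act21_def L.coform_hat[OF c] sw_evs) (simp add: ev_def)
  qed
  have right_inv: "sigma_right_inv H M N s em em' t en en' \<mu> = R.tau \<mu>"
    if \<mu>: "\<mu> \<in> carr (yd_right_dual H (yd_tensor H M N))" for \<mu>
    unfolding sigma_right_inv_def r
  proof (rule R.tau_eq[OF \<mu>])
    fix i j assume "i \<in> {1..s}" "j \<in> {1..t}"
    note c = R.bases_closed(1)[OF this(1)] R.bases_closed(3)[OF this(2)]
    note b = bilin_coform(1)[OF R.bilin_hat[OF \<mu>]]
    note [lins] = bilin_lin1[OF b] bilin_lin2[OF b]
    \<comment> \<open>Reversal sends the second leg of \<open>twist_inv\<close> to N and the first
      to M, which is how they occur in the stated inverse for right duals.\<close>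
    have "act21 (flip2 T g2) (coform (R.hat \<mu>)) (em i) (en j)
        = ev H H g2 (\<lambda>g1 g2. coform (R.hat \<mu>) (ac M (T g1) (em i)) (ac N (T g2) (en j)))"
      by (simp add: act21_def ev2_flip2[where U=ground] lins)
    then show "(\<Sum>(g1, g2)\<leftarrow>sw2 H g2. \<Sum>(a, n0)\<leftarrow>sw H N (coact N (act N (T g2) (en j))). \<mu> (pure M N (act M (a * T g1) (em i)) n0))
        = act21 (flip2 T g2) (coform (R.hat \<mu>)) (em i) (en j)"
      by (simp add: R.coform_hat[OF c] sw_evs) (simp add: ev_def)
  qed
  show ?thesis
  proof (intro conjI ballI)
    show "yd_iso_with_inverse H (yd_tensor H (yd_left_dual H M) (yd_left_dual H N)) (yd_left_dual H (yd_tensor H M N))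
       (sigma_left H M N) (sigma_left_inv H M N s em em' t en en')"
      by (rule L.yd_iso[OF left left_inv])
    show "yd_iso_with_inverse H (yd_tensor H (yd_right_dual H M) (yd_right_dual H N)) (yd_right_dual H (yd_tensor H M N))
       (sigma_right H M N) (sigma_right_inv H M N s em em' t en en')"
      by (rule R.yd_iso[OF right right_inv])
    fix \<phi> \<psi> m n assume a: "\<phi> \<in> carr (dual_space M)" "\<psi> \<in> carr (dual_space N)" "m \<in> carr M" "n \<in> carr N"
    show "sigma_left H M N (pure (dual_space M) (dual_space N) \<phi> \<psi>) (pure M N m n) = sigma_left_form H M N \<phi> \<psi> m n"
      using a by (simp add: l left pure_in_tensor L.carr_duals L.sigma_pure_form sigma_left_form_eq)
    show "sigma_right H M N (pure (dual_space M) (dual_space N) \<phi> \<psi>) (pure M N m n) = sigma_right_form H M N \<phi> \<psi> m n"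
      using a by (simp add: r right pure_in_tensor R.carr_duals R.sigma_pure_form sigma_right_form_eq)
  qed
qed

end
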